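(* Let $\mathbf S$ be a super Fermat theory and let $\tau_{\mathbb K}:\mathbf{SCom}_{\mathbb K}\to\mathbf S$ be its structure map, where $\mathbb K=\mathbf S(0|0)$ is the ground ring. Then for every $\mathbf S$-algebra $A$, the induced functor $$(\tau_{\mathbb K}^* )_A:\mathrm{Mod}(A)\to\mathrm{Mod}(A_\sharp)$$ is an equivalence of categories.
   Context: All rings contain $\mathbb Q$; "super" means $\mathbb Z_2$-graded. Super Fermat theories. $\mathbf{SCom}$ is the two-sorted Lawvere theory of supercommutative $\mathbb Q$-superalgebras. A super Fermat theory is a two-sorted Lawvere theory $\mathbf S$ (objects $(m|n)$, products of $m$ copies of the even sort $(1|0)$ and $n$ copies of the odd sort $(0|1)$) with a morphism of theories $\mathbf{SCom}\to\mathbf S$. $\mathbf S$-algebras are finite-product-preserving functors $\mathbf S\to\mathbf{Set}$. The free $\mathbf S$-algebra on $m$ even and $n$ odd generators is $\mathbf S(m|n)=\mathbb K\{x_1,\dots,x_m;\xi_1,\dots,\xi_n\}$ (even/odd elements = morphisms $(m|n)\to(1|0)$, resp. $(0|1)$), $\mathbb K=\mathbf S(0|0)$. Required: (i) each $f\in\mathbb K\{x,z;\zeta\}$ has a unique $g\in\mathbb K\{x,y,z;\zeta\}$ with $f(x,z;\zeta)-f(y,z;\zeta)=(x-y)g(x,y,z;\zeta)$; (ii) each $f\in\mathbb K\{z;\xi,\zeta\}$ has a unique $h\in\mathbb K\{z;\zeta\}$ with $f(z;\theta,\zeta)-f(z;\eta,\zeta)=(\theta-\eta)h(z;\zeta)$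 ($z,\zeta$ finite tuples of even/odd variables). $\mathbf{SCom}_{\mathbb K}$ is the theory of supercommutative $\mathbb K$-algebras; $\tau_{\mathbb K}:\mathbf{SCom}_{\mathbb K}\to\mathbf S$ is the canonical map, and $\tau_{\mathbb K}^*$ sends an $\mathbf S$-algebra $A$ to its underlying supercommutative $\mathbb K$-algebra $A_\sharp$. For an object $X$ of a category $\mathbf C$, $\mathrm{Mod}(X)=\mathrm{Ab}(\mathbf C/X)$ is the category of abelian group objects in the slice category $\mathbf C/X$. Here $\mathrm{Mod}(A)$ is taken in the category of $\mathbf S$-algebras and $\mathrm{Mod}(A_\sharp)$ in the category of supercommutative $\mathbb K$-algebras; $\tau_{\mathbb K}^*$ preserves pullbacks, hence induces a functor $\mathbf{S}\mathbf{Alg}/A\to\mathbf{SCom}_{\mathbb K}\mathbf{Alg}/A_\sharp$ preserving finite products and so an additive functor $(\tau_{\mathbb K}^* )_A$ on abelian group objects. *)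

theory Defs
  imports Complex_Main "HOL-Library.FuncSet" "HOL-Library.Z2" "HOL-Library.Product_Plus"
begin

section \<open>Categories\<close>

text \<open>
  Hom-sets are indexed by pairs of objects and need not be disjoint; for this reason composition
  also takes the objects as arguments: \<open>Comp C X Y Z g f\<close> is the composite of
  \<open>f \<in> Hom C X Y\<close> and \<open>g \<in> Hom C Y Z\<close>.
\<close>

record ('o, 'a) cat =
  Obj :: "'o set"
  Hom :: "'o \<Rightarrow> 'o \<Rightarrow> 'a set"
  Ident :: "'o \<Rightarrow> 'a"
  Comp :: "'o \<Rightarrow> 'o \<Rightarrow> 'o \<Rightarrow> 'a \<Rightarrow> 'a \<Rightarrow> 'a"

locale category =
  fixes C :: "('o, 'a, 'c) cat_scheme"
  assumes ident_in_hom: "X \<in> Obj C \<Longrightarrow> Ident C X \<in> Hom C X X"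
    and comp_in_hom:
      "\<lbrakk>X \<in> Obj C; Y \<in> Obj C; Z \<in> Obj C; f \<in> Hom C X Y; g \<in> Hom C Y Z\<rbrakk>
        \<Longrightarrow> Comp C X Y Z g f \<in> Hom C X Z"
    and ident_left:
      "\<lbrakk>X \<in> Obj C; Y \<in> Obj C; f \<in> Hom C X Y\<rbrakk> \<Longrightarrow> Comp C X Y Y (Ident C Y) f = f"
    and ident_right:
      "\<lbrakk>X \<in> Obj C; Y \<in> Obj C; f \<in> Hom C X Y\<rbrakk> \<Longrightarrow> Comp C X X Y f (Ident C X) = f"
    and comp_assoc:
      "\<lbrakk>W \<in> Obj C; X \<in> Obj C; Y \<in> Obj C; Z \<in> Obj C;
        f \<in> Hom C W X; g \<in> Hom C X Y; h \<in> Hom C Y Z\<rbrakk>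
        \<Longrightarrow> Comp C W Y Z h (Comp C W X Y g f) = Comp C W X Z (Comp C X Y Z h g) f"

record ('o, 'a, 'p, 'b) fnctr =
  fob :: "'o \<Rightarrow> 'p"
  fmap :: "'o \<Rightarrow> 'o \<Rightarrow> 'a \<Rightarrow> 'b"

locale cat_functor = dom: category C + cod: category D
  for C :: "('o, 'a, 'c) cat_scheme" and D :: "('p, 'b, 'd) cat_scheme" +
  fixes F :: "('o, 'a, 'p, 'b) fnctr"
  assumes fob_in_obj: "X \<in> Obj C \<Longrightarrow> fob F X \<in> Obj D"
    and fmap_in_hom:
      "\<lbrakk>X \<in> Obj C; Y \<in> Obj C; f \<in> Hom C X Y\<rbrakk> \<Longrightarrow> fmap F X Y f \<in> Hom D (fob F X) (fob F Y)"
    and fmap_ident: "X \<in> Obj C \<Longrightarrow> fmap F X X (Ident C X) = Ident D (fob F X)"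
    and fmap_comp:
      "\<lbrakk>X \<in> Obj C; Y \<in> Obj C; Z \<in> Obj C; f \<in> Hom C X Y; g \<in> Hom C Y Z\<rbrakk>
        \<Longrightarrow> fmap F X Z (Comp C X Y Z g f)
          = Comp D (fob F X) (fob F Y) (fob F Z) (fmap F Y Z g) (fmap F X Y f)"

definition id_functor :: "('o, 'a, 'o, 'a) fnctr" where
  "id_functor = \<lparr>fob = (\<lambda>X. X), fmap = (\<lambda>X Y f. f)\<rparr>"

definition comp_functor ::
  "('p, 'b, 'q, 'e) fnctr \<Rightarrow> ('o, 'a, 'p, 'b) fnctr \<Rightarrow> ('o, 'a, 'q, 'e) fnctr" where
  "comp_functor G F =
    \<lparr>fob = (\<lambda>X. fob G (fob F X)), fmap = (\<lambda>X Y f. fmap G (fob F X) (fob F Y) (fmap F X Y f))\<rparr>"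

definition natural_transformation ::
  "('o, 'a, 'c) cat_scheme \<Rightarrow> ('p, 'b, 'd) cat_scheme \<Rightarrow> ('o, 'a, 'p, 'b) fnctr \<Rightarrow>
    ('o, 'a, 'p, 'b) fnctr \<Rightarrow> ('o \<Rightarrow> 'b) \<Rightarrow> bool" where
  "natural_transformation C D F G \<eta> \<longleftrightarrow>
    (\<forall>X\<in>Obj C. \<eta> X \<in> Hom D (fob F X) (fob G X)) \<and>
    (\<forall>X\<in>Obj C. \<forall>Y\<in>Obj C. \<forall>f\<in>Hom C X Y.
      Comp D (fob F X) (fob F Y) (fob G Y) (\<eta> Y) (fmap F X Y f)
        = Comp D (fob F X) (fob G X) (fob G Y) (fmap G X Y f) (\<eta> X))"

definition isomorphism :: "('o, 'a, 'c) cat_scheme \<Rightarrow> 'o \<Rightarrow> 'o \<Rightarrow> 'a \<Rightarrow> bool" where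
  "isomorphism C X Y f \<longleftrightarrow>
    f \<in> Hom C X Y \<and>
    (\<exists>g\<in>Hom C Y X. Comp C X Y X g f = Ident C X \<and> Comp C Y X Y f g = Ident C Y)"

definition natural_isomorphism ::
  "('o, 'a, 'c) cat_scheme \<Rightarrow> ('p, 'b, 'd) cat_scheme \<Rightarrow> ('o, 'a, 'p, 'b) fnctr \<Rightarrow>
    ('o, 'a, 'p, 'b) fnctr \<Rightarrow> ('o \<Rightarrow> 'b) \<Rightarrow> bool" where
  "natural_isomorphism C D F G \<eta> \<longleftrightarrow>
    natural_transformation C D F G \<eta> \<and>
    (\<forall>X\<in>Obj C. isomorphism D (fob F X) (fob G X) (\<eta> X))"

definition equivalence_of_categories ::
  "('o, 'a, 'c) cat_scheme \<Rightarrow> ('p, 'b, 'd) cat_scheme \<Rightarrow> ('o, 'a, 'p, 'b) fnctr \<Rightarrow> bool" where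
  "equivalence_of_categories C D F \<longleftrightarrow>
    cat_functor C D F \<and>
    (\<exists>G \<eta> \<epsilon>. cat_functor D C G \<and>
      natural_isomorphism C C id_functor (comp_functor G F) \<eta> \<and>
      natural_isomorphism D D (comp_functor F G) id_functor \<epsilon>)"


section \<open>Products\<close>

definition is_product ::
  "('o, 'a, 'c) cat_scheme \<Rightarrow> nat set \<Rightarrow> (nat \<Rightarrow> 'o) \<Rightarrow> 'o \<Rightarrow> (nat \<Rightarrow> 'a) \<Rightarrow> bool" where
  "is_product C I X P \<pi> \<longleftrightarrow>
    P \<in> Obj C \<and> (\<forall>i\<in>I. X i \<in> Obj C \<and> \<pi> i \<in> Hom C P (X i)) \<and>
    (\<forall>Y\<in>Obj C. \<forall>f. (\<forall>i\<in>I. f i \<in> Hom C Y (X i)) \<longrightarrow>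
      (\<exists>!h. h \<in> Hom C Y P \<and> (\<forall>i\<in>I. Comp C Y P (X i) (\<pi> i) h = f i)))"

definition tuple ::
  "('o, 'a, 'c) cat_scheme \<Rightarrow> nat set \<Rightarrow> (nat \<Rightarrow> 'o) \<Rightarrow> 'o \<Rightarrow> (nat \<Rightarrow> 'a) \<Rightarrow>
    'o \<Rightarrow> (nat \<Rightarrow> 'a) \<Rightarrow> 'a" where
  "tuple C I X P \<pi> Y f =
    (THE h. h \<in> Hom C Y P \<and> (\<forall>i\<in>I. Comp C Y P (X i) (\<pi> i) h = f i))"

definition is_terminal :: "('o, 'a, 'c) cat_scheme \<Rightarrow> 'o \<Rightarrow> bool" where
  "is_terminal C T \<longleftrightarrow> T \<in> Obj C \<and> (\<forall>Y\<in>Obj C. \<exists>!h. h \<in> Hom C Y T)"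

definition preserves_finite_products ::
  "('o, 'a, 'c) cat_scheme \<Rightarrow> ('p, 'b, 'd) cat_scheme \<Rightarrow> ('o, 'a, 'p, 'b) fnctr \<Rightarrow> bool" where
  "preserves_finite_products C D F \<longleftrightarrow>
    (\<forall>I X P \<pi>. finite I \<longrightarrow> is_product C I X P \<pi> \<longrightarrow>
      is_product D I (\<lambda>i. fob F (X i)) (fob F P) (\<lambda>i. fmap F P (X i) (\<pi> i)))"


section \<open>Abelian group objects and slices\<close>

text \<open>
  A terminal object and a product of the carrier with itself are part of the data of an abelian
  group object. They are unique up to a unique isomorphism, and morphisms ignore them, so this is the
  usual category of abelian group objects; a functor that preserves finite products can be applied
  to all the data without choosing comparison isomorphisms.
\<close>

record ('o, 'a) abobj =
  ab_carrier :: 'o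
  ab_one :: 'o
  ab_square :: 'o
  ab_pr :: "nat \<Rightarrow> 'a"
  ab_add :: 'a
  ab_zero :: 'a
  ab_neg :: 'a

definition ab_pair ::
  "('o, 'a, 'c) cat_scheme \<Rightarrow> ('o, 'a) abobj \<Rightarrow> 'o \<Rightarrow> 'a \<Rightarrow> 'a \<Rightarrow> 'a" where
  "ab_pair C G Y f g =
    tuple C {0, 1} (\<lambda>_. ab_carrier G) (ab_square G) (ab_pr G) Y (\<lambda>i. if i = 0 then f else g)"

definition ab_sum ::
  "('o, 'a, 'c) cat_scheme \<Rightarrow> ('o, 'a) abobj \<Rightarrow> 'o \<Rightarrow> 'a \<Rightarrow> 'a \<Rightarrow> 'a" where
  "ab_sum C G Y f g = Comp C Y (ab_square G) (ab_carrier G) (ab_add G) (ab_pair C G Y f g)"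

text \<open>The composite \<open>Y \<rightarrow> 1 \<rightarrow> G\<close> with the neutral element.\<close>

definition ab_null :: "('o, 'a, 'c) cat_scheme \<Rightarrow> ('o, 'a) abobj \<Rightarrow> 'o \<Rightarrow> 'a" where
  "ab_null C G Y =
    Comp C Y (ab_one G) (ab_carrier G) (ab_zero G) (THE h. h \<in> Hom C Y (ab_one G))"

text \<open>
  Associativity is stated for all triples of arrows into the carrier; the three projections of a
  triple product give the usual diagram.
\<close>

locale abelian_group_object =
  fixes C :: "('o, 'a, 'c) cat_scheme" and G :: "('o, 'a) abobj"
  assumes carrier_obj: "ab_carrier G \<in> Obj C"
    and one_terminal: "is_terminal C (ab_one G)"
    and square_product: "is_product C {0, 1} (\<lambda>_. ab_carrier G) (ab_square G) (ab_pr G)"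
    and add_in_hom: "ab_add G \<in> Hom C (ab_square G) (ab_carrier G)"
    and zero_in_hom: "ab_zero G \<in> Hom C (ab_one G) (ab_carrier G)"
    and neg_in_hom: "ab_neg G \<in> Hom C (ab_carrier G) (ab_carrier G)"
    and ab_add_assoc:
      "\<lbrakk>Y \<in> Obj C; f \<in> Hom C Y (ab_carrier G); g \<in> Hom C Y (ab_carrier G);
        h \<in> Hom C Y (ab_carrier G)\<rbrakk>
        \<Longrightarrow> ab_sum C G Y (ab_sum C G Y f g) h = ab_sum C G Y f (ab_sum C G Y g h)"
    and ab_add_comm: "ab_sum C G (ab_square G) (ab_pr G 1) (ab_pr G 0) = ab_add G"
    and ab_add_zero:
      "ab_sum C G (ab_carrier G) (ab_null C G (ab_carrier G)) (Ident C (ab_carrier G))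
        = Ident C (ab_carrier G)"
    and ab_add_neg:
      "ab_sum C G (ab_carrier G) (ab_neg G) (Ident C (ab_carrier G)) = ab_null C G (ab_carrier G)"

definition Ab :: "('o, 'a, 'c) cat_scheme \<Rightarrow> (('o, 'a) abobj, 'a) cat" where
  "Ab C =
    \<lparr>Obj = {G. abelian_group_object C G},
     Hom = (\<lambda>G H. {u \<in> Hom C (ab_carrier G) (ab_carrier H).
        Comp C (ab_square G) (ab_carrier G) (ab_carrier H) u (ab_add G)
          = ab_sum C H (ab_square G)
              (Comp C (ab_square G) (ab_carrier G) (ab_carrier H) u (ab_pr G 0))
              (Comp C (ab_square G) (ab_carrier G) (ab_carrier H) u (ab_pr G 1))}),
     Ident = (\<lambda>G. Ident C (ab_carrier G)),
     Comp = (\<lambda>G H K. Comp C (ab_carrier G) (ab_carrier H) (ab_carrier K))\<rparr>"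

definition Ab_map ::
  "('o, 'a, 'p, 'b) fnctr \<Rightarrow> (('o, 'a) abobj, 'a, ('p, 'b) abobj, 'b) fnctr" where
  "Ab_map F =
    \<lparr>fob = (\<lambda>G.
      \<lparr>ab_carrier = fob F (ab_carrier G),
       ab_one = fob F (ab_one G),
       ab_square = fob F (ab_square G),
       ab_pr = (\<lambda>i. fmap F (ab_square G) (ab_carrier G) (ab_pr G i)),
       ab_add = fmap F (ab_square G) (ab_carrier G) (ab_add G),
       ab_zero = fmap F (ab_one G) (ab_carrier G) (ab_zero G),
       ab_neg = fmap F (ab_carrier G) (ab_carrier G) (ab_neg G)\<rparr>),
     fmap = (\<lambda>G H. fmap F (ab_carrier G) (ab_carrier H))\<rparr>"

definition slice :: "('o, 'a, 'c) cat_scheme \<Rightarrow> 'o \<Rightarrow> ('o \<times> 'a, 'a) cat" where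
  "slice C A =
    \<lparr>Obj = {(X, f). X \<in> Obj C \<and> f \<in> Hom C X A},
     Hom = (\<lambda>(X, f) (Y, g). {h \<in> Hom C X Y. Comp C X Y A g h = f}),
     Ident = (\<lambda>(X, f). Ident C X),
     Comp = (\<lambda>(X, f) (Y, g) (Z, k). Comp C X Y Z)\<rparr>"

definition slice_map ::
  "('o, 'a, 'p, 'b) fnctr \<Rightarrow> 'o \<Rightarrow> ('o \<times> 'a, 'a, 'p \<times> 'b, 'b) fnctr" where
  "slice_map F A =
    \<lparr>fob = (\<lambda>(X, f). (fob F X, fmap F X A f)),
     fmap = (\<lambda>(X, f) (Y, g). fmap F X Y)\<rparr>"

definition Mod :: "('o, 'a, 'c) cat_scheme \<Rightarrow> 'o \<Rightarrow> (('o \<times> 'a, 'a) abobj, 'a) cat" where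
  "Mod C A = Ab (slice C A)"

definition Mod_map ::
  "('o, 'a, 'p, 'b) fnctr \<Rightarrow> 'o \<Rightarrow> (('o \<times> 'a, 'a) abobj, 'a, ('p \<times> 'b, 'b) abobj, 'b) fnctr" where
  "Mod_map F A = Ab_map (slice_map F A)"


section \<open>Two-sorted Lawvere theories and their algebras\<close>

text \<open>
  The object \<open>(m, n)\<close> is \<open>(m|n)\<close>. Its \<open>m + n\<close> coordinates are numbered with the \<open>m\<close> even ones
  first, and the coordinate projections \<open>proj T (m, n) i\<close> are part of the structure.
\<close>

record 's thy = "(nat \<times> nat, 's) cat" +
  proj :: "nat \<times> nat \<Rightarrow> nat \<Rightarrow> 's"

definition srt :: "bit \<Rightarrow> nat \<times> nat" where
  "srt p = (if p = 0 then (1, 0) else (0, 1))"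

definition len :: "nat \<times> nat \<Rightarrow> nat" where
  "len X = fst X + snd X"

definition gr :: "nat \<times> nat \<Rightarrow> nat \<Rightarrow> bit" where
  "gr X i = (if i < fst X then 0 else 1)"

locale lawvere_theory = category T for T :: "('s, 'x) thy_scheme" +
  assumes obj_UNIV: "Obj T = UNIV"
    and proj_product: "is_product T {..<len X} (\<lambda>i. srt (gr X i)) X (proj T X)"
    and proj_srt: "proj T (srt p) 0 = Ident T (srt p)"

definition tup :: "('s, 'x) thy_scheme \<Rightarrow> nat \<times> nat \<Rightarrow> nat \<times> nat \<Rightarrow> (nat \<Rightarrow> 's) \<Rightarrow> 's" where
  "tup T X Y f = tuple T {..<len Y} (\<lambda>i. srt (gr Y i)) Y (proj T Y) X f"

locale theory_morphism =
  src: lawvere_theory S + tgt: lawvere_theory T + cat_functor S T \<tau>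
  for S :: "('s, 'x) thy_scheme" and T :: "('t, 'y) thy_scheme"
    and \<tau> :: "(nat \<times> nat, 's, nat \<times> nat, 't) fnctr" +
  assumes fob_id: "fob \<tau> X = X"
    and fmap_proj: "i < len X \<Longrightarrow> fmap \<tau> X (srt (gr X i)) (proj S X i) = proj T X i"

text \<open>
  The category of sets with elements in the type \<open>'u\<close>, which plays the role of a universe.
\<close>

definition set_cat :: "('u set, 'u \<Rightarrow> 'u) cat" where
  "set_cat =
    \<lparr>Obj = UNIV,
     Hom = (\<lambda>A B. A \<rightarrow>\<^sub>E B),
     Ident = (\<lambda>A. \<lambda>x\<in>A. x),
     Comp = (\<lambda>A B C g f. compose A g f)\<rparr>"

type_synonym ('s, 'u) alg = "(nat \<times> nat, 's, 'u set, 'u \<Rightarrow> 'u) fnctr"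

definition Alg ::
  "('s, 'x) thy_scheme \<Rightarrow> (('s, 'u) alg, nat \<times> nat \<Rightarrow> 'u \<Rightarrow> 'u) cat" where
  "Alg T =
    \<lparr>Obj = {A. cat_functor T set_cat A \<and> preserves_finite_products T set_cat A},
     Hom = (\<lambda>A B. {\<eta>. natural_transformation T set_cat A B \<eta>}),
     Ident = (\<lambda>A X. Ident set_cat (fob A X)),
     Comp = (\<lambda>A B C \<theta> \<eta> X. Comp set_cat (fob A X) (fob B X) (fob C X) (\<theta> X) (\<eta> X))\<rparr>"

text \<open>The functor \<open>\<tau>\<^sup>*\<close> between the categories of algebras: precomposition with \<open>\<tau>\<close>.\<close>

definition pullback_functor ::
  "(nat \<times> nat, 's, nat \<times> nat, 't) fnctr \<Rightarrow>
    (('t, 'u) alg, nat \<times> nat \<Rightarrow> 'u \<Rightarrow> 'u, ('s, 'u) alg, nat \<times> nat \<Rightarrow> 'u \<Rightarrow> 'u) fnctr" where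
  "pullback_functor \<tau> =
    \<lparr>fob = (\<lambda>A. comp_functor A \<tau>), fmap = (\<lambda>A B \<eta> X. \<eta> (fob \<tau> X))\<rparr>"


section \<open>The theory of supercommutative algebras over a ground superring\<close>

record 'k superring =
  car :: "bit \<Rightarrow> 'k set"
  sadd :: "bit \<Rightarrow> 'k \<Rightarrow> 'k \<Rightarrow> 'k"
  smul :: "bit \<Rightarrow> bit \<Rightarrow> 'k \<Rightarrow> 'k \<Rightarrow> 'k"
  szero :: "bit \<Rightarrow> 'k"
  sone :: 'k

definition rat_superring :: "rat superring" where
  "rat_superring =
    \<lparr>car = (\<lambda>p. if p = 0 then UNIV else {0}), sadd = (\<lambda>_. (+)), smul = (\<lambda>_ _. (*)),
     szero = (\<lambda>_. 0), sone = 1\<rparr>"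

text \<open>
  Homogeneous terms: \<open>wt K X p t\<close> says that \<open>t\<close> is a term of parity \<open>p\<close> in the coordinates
  of \<open>X\<close>, with a constant for every element of \<open>K\<close>.
\<close>

datatype 'k trm =
    Var nat
  | Cst bit 'k
  | Add "'k trm" "'k trm"
  | Neg "'k trm"
  | Mul "'k trm" "'k trm"

inductive wt :: "('k, 'z) superring_scheme \<Rightarrow> nat \<times> nat \<Rightarrow> bit \<Rightarrow> 'k trm \<Rightarrow> bool"
  for K X where
  wt_Var: "i < len X \<Longrightarrow> wt K X (gr X i) (Var i)"
| wt_Cst: "c \<in> car K p \<Longrightarrow> wt K X p (Cst p c)"
| wt_Add: "wt K X p t \<Longrightarrow> wt K X p u \<Longrightarrow> wt K X p (Add t u)"
| wt_Neg: "wt K X p t \<Longrightarrow> wt K X p (Neg t)"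
| wt_Mul: "wt K X p t \<Longrightarrow> wt K X q u \<Longrightarrow> wt K X (p + q) (Mul t u)"

text \<open>
  Provable equality from the axioms of supercommutative \<open>K\<close>-algebras. Distributivity on the
  other side, the unit law on the other side, and the laws for negatives of constants follow.
\<close>

inductive teq ::
  "('k, 'z) superring_scheme \<Rightarrow> nat \<times> nat \<Rightarrow> bit \<Rightarrow> 'k trm \<Rightarrow> 'k trm \<Rightarrow> bool"
  for K X where
  teq_refl: "wt K X p t \<Longrightarrow> teq K X p t t"
| teq_sym: "teq K X p t u \<Longrightarrow> teq K X p u t"
| teq_trans: "teq K X p t u \<Longrightarrow> teq K X p u v \<Longrightarrow> teq K X p t v"
| teq_Add: "teq K X p t t' \<Longrightarrow> teq K X p u u' \<Longrightarrow> teq K X p (Add t u) (Add t' u')"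
| teq_Neg: "teq K X p t t' \<Longrightarrow> teq K X p (Neg t) (Neg t')"
| teq_Mul: "teq K X p t t' \<Longrightarrow> teq K X q u u' \<Longrightarrow> teq K X (p + q) (Mul t u) (Mul t' u')"
| teq_add_assoc: "wt K X p t \<Longrightarrow> wt K X p u \<Longrightarrow> wt K X p v \<Longrightarrow>
    teq K X p (Add (Add t u) v) (Add t (Add u v))"
| teq_add_comm: "wt K X p t \<Longrightarrow> wt K X p u \<Longrightarrow> teq K X p (Add t u) (Add u t)"
| teq_add_zero: "wt K X p t \<Longrightarrow> teq K X p (Add (Cst p (szero K p)) t) t"
| teq_add_neg: "wt K X p t \<Longrightarrow> teq K X p (Add (Neg t) t) (Cst p (szero K p))"
| teq_mul_assoc: "wt K X p t \<Longrightarrow> wt K X q u \<Longrightarrow> wt K X r v \<Longrightarrow>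
    teq K X (p + q + r) (Mul (Mul t u) v) (Mul t (Mul u v))"
| teq_mul_one: "wt K X p t \<Longrightarrow> teq K X p (Mul (Cst 0 (sone K)) t) t"
| teq_mul_add: "wt K X p t \<Longrightarrow> wt K X q u \<Longrightarrow> wt K X q v \<Longrightarrow>
    teq K X (p + q) (Mul t (Add u v)) (Add (Mul t u) (Mul t v))"
| teq_mul_supercomm: "wt K X p t \<Longrightarrow> wt K X q u \<Longrightarrow>
    teq K X (p + q) (Mul t u) (if p = 1 \<and> q = 1 then Neg (Mul u t) else Mul u t)"
| teq_cst_add: "c \<in> car K p \<Longrightarrow> d \<in> car K p \<Longrightarrow>
    teq K X p (Add (Cst p c) (Cst p d)) (Cst p (sadd K p c d))"
| teq_cst_mul: "c \<in> car K p \<Longrightarrow> d \<in> car K q \<Longrightarrow>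
    teq K X (p + q) (Mul (Cst p c) (Cst q d)) (Cst (p + q) (smul K p q c d))"

primrec subst :: "(nat \<Rightarrow> 'k trm) \<Rightarrow> 'k trm \<Rightarrow> 'k trm" where
  "subst s (Var i) = s i"
| "subst s (Cst p c) = Cst p c"
| "subst s (Add t u) = Add (subst s t) (subst s u)"
| "subst s (Neg t) = Neg (subst s t)"
| "subst s (Mul t u) = Mul (subst s t) (subst s u)"

definition cls :: "('k, 'z) superring_scheme \<Rightarrow> nat \<times> nat \<Rightarrow> bit \<Rightarrow> 'k trm \<Rightarrow> 'k trm set" where
  "cls K X p t = {u. teq K X p t u}"

text \<open>
  Arrows \<open>(m|n) \<rightarrow> (p|q)\<close> of the theory of supercommutative \<open>K\<close>-algebras: \<open>p\<close> even and \<open>q\<close> odd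
  elements of the free algebra \<open>K[x\<^sub>1, \<dots>, x\<^sub>m; \<xi>\<^sub>1, \<dots>, \<xi>\<^sub>n]\<close>, which consists of terms modulo
  provable equality. Composition is substitution.
\<close>

definition SCom :: "('k, 'z) superring_scheme \<Rightarrow> 'k trm set list thy" where
  "SCom K =
    \<lparr>Obj = UNIV,
     Hom = (\<lambda>X Y. {fs. length fs = len Y \<and>
        (\<forall>i<len Y. \<exists>t. wt K X (gr Y i) t \<and> fs ! i = cls K X (gr Y i) t)}),
     Ident = (\<lambda>X. map (\<lambda>i. cls K X (gr X i) (Var i)) [0..<len X]),
     Comp = (\<lambda>X Y Z gs fs. map (\<lambda>j.
        {u. \<exists>t\<in>gs ! j. \<exists>s. (\<forall>i<len Y. s i \<in> fs ! i) \<and> teq K X (gr Z j) (subst s t) u})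
        [0..<len Z]),
     proj = (\<lambda>X i. [cls K X (gr X i) (Var i)])\<rparr>"


section \<open>Super Fermat theories\<close>

text \<open>
  Let \<open>\<tau>\<close> be a morphism from the theory of supercommutative algebras over the rationals to \<open>S\<close>.
  The elements of parity \<open>p\<close> of the free algebra \<open>S(X)\<close> are the arrows \<open>X \<rightarrow> srt p\<close>, and the
  following are their algebra operations.
\<close>

type_synonym 's scom_map = "(nat \<times> nat, rat trm set list, nat \<times> nat, 's) fnctr"

definition oadd ::
  "('s, 'x) thy_scheme \<Rightarrow> 's scom_map \<Rightarrow> nat \<times> nat \<Rightarrow> bit \<Rightarrow> 's \<Rightarrow> 's \<Rightarrow> 's" where
  "oadd S \<tau> X p f g =
    (let D = srt p + srt p in
      Comp S X D (srt p) (fmap \<tau> D (srt p) [cls rat_superring D p (Add (Var 0) (Var 1))])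
        (tup S X D (\<lambda>i. if i = 0 then f else g)))"

definition oneg ::
  "('s, 'x) thy_scheme \<Rightarrow> 's scom_map \<Rightarrow> nat \<times> nat \<Rightarrow> bit \<Rightarrow> 's \<Rightarrow> 's" where
  "oneg S \<tau> X p f =
    Comp S X (srt p) (srt p)
      (fmap \<tau> (srt p) (srt p) [cls rat_superring (srt p) p (Neg (Var 0))]) f"

text \<open>
  The two factors occupy the coordinates \<open>i\<close> and \<open>1 - i\<close> of \<open>srt p + srt q\<close>; they are swapped
  for odd times even, because even coordinates come first.
\<close>

definition omul ::
  "('s, 'x) thy_scheme \<Rightarrow> 's scom_map \<Rightarrow> nat \<times> nat \<Rightarrow> bit \<Rightarrow> bit \<Rightarrow> 's \<Rightarrow> 's \<Rightarrow> 's" where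
  "omul S \<tau> X p q f g =
    (let D = srt p + srt q; i = (if p = 1 \<and> q = 0 then 1 else 0) in
      Comp S X D (srt (p + q))
        (fmap \<tau> D (srt (p + q)) [cls rat_superring D (p + q) (Mul (Var i) (Var (1 - i)))])
        (tup S X D (\<lambda>k. if k = i then f else g)))"

definition osub ::
  "('s, 'x) thy_scheme \<Rightarrow> 's scom_map \<Rightarrow> nat \<times> nat \<Rightarrow> bit \<Rightarrow> 's \<Rightarrow> 's \<Rightarrow> 's" where
  "osub S \<tau> X p f g = oadd S \<tau> X p f (oneg S \<tau> X p g)"

text \<open>
  In the even condition the coordinates of \<open>(2 + p, q)\<close> are \<open>x, y, z; \<zeta>\<close>; in the odd condition
  those of \<open>(p, 2 + q)\<close> are \<open>z; \<theta>, \<eta>, \<zeta>\<close>.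
\<close>

locale super_fermat_theory = theory_morphism "SCom rat_superring" S \<tau>
  for S :: "('s, 'x) thy_scheme"
    and \<tau> :: "'s scom_map" +
  assumes fermat_even:
    "f \<in> Hom S (1 + p, q) (srt s) \<Longrightarrow>
      (let X = (2 + p, q); x = proj S X 0; y = proj S X 1;
        f_xz = Comp S X (1 + p, q) (srt s) f
          (tup S X (1 + p, q) (\<lambda>i. proj S X (if i = 0 then 0 else i + 1)));
        f_yz = Comp S X (1 + p, q) (srt s) f
          (tup S X (1 + p, q) (\<lambda>i. proj S X (i + 1)))
      in \<exists>!g. g \<in> Hom S X (srt s) \<and>
        osub S \<tau> X s f_xz f_yz = omul S \<tau> X 0 s (osub S \<tau> X 0 x y) g)"
  and fermat_odd:
    "f \<in> Hom S (p, 1 + q) (srt s) \<Longrightarrow>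
      (let X = (p, 2 + q); \<theta> = proj S X p; \<eta> = proj S X (p + 1);
        f_\<theta> = Comp S X (p, 1 + q) (srt s) f
          (tup S X (p, 1 + q) (\<lambda>i. proj S X (if i \<le> p then i else i + 1)));
        f_\<eta> = Comp S X (p, 1 + q) (srt s) f
          (tup S X (p, 1 + q) (\<lambda>i. proj S X (if i < p then i else i + 1)))
      in \<exists>!h. h \<in> Hom S (p, q) (srt (s + 1)) \<and>
        osub S \<tau> X s f_\<theta> f_\<eta> =
          omul S \<tau> X 1 (s + 1) (osub S \<tau> X 1 \<theta> \<eta>)
            (Comp S X (p, q) (srt (s + 1)) h
              (tup S X (p, q) (\<lambda>i. proj S X (if i < p then i else i + 2)))))"

text \<open>The ground ring \<open>S(0|0)\<close>.\<close>

definition ground :: "('s, 'x) thy_scheme \<Rightarrow> 's scom_map \<Rightarrow> 's superring" where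
  "ground S \<tau> =
    \<lparr>car = (\<lambda>p. Hom S (0, 0) (srt p)),
     sadd = oadd S \<tau> (0, 0),
     smul = omul S \<tau> (0, 0),
     szero = (\<lambda>p. fmap \<tau> (0, 0) (srt p) [cls rat_superring (0, 0) p (Cst p 0)]),
     sone = fmap \<tau> (0, 0) (srt 0) [cls rat_superring (0, 0) 0 (Cst 0 1)]\<rparr>"

text \<open>
  The structure map from the theory of supercommutative \<open>S(0|0)\<close>-algebras to \<open>S\<close> evaluates terms
  in the algebras \<open>S(X)\<close>; a constant is itself an arrow \<open>(0|0) \<rightarrow> srt p\<close>.
\<close>

primrec tgr :: "nat \<times> nat \<Rightarrow> 'k trm \<Rightarrow> bit" where
  "tgr X (Var i) = gr X i"
| "tgr X (Cst p c) = p"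
| "tgr X (Add t u) = tgr X t"
| "tgr X (Neg t) = tgr X t"
| "tgr X (Mul t u) = tgr X t + tgr X u"

primrec interp ::
  "('s, 'x) thy_scheme \<Rightarrow> 's scom_map \<Rightarrow> nat \<times> nat \<Rightarrow> 's trm \<Rightarrow> 's" where
  "interp S \<tau> X (Var i) = proj S X i"
| "interp S \<tau> X (Cst p c) = Comp S X (0, 0) (srt p) c (tup S X (0, 0) (\<lambda>_. undefined))"
| "interp S \<tau> X (Add t u) = oadd S \<tau> X (tgr X t) (interp S \<tau> X t) (interp S \<tau> X u)"
| "interp S \<tau> X (Neg t) = oneg S \<tau> X (tgr X t) (interp S \<tau> X t)"
| "interp S \<tau> X (Mul t u) =
    omul S \<tau> X (tgr X t) (tgr X u) (interp S \<tau> X t) (interp S \<tau> X u)"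

definition structure_map ::
  "('s, 'x) thy_scheme \<Rightarrow> 's scom_map \<Rightarrow>
    (nat \<times> nat, 's trm set list, nat \<times> nat, 's) fnctr" where
  "structure_map S \<tau> =
    \<lparr>fob = (\<lambda>X. X),
     fmap = (\<lambda>X Y fs. tup S X Y (\<lambda>i. the_elem (interp S \<tau> X ` (fs ! i))))\<rparr>"

end

theory Submission
  imports Defs "HOL-Algebra.Ring"
begin

text \<open>
  An abelian group object over an algebra \<open>A\<close> is a split extension of \<open>A\<close> whose kernel has square
  zero, and this is equally true for \<open>S\<close>-algebras and for supercommutative \<open>K\<close>-algebras. Indeed let
  \<open>C \<rightarrow> A\<close> be the carrier and \<open>e\<close> the neutral element of a fibre. Since the group law
  \<open>C \<times>\<^sub>A C \<rightarrow> C\<close> preserves sums, \<open>(x, y) + (e, e) = (x, e) + (e, y)\<close> forces it to be \<open>x + y - e\<close>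
  (\<open>add_formula\<close>); since it preserves products, \<open>(m, 0)(0, n) = 0\<close> forces the product of two elements
  of the kernel to vanish (\<open>kernel_square_zero\<close>). In particular a morphism over \<open>A\<close> is a morphism of
  group objects as soon as it preserves the neutral elements (\<open>Mod_Hom\<close>), and associativity is automatic.
  So the theorem is a statement about split square-zero extensions: each one in the category of
  \<open>K\<close>-algebras carries exactly one \<open>S\<close>-structure compatible with projection and section, and
  \<open>K\<close>-linear homomorphisms of such extensions respect it.

  Both facts come from differential calculus. The difference quotients of a super Fermat theory give
  every operation \<open>f\<close> partial derivatives \<open>pd X i f\<close>, and in every \<open>S\<close>-algebra
  \<open>f(b + d) = f(b) + \<Sum>\<^sub>i d\<^sub>i (\<partial>\<^sub>i f)(b)\<close> modulo products of two increments (\<open>taylor\<close>). On an extension with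
  section \<open>s\<close>, projection \<open>p\<close> and square-zero kernel the value of \<open>f\<close> at \<open>c\<close> must therefore be
  \<open>s(f(p c)) + \<Sum>\<^sub>i (c\<^sub>i - s p c\<^sub>i) s((\<partial>\<^sub>i f)(p c))\<close>, an expression in the ring structure and the
  operations of \<open>A\<close> alone (\<open>lifted_op\<close>, \<open>op_of_algebra\<close>, \<open>lifted_op_natural\<close>). This gives full
  faithfulness. Conversely, the same formula defines operations on any split square-zero extension of
  \<open>K\<close>-algebras: they are compatible with composition by the chain rule (\<open>pd_chain\<close>,
  \<open>lifted_op_chain\<close>), and they induce the given \<open>K\<close>-algebra structure because the derivatives of sums
  and products are the usual ones (\<open>lifted_op_interp\<close>). This gives essential surjectivity.

  The chain rule is obtained from a uniqueness property of derivatives (\<open>pd_unique\<close>): in a free algebra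
  with two additional variables, their difference \<open>\<epsilon>\<close> can be cancelled, so the coefficient of \<open>\<epsilon>\<close> in an
  expansion modulo \<open>\<epsilon>\<^sup>2\<close> is determined. Signs are kept under control by computing in the ungraded ring
  spanned by the even and the odd part of an algebra, with increments always on the left.
\<close>

section \<open>Equivalences of categories\<close>

text \<open>
  A quasi-inverse sends an object to a chosen object with isomorphic image, and an arrow to the unique
  preimage of its conjugate by the chosen isomorphisms.
\<close>

lemma equivalence_if_fully_faithful_ess_surj:
  assumes F: "cat_functor C D F"
    and ff: "\<And>X Y. X \<in> Obj C \<Longrightarrow> Y \<in> Obj C \<Longrightarrow>
      bij_betw (fmap F X Y) (Hom C X Y) (Hom D (fob F X) (fob F Y))"
    and es: "\<And>Z. Z \<in> Obj D \<Longrightarrow> \<exists>X\<in>Obj C. \<exists>u. isomorphism D (fob F X) Z u"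
  shows "equivalence_of_categories C D F"
proof -
  interpret F: cat_functor C D F by fact
  note [simp] = F.fob_in_obj F.fmap_in_hom F.fmap_ident F.fmap_comp
    F.dom.ident_in_hom F.dom.comp_in_hom F.dom.ident_left F.dom.ident_right
    F.cod.ident_in_hom F.cod.comp_in_hom F.cod.ident_left F.cod.ident_right
  have faithful: "f = g" if "X \<in> Obj C" "Y \<in> Obj C" "f \<in> Hom C X Y" "g \<in> Hom C X Y"
      "fmap F X Y f = fmap F X Y g" for X Y f g
    using ff[OF that(1,2)] that by (auto simp: bij_betw_def dest: inj_onD)
  define L where "L X Y = inv_into (Hom C X Y) (fmap F X Y)" for X Y
  have L_hom[simp]: "L X Y f \<in> Hom C X Y" and F_L[simp]: "fmap F X Y (L X Y f) = f"
    if "X \<in> Obj C" "Y \<in> Obj C" "f \<in> Hom D (fob F X) (fob F Y)" for X Y f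
    using ff[OF that(1,2)] that(3) unfolding L_def bij_betw_def
    by (metis inv_into_into, metis f_inv_into_f)
  obtain g e where gobj[simp]: "\<And>Z. Z \<in> Obj D \<Longrightarrow> g Z \<in> Obj C"
    and "\<And>Z. Z \<in> Obj D \<Longrightarrow> isomorphism D (fob F (g Z)) Z (e Z)"
    using es by metis
  then obtain e' where e[simp]: "\<And>Z. Z \<in> Obj D \<Longrightarrow> e Z \<in> Hom D (fob F (g Z)) Z"
    and e'[simp]: "\<And>Z. Z \<in> Obj D \<Longrightarrow> e' Z \<in> Hom D Z (fob F (g Z))"
    and e'e[simp]: "\<And>Z. Z \<in> Obj D \<Longrightarrow> Comp D (fob F (g Z)) Z (fob F (g Z)) (e' Z) (e Z) = Ident D (fob F (g Z))"
    and ee'[simp]: "\<And>Z. Z \<in> Obj D \<Longrightarrow> Comp D Z (fob F (g Z)) Z (e Z) (e' Z) = Ident D Z"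
    unfolding isomorphism_def by metis
  have e'_e_comp[simp]: "Comp D X Z (fob F (g Z)) (e' Z) (Comp D X (fob F (g Z)) Z (e Z) f) = f"
    if "X \<in> Obj D" "Z \<in> Obj D" "f \<in> Hom D X (fob F (g Z))" for X Z f
    using that F.cod.comp_assoc[of X "fob F (g Z)" Z "fob F (g Z)" f "e Z" "e' Z"] by simp
  have e_e'_comp[simp]: "Comp D X (fob F (g Z)) Z (e Z) (Comp D X Z (fob F (g Z)) (e' Z) f) = f"
    if "X \<in> Obj D" "Z \<in> Obj D" "f \<in> Hom D X Z" for X Z f
    using that F.cod.comp_assoc[of X Z "fob F (g Z)" Z f "e' Z" "e Z"] by simp
  define conj where "conj Z W f =
    Comp D (fob F (g Z)) W (fob F (g W)) (e' W) (Comp D (fob F (g Z)) Z W f (e Z))" for Z W f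
  have conj_hom[simp]: "conj Z W f \<in> Hom D (fob F (g Z)) (fob F (g W))"
    if "Z \<in> Obj D" "W \<in> Obj D" "f \<in> Hom D Z W" for Z W f
    using that unfolding conj_def by (meson F.cod.comp_in_hom F.fob_in_obj e e' gobj)
  have conj_comp: "conj Z V (Comp D Z W V k f)
      = Comp D (fob F (g Z)) (fob F (g W)) (fob F (g V)) (conj W V k) (conj Z W f)"
    if "Z \<in> Obj D" "W \<in> Obj D" "V \<in> Obj D" "f \<in> Hom D Z W" "k \<in> Hom D W V" for Z W V f k
  proof -
    define f' where "f' = Comp D (fob F (g Z)) Z W f (e Z)"
    have f'[simp]: "f' \<in> Hom D (fob F (g Z)) W"
      using that unfolding f'_def by simp
    have "Comp D (fob F (g Z)) (fob F (g W)) (fob F (g V)) (conj W V k) (conj Z W f)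
      = Comp D (fob F (g Z)) V (fob F (g V)) (e' V)
         (Comp D (fob F (g Z)) (fob F (g W)) V (Comp D (fob F (g W)) W V k (e W)) (conj Z W f))"
      unfolding conj_def[of W V] using that conj_hom[of Z W f]
      by (subst F.cod.comp_assoc) (auto simp del: conj_hom)
    also have "Comp D (fob F (g Z)) (fob F (g W)) V (Comp D (fob F (g W)) W V k (e W)) (conj Z W f)
      = Comp D (fob F (g Z)) W V k (Comp D (fob F (g Z)) (fob F (g W)) W (e W) (conj Z W f))"
      using that by (subst F.cod.comp_assoc) auto
    also have "Comp D (fob F (g Z)) (fob F (g W)) W (e W) (conj Z W f) = f'"
      unfolding conj_def f'_def[symmetric] using that by simp
    also have "Comp D (fob F (g Z)) W V k f' = Comp D (fob F (g Z)) Z V (Comp D Z W V k f) (e Z)"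
      unfolding f'_def using that by (subst F.cod.comp_assoc) auto
    finally show ?thesis unfolding conj_def by simp
  qed
  have conj_ident: "conj Z Z (Ident D Z) = Ident D (fob F (g Z))" if "Z \<in> Obj D" for Z
    using that unfolding conj_def by simp
  define G where "G = \<lparr>fob = g, fmap = (\<lambda>Z W f. L (g Z) (g W) (conj Z W f))\<rparr>"
  have fobG[simp]: "fob G Z = g Z" and fmapG[simp]: "fmap G Z W f = L (g Z) (g W) (conj Z W f)"
    for Z W f by (simp_all add: G_def)
  have catG: "cat_functor D C G"
  proof (unfold_locales, goal_cases)
    case (3 Z)
    then show ?case by (intro faithful[of "g Z" "g Z"]) (auto simp: conj_ident)
  next
    case (4 X Y Z f k)
    then show ?case by (intro faithful[of "g X" "g Z"]) (auto simp: conj_comp)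
  qed auto
  define \<eta> where "\<eta> X = L X (g (fob F X)) (e' (fob F X))" for X
  have \<eta>: "\<eta> X \<in> Hom C X (g (fob F X))" "fmap F X (g (fob F X)) (\<eta> X) = e' (fob F X)"
    if "X \<in> Obj C" for X using that by (auto simp: \<eta>_def)
  have nat1: "natural_isomorphism C C id_functor (comp_functor G F) \<eta>"
    unfolding natural_isomorphism_def natural_transformation_def isomorphism_def
  proof (intro conjI ballI, goal_cases)
    case (1 X) then show ?case by (simp add: id_functor_def comp_functor_def \<eta>)
  next
    case (2 X Y f)
    let ?P = "fob F X" and ?Q = "fob F Y"
    have "Comp D ?P ?Q (fob F (g ?Q)) (e' ?Q) (fmap F X Y f)
      = Comp D ?P (fob F (g ?P)) (fob F (g ?Q)) (conj ?P ?Q (fmap F X Y f)) (e' ?P)"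
    proof -
      have "Comp D ?P (fob F (g ?P)) (fob F (g ?Q)) (conj ?P ?Q (fmap F X Y f)) (e' ?P)
        = Comp D ?P ?Q (fob F (g ?Q)) (e' ?Q) (Comp D ?P (fob F (g ?P)) ?Q
            (Comp D (fob F (g ?P)) ?P ?Q (fmap F X Y f) (e ?P)) (e' ?P))"
        unfolding conj_def using 2 by (subst F.cod.comp_assoc) auto
      also have "Comp D ?P (fob F (g ?P)) ?Q
            (Comp D (fob F (g ?P)) ?P ?Q (fmap F X Y f) (e ?P)) (e' ?P) = fmap F X Y f"
        using 2 by (subst F.cod.comp_assoc[symmetric]) auto
      finally show ?thesis by simp
    qed
    then show ?case using 2
      by (intro faithful[of X "g ?Q"]) (simp_all add: id_functor_def comp_functor_def \<eta>)
  next
    case (3 X) then show ?case by (simp add: id_functor_def comp_functor_def \<eta>)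
  next
    case (4 X)
    let ?P = "fob F X"
    show ?case
    proof (rule bexI[of _ "L (g ?P) X (e ?P)"], goal_cases)
      case 1
      have "Comp C X (g ?P) X (L (g ?P) X (e ?P)) (\<eta> X) = Ident C X"
        using 4 by (intro faithful[of X X]) (simp_all add: \<eta>)
      moreover have "Comp C (g ?P) X (g ?P) (\<eta> X) (L (g ?P) X (e ?P)) = Ident C (g ?P)"
        using 4 by (intro faithful[of "g ?P" "g ?P"]) (simp_all add: \<eta>)
      ultimately show ?case using 4 by (simp add: id_functor_def comp_functor_def)
    qed (use 4 in \<open>simp add: id_functor_def comp_functor_def\<close>)
  qed
  have nat2: "natural_isomorphism D D (comp_functor F G) id_functor e"
    unfolding natural_isomorphism_def natural_transformation_def isomorphism_def
  proof (intro conjI ballI, goal_cases)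
    case (1 X) then show ?case by (simp add: id_functor_def comp_functor_def)
  next
    case (2 Z W f)
    then have "Comp D (fob F (g Z)) (fob F (g W)) W (e W) (conj Z W f)
      = Comp D (fob F (g Z)) Z W f (e Z)" unfolding conj_def by simp
    then show ?case using 2 by (simp add: id_functor_def comp_functor_def)
  next
    case (3 X) then show ?case by (simp add: id_functor_def comp_functor_def)
  next
    case (4 X) then show ?case by (intro bexI[of _ "e' X"]) (simp_all add: id_functor_def comp_functor_def)
  qed
  show ?thesis
    unfolding equivalence_of_categories_def using F catG nat1 nat2 by blast
qed

section \<open>Set-valued functors and Lawvere theories\<close>

lemma set_cat_simps[simp]:
  "Obj set_cat = UNIV" "Hom set_cat A B = A \<rightarrow>\<^sub>E B"
  "Ident set_cat A = (\<lambda>x\<in>A. x)" "Comp set_cat A B C g f = compose A g f"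
  by (simp_all add: set_cat_def)

lemma category_set_cat: "category set_cat"
  by unfold_locales (auto simp: compose_def fun_eq_iff PiE_iff extensional_def Pi_iff)

lemma is_product_set_cat_iff:
  fixes P :: "'u set"
  shows "is_product set_cat I X P \<pi> \<longleftrightarrow>
    (\<forall>i\<in>I. \<pi> i \<in> P \<rightarrow>\<^sub>E X i) \<and>
    (\<forall>a. (\<forall>i\<in>I. a i \<in> X i) \<longrightarrow> (\<exists>!x. x \<in> P \<and> (\<forall>i\<in>I. \<pi> i x = a i)))" (is "?l \<longleftrightarrow> ?r")
proof
  assume l: ?l
  show ?r
  proof (intro conjI allI impI)
    show "\<forall>i\<in>I. \<pi> i \<in> P \<rightarrow>\<^sub>E X i" using l by (simp add: is_product_def)
    fix a assume a: "\<forall>i\<in>I. a i \<in> X i"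
    let ?Y = "{undefined :: 'u}"
    have "\<forall>i\<in>I. (\<lambda>x\<in>?Y. a i) \<in> ?Y \<rightarrow>\<^sub>E X i" using a by auto
    then have ex1: "\<exists>!h. h \<in> ?Y \<rightarrow>\<^sub>E P \<and> (\<forall>i\<in>I. compose ?Y (\<pi> i) h = (\<lambda>x\<in>?Y. a i))"
      using l by (simp add: is_product_def)
    then obtain h where h: "h \<in> ?Y \<rightarrow>\<^sub>E P" "\<forall>i\<in>I. compose ?Y (\<pi> i) h = (\<lambda>x\<in>?Y. a i)" by blast
    show "\<exists>!x. x \<in> P \<and> (\<forall>i\<in>I. \<pi> i x = a i)"
    proof (intro ex1I[of _ "h undefined"] conjI ballI)
      show "h undefined \<in> P" using h(1) by auto
      show "\<pi> i (h undefined) = a i" if "i \<in> I" for i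
        using h(2)[rule_format, OF that, THEN fun_cong, of undefined] by (simp add: compose_def)
      fix x assume x: "x \<in> P \<and> (\<forall>i\<in>I. \<pi> i x = a i)"
      have "(\<lambda>y\<in>?Y. x) \<in> ?Y \<rightarrow>\<^sub>E P \<and> (\<forall>i\<in>I. compose ?Y (\<pi> i) (\<lambda>y\<in>?Y. x) = (\<lambda>x\<in>?Y. a i))"
        using x by (auto simp: compose_def fun_eq_iff)
      then have "(\<lambda>y\<in>?Y. x) = h" using ex1 h by blast
      then show "x = h undefined" by (metis restrict_apply singletonI)
    qed
  qed
next
  assume r: ?r
  show ?l unfolding is_product_def
  proof (intro conjI allI impI ballI)
    fix Y :: "'u set" and f assume f: "\<forall>i\<in>I. f i \<in> Hom set_cat Y (X i)"
    have "\<forall>y\<in>Y. \<exists>!x. x \<in> P \<and> (\<forall>i\<in>I. \<pi> i x = f i y)" using r f by (auto simp: PiE_iff)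
    then obtain h where h: "\<And>y. y \<in> Y \<Longrightarrow> h y \<in> P \<and> (\<forall>i\<in>I. \<pi> i (h y) = f i y)"
      and u: "\<And>y x. y \<in> Y \<Longrightarrow> x \<in> P \<and> (\<forall>i\<in>I. \<pi> i x = f i y) \<Longrightarrow> x = h y" by metis
    show "\<exists>!h. h \<in> Hom set_cat Y P \<and> (\<forall>i\<in>I. Comp set_cat Y P (X i) (\<pi> i) h = f i)"
    proof (intro ex1I[of _ "restrict h Y"] conjI ballI)
      show "restrict h Y \<in> Hom set_cat Y P" using h by auto
      show "Comp set_cat Y P (X i) (\<pi> i) (restrict h Y) = f i" if "i \<in> I" for i
      proof
        fix y show "Comp set_cat Y P (X i) (\<pi> i) (restrict h Y) y = f i y"
          using h[of y] f that by (cases "y \<in> Y") (auto simp: compose_def PiE_iff extensional_def)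
      qed
      fix k assume k: "k \<in> Hom set_cat Y P \<and> (\<forall>i\<in>I. Comp set_cat Y P (X i) (\<pi> i) k = f i)"
      show "k = restrict h Y"
      proof
        fix y show "k y = restrict h Y y"
        proof (cases "y \<in> Y")
          case True
          have "\<pi> i (k y) = f i y" if "i \<in> I" for i
          proof -
            have "compose Y (\<pi> i) k y = f i y" using k that by simp
            then show ?thesis using True by (simp add: compose_def)
          qed
          then show ?thesis using True k u[of y "k y"] by (auto simp: PiE_iff)
        next
          case False then show ?thesis using k by (auto simp: PiE_iff extensional_def)
        qed
      qed
    qed
  qed (use r in auto)
qed

lemma cat_functor_set_cat_iff:
  "cat_functor T set_cat A \<longleftrightarrow> category T \<and>
    (\<forall>X\<in>Obj T. \<forall>Y\<in>Obj T. \<forall>f\<in>Hom T X Y. fmap A X Y f \<in> fob A X \<rightarrow>\<^sub>E fob A Y) \<and>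
    (\<forall>X\<in>Obj T. \<forall>x\<in>fob A X. fmap A X X (Ident T X) x = x) \<and>
    (\<forall>X\<in>Obj T. \<forall>Y\<in>Obj T. \<forall>Z\<in>Obj T. \<forall>f\<in>Hom T X Y. \<forall>g\<in>Hom T Y Z. \<forall>x\<in>fob A X.
      fmap A X Z (Comp T X Y Z g f) x = fmap A Y Z g (fmap A X Y f x))" (is "?l \<longleftrightarrow> ?r")
proof
  assume ?l
  then interpret cat_functor T set_cat A .
  show ?r
  proof (intro conjI ballI)
    show "category T" by unfold_locales
    fix X assume X: "X \<in> Obj T"
    show "fmap A X X (Ident T X) x = x" if "x \<in> fob A X" for x
      using fmap_ident[OF X] that by simp
    fix Y f assume Y: "Y \<in> Obj T" "f \<in> Hom T X Y"
    show "fmap A X Y f \<in> fob A X \<rightarrow>\<^sub>E fob A Y" using fmap_in_hom[OF X Y] by simp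
    fix Z g x assume Z: "Z \<in> Obj T" "g \<in> Hom T Y Z" "x \<in> fob A X"
    show "fmap A X Z (Comp T X Y Z g f) x = fmap A Y Z g (fmap A X Y f x)"
      using fmap_comp[OF X Y(1) Z(1) Y(2) Z(2)] Z by (simp add: compose_def)
  qed
next
  assume r: ?r
  interpret category T using r by simp
  interpret sc: category set_cat by (rule category_set_cat)
  show ?l
  proof (unfold_locales, goal_cases)
    case (3 X)
    have "fmap A X X (Ident T X) \<in> fob A X \<rightarrow>\<^sub>E fob A X" using r 3 ident_in_hom by blast
    then show ?case using r 3 by (auto simp: fun_eq_iff PiE_iff extensional_def)
  next
    case (4 X Y Z f g)
    have "fmap A X Z (Comp T X Y Z g f) \<in> fob A X \<rightarrow>\<^sub>E fob A Z"
      using r 4 comp_in_hom by blast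
    then show ?case using r 4 by (auto simp: fun_eq_iff PiE_iff extensional_def compose_def)
  qed (use r in auto)
qed

lemma natural_transformation_set_cat_iff:
  assumes "cat_functor T set_cat A" "cat_functor T set_cat B"
  shows "natural_transformation T set_cat A B \<eta> \<longleftrightarrow>
    (\<forall>X\<in>Obj T. \<eta> X \<in> fob A X \<rightarrow>\<^sub>E fob B X) \<and>
    (\<forall>X\<in>Obj T. \<forall>Y\<in>Obj T. \<forall>f\<in>Hom T X Y. \<forall>x\<in>fob A X.
      \<eta> Y (fmap A X Y f x) = fmap B X Y f (\<eta> X x))"
proof -
  have "(compose (fob A X) (\<eta> Y) (fmap A X Y f) = compose (fob A X) (fmap B X Y f) (\<eta> X)) \<longleftrightarrow>
    (\<forall>x\<in>fob A X. \<eta> Y (fmap A X Y f x) = fmap B X Y f (\<eta> X x))" for X Y f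
    by (auto simp: compose_def fun_eq_iff)
  then show ?thesis unfolding natural_transformation_def by auto
qed

text \<open>
  The objects of a theory are pairs of numbers, which are never to be taken apart by the simplifier.
\<close>

declare split_paired_All[simp del] split_paired_Ex[simp del]

lemma bit_cases: "p = 0 \<or> p = (1::bit)"
  by (cases p) auto

lemma len_srt[simp]: "len (srt p) = Suc 0"
  by (simp add: len_def srt_def)

lemma gr_srt[simp]: "gr (srt p) 0 = p"
  using bit_cases[of p] by (auto simp: gr_def srt_def)

lemma len_add[simp]: "len (X + Y) = len X + len Y"
  by (simp add: len_def)

lemma len_zero[simp]: "len (0, 0) = 0"
  by (simp add: len_def)

context lawvere_theory
begin

lemma obj[simp]: "X \<in> Obj T"
  by (simp add: obj_UNIV)

lemmas comp_hom[simp] = comp_in_hom[OF obj obj obj]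
lemmas id_hom[simp] = ident_in_hom[OF obj]
lemmas comp_id_left[simp] = ident_left[OF obj obj]
lemmas comp_id_right[simp] = ident_right[OF obj obj]
lemmas assoc = comp_assoc[OF obj obj obj obj]

lemma proj_hom[simp]: "i < len X \<Longrightarrow> proj T X i \<in> Hom T X (srt (gr X i))"
  using proj_product[of X] by (simp add: is_product_def)

lemma tup_ex1:
  assumes "\<And>i. i < len Y \<Longrightarrow> f i \<in> Hom T X (srt (gr Y i))"
  shows "\<exists>!h. h \<in> Hom T X Y \<and> (\<forall>i<len Y. Comp T X Y (srt (gr Y i)) (proj T Y i) h = f i)"
proof -
  have "(\<forall>i\<in>{..<len Y}. f i \<in> Hom T X (srt (gr Y i))) \<longrightarrow>
    (\<exists>!h. h \<in> Hom T X Y \<and> (\<forall>i\<in>{..<len Y}. Comp T X Y (srt (gr Y i)) (proj T Y i) h = f i))"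
    using proj_product[of Y] obj[of X] unfolding is_product_def by blast
  then show ?thesis using assms by (simp add: Ball_def)
qed

lemma tup_hom[simp]: "(\<And>i. i < len Y \<Longrightarrow> f i \<in> Hom T X (srt (gr Y i))) \<Longrightarrow> tup T X Y f \<in> Hom T X Y"
  and proj_tup[simp]: "(\<And>i. i < len Y \<Longrightarrow> f i \<in> Hom T X (srt (gr Y i))) \<Longrightarrow> j < len Y \<Longrightarrow>
    Comp T X Y (srt (gr Y j)) (proj T Y j) (tup T X Y f) = f j"
  using theI'[OF tup_ex1[of Y f X]] by (simp_all add: tup_def tuple_def Ball_def)

lemma arrow_eqI:
  assumes "f \<in> Hom T X Y" "g \<in> Hom T X Y"
    "\<And>i. i < len Y \<Longrightarrow> Comp T X Y (srt (gr Y i)) (proj T Y i) f = Comp T X Y (srt (gr Y i)) (proj T Y i) g"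
  shows "f = g"
  using tup_ex1[of Y "\<lambda>i. Comp T X Y (srt (gr Y i)) (proj T Y i) g" X] assms by (metis comp_hom proj_hom)

lemma tup_eqI:
  assumes "h \<in> Hom T X Y"
    "\<And>i. i < len Y \<Longrightarrow> Comp T X Y (srt (gr Y i)) (proj T Y i) h = f i"
  shows "tup T X Y f = h"
proof -
  have f: "f i \<in> Hom T X (srt (gr Y i))" if "i < len Y" for i
    using assms that by (metis comp_hom proj_hom)
  show ?thesis by (rule arrow_eqI[of _ X Y]) (use assms f in auto)
qed

lemma tup_cong: "(\<And>i. i < len Y \<Longrightarrow> f i = g i) \<Longrightarrow> tup T X Y f = tup T X Y g"
  by (simp add: tup_def tuple_def)

lemma tup_precomp:
  assumes "\<And>i. i < len Y \<Longrightarrow> f i \<in> Hom T X (srt (gr Y i))" "h \<in> Hom T W X"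
  shows "Comp T W X Y (tup T X Y f) h = tup T W Y (\<lambda>i. Comp T W X (srt (gr Y i)) (f i) h)"
  by (rule tup_eqI[symmetric]) (use assms in \<open>auto simp: assoc\<close>)

lemma tup_ident[simp]: "tup T Y Y (proj T Y) = Ident T Y"
  by (rule tup_eqI) auto

lemma tup_srt: "f 0 \<in> Hom T X (srt p) \<Longrightarrow> tup T X (srt p) f = f 0"
  by (rule tup_eqI) (auto simp: proj_srt)

end

section \<open>Elements of algebras\<close>

text \<open>
  Elements of \<open>A(X)\<close> are families of elements of the two sorts \<open>A(1|0)\<close> and \<open>A(0|1)\<close>: \<open>crd\<close> takes
  coordinates and \<open>mk\<close> is its inverse. An arrow \<open>X \<rightarrow> srt p\<close> is an operation on families, evaluated by
  \<open>ev\<close>. Homomorphisms are natural families of maps; unlike the arrows of the category of algebras they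
  may take arbitrary values outside the carrier sets, hence the separate notion \<open>thom\<close>.
\<close>

definition crd :: "('s, 'x) thy_scheme \<Rightarrow> ('s, 'u) alg \<Rightarrow> nat \<times> nat \<Rightarrow> 'u \<Rightarrow> nat \<Rightarrow> 'u" where
  "crd T A X x i = fmap A X (srt (gr X i)) (proj T X i) x"

definition fam :: "('s, 'u) alg \<Rightarrow> nat \<times> nat \<Rightarrow> (nat \<Rightarrow> 'u) \<Rightarrow> bool" where
  "fam A X a \<longleftrightarrow> (\<forall>i<len X. a i \<in> fob A (srt (gr X i)))"

definition mk :: "('s, 'x) thy_scheme \<Rightarrow> ('s, 'u) alg \<Rightarrow> nat \<times> nat \<Rightarrow> (nat \<Rightarrow> 'u) \<Rightarrow> 'u" where
  "mk T A X a = (THE x. x \<in> fob A X \<and> (\<forall>i<len X. crd T A X x i = a i))"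

definition ev ::
  "('s, 'x) thy_scheme \<Rightarrow> ('s, 'u) alg \<Rightarrow> nat \<times> nat \<Rightarrow> bit \<Rightarrow> 's \<Rightarrow> (nat \<Rightarrow> 'u) \<Rightarrow> 'u" where
  "ev T A X p f a = fmap A X (srt p) f (mk T A X a)"

definition thom ::
  "('s, 'x) thy_scheme \<Rightarrow> ('s, 'u) alg \<Rightarrow> ('s, 'v) alg \<Rightarrow> (nat \<times> nat \<Rightarrow> 'u \<Rightarrow> 'v) \<Rightarrow> bool" where
  "thom T A B h \<longleftrightarrow> (\<forall>X. h X \<in> fob A X \<rightarrow> fob B X) \<and>
    (\<forall>X Y. \<forall>f\<in>Hom T X Y. \<forall>x\<in>fob A X. h Y (fmap A X Y f x) = fmap B X Y f (h X x))"

lemma Obj_Alg: "A \<in> Obj (Alg T) \<longleftrightarrow> cat_functor T set_cat A \<and> preserves_finite_products T set_cat A"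
  by (simp add: Alg_def)

context lawvere_theory
begin

lemma alg_fmap[simp]:
  assumes "A \<in> Obj (Alg T)"
  shows alg_fmap_in: "f \<in> Hom T X Y \<Longrightarrow> x \<in> fob A X \<Longrightarrow> fmap A X Y f x \<in> fob A Y"
    and alg_fmap_PiE: "f \<in> Hom T X Y \<Longrightarrow> fmap A X Y f \<in> fob A X \<rightarrow>\<^sub>E fob A Y"
    and alg_fmap_ident: "x \<in> fob A X \<Longrightarrow> fmap A X X (Ident T X) x = x"
    and alg_fmap_comp: "f \<in> Hom T X Y \<Longrightarrow> g \<in> Hom T Y Z \<Longrightarrow> x \<in> fob A X \<Longrightarrow>
      fmap A X Z (Comp T X Y Z g f) x = fmap A Y Z g (fmap A X Y f x)"
proof -
  have "cat_functor T set_cat A" using assms by (simp add: Obj_Alg)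
  note * = this[unfolded cat_functor_set_cat_iff]
  show "f \<in> Hom T X Y \<Longrightarrow> fmap A X Y f \<in> fob A X \<rightarrow>\<^sub>E fob A Y"
    "x \<in> fob A X \<Longrightarrow> fmap A X X (Ident T X) x = x"
    "f \<in> Hom T X Y \<Longrightarrow> g \<in> Hom T Y Z \<Longrightarrow> x \<in> fob A X \<Longrightarrow>
      fmap A X Z (Comp T X Y Z g f) x = fmap A Y Z g (fmap A X Y f x)"
    using * by simp_all
  then show "f \<in> Hom T X Y \<Longrightarrow> x \<in> fob A X \<Longrightarrow> fmap A X Y f x \<in> fob A Y" by auto
qed

lemma alg_product:
  assumes "A \<in> Obj (Alg T)" "finite I" "is_product T I X P \<pi>" "\<And>i. i \<in> I \<Longrightarrow> a i \<in> fob A (X i)"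
  shows "\<exists>!x. x \<in> fob A P \<and> (\<forall>i\<in>I. fmap A P (X i) (\<pi> i) x = a i)"
proof -
  have "is_product set_cat I (\<lambda>i. fob A (X i)) (fob A P) (\<lambda>i. fmap A P (X i) (\<pi> i))"
    using assms unfolding Obj_Alg preserves_finite_products_def by blast
  then show ?thesis using assms(4) unfolding is_product_set_cat_iff by blast
qed

lemma mk_ex1:
  assumes "A \<in> Obj (Alg T)" "fam A X a"
  shows "\<exists>!x. x \<in> fob A X \<and> (\<forall>i<len X. crd T A X x i = a i)"
  using alg_product[OF assms(1) finite_lessThan proj_product[of X], of a] assms(2)
  unfolding fam_def crd_def by (simp add: Ball_def)

lemma mk_in[simp]: "A \<in> Obj (Alg T) \<Longrightarrow> fam A X a \<Longrightarrow> mk T A X a \<in> fob A X"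
  and crd_mk[simp]: "A \<in> Obj (Alg T) \<Longrightarrow> fam A X a \<Longrightarrow> i < len X \<Longrightarrow> crd T A X (mk T A X a) i = a i"
  unfolding mk_def using theI'[OF mk_ex1[of A X a]] by blast+

lemma crd_in[simp]: "A \<in> Obj (Alg T) \<Longrightarrow> x \<in> fob A X \<Longrightarrow> i < len X \<Longrightarrow> crd T A X x i \<in> fob A (srt (gr X i))"
  by (simp add: crd_def)

lemma fam_crd[simp]: "A \<in> Obj (Alg T) \<Longrightarrow> x \<in> fob A X \<Longrightarrow> fam A X (crd T A X x)"
  by (simp add: fam_def)

lemma alg_eqI:
  assumes "A \<in> Obj (Alg T)" "x \<in> fob A X" "y \<in> fob A X"
    "\<And>i. i < len X \<Longrightarrow> crd T A X x i = crd T A X y i"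
  shows "x = y"
proof -
  have "\<exists>!z. z \<in> fob A X \<and> (\<forall>i<len X. crd T A X z i = crd T A X x i)"
    by (rule mk_ex1[OF assms(1) fam_crd[OF assms(1,2)]])
  then show ?thesis using assms(2-4) by auto
qed

lemma mk_eqI:
  assumes "A \<in> Obj (Alg T)" "x \<in> fob A X" "\<And>i. i < len X \<Longrightarrow> crd T A X x i = a i"
  shows "mk T A X a = x"
proof -
  have a: "fam A X a" using assms fam_crd[OF assms(1,2)] by (simp add: fam_def)
  show ?thesis by (rule alg_eqI[of A _ X]) (use assms a in auto)
qed

lemma mk_crd[simp]: "A \<in> Obj (Alg T) \<Longrightarrow> x \<in> fob A X \<Longrightarrow> mk T A X (crd T A X x) = x"
  by (rule mk_eqI) auto

lemma mk_cong: "(\<And>i. i < len X \<Longrightarrow> a i = b i) \<Longrightarrow> mk T A X a = mk T A X b"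
  unfolding mk_def by (simp cong: conj_cong)

lemma ev_in[simp]: "A \<in> Obj (Alg T) \<Longrightarrow> f \<in> Hom T X (srt p) \<Longrightarrow> fam A X a \<Longrightarrow> ev T A X p f a \<in> fob A (srt p)"
  by (simp add: ev_def)

lemma ev_cong: "(\<And>i. i < len X \<Longrightarrow> a i = b i) \<Longrightarrow> ev T A X p f a = ev T A X p f b"
  unfolding ev_def using mk_cong by metis

lemma ev_proj[simp]: "A \<in> Obj (Alg T) \<Longrightarrow> fam A X a \<Longrightarrow> i < len X \<Longrightarrow> p = gr X i \<Longrightarrow> ev T A X p (proj T X i) a = a i"
  using crd_mk[of A X a i] by (simp add: ev_def crd_def)

lemma fam_ev[simp]:
  assumes "A \<in> Obj (Alg T)" "fam A X a" "\<And>i. i < len Y \<Longrightarrow> h i \<in> Hom T X (srt (gr Y i))"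
  shows "fam A Y (\<lambda>i. ev T A X (gr Y i) (h i) a)"
  using assms by (simp add: fam_def)

lemma fmap_mk_tup:
  assumes "A \<in> Obj (Alg T)" "fam A X a" "\<And>i. i < len Y \<Longrightarrow> h i \<in> Hom T X (srt (gr Y i))"
  shows "fmap A X Y (tup T X Y h) (mk T A X a) = mk T A Y (\<lambda>i. ev T A X (gr Y i) (h i) a)"
proof (rule mk_eqI[symmetric])
  fix i assume i: "i < len Y"
  show "crd T A Y (fmap A X Y (tup T X Y h) (mk T A X a)) i = ev T A X (gr Y i) (h i) a"
    using alg_fmap_comp[OF assms(1) tup_hom[OF assms(3)] proj_hom[OF i] mk_in[OF assms(1,2)]] proj_tup[OF assms(3) i]
    by (simp add: crd_def ev_def)
qed (use assms in auto)

text \<open>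
  Composition in the theory is substitution of operations into operations.
\<close>

lemma ev_comp_tup:
  assumes "A \<in> Obj (Alg T)" "fam A X a" "\<And>i. i < len Y \<Longrightarrow> h i \<in> Hom T X (srt (gr Y i))"
    "f \<in> Hom T Y (srt p)"
  shows "ev T A X p (Comp T X Y (srt p) f (tup T X Y h)) a = ev T A Y p f (\<lambda>i. ev T A X (gr Y i) (h i) a)"
  using fmap_mk_tup[OF assms(1-3)] assms by (simp add: ev_def)

lemma crd_fmap:
  assumes "A \<in> Obj (Alg T)" "x \<in> fob A X" "f \<in> Hom T X Y" "i < len Y"
  shows "crd T A Y (fmap A X Y f x) i = ev T A X (gr Y i) (Comp T X Y (srt (gr Y i)) (proj T Y i) f) (crd T A X x)"
  using assms by (simp add: crd_def ev_def flip: crd_def[abs_def])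

lemma category_Alg_aux: "A \<in> Obj (Alg T) \<Longrightarrow> cat_functor T set_cat A"
  by (simp add: Obj_Alg)

lemma Hom_Alg:
  assumes "A \<in> Obj (Alg T)" "B \<in> Obj (Alg T)"
  shows "\<eta> \<in> Hom (Alg T) A B \<longleftrightarrow> (\<forall>X. \<eta> X \<in> extensional (fob A X)) \<and> thom T A B \<eta>"
  using natural_transformation_set_cat_iff[OF category_Alg_aux[OF assms(1)] category_Alg_aux[OF assms(2)], of \<eta>]
  by (auto simp: Alg_def thom_def PiE_def)

end

lemma Ident_Alg: "Ident (Alg T) A = (\<lambda>X. \<lambda>x\<in>fob A X. x)"
  by (simp add: Alg_def)

lemma Comp_Alg: "Comp (Alg T) A B C \<theta> \<eta> = (\<lambda>X. compose (fob A X) (\<theta> X) (\<eta> X))"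
  by (simp add: Alg_def)

lemma Comp_Alg_app[simp]: "x \<in> fob A X \<Longrightarrow> Comp (Alg T) A B C \<theta> \<eta> X x = \<theta> X (\<eta> X x)"
  by (simp add: Comp_Alg compose_def)

lemma thom_in: "thom T A B h \<Longrightarrow> x \<in> fob A X \<Longrightarrow> h X x \<in> fob B X"
  by (auto simp: thom_def)

lemma thom_fmap: "thom T A B h \<Longrightarrow> f \<in> Hom T X Y \<Longrightarrow> x \<in> fob A X \<Longrightarrow>
    h Y (fmap A X Y f x) = fmap B X Y f (h X x)"
  by (auto simp: thom_def)

lemma thom_comp: "thom T A B h \<Longrightarrow> thom T B C k \<Longrightarrow> thom T A C (\<lambda>X x. k X (h X x))"
  by (fastforce simp: thom_def)

lemma thom_cong: "(\<And>X x. x \<in> fob A X \<Longrightarrow> h X x = k X x) \<Longrightarrow>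
  (\<And>X Y f x. f \<in> Hom T X Y \<Longrightarrow> x \<in> fob A X \<Longrightarrow> fmap A X Y f x \<in> fob A Y) \<Longrightarrow> thom T A B h = thom T A B k"
  unfolding thom_def by (auto simp: Pi_iff)

context lawvere_theory
begin

lemma Hom_Alg_thom: "A \<in> Obj (Alg T) \<Longrightarrow> B \<in> Obj (Alg T) \<Longrightarrow> \<eta> \<in> Hom (Alg T) A B \<Longrightarrow> thom T A B \<eta>"
  by (simp add: Hom_Alg)

lemma Hom_Alg_eqI:
  assumes "A \<in> Obj (Alg T)" "B \<in> Obj (Alg T)" "\<eta> \<in> Hom (Alg T) A B" "\<theta> \<in> Hom (Alg T) A B"
    "\<And>X x. x \<in> fob A X \<Longrightarrow> \<eta> X x = \<theta> X x"
  shows "\<eta> = \<theta>"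
proof
  fix X show "\<eta> X = \<theta> X" using assms by (intro extensionalityI[of _ "fob A X"]) (auto simp: Hom_Alg)
qed

lemma Hom_AlgI:
  assumes "A \<in> Obj (Alg T)" "B \<in> Obj (Alg T)" "thom T A B h"
  shows "(\<lambda>X. restrict (h X) (fob A X)) \<in> Hom (Alg T) A B"
  using assms(3) thom_cong[of A "\<lambda>X. restrict (h X) (fob A X)" h T B] assms(1)
  by (simp add: Hom_Alg[OF assms(1,2)])

lemma thom_id: "A \<in> Obj (Alg T) \<Longrightarrow> thom T A A (\<lambda>X x. x)"
  by (simp add: thom_def)

lemma category_Alg: "category (Alg T :: (('s,'u) alg, nat \<times> nat \<Rightarrow> 'u \<Rightarrow> 'u) cat)"
proof (unfold_locales, goal_cases)
  case (1 X) then show ?case using Hom_AlgI[OF 1 1 thom_id[OF 1]] by (simp add: Ident_Alg)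
next
  case c: (2 X Y Z f g)
  have "compose (fob X W) (g W) (f W) = restrict (\<lambda>x. g W (f W x)) (fob X W)" for W
    by (simp add: compose_def)
  then show ?case using Hom_AlgI[OF c(1,3) thom_comp[OF Hom_Alg_thom[OF c(1,2,4)] Hom_Alg_thom[OF c(2,3,5)]]]
    by (simp add: Comp_Alg)
next
  case c: (3 X Y f)
  show ?case using c thom_in[OF Hom_Alg_thom[OF c]]
    by (auto simp: Comp_Alg Ident_Alg fun_eq_iff compose_def Hom_Alg extensional_def)
next
  case c: (4 X Y f)
  show ?case using c
    by (auto simp: Comp_Alg Ident_Alg fun_eq_iff compose_def Hom_Alg extensional_def)
next
  case c: (5 W X Y Z f g h)
  show ?case using thom_in[OF Hom_Alg_thom[OF c(1,2,5)]]
    by (auto simp: Comp_Alg fun_eq_iff compose_def)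
qed

text \<open>
  Operations are arrows into a sort, so naturality says that homomorphisms commute with them.
\<close>

lemma thom_crd: "thom T A B h \<Longrightarrow> A \<in> Obj (Alg T) \<Longrightarrow> x \<in> fob A X \<Longrightarrow> i < len X \<Longrightarrow>
    crd T B X (h X x) i = h (srt (gr X i)) (crd T A X x i)"
  by (simp add: crd_def thom_fmap)

lemma thom_fam: "thom T A B h \<Longrightarrow> fam A X a \<Longrightarrow> fam B X (\<lambda>i. h (srt (gr X i)) (a i))"
  by (simp add: fam_def thom_in)

lemma thom_mk:
  assumes "thom T A B h" "A \<in> Obj (Alg T)" "B \<in> Obj (Alg T)" "fam A X a"
  shows "h X (mk T A X a) = mk T B X (\<lambda>i. h (srt (gr X i)) (a i))"
  by (rule mk_eqI[symmetric]) (use assms in \<open>auto simp: thom_crd thom_in\<close>)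

lemma thom_ev:
  assumes "thom T A B h" "A \<in> Obj (Alg T)" "B \<in> Obj (Alg T)" "fam A X a" "f \<in> Hom T X (srt p)"
  shows "h (srt p) (ev T A X p f a) = ev T B X p f (\<lambda>i. h (srt (gr X i)) (a i))"
  using assms by (simp add: ev_def thom_fmap thom_mk)

text \<open>Naturality needs to be checked only for coordinates and operations.\<close>

lemma thom_if_ev:
  assumes A: "A \<in> Obj (Alg T)" and B: "B \<in> Obj (Alg T)"
    and h: "\<And>X x. x \<in> fob A X \<Longrightarrow> h X x \<in> fob B X"
    and crd: "\<And>X x i. x \<in> fob A X \<Longrightarrow> i < len X \<Longrightarrow> crd T B X (h X x) i = h (srt (gr X i)) (crd T A X x i)"
    and ev: "\<And>X p f x. x \<in> fob A X \<Longrightarrow> f \<in> Hom T X (srt p) \<Longrightarrow>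
      h (srt p) (ev T A X p f (crd T A X x)) = ev T B X p f (crd T B X (h X x))"
  shows "thom T A B h"
  unfolding thom_def
proof (intro conjI allI ballI)
  fix X Y f x assume f: "f \<in> Hom T X Y" and x: "x \<in> fob A X"
  show "h Y (fmap A X Y f x) = fmap B X Y f (h X x)"
  proof (rule alg_eqI[OF B])
    fix i assume i: "i < len Y"
    show "crd T B Y (h Y (fmap A X Y f x)) i = crd T B Y (fmap B X Y f (h X x)) i"
      using f x i A B by (simp add: crd crd_fmap h ev)
  qed (use f x A B h in auto)
qed (use h in auto)

end

text \<open>
  The free algebra on the coordinates of \<open>W\<close>; evaluating its elements at a family is a homomorphism by
  the Yoneda lemma, so that identities of operations can be computed in free algebras.
\<close>

definition rep :: "('s, 'x) thy_scheme \<Rightarrow> nat \<times> nat \<Rightarrow> ('s, 's) alg" where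
  "rep T W = \<lparr>fob = Hom T W, fmap = (\<lambda>X Y f. \<lambda>h\<in>Hom T W X. Comp T W X Y f h)\<rparr>"

lemma fob_rep[simp]: "fob (rep T W) X = Hom T W X"
  by (simp add: rep_def)

lemma fmap_rep[simp]: "h \<in> Hom T W X \<Longrightarrow> fmap (rep T W) X Y f h = Comp T W X Y f h"
  by (simp add: rep_def)

context lawvere_theory
begin

lemma rep_obj[simp]: "rep T W \<in> Obj (Alg T)"
proof -
  have "category T" by unfold_locales
  then have "cat_functor T set_cat (rep T W)"
    unfolding cat_functor_set_cat_iff by (auto simp: assoc) (auto simp: rep_def)
  moreover have "preserves_finite_products T set_cat (rep T W)"
    unfolding preserves_finite_products_def
  proof (intro allI impI)
    fix I X P \<pi> assume "finite I" and p: "is_product T I X P \<pi>"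
    show "is_product set_cat I (\<lambda>i. fob (rep T W) (X i)) (fob (rep T W) P) (\<lambda>i. fmap (rep T W) P (X i) (\<pi> i))"
      unfolding is_product_set_cat_iff using p
      by (auto simp: is_product_def rep_def cong: conj_cong)
  qed
  ultimately show ?thesis by (simp add: Obj_Alg)
qed

lemma fam_rep: "fam (rep T W) X f \<longleftrightarrow> (\<forall>i<len X. f i \<in> Hom T W (srt (gr X i)))"
  by (simp add: fam_def)

lemma crd_rep[simp]: "h \<in> Hom T W X \<Longrightarrow> crd T (rep T W) X h i = Comp T W X (srt (gr X i)) (proj T X i) h"
  by (simp add: crd_def)

lemma mk_rep: "fam (rep T W) X f \<Longrightarrow> mk T (rep T W) X f = tup T W X f"
  by (rule mk_eqI) (auto simp: fam_rep)

lemma ev_rep: "fam (rep T W) X a \<Longrightarrow> ev T (rep T W) X p f a = Comp T W X (srt p) f (tup T W X a)"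
  by (subst ev_def, subst mk_rep) (auto simp: fam_rep)

lemma thom_rep: "A \<in> Obj (Alg T) \<Longrightarrow> w \<in> fob A W \<Longrightarrow> thom T (rep T W) A (\<lambda>X g. fmap A W X g w)"
  by (simp add: thom_def)

end

section \<open>Products in a Lawvere theory\<close>

text \<open>
  Coordinates of an object are sorted with the even ones first, so a finite set with parities has to be
  renumbered.
\<close>

lemma finite_parity_numbering:
  fixes g :: "'n \<Rightarrow> bit"
  assumes "finite N"
  shows "\<exists>Z d. bij_betw d N {..<len Z} \<and> (\<forall>n\<in>N. gr Z (d n) = g n)"
proof -
  let ?E = "{n\<in>N. g n = 0}" and ?O = "{n\<in>N. g n = 1}"
  have fin: "finite ?E" "finite ?O" using assms by auto
  obtain e o' where e: "bij_betw e ?E {0..<card ?E}" and o: "bij_betw o' ?O {0..<card ?O}"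
    using ex_bij_betw_finite_nat[OF fin(1)] ex_bij_betw_finite_nat[OF fin(2)] by blast
  define Z where "Z = (card ?E, card ?O)"
  define d where "d n = (if g n = 0 then e n else card ?E + o' n)" for n
  have d0: "d n < card ?E" if "n \<in> ?E" for n using e that by (auto simp: d_def bij_betw_def)
  have b1: "bij_betw d ?E {0..<card ?E}"
    using e by (rule bij_betw_cong[THEN iffD1, rotated]) (simp add: d_def)
  have "bij_betw (\<lambda>n. card ?E + o' n) ?O ((+) (card ?E) ` {0..<card ?O})"
    using o by (auto simp: bij_betw_def inj_on_def image_image[symmetric])
  then have b2: "bij_betw d ?O {card ?E..<card ?E + card ?O}"
    by (subst bij_betw_cong[where g = "\<lambda>n. card ?E + o' n"]) (auto simp: d_def add.commute)
  have "bij_betw d (?E \<union> ?O) ({0..<card ?E} \<union> {card ?E..<card ?E + card ?O})"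
    using b1 b2 by (rule bij_betw_combine) auto
  moreover have "?E \<union> ?O = N" using bit_cases by auto
  moreover have "{0..<card ?E} \<union> {card ?E..<card ?E + card ?O} = {..<len Z}"
    by (auto simp: len_def Z_def)
  ultimately have "bij_betw d N {..<len Z}" by simp
  moreover have "gr Z (d n) = g n" if "n \<in> N" for n
    using that d0[of n] bit_cases[of "g n"] by (auto simp: gr_def Z_def d_def)
  ultimately show ?thesis by blast
qed

context lawvere_theory
begin

lemma is_product_ex1:
  assumes "is_product T I X P \<pi>" "\<And>i. i \<in> I \<Longrightarrow> f i \<in> Hom T Y (X i)"
  shows "\<exists>!h. h \<in> Hom T Y P \<and> (\<forall>i\<in>I. Comp T Y P (X i) (\<pi> i) h = f i)"
  using assms obj[of Y] unfolding is_product_def by blast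

text \<open>
  The product of the \<open>X i\<close> has the coordinates of all factors together, renumbered: \<open>c j = (i, k)\<close>
  says that the coordinate \<open>j\<close> is the \<open>k\<close>-th one of \<open>X i\<close>.
\<close>

lemma canonical_product:
  assumes "finite I"
  obtains Z q c where
    "is_product T I X Z q"
    "\<And>j. j < len Z \<Longrightarrow> fst (c j) \<in> I \<and> snd (c j) < len (X (fst (c j))) \<and>
       gr Z j = gr (X (fst (c j))) (snd (c j)) \<and>
       proj T Z j = Comp T Z (X (fst (c j))) (srt (gr Z j)) (proj T (X (fst (c j))) (snd (c j))) (q (fst (c j)))"
    "\<And>i k. i \<in> I \<Longrightarrow> k < len (X i) \<Longrightarrow> \<exists>j<len Z. c j = (i, k)"
proof -
  let ?N = "SIGMA i:I. {..<len (X i)}"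
  obtain Z d where d: "bij_betw d ?N {..<len Z}" and g: "\<forall>n\<in>?N. gr Z (d n) = gr (X (fst n)) (snd n)"
    using finite_parity_numbering[of ?N "\<lambda>n. gr (X (fst n)) (snd n)"] assms by auto
  define c where "c = inv_into ?N d"
  have c: "c j \<in> ?N" "d (c j) = j" if "j < len Z" for j
    using d that by (simp_all add: c_def bij_betw_def inv_into_into f_inv_into_f)
  have cd: "c (d n) = n" if "n \<in> ?N" for n
    using d that by (simp add: c_def bij_betw_def inv_into_f_f)
  have dlt: "d n < len Z" if "n \<in> ?N" for n using d that by (auto simp: bij_betw_def)
  define q where "q i = tup T Z (X i) (\<lambda>k. proj T Z (d (i, k)))" for i
  have pd: "proj T Z (d (i, k)) \<in> Hom T Z (srt (gr (X i) k))" if "i \<in> I" "k < len (X i)" for i k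
    using proj_hom[of "d (i,k)" Z] dlt[of "(i,k)"] g that by auto
  have qh: "q i \<in> Hom T Z (X i)" if "i \<in> I" for i using pd that by (auto simp: q_def)
  have qp: "Comp T Z (X i) (srt (gr (X i) k)) (proj T (X i) k) (q i) = proj T Z (d (i, k))"
    if "i \<in> I" "k < len (X i)" for i k unfolding q_def using that pd by (intro proj_tup) auto
  show ?thesis
  proof
    fix j assume j: "j < len Z"
    show "fst (c j) \<in> I \<and> snd (c j) < len (X (fst (c j))) \<and> gr Z j = gr (X (fst (c j))) (snd (c j)) \<and>
       proj T Z j = Comp T Z (X (fst (c j))) (srt (gr Z j)) (proj T (X (fst (c j))) (snd (c j))) (q (fst (c j)))"
      using c[OF j] g qp[of "fst (c j)" "snd (c j)"] by force
  next
    fix i k assume "i \<in> I" "k < len (X i)"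
    then show "\<exists>j<len Z. c j = (i, k)" using dlt cd by (intro exI[of _ "d (i,k)"]) auto
  next
    show "is_product T I X Z q" unfolding is_product_def
    proof (intro conjI ballI allI impI)
      fix Y f assume f: "\<forall>i\<in>I. f i \<in> Hom T Y (X i)"
      define t where "t j = Comp T Y (X (fst (c j))) (srt (gr Z j)) (proj T (X (fst (c j))) (snd (c j))) (f (fst (c j)))" for j
      have t: "t j \<in> Hom T Y (srt (gr Z j))" if "j < len Z" for j
      proof -
        have "gr Z j = gr (X (fst (c j))) (snd (c j))" using c[OF that] g by force
        then show ?thesis using c[OF that] f by (auto simp: t_def)
      qed
      show "\<exists>!h. h \<in> Hom T Y Z \<and> (\<forall>i\<in>I. Comp T Y Z (X i) (q i) h = f i)"
      proof (intro ex1I[of _ "tup T Y Z t"] conjI ballI)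
        show h: "tup T Y Z t \<in> Hom T Y Z" using t by simp
        fix i assume i: "i \<in> I"
        show "Comp T Y Z (X i) (q i) (tup T Y Z t) = f i"
        proof (rule arrow_eqI[of _ Y "X i"])
          fix k assume k: "k < len (X i)"
          have d: "d (i, k) < len Z" "c (d (i,k)) = (i,k)" "gr Z (d (i,k)) = gr (X i) k"
            using i k dlt cd g by auto
          have "Comp T Y (X i) (srt (gr (X i) k)) (proj T (X i) k) (Comp T Y Z (X i) (q i) (tup T Y Z t))
            = Comp T Y Z (srt (gr (X i) k)) (proj T Z (d (i,k))) (tup T Y Z t)"
            using i k qh h by (simp add: assoc qp)
          also have "\<dots> = t (d (i,k))" using proj_tup[of Z t Y "d (i,k)"] t d by simp
          also have "\<dots> = Comp T Y (X i) (srt (gr (X i) k)) (proj T (X i) k) (f i)"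
            using d by (simp add: t_def)
          finally show "Comp T Y (X i) (srt (gr (X i) k)) (proj T (X i) k) (Comp T Y Z (X i) (q i) (tup T Y Z t))
            = Comp T Y (X i) (srt (gr (X i) k)) (proj T (X i) k) (f i)" .
        qed (use i qh h f in auto)
      next
        fix h assume h: "h \<in> Hom T Y Z \<and> (\<forall>i\<in>I. Comp T Y Z (X i) (q i) h = f i)"
        have "tup T Y Z t = h"
        proof (rule tup_eqI)
          fix j assume j: "j < len Z"
          obtain i k where ik: "c j = (i,k)" by force
          have i: "i \<in> I" "k < len (X i)" "d (i,k) = j" "gr Z j = gr (X i) k" using c[OF j] g ik by auto
          have "t j = Comp T Y (X i) (srt (gr (X i) k)) (proj T (X i) k) (Comp T Y Z (X i) (q i) h)"
            using ik i h by (simp add: t_def)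
          also have "\<dots> = Comp T Y Z (srt (gr (X i) k)) (proj T Z j) h"
            using assoc[OF h[THEN conjunct1] qh[OF i(1)] proj_hom[OF i(2)]] qp[OF i(1,2)] i by simp
          finally show "Comp T Y Z (srt (gr Z j)) (proj T Z j) h = t j" using i by simp
        qed (use h in simp)
        then show "h = tup T Y Z t" ..
      qed
    qed (use qh in auto)
  qed
qed

text \<open>
  A finite product \<open>P\<close> is a retract of the product \<open>Z\<close> whose coordinates are those of the factors; so a
  set-valued functor that respects the coordinates of every single object respects all finite products.
\<close>

lemma preserves_finite_products_if_coordinates:
  assumes B: "cat_functor T set_cat B"
    and co: "\<And>X a. fam B X a \<Longrightarrow> \<exists>!x. x \<in> fob B X \<and> (\<forall>i<len X. crd T B X x i = a i)"
  shows "B \<in> Obj (Alg T)"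
proof -
  note Bf = B[unfolded cat_functor_set_cat_iff]
  have Bin: "fmap B X Y f x \<in> fob B Y" if "f \<in> Hom T X Y" "x \<in> fob B X" for X Y f x
    using Bf that by (auto dest!: bspec[OF bspec[OF bspec[OF _ obj[of X]] obj[of Y]]])
  have Bco: "fmap B X Z (Comp T X Y Z g f) x = fmap B Y Z g (fmap B X Y f x)"
    if "f \<in> Hom T X Y" "g \<in> Hom T Y Z" "x \<in> fob B X" for X Y Z f g x using Bf that by auto
  have eqI: "x = y" if "x \<in> fob B X" "y \<in> fob B X" "\<And>i. i < len X \<Longrightarrow> crd T B X x i = crd T B X y i" for X x y
  proof -
    have "fam B X (crd T B X x)" using that Bin by (auto simp: fam_def crd_def)
    then show ?thesis using co[of X "crd T B X x"] that by metis
  qed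
  have "preserves_finite_products T set_cat B" unfolding preserves_finite_products_def
  proof (intro allI impI)
    fix I X P \<pi> assume I: "finite I" and P: "is_product T I X P \<pi>"
    obtain Z q c where Z: "is_product T I X Z q" and
      c: "\<And>j. j < len Z \<Longrightarrow> fst (c j) \<in> I \<and> snd (c j) < len (X (fst (c j))) \<and>
       gr Z j = gr (X (fst (c j))) (snd (c j)) \<and>
       proj T Z j = Comp T Z (X (fst (c j))) (srt (gr Z j)) (proj T (X (fst (c j))) (snd (c j))) (q (fst (c j)))"
      and c': "\<And>i k. i \<in> I \<Longrightarrow> k < len (X i) \<Longrightarrow> \<exists>j<len Z. c j = (i, k)"
      using canonical_product[OF I] by metis
    have \<pi>: "\<And>i. i \<in> I \<Longrightarrow> \<pi> i \<in> Hom T P (X i)" and q: "\<And>i. i \<in> I \<Longrightarrow> q i \<in> Hom T Z (X i)"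
      using P Z by (auto simp: is_product_def)
    obtain r where r: "r \<in> Hom T P Z" "\<And>i. i \<in> I \<Longrightarrow> Comp T P Z (X i) (q i) r = \<pi> i"
      using is_product_ex1[OF Z, of \<pi> P] \<pi> by blast
    obtain t where t: "t \<in> Hom T Z P" "\<And>i. i \<in> I \<Longrightarrow> Comp T Z P (X i) (\<pi> i) t = q i"
      using is_product_ex1[OF P, of q Z] q by blast
    have tr: "Comp T P Z P t r = Ident T P"
    proof -
      have "\<exists>!h. h \<in> Hom T P P \<and> (\<forall>i\<in>I. Comp T P P (X i) (\<pi> i) h = \<pi> i)"
        using is_product_ex1[OF P, of \<pi> P] \<pi> by blast
      moreover have "Comp T P P (X i) (\<pi> i) (Comp T P Z P t r) = \<pi> i" if "i \<in> I" for i
        using r t that \<pi> by (simp add: assoc)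
      moreover have "Comp T P P (X i) (\<pi> i) (Ident T P) = \<pi> i" if "i \<in> I" for i
        using \<pi> that by simp
      ultimately show ?thesis using r t by (metis comp_hom id_hom)
    qed
    have crdq: "crd T B Z z j = crd T B (X (fst (c j))) (fmap B Z (X (fst (c j))) (q (fst (c j))) z) (snd (c j))"
      if "j < len Z" "z \<in> fob B Z" for z j
      using c[OF that(1)] that q by (simp add: crd_def Bco)
    show "is_product set_cat I (\<lambda>i. fob B (X i)) (fob B P) (\<lambda>i. fmap B P (X i) (\<pi> i))"
      unfolding is_product_set_cat_iff
    proof (intro conjI ballI allI impI)
      show "fmap B P (X i) (\<pi> i) \<in> fob B P \<rightarrow>\<^sub>E fob B (X i)" if "i \<in> I" for i
        using Bf \<pi>[OF that] by simp
      fix a assume a: "\<forall>i\<in>I. a i \<in> fob B (X i)"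
      let ?b = "\<lambda>j. crd T B (X (fst (c j))) (a (fst (c j))) (snd (c j))"
      have "fam B Z ?b" unfolding fam_def crd_def
      proof (intro allI impI)
        fix j assume "j < len Z"
        then show "fmap B (X (fst (c j))) (srt (gr (X (fst (c j))) (snd (c j)))) (proj T (X (fst (c j))) (snd (c j))) (a (fst (c j)))
          \<in> fob B (srt (gr Z j))" using c[of j] a Bin by simp
      qed
      then obtain z where z: "z \<in> fob B Z" "\<And>j. j < len Z \<Longrightarrow> crd T B Z z j = ?b j"
        using co by blast
      have qz: "fmap B Z (X i) (q i) z = a i" if iI: "i \<in> I" for i
      proof (rule eqI[of _ "X i"])
        fix k assume "k < len (X i)"
        then obtain j where j: "j < len Z" "c j = (i,k)" using c' iI by blast
        show "crd T B (X i) (fmap B Z (X i) (q i) z) k = crd T B (X i) (a i) k"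
          using crdq[OF j(1) z(1)] z(2)[OF j(1)] j by simp
      qed (use iI a z q Bin in auto)
      show "\<exists>!x. x \<in> fob B P \<and> (\<forall>i\<in>I. fmap B P (X i) (\<pi> i) x = a i)"
      proof (intro ex1I[of _ "fmap B Z P t z"] conjI ballI)
        show "fmap B Z P t z \<in> fob B P" using t z Bin by simp
        show "fmap B P (X i) (\<pi> i) (fmap B Z P t z) = a i" if "i \<in> I" for i
          using Bco[of t Z P "\<pi> i" "X i" z] t z that qz \<pi> by simp
        fix x assume x: "x \<in> fob B P \<and> (\<forall>i\<in>I. fmap B P (X i) (\<pi> i) x = a i)"
        have "fmap B P Z r x = z"
        proof (rule eqI[of _ Z])
          fix j assume j: "j < len Z"
          have "fmap B Z (X (fst (c j))) (q (fst (c j))) (fmap B P Z r x) = a (fst (c j))"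
            using Bco[of r P Z "q (fst (c j))" "X (fst (c j))" x] c[OF j] r x q by simp
          then show "crd T B Z (fmap B P Z r x) j = crd T B Z z j"
            using crdq[OF j Bin[OF r(1)]] x j z by simp
        qed (use x r z Bin in auto)
        then show "x = fmap B Z P t z"
          using Bco[of r P Z t P x] r t x tr Bf by simp
      qed
    qed
  qed
  then show ?thesis using B by (simp add: Obj_Alg)
qed

end

text \<open>
  Parities are added; rewriting the sum to an exclusive disjunction would hide the group structure.
\<close>

declare add_bit_eq_xor[simp del]

lemma bit_add_self[simp]: "p + p = (0 :: bit)" "p + (p + q) = (q :: bit)"
  by (cases p; cases q; simp)+

section \<open>The theory of supercommutative algebras\<close>

text \<open>
  Closure of \<open>K\<close> under its operations makes provable equality preserve the parities of terms (\<open>teq_wt\<close>),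
  so that \<open>SCom K\<close> is a Lawvere theory.
\<close>

locale closed_superring =
  fixes K :: "('k, 'z) superring_scheme"
  assumes szero_car[simp]: "szero K p \<in> car K p"
    and sone_car[simp]: "sone K \<in> car K 0"
    and sadd_car[simp]: "c \<in> car K p \<Longrightarrow> d \<in> car K p \<Longrightarrow> sadd K p c d \<in> car K p"
    and smul_car[simp]: "c \<in> car K p \<Longrightarrow> d \<in> car K q \<Longrightarrow> smul K p q c d \<in> car K (p + q)"

lemma wt_tgr: "wt K X p t \<Longrightarrow> tgr X t = p"
  by (induction rule: wt.induct) auto

lemma wt_subst:
  "wt K Y q t \<Longrightarrow> (\<And>i. i < len Y \<Longrightarrow> wt K X (gr Y i) (s i)) \<Longrightarrow> wt K X q (subst s t)"
  by (induction rule: wt.induct) (auto intro: wt.intros)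

lemma subst_subst: "subst r (subst s t) = subst (\<lambda>i. subst r (s i)) t"
  by (induction t) auto

lemma subst_Var: "subst Var t = t"
  by (induction t) auto

lemma teq_subst_right:
  "wt K Y q t \<Longrightarrow> (\<And>i. i < len Y \<Longrightarrow> teq K X (gr Y i) (s i) (s' i)) \<Longrightarrow>
    teq K X q (subst s t) (subst s' t)"
  by (induction rule: wt.induct) (auto intro: teq.intros wt.intros)

context closed_superring
begin

lemma wt_Mul': "wt K X p t \<Longrightarrow> wt K X q u \<Longrightarrow> r = p + q \<Longrightarrow> wt K X r (Mul t u)"
  by (auto intro: wt_Mul)

lemma teq_wt: "teq K X p t u \<Longrightarrow> wt K X p t \<and> wt K X p u"
proof (induction rule: teq.induct)
  case (teq_mul_assoc p t q u r v)
  then show ?case using wt_Mul[OF wt_Mul] wt_Mul[OF _ wt_Mul] by (metis add.assoc)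
next
  case (teq_mul_supercomm p t q u)
  then show ?case by (auto intro!: wt_Mul' wt_Neg simp: add.commute)
next
  case (teq_mul_one p t)
  then show ?case by (auto intro!: wt_Mul'[of _ 0] wt.intros)
next
  case (teq_mul_add p t q u v)
  then show ?case by (auto intro: wt.intros)
next
  case (teq_cst_mul c p d q)
  then show ?case by (auto intro: wt.intros)
qed (auto intro: wt.intros intro!: wt_Add wt_Cst)

lemma teq_subst_left:
  "teq K Y q t u \<Longrightarrow> (\<And>i. i < len Y \<Longrightarrow> wt K X (gr Y i) (s i)) \<Longrightarrow>
    teq K X q (subst s t) (subst s u)"
proof (induction rule: teq.induct)
  case (teq_sym p t u) then show ?case by (blast intro: teq.teq_sym)
next
  case (teq_trans p t u v) then show ?case by (blast intro: teq.teq_trans)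
next
  case (teq_mul_assoc p t q u r v)
  then show ?case by (auto intro: teq.teq_mul_assoc wt_subst)
next
  case (teq_mul_supercomm p t q u)
  then show ?case using teq.teq_mul_supercomm[of K X p "subst s t" q "subst s u"] wt_subst[of K Y _ _ X s]
    by (auto split: if_splits)
qed (auto intro: teq.intros wt_subst)

lemma teq_subst:
  assumes "teq K Y q t u" "\<And>i. i < len Y \<Longrightarrow> teq K X (gr Y i) (s i) (s' i)"
  shows "teq K X q (subst s t) (subst s' u)"
proof (rule teq_trans)
  show "teq K X q (subst s t) (subst s u)" using assms teq_wt by (blast intro: teq_subst_left)
  show "teq K X q (subst s u) (subst s' u)" using assms teq_wt by (blast intro: teq_subst_right)
qed

lemma cls_eqI: "teq K X p t u \<Longrightarrow> cls K X p t = cls K X p u"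
  unfolding cls_def by (auto intro: teq_trans teq_sym)

lemma in_cls: "wt K X p t \<Longrightarrow> t \<in> cls K X p t"
  by (simp add: cls_def teq_refl)

text \<open>
  Every arrow of \<open>SCom K\<close> is given by a tuple of terms; \<open>comp_arr\<close> computes with representatives.
\<close>

definition arr :: "nat \<times> nat \<Rightarrow> nat \<times> nat \<Rightarrow> (nat \<Rightarrow> 'k trm) \<Rightarrow> 'k trm set list" where
  "arr X Y t = map (\<lambda>i. cls K X (gr Y i) (t i)) [0..<len Y]"

definition wts :: "nat \<times> nat \<Rightarrow> nat \<times> nat \<Rightarrow> (nat \<Rightarrow> 'k trm) \<Rightarrow> bool" where
  "wts X Y t \<longleftrightarrow> (\<forall>i<len Y. wt K X (gr Y i) (t i))"

lemma SCom_Hom: "f \<in> Hom (SCom K) X Y \<longleftrightarrow> (\<exists>t. wts X Y t \<and> f = arr X Y t)"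
proof
  assume "f \<in> Hom (SCom K) X Y"
  then have l: "length f = len Y" and "\<forall>i<len Y. \<exists>t. wt K X (gr Y i) t \<and> f ! i = cls K X (gr Y i) t"
    by (auto simp: SCom_def)
  then obtain t where "\<forall>i<len Y. wt K X (gr Y i) (t i) \<and> f ! i = cls K X (gr Y i) (t i)" by metis
  then show "\<exists>t. wts X Y t \<and> f = arr X Y t" using l
    by (intro exI[of _ t]) (auto simp: wts_def arr_def intro!: nth_equalityI)
qed (auto simp: SCom_def wts_def arr_def)

lemma arr_hom[simp]: "wts X Y t \<Longrightarrow> arr X Y t \<in> Hom (SCom K) X Y"
  using SCom_Hom by blast

lemma comp_arr:
  assumes "wts X Y t" "wts Y Z u"
  shows "Comp (SCom K) X Y Z (arr Y Z u) (arr X Y t) = arr X Z (\<lambda>j. subst t (u j))"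
proof -
  have "{v. \<exists>u'\<in>arr Y Z u ! j. \<exists>s. (\<forall>i<len Y. s i \<in> arr X Y t ! i) \<and> teq K X (gr Z j) (subst s u') v}
    = cls K X (gr Z j) (subst t (u j))" (is "?L = ?R") if j: "j < len Z" for j
  proof (rule Set.set_eqI, rule iffI)
    fix v assume "v \<in> ?L"
    then obtain u' s where u': "u' \<in> arr Y Z u ! j" and s: "\<forall>i<len Y. s i \<in> arr X Y t ! i"
      and v: "teq K X (gr Z j) (subst s u') v" by blast
    have "teq K X (gr Z j) (subst t (u j)) (subst s u')"
      using u' s j by (intro teq_subst) (auto simp: arr_def cls_def)
    then show "v \<in> ?R" using v by (auto simp: cls_def intro: teq_trans)
  next
    fix v assume v: "v \<in> ?R"
    show "v \<in> ?L"
      using j v assms by (auto simp: arr_def wts_def cls_def intro!: exI[of _ "u j"] exI[of _ t] teq_refl)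
  qed
  then show ?thesis by (auto simp: SCom_def arr_def)
qed

lemma wts_subst: "wts X Y t \<Longrightarrow> wts Y Z u \<Longrightarrow> wts X Z (\<lambda>j. subst t (u j))"
  by (auto simp: wts_def intro: wt_subst)

lemma wts_Var: "wts X X Var"
  by (simp add: wts_def wt_Var)

lemma Ident_SCom: "Ident (SCom K) X = arr X X Var"
  by (simp add: SCom_def arr_def)

lemma proj_SCom: "proj (SCom K) X i = [cls K X (gr X i) (Var i)]"
  by (simp add: SCom_def)

lemma single_arr: "[cls K X p t] = arr X (srt p) (\<lambda>_. t)"
  by (simp add: arr_def)

lemma wts_srt: "wts X (srt p) t \<longleftrightarrow> wt K X p (t 0)"
  by (simp add: wts_def)

lemma arr_srt: "arr X (srt p) t = [cls K X p (t 0)]"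
  by (simp add: arr_def)

sublocale SC: lawvere_theory "SCom K"
proof
  have uniq: "h = arr Y X t" if "wts Y X t" "h \<in> Hom (SCom K) Y X"
    "\<And>i. i < len X \<Longrightarrow> Comp (SCom K) Y X (srt (gr X i)) (proj (SCom K) X i) h = arr Y (srt (gr X i)) (\<lambda>_. t i)"
    for X Y h t
  proof -
    obtain u where u: "wts Y X u" "h = arr Y X u" using \<open>h \<in> _\<close> SCom_Hom by blast
    have "arr Y (srt (gr X i)) (\<lambda>_. u i) = arr Y (srt (gr X i)) (\<lambda>_. t i)" if "i < len X" for i
      using \<open>\<And>i. i < len X \<Longrightarrow> Comp _ _ _ _ _ _ = _\<close>[OF that] u that
      by (simp add: proj_SCom single_arr comp_arr wts_srt wt_Var)
    then show ?thesis unfolding u by (simp add: arr_def)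
  qed
  fix X Y Z W f g h
  show "Obj (SCom K) = UNIV" by (simp add: SCom_def)
  show "Ident (SCom K) X \<in> Hom (SCom K) X X" by (simp add: Ident_SCom wts_Var)
  show "proj (SCom K) (srt p) 0 = Ident (SCom K) (srt p)" for p
    by (simp add: proj_SCom Ident_SCom arr_def)
  show "is_product (SCom K) {..<len X} (\<lambda>i. srt (gr X i)) X (proj (SCom K) X)"
    unfolding is_product_def
  proof (intro conjI ballI allI impI)
    show "X \<in> Obj (SCom K)" "srt (gr X i) \<in> Obj (SCom K)" for i by (simp_all add: SCom_def)
    show "i \<in> {..<len X} \<Longrightarrow> proj (SCom K) X i \<in> Hom (SCom K) X (srt (gr X i))" for i
      by (simp add: proj_SCom single_arr wts_srt wt_Var)
    fix Y f assume "\<forall>i\<in>{..<len X}. f i \<in> Hom (SCom K) Y (srt (gr X i))"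
    then have "\<forall>i\<in>{..<len X}. \<exists>t. wt K Y (gr X i) t \<and> f i = arr Y (srt (gr X i)) (\<lambda>_. t)"
      unfolding SCom_Hom wts_srt arr_srt by blast
    then obtain t where t: "\<forall>i\<in>{..<len X}. wt K Y (gr X i) (t i) \<and> f i = arr Y (srt (gr X i)) (\<lambda>_. t i)"
      by metis
    then have w: "wts Y X t" by (simp add: wts_def)
    show "\<exists>!h. h \<in> Hom (SCom K) Y X \<and> (\<forall>i\<in>{..<len X}. Comp (SCom K) Y X (srt (gr X i)) (proj (SCom K) X i) h = f i)"
    proof (rule ex1I[of _ "arr Y X t"])
      show "arr Y X t \<in> Hom (SCom K) Y X \<and> (\<forall>i\<in>{..<len X}. Comp (SCom K) Y X (srt (gr X i)) (proj (SCom K) X i) (arr Y X t) = f i)"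
        using w t by (simp add: proj_SCom single_arr comp_arr wts_srt wt_Var)
    qed (use uniq[OF w] t in auto)
  qed
  {
    assume "f \<in> Hom (SCom K) X Y" "g \<in> Hom (SCom K) Y Z"
    then show "Comp (SCom K) X Y Z g f \<in> Hom (SCom K) X Z"
      unfolding SCom_Hom using comp_arr wts_subst by metis
  }
  {
    assume "f \<in> Hom (SCom K) X Y"
    then obtain t where "wts X Y t" "f = arr X Y t" unfolding SCom_Hom by blast
    then show "Comp (SCom K) X Y Y (Ident (SCom K) Y) f = f" "Comp (SCom K) X X Y f (Ident (SCom K) X) = f"
      using wts_Var by (simp_all add: Ident_SCom comp_arr subst_Var)
  }
  {
    assume "f \<in> Hom (SCom K) W X" "g \<in> Hom (SCom K) X Y" "h \<in> Hom (SCom K) Y Z"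
    then obtain t u v where "wts W X t" "f = arr W X t" "wts X Y u" "g = arr X Y u" "wts Y Z v" "h = arr Y Z v"
      unfolding SCom_Hom by metis
    then show "Comp (SCom K) W Y Z h (Comp (SCom K) W X Y g f) = Comp (SCom K) W X Z (Comp (SCom K) X Y Z h g) f"
      by (simp add: comp_arr wts_subst subst_subst)
  }
qed

lemma tup_SCom: "wts X Y t \<Longrightarrow> tup (SCom K) X Y (\<lambda>i. [cls K X (gr Y i) (t i)]) = arr X Y t"
  by (rule SC.tup_eqI) (auto simp: proj_SCom single_arr comp_arr wts_srt wt_Var)

end

section \<open>Supercommutative rings as graded rings\<close>

locale supercommutative = closed_superring N for N :: "('v, 'z) superring_scheme" +
  assumes sadd_assoc: "x \<in> car N p \<Longrightarrow> y \<in> car N p \<Longrightarrow> z \<in> car N p \<Longrightarrow>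
      sadd N p (sadd N p x y) z = sadd N p x (sadd N p y z)"
    and sadd_comm: "x \<in> car N p \<Longrightarrow> y \<in> car N p \<Longrightarrow> sadd N p x y = sadd N p y x"
    and szero_add: "x \<in> car N p \<Longrightarrow> sadd N p (szero N p) x = x"
    and sneg_ex: "x \<in> car N p \<Longrightarrow> \<exists>y\<in>car N p. sadd N p y x = szero N p"
    and smul_assoc: "x \<in> car N p \<Longrightarrow> y \<in> car N q \<Longrightarrow> z \<in> car N r \<Longrightarrow>
      smul N (p + q) r (smul N p q x y) z = smul N p (q + r) x (smul N q r y z)"
    and sone_mul: "x \<in> car N p \<Longrightarrow> smul N 0 p (sone N) x = x"
    and smul_add: "x \<in> car N p \<Longrightarrow> y \<in> car N q \<Longrightarrow> z \<in> car N q \<Longrightarrow>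
      smul N p q x (sadd N q y z) = sadd N (p + q) (smul N p q x y) (smul N p q x z)"
    and smul_comm: "x \<in> car N p \<Longrightarrow> y \<in> car N q \<Longrightarrow> p = 0 \<or> q = 0 \<Longrightarrow>
      smul N p q x y = smul N q p y x"
    and smul_anticomm: "x \<in> car N 1 \<Longrightarrow> y \<in> car N 1 \<Longrightarrow>
      sadd N 0 (smul N 1 1 x y) (smul N 1 1 y x) = szero N 0"

text \<open>
  The ring \<open>N\<^sub>0 \<oplus> N\<^sub>1\<close>, with the embeddings \<open>inc\<close> of the homogeneous parts and the projections \<open>cmp\<close>
  onto them. It is an ordinary ring, so ring-theoretic computations need no bookkeeping of parities.
\<close>

definition tot :: "('v, 'z) superring_scheme \<Rightarrow> ('v \<times> 'v) ring" where
  "tot N = \<lparr>carrier = car N 0 \<times> car N 1,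
    mult = (\<lambda>x y. (sadd N 0 (smul N 0 0 (fst x) (fst y)) (smul N 1 1 (snd x) (snd y)),
                   sadd N 1 (smul N 0 1 (fst x) (snd y)) (smul N 1 0 (snd x) (fst y)))),
    one = (sone N, szero N 1), zero = (szero N 0, szero N 1),
    add = (\<lambda>x y. (sadd N 0 (fst x) (fst y), sadd N 1 (snd x) (snd y)))\<rparr>"

definition inc :: "('v, 'z) superring_scheme \<Rightarrow> bit \<Rightarrow> 'v \<Rightarrow> 'v \<times> 'v" where
  "inc N p x = (if p = 0 then (x, szero N 1) else (szero N 0, x))"

definition cmp :: "bit \<Rightarrow> 'v \<times> 'v \<Rightarrow> 'v" where
  "cmp p z = (if p = 0 then fst z else snd z)"

context supercommutative
begin

lemma smul_car': "x \<in> car N p \<Longrightarrow> y \<in> car N q \<Longrightarrow> r = p + q \<Longrightarrow> smul N p q x y \<in> car N r"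
  by simp

lemma mul_closed[simp]:
  "x \<in> car N 0 \<Longrightarrow> y \<in> car N 0 \<Longrightarrow> smul N 0 0 x y \<in> car N 0"
  "x \<in> car N 0 \<Longrightarrow> y \<in> car N 1 \<Longrightarrow> smul N 0 1 x y \<in> car N 1"
  "x \<in> car N 1 \<Longrightarrow> y \<in> car N 0 \<Longrightarrow> smul N 1 0 x y \<in> car N 1"
  "x \<in> car N 1 \<Longrightarrow> y \<in> car N 1 \<Longrightarrow> smul N 1 1 x y \<in> car N 0"
  by (rule smul_car'; simp)+

lemma sadd_left_comm: "x \<in> car N p \<Longrightarrow> y \<in> car N p \<Longrightarrow> z \<in> car N p \<Longrightarrow>
      sadd N p x (sadd N p y z) = sadd N p y (sadd N p x z)"
  by (metis sadd_assoc sadd_comm)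

lemmas sadd_ac = sadd_assoc sadd_comm sadd_left_comm

lemma add_szero: "x \<in> car N p \<Longrightarrow> sadd N p x (szero N p) = x"
  by (metis sadd_comm szero_add szero_car)

lemma add_self_zero: "x \<in> car N p \<Longrightarrow> sadd N p x x = x \<Longrightarrow> x = szero N p"
  by (metis sadd_assoc sneg_ex szero_add)

lemma smul_szero: "x \<in> car N p \<Longrightarrow> smul N p q x (szero N q) = szero N (p + q)"
  by (rule add_self_zero) (simp_all add: szero_add flip: smul_add)

lemma add_eq_zeroD: "x \<in> car N p \<Longrightarrow> y \<in> car N p \<Longrightarrow> z \<in> car N p \<Longrightarrow>
  sadd N p x z = szero N p \<Longrightarrow> sadd N p y z = szero N p \<Longrightarrow> x = y"
  by (metis sadd_assoc sadd_comm szero_add)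

lemma smul_add_left:
  assumes "x \<in> car N p" "y \<in> car N p" "z \<in> car N q"
  shows "smul N p q (sadd N p x y) z = sadd N (p + q) (smul N p q x z) (smul N p q y z)"
proof (cases "p = 0 \<or> q = 0")
  case True
  then show ?thesis using assms smul_add[of z q x p y] smul_comm[of _ p z q]
    by (simp add: add.commute)
next
  case False
  then have [simp]: "p = 1" "q = 1" using bit_cases by auto
  have c: "x \<in> car N 1" "y \<in> car N 1" "z \<in> car N 1" using assms by auto
  have "sadd N 0 (sadd N 0 (smul N 1 1 x z) (smul N 1 1 y z)) (smul N 1 1 z (sadd N 1 x y))
    = sadd N 0 (sadd N 0 (smul N 1 1 x z) (smul N 1 1 z x)) (sadd N 0 (smul N 1 1 y z) (smul N 1 1 z y))"
    using c smul_add[of z 1 x 1 y] by (simp add: sadd_ac)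
  also have "\<dots> = szero N 0" using c by (simp add: smul_anticomm szero_add)
  finally show ?thesis
    using add_eq_zeroD[of "smul N 1 1 (sadd N 1 x y) z" 0 "sadd N 0 (smul N 1 1 x z) (smul N 1 1 y z)"
       "smul N 1 1 z (sadd N 1 x y)"] smul_anticomm[of "sadd N 1 x y" z] c by simp
qed

lemma szero_smul:
  assumes "x \<in> car N q" shows "smul N p q (szero N p) x = szero N (p + q)"
proof (rule add_self_zero)
  show "smul N p q (szero N p) x \<in> car N (p + q)" using assms by simp
  show "sadd N (p + q) (smul N p q (szero N p) x) (smul N p q (szero N p) x) = smul N p q (szero N p) x"
    using assms smul_add_left[of "szero N p" p "szero N p" x q] by (simp add: szero_add)
qed

lemma smul_sone: "x \<in> car N p \<Longrightarrow> smul N p 0 x (sone N) = x"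
  using smul_comm[of x p "sone N" 0] by (simp add: sone_mul)

lemmas szero_rules =
  smul_szero[of _ 0 0, simplified] smul_szero[of _ 0 1, simplified]
  smul_szero[of _ 1 0, simplified] smul_szero[of _ 1 1, simplified]
  szero_smul[of _ 0 0, simplified] szero_smul[of _ 0 1, simplified]
  szero_smul[of _ 1 0, simplified] szero_smul[of _ 1 1, simplified]

lemmas smul_add_rules =
  smul_add[of _ 0 _ 0, simplified] smul_add[of _ 0 _ 1, simplified]
  smul_add[of _ 1 _ 0, simplified] smul_add[of _ 1 _ 1, simplified]
  smul_add_left[of _ 0 _ _ 0, simplified] smul_add_left[of _ 0 _ _ 1, simplified]
  smul_add_left[of _ 1 _ _ 0, simplified] smul_add_left[of _ 1 _ _ 1, simplified]

lemmas smul_assoc_rules =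
  smul_assoc[of _ 0 _ 0 _ 0, simplified] smul_assoc[of _ 0 _ 0 _ 1, simplified]
  smul_assoc[of _ 0 _ 1 _ 0, simplified] smul_assoc[of _ 0 _ 1 _ 1, simplified]
  smul_assoc[of _ 1 _ 0 _ 0, simplified] smul_assoc[of _ 1 _ 0 _ 1, simplified]
  smul_assoc[of _ 1 _ 1 _ 0, simplified] smul_assoc[of _ 1 _ 1 _ 1, simplified]

text \<open>
  Distributivity and associativity amount to the eight cases of parities of the factors.
\<close>

lemma ring_tot: "ring (tot N)"
proof (rule ringI)
  show "abelian_group (tot N)"
  proof (rule abelian_groupI)
    fix x assume "x \<in> carrier (tot N)"
    then obtain a b where x: "x = (a, b)" "a \<in> car N 0" "b \<in> car N 1" by (auto simp: tot_def)
    obtain a' b' where "a' \<in> car N 0" "b' \<in> car N 1" "sadd N 0 a' a = szero N 0" "sadd N 1 b' b = szero N 1"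
      using sneg_ex[OF x(2)] sneg_ex[OF x(3)] by blast
    then show "\<exists>y\<in>carrier (tot N). y \<oplus>\<^bsub>tot N\<^esub> x = \<zero>\<^bsub>tot N\<^esub>"
      by (intro bexI[of _ "(a', b')"]) (auto simp: tot_def x)
  qed (auto simp: tot_def sadd_ac szero_add add_szero)
  show "Group.monoid (tot N)"
    by (rule monoidI) (auto simp: tot_def szero_rules szero_add add_szero sone_mul smul_sone smul_add_rules smul_assoc_rules sadd_ac)
qed (auto simp: tot_def smul_add_rules sadd_ac)

sublocale R: ring "tot N"
  by (rule ring_tot)

lemma inc_carrier[simp]: "x \<in> car N p \<Longrightarrow> inc N p x \<in> carrier (tot N)"
  using bit_cases[of p] by (auto simp: inc_def tot_def)

lemma cmp_car[simp]: "z \<in> carrier (tot N) \<Longrightarrow> cmp p z \<in> car N p"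
  using bit_cases[of p] by (auto simp: cmp_def tot_def)

lemma cmp_inc[simp]: "cmp p (inc N p x) = x"
  by (simp add: cmp_def inc_def)

lemma inc_eq_iff[simp]: "inc N p x = inc N p y \<longleftrightarrow> x = y"
  by (metis cmp_inc)

lemma inc_szero[simp]: "inc N p (szero N p) = \<zero>\<^bsub>tot N\<^esub>"
  using bit_cases[of p] by (auto simp: inc_def tot_def)

lemma inc_sone[simp]: "inc N 0 (sone N) = \<one>\<^bsub>tot N\<^esub>"
  by (auto simp: inc_def tot_def)

lemma inc_sadd: "x \<in> car N p \<Longrightarrow> y \<in> car N p \<Longrightarrow> inc N p (sadd N p x y) = inc N p x \<oplus>\<^bsub>tot N\<^esub> inc N p y"
  using bit_cases[of p] by (auto simp: inc_def tot_def szero_add)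

lemma inc_smul: "x \<in> car N p \<Longrightarrow> y \<in> car N q \<Longrightarrow>
    inc N (p + q) (smul N p q x y) = inc N p x \<otimes>\<^bsub>tot N\<^esub> inc N q y"
  using bit_cases[of p] bit_cases[of q]
  by (auto simp: inc_def tot_def szero_add add_szero szero_rules)

lemma inc_comm: "x \<in> car N p \<Longrightarrow> y \<in> car N q \<Longrightarrow> p = 0 \<or> q = 0 \<Longrightarrow>
    inc N p x \<otimes>\<^bsub>tot N\<^esub> inc N q y = inc N q y \<otimes>\<^bsub>tot N\<^esub> inc N p x"
  using inc_smul[of x p y q] inc_smul[of y q x p] smul_comm[of x p y q] by (simp add: add.commute)

lemma inc_anticomm: "x \<in> car N 1 \<Longrightarrow> y \<in> car N 1 \<Longrightarrow>
    inc N 1 x \<otimes>\<^bsub>tot N\<^esub> inc N 1 y = \<ominus>\<^bsub>tot N\<^esub> (inc N 1 y \<otimes>\<^bsub>tot N\<^esub> inc N 1 x)"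
  using smul_anticomm[of x y] inc_smul[of x 1 y 1] inc_smul[of y 1 x 1] inc_sadd[of "smul N 1 1 x y" 0 "smul N 1 1 y x"]
  by (intro R.minus_equality[symmetric]) (auto simp: R.a_comm)

lemma inc_decomp: "z \<in> carrier (tot N) \<Longrightarrow> z = inc N 0 (cmp 0 z) \<oplus>\<^bsub>tot N\<^esub> inc N 1 (cmp 1 z)"
  by (auto simp: tot_def inc_def cmp_def szero_add add_szero)

lemma cmp_add: "x \<in> carrier (tot N) \<Longrightarrow> y \<in> carrier (tot N) \<Longrightarrow>
    cmp p (x \<oplus>\<^bsub>tot N\<^esub> y) = sadd N p (cmp p x) (cmp p y)"
  using bit_cases[of p] by (auto simp: cmp_def tot_def)

lemma cmp_mul_inc: "x \<in> car N p \<Longrightarrow> z \<in> carrier (tot N) \<Longrightarrow>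
    cmp q (inc N p x \<otimes>\<^bsub>tot N\<^esub> z) = smul N p (p + q) x (cmp (p + q) z)"
  using bit_cases[of p] bit_cases[of q]
  by (auto simp: cmp_def tot_def inc_def szero_rules szero_add add_szero)

end

definition shom :: "('v, 'z) superring_scheme \<Rightarrow> ('w, 'y) superring_scheme \<Rightarrow> (bit \<Rightarrow> 'v \<Rightarrow> 'w) \<Rightarrow> bool" where
  "shom N M h \<longleftrightarrow> (\<forall>p. h p \<in> car N p \<rightarrow> car M p) \<and>
    (\<forall>p. \<forall>x\<in>car N p. \<forall>y\<in>car N p. h p (sadd N p x y) = sadd M p (h p x) (h p y)) \<and>
    (\<forall>p q. \<forall>x\<in>car N p. \<forall>y\<in>car N q. h (p + q) (smul N p q x y) = smul M p q (h p x) (h q y)) \<and>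
    (\<forall>p. h p (szero N p) = szero M p) \<and> h 0 (sone N) = sone M"

definition totmap :: "(bit \<Rightarrow> 'v \<Rightarrow> 'w) \<Rightarrow> 'v \<times> 'v \<Rightarrow> 'w \<times> 'w" where
  "totmap h z = (h 0 (fst z), h 1 (snd z))"

lemma totmap_inc: "shom N M h \<Longrightarrow> totmap h (inc N p x) = inc M p (h p x)"
  using bit_cases[of p] by (auto simp: totmap_def inc_def shom_def)

lemma totmap_ring_hom:
  assumes "supercommutative N" "supercommutative M" "shom N M h"
  shows "totmap h \<in> ring_hom (tot N) (tot M)"
proof -
  interpret N: supercommutative N by fact
  interpret M: supercommutative M by fact
  note h = assms(3)[unfolded shom_def]
  have c: "h 0 a \<in> car M 0" if "a \<in> car N 0" for a using h that by auto
  have c1: "h 1 a \<in> car M 1" if "a \<in> car N 1" for a using h that by auto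
  have "h 0 (smul N 0 0 a b) = smul M 0 0 (h 0 a) (h 0 b)" if "a \<in> car N 0" "b \<in> car N 0" for a b
    using h that by (metis add_0)
  moreover have "h 1 (smul N 0 1 a b) = smul M 0 1 (h 0 a) (h 1 b)" if "a \<in> car N 0" "b \<in> car N 1" for a b
    using h that by (metis add_0)
  moreover have "h 1 (smul N 1 0 a b) = smul M 1 0 (h 1 a) (h 0 b)" if "a \<in> car N 1" "b \<in> car N 0" for a b
    using h that by (metis add_0_right)
  moreover have "h 0 (smul N 1 1 a b) = smul M 1 1 (h 1 a) (h 1 b)" if "a \<in> car N 1" "b \<in> car N 1" for a b
  proof -
    have "h (1 + 1) (smul N 1 1 a b) = smul M 1 1 (h 1 a) (h 1 b)" using h that by blast
    then show ?thesis by simp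
  qed
  ultimately show ?thesis
    using h by (auto simp: ring_hom_def totmap_def tot_def c c1)
qed

section \<open>The superring underlying an algebra\<close>

text \<open>
  The value of a term; \<open>under K B\<close> collects the operations of addition and multiplication so obtained
  into a superring. As even coordinates come before odd ones, the left factor of a product occupies the
  coordinate \<open>mi p q\<close> of \<open>srt p + srt q\<close>.
\<close>

definition tev ::
  "('k, 'z) superring_scheme \<Rightarrow> ('k trm set list, 'u) alg \<Rightarrow> nat \<times> nat \<Rightarrow> bit \<Rightarrow> 'k trm \<Rightarrow> (nat \<Rightarrow> 'u) \<Rightarrow> 'u" where
  "tev K B X p t a = ev (SCom K) B X p [cls K X p t] a"

definition mi :: "bit \<Rightarrow> bit \<Rightarrow> nat" where
  "mi p q = (if p = 1 \<and> q = 0 then 1 else 0)"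

definition under :: "('k, 'z) superring_scheme \<Rightarrow> ('k trm set list, 'u) alg \<Rightarrow> 'u superring" where
  "under K B = \<lparr>car = (\<lambda>p. fob B (srt p)),
    sadd = (\<lambda>p x y. tev K B (srt p + srt p) p (Add (Var 0) (Var 1)) (\<lambda>i. if i = 0 then x else y)),
    smul = (\<lambda>p q x y. tev K B (srt p + srt q) (p + q) (Mul (Var (mi p q)) (Var (1 - mi p q)))
      (\<lambda>k. if k = mi p q then x else y)),
    szero = (\<lambda>p. tev K B (0, 0) p (Cst p (szero K p)) (\<lambda>_. undefined)),
    sone = tev K B (0, 0) 0 (Cst 0 (sone K)) (\<lambda>_. undefined)\<rparr>"

lemma gr_add_srt_same[simp]: "gr (srt p + srt p) 0 = p" "gr (srt p + srt p) (Suc 0) = p"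
  using bit_cases[of p] by (auto simp: gr_def srt_def)

lemma gr_mi[simp]: "gr (srt p + srt q) (mi p q) = p" "gr (srt p + srt q) (Suc 0 - mi p q) = q"
  using bit_cases[of p] bit_cases[of q] by (auto simp: gr_def srt_def mi_def)

lemma mi_less[simp]: "mi p q < Suc (Suc 0)" "Suc 0 - mi p q < Suc (Suc 0)"
  by (auto simp: mi_def)

lemma less_2_mi: "i < Suc (Suc 0) \<Longrightarrow> i \<noteq> mi p q \<Longrightarrow> i = Suc 0 - mi p q"
  by (auto simp: mi_def split: if_splits)

lemma mi_neq[simp]: "Suc 0 - mi p q \<noteq> mi p q"
  by (auto simp: mi_def)

lemma car_under[simp]: "car (under K B) p = fob B (srt p)"
  by (simp add: under_def)

context closed_superring
begin

lemma wt_binary: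
  "wt K (srt p + srt p) p (Add (Var 0) (Var 1))"
  "wt K (srt p + srt q) (p + q) (Mul (Var (mi p q)) (Var (Suc 0 - mi p q)))"
  using wt_Var[of 0 "srt p + srt p" K] wt_Var[of 1 "srt p + srt p" K]
    wt_Var[of "mi p q" "srt p + srt q" K] wt_Var[of "Suc 0 - mi p q" "srt p + srt q" K]
  by (auto intro: wt.intros)

lemma cls_hom[simp]: "wt K X p t \<Longrightarrow> [cls K X p t] \<in> Hom (SCom K) X (srt p)"
  by (simp add: single_arr wts_srt)

lemma tev_eq: "teq K X p t u \<Longrightarrow> tev K B X p t a = tev K B X p u a"
  by (simp add: tev_def cls_eqI)

lemma tev_cong: "(\<And>i. i < len X \<Longrightarrow> a i = b i) \<Longrightarrow> tev K B X p t a = tev K B X p t b"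
  unfolding tev_def by (rule SC.ev_cong)

context
  fixes B :: "('k trm set list, 'u) alg"
  assumes B: "B \<in> Obj (Alg (SCom K))"
begin

lemma tev_in[simp]: "fam B X a \<Longrightarrow> wt K X p t \<Longrightarrow> tev K B X p t a \<in> fob B (srt p)"
  using B by (simp add: tev_def)

lemma tev_subst:
  assumes "fam B X a" "wt K Y q t" "\<And>i. i < len Y \<Longrightarrow> wt K X (gr Y i) (s i)"
  shows "tev K B X q (subst s t) a = tev K B Y q t (\<lambda>i. tev K B X (gr Y i) (s i) a)"
proof -
  have "wts X Y s" using assms by (simp add: wts_def)
  then have "Comp (SCom K) X Y (srt q) [cls K Y q t] (tup (SCom K) X Y (\<lambda>i. [cls K X (gr Y i) (s i)]))
    = [cls K X q (subst s t)]"
    using assms by (subst tup_SCom) (simp_all add: single_arr comp_arr wts_srt)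
  then show ?thesis
    using SC.ev_comp_tup[OF B assms(1), of Y "\<lambda>i. [cls K X (gr Y i) (s i)]" "[cls K Y q t]" q] assms
    by (simp add: tev_def)
qed

lemma tev_Var[simp]: "fam B X a \<Longrightarrow> i < len X \<Longrightarrow> p = gr X i \<Longrightarrow> tev K B X p (Var i) a = a i"
  using SC.ev_proj[OF B, of X a i] by (simp add: tev_def proj_SCom)

lemma tev_Cst:
  assumes "fam B X a" "c \<in> car K p"
  shows "tev K B X p (Cst p c) a = tev K B (0, 0) p (Cst p c) (\<lambda>_. undefined)"
proof -
  have "tev K B X p (Cst p c) a = tev K B (0, 0) p (Cst p c) (\<lambda>i. tev K B X (gr (0,0) i) (Var i) a)"
    using tev_subst[of X a "(0,0)" p "Cst p c" Var] assms by (simp add: wt_Cst)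
  also have "\<dots> = tev K B (0, 0) p (Cst p c) (\<lambda>_. undefined)" by (rule tev_cong) simp
  finally show ?thesis .
qed

lemma tev_szero: "fam B X a \<Longrightarrow> tev K B X p (Cst p (szero K p)) a = szero (under K B) p"
  and tev_sone: "fam B X a \<Longrightarrow> tev K B X 0 (Cst 0 (sone K)) a = sone (under K B)"
  by (simp_all add: tev_Cst under_def)

lemma tev_Add:
  assumes "fam B X a" "wt K X p t" "wt K X p u"
  shows "tev K B X p (Add t u) a = sadd (under K B) p (tev K B X p t a) (tev K B X p u a)"
proof -
  let ?s = "\<lambda>i. if i = 0 then t else u" and ?D = "srt p + srt p"
  have g: "gr ?D i = p" if "i < Suc (Suc 0)" for i using that by (cases "i = 0") (auto simp: less_Suc_eq)
  have "tev K B X p (subst ?s (Add (Var 0) (Var 1))) a =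
    tev K B ?D p (Add (Var 0) (Var 1)) (\<lambda>i. tev K B X (gr ?D i) (?s i) a)"
    using assms wt_binary by (intro tev_subst) (auto simp: g)
  also have "\<dots> = tev K B ?D p (Add (Var 0) (Var 1)) (\<lambda>i. if i = 0 then tev K B X p t a else tev K B X p u a)"
    by (rule tev_cong) (auto simp: g)
  finally show ?thesis by (simp add: under_def)
qed

lemma tev_Mul:
  assumes "fam B X a" "wt K X p t" "wt K X q u" "r = p + q"
  shows "tev K B X r (Mul t u) a = smul (under K B) p q (tev K B X p t a) (tev K B X q u a)"
proof -
  let ?s = "\<lambda>i. if i = mi p q then t else u" and ?D = "srt p + srt q"
  have "tev K B X (p + q) (subst ?s (Mul (Var (mi p q)) (Var (1 - mi p q)))) a =
    tev K B ?D (p + q) (Mul (Var (mi p q)) (Var (1 - mi p q))) (\<lambda>i. tev K B X (gr ?D i) (?s i) a)"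
    using assms wt_binary by (intro tev_subst) (auto dest: less_2_mi)
  also have "\<dots> = tev K B ?D (p + q) (Mul (Var (mi p q)) (Var (1 - mi p q)))
      (\<lambda>i. if i = mi p q then tev K B X p t a else tev K B X q u a)"
    by (rule tev_cong) (auto dest: less_2_mi)
  finally show ?thesis by (simp add: under_def assms(4))
qed

lemma fam_00[simp]: "fam B (0, 0) a"
  by (simp add: fam_def)

text \<open>Identities in three homogeneous variables can thus be checked at a family indexed by a single object, \<open>(3|3)\<close>.\<close>

lemma three_elements:
  assumes "x \<in> fob B (srt p)" "y \<in> fob B (srt q)" "z \<in> fob B (srt r)"
  obtains X a i j k where "fam B X a" "i < len X" "j < len X" "k < len X"
    "gr X i = p" "gr X j = q" "gr X k = r" "a i = x" "a j = y" "a k = z"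
proof -
  define X :: "nat \<times> nat" where "X = (3, 3)"
  define i j k where "i = (if p = 0 then 0 else 3 :: nat)" "j = (if q = 0 then 1 else 4 :: nat)"
    "k = (if r = 0 then 2 else 5 :: nat)"
  define a where "a n = (if n = i then x else if n = j then y else if n = k then z
    else tev K B (0, 0) (gr X n) (Cst (gr X n) (szero K (gr X n))) (\<lambda>_. undefined))" for n
  have g: "i < len X" "j < len X" "k < len X" "gr X i = p" "gr X j = q" "gr X k = r" "i \<noteq> j" "j \<noteq> k" "i \<noteq> k"
    using bit_cases[of p] bit_cases[of q] bit_cases[of r]
    by (auto simp: X_def i_j_k_def len_def gr_def)
  moreover have "fam B X a" using assms g by (auto simp: fam_def a_def intro!: tev_in wt_Cst)
  moreover have "a i = x" "a j = y" "a k = z" using g by (auto simp: a_def)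
  ultimately show ?thesis using that by blast
qed

lemma fam_unary: "x \<in> fob B (srt p) \<Longrightarrow> fam B (srt p) (\<lambda>_. x)"
  by (auto simp: fam_def)

lemma fam_add: "x \<in> fob B (srt p) \<Longrightarrow> y \<in> fob B (srt p) \<Longrightarrow> fam B (srt p + srt p) (\<lambda>i. if i = 0 then x else y)"
  by (auto simp: fam_def less_Suc_eq)

lemma fam_mul: "x \<in> fob B (srt p) \<Longrightarrow> y \<in> fob B (srt q) \<Longrightarrow> fam B (srt p + srt q) (\<lambda>i. if i = mi p q then x else y)"
  by (auto simp: fam_def dest: less_2_mi)

text \<open>
  Each axiom is the evaluation of a provable equality at a family that contains the given elements.
\<close>

lemma supercommutative_under: "supercommutative (under K B)"
proof -
  interpret U: closed_superring "under K B"
  proof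
    fix p q c d
    show "szero (under K B) p \<in> car (under K B) p" "sone (under K B) \<in> car (under K B) 0"
      by (simp_all add: under_def wt_Cst)
    show "sadd (under K B) p c d \<in> car (under K B) p" if "c \<in> car (under K B) p" "d \<in> car (under K B) p"
      using tev_in[OF fam_add wt_binary(1)] that by (simp add: under_def)
    show "smul (under K B) p q c d \<in> car (under K B) (p + q)" if "c \<in> car (under K B) p" "d \<in> car (under K B) q"
      using tev_in[OF fam_mul wt_binary(2)] that by (simp add: under_def)
  qed
  note simps = tev_Add tev_Mul tev_szero tev_sone wt_Var wt_Cst wt_Add wt_Mul add.assoc
  have ax: "tev K B X p t a = tev K B X p u a" if "fam B X a" "teq K X p t u" for X p t u a
    using that by (simp add: tev_eq)
  show ?thesis
  proof
    fix x y z p q r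
    { assume xyz: "x \<in> car (under K B) p" "y \<in> car (under K B) p" "z \<in> car (under K B) p"
      obtain X a i j k where c: "fam B X a" "i < len X" "j < len X" "k < len X"
        "gr X i = p" "gr X j = p" "gr X k = p" "a i = x" "a j = y" "a k = z"
        by (rule three_elements[OF xyz[unfolded car_under]])
      note w = c(1-4) wt_Var[OF c(2), of K, unfolded c] wt_Var[OF c(3), of K, unfolded c] wt_Var[OF c(4), of K, unfolded c]
      show "sadd (under K B) p (sadd (under K B) p x y) z = sadd (under K B) p x (sadd (under K B) p y z)"
        using ax[OF c(1) teq_add_assoc[of K X p "Var i" "Var j" "Var k"]] w c(5-)
        by (simp add: tev_Add wt_Add) }
    { assume xyz: "x \<in> car (under K B) p" "y \<in> car (under K B) p"
      obtain X a i j k where c: "fam B X a" "i < len X" "j < len X" "k < len X"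
        "gr X i = p" "gr X j = p" "gr X k = p" "a i = x" "a j = y" "a k = y"
        by (rule three_elements[OF xyz[unfolded car_under] xyz(2)[unfolded car_under]])
      note w = c(1-4) wt_Var[OF c(2), of K, unfolded c] wt_Var[OF c(3), of K, unfolded c] wt_Var[OF c(4), of K, unfolded c]
      show "sadd (under K B) p x y = sadd (under K B) p y x"
        using ax[OF c(1) teq_add_comm[of K X p "Var i" "Var j"]] w c(5-)
        by (simp add: tev_Add) }
    { assume "x \<in> car (under K B) p"
      then have c: "fam B (srt p) (\<lambda>_. x)" by (simp add: fam_unary)
      have w: "wt K (srt p) p (Var 0)" using wt_Var[of 0 "srt p" K] by simp
      show "sadd (under K B) p (szero (under K B) p) x = x"
        using ax[OF c teq_add_zero[of K "srt p" p "Var 0"]] w c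
        by (simp add: tev_Add tev_szero wt_Cst)
      show "\<exists>y\<in>car (under K B) p. sadd (under K B) p y x = szero (under K B) p"
        using ax[OF c teq_add_neg[of K "srt p" p "Var 0"]] w c
        by (intro bexI[of _ "tev K B (srt p) p (Neg (Var 0)) (\<lambda>_. x)"]) (simp_all add: tev_Add tev_szero wt_Neg)
      show "smul (under K B) 0 p (sone (under K B)) x = x"
        using ax[OF c teq_mul_one[of K "srt p" p "Var 0"]] w c
        by (simp add: tev_Mul[where p = 0] tev_sone wt_Cst) }
    { assume xyz: "x \<in> car (under K B) p" "y \<in> car (under K B) q" "z \<in> car (under K B) r"
      obtain X a i j k where c: "fam B X a" "i < len X" "j < len X" "k < len X"
        "gr X i = p" "gr X j = q" "gr X k = r" "a i = x" "a j = y" "a k = z"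
        by (rule three_elements[OF xyz[unfolded car_under]])
      note w = c(1-4) wt_Var[OF c(2), of K, unfolded c] wt_Var[OF c(3), of K, unfolded c] wt_Var[OF c(4), of K, unfolded c]
      show "smul (under K B) (p + q) r (smul (under K B) p q x y) z = smul (under K B) p (q + r) x (smul (under K B) q r y z)"
        using ax[OF c(1) teq_mul_assoc[of K X p "Var i" q "Var j" r "Var k"]] w c(5-)
        by (simp add: tev_Mul[where p = p and q = q] tev_Mul[where p = q and q = r] wt_Mul
              tev_Mul[where p = p and q = "q + r"] tev_Mul[where p = "p + q" and q = r] add.assoc) }
    { assume xyz: "x \<in> car (under K B) p" "y \<in> car (under K B) q" "z \<in> car (under K B) q"
      obtain X a i j k where c: "fam B X a" "i < len X" "j < len X" "k < len X"
        "gr X i = p" "gr X j = q" "gr X k = q" "a i = x" "a j = y" "a k = z"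
        by (rule three_elements[OF xyz[unfolded car_under]])
      note w = c(1-4) wt_Var[OF c(2), of K, unfolded c] wt_Var[OF c(3), of K, unfolded c] wt_Var[OF c(4), of K, unfolded c]
      show "smul (under K B) p q x (sadd (under K B) q y z) = sadd (under K B) (p + q) (smul (under K B) p q x y) (smul (under K B) p q x z)"
        using ax[OF c(1) teq_mul_add[of K X p "Var i" q "Var j" "Var k"]] w c(5-)
        by (simp add: tev_Add wt_Add wt_Mul tev_Mul[where p = p and q = q]) }
    { assume xyz: "x \<in> car (under K B) p" "y \<in> car (under K B) q" "p = 0 \<or> q = 0"
      obtain X a i j k where c: "fam B X a" "i < len X" "j < len X" "k < len X"
        "gr X i = p" "gr X j = q" "gr X k = q" "a i = x" "a j = y" "a k = y"
        by (rule three_elements[OF xyz(1,2,2)[unfolded car_under]])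
      note w = c(1-4) wt_Var[OF c(2), of K, unfolded c] wt_Var[OF c(3), of K, unfolded c] wt_Var[OF c(4), of K, unfolded c]
      show "smul (under K B) p q x y = smul (under K B) q p y x"
        using ax[OF c(1) teq_mul_supercomm[of K X p "Var i" q "Var j"]] w c(5-) xyz(3)
        by (auto simp: tev_Mul[where p = p and q = q] tev_Mul[where p = q and q = p] add.commute) }
    { assume xyz: "x \<in> car (under K B) 1" "y \<in> car (under K B) 1"
      obtain X a i j k where c: "fam B X a" "i < len X" "j < len X" "k < len X"
        "gr X i = 1" "gr X j = 1" "gr X k = 1" "a i = x" "a j = y" "a k = y"
        by (rule three_elements[OF xyz[unfolded car_under] xyz(2)[unfolded car_under]])
      note w = c(1-4) wt_Var[OF c(2), of K, unfolded c] wt_Var[OF c(3), of K, unfolded c] wt_Var[OF c(4), of K, unfolded c]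
      have m: "wt K X 0 (Mul (Var j) (Var i))" "wt K X 0 (Mul (Var i) (Var j))"
        using wt_Mul[OF w(5,6)] wt_Mul[OF w(6,5)] by simp_all
      have T: "teq K X 0 (Add (Mul (Var i) (Var j)) (Mul (Var j) (Var i))) (Add (Neg (Mul (Var j) (Var i))) (Mul (Var j) (Var i)))"
        using teq_mul_supercomm[of K X 1 "Var i" 1 "Var j"] w m by (intro teq_Add) (auto intro: teq_refl)
      show "sadd (under K B) 0 (smul (under K B) 1 1 x y) (smul (under K B) 1 1 y x) = szero (under K B) 0"
        using ax[OF c(1) teq_trans[OF T teq_add_neg[OF m(1)]]] w c(5-) m
        by (simp add: tev_Add tev_szero tev_Mul[where p = 1 and q = 1]) }
  qed
qed

lemma tev_Neg:
  assumes "fam B X a" "wt K X p t"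
  shows "sadd (under K B) p (tev K B X p (Neg t) a) (tev K B X p t a) = szero (under K B) p"
  using tev_eq[OF teq_add_neg[OF assms(2)], of B a] assms by (simp add: tev_Add tev_szero wt_Neg)

end

lemma thom_tev:
  assumes "thom (SCom K) B B' h" "B \<in> Obj (Alg (SCom K))" "B' \<in> Obj (Alg (SCom K))" "fam B X a" "wt K X p t"
  shows "h (srt p) (tev K B X p t a) = tev K B' X p t (\<lambda>i. h (srt (gr X i)) (a i))"
  using assms by (simp add: tev_def SC.thom_ev)

lemma shom_thom:
  assumes h: "thom (SCom K) B B' h" and B: "B \<in> Obj (Alg (SCom K))" "B' \<in> Obj (Alg (SCom K))"
  shows "shom (under K B) (under K B') (\<lambda>p. h (srt p))"
  unfolding shom_def
proof (intro conjI allI ballI)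
  have cong0: "tev K B' (0, 0) p t (\<lambda>i. h (srt (gr (0, 0) i)) undefined) = tev K B' (0, 0) p t (\<lambda>_. undefined)" for p t
    by (rule tev_cong) simp
  show "h (srt p) \<in> car (under K B) p \<rightarrow> car (under K B') p" for p using h by (auto simp: thom_def)
  show "h (srt p) (szero (under K B) p) = szero (under K B') p" for p
    using thom_tev[OF h B fam_00[OF B(1)], of p "Cst p (szero K p)" "\<lambda>_. undefined"] cong0
    by (simp add: under_def wt_Cst)
  show "h (srt 0) (sone (under K B)) = sone (under K B')"
    using thom_tev[OF h B fam_00[OF B(1)], of 0 "Cst 0 (sone K)" "\<lambda>_. undefined"] cong0
    by (simp add: under_def wt_Cst)
  fix p x y assume "x \<in> car (under K B) p" "y \<in> car (under K B) p"
  then have "h (srt p) (sadd (under K B) p x y) = tev K B' (srt p + srt p) p (Add (Var 0) (Var 1))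
      (\<lambda>i. h (srt (gr (srt p + srt p) i)) (if i = 0 then x else y))"
    using thom_tev[OF h B fam_add[OF B(1)] wt_binary(1)] by (simp add: under_def)
  also have "\<dots> = tev K B' (srt p + srt p) p (Add (Var 0) (Var 1)) (\<lambda>i. if i = 0 then h (srt p) x else h (srt p) y)"
    by (rule tev_cong) (auto simp: less_Suc_eq)
  finally show "h (srt p) (sadd (under K B) p x y) = sadd (under K B') p (h (srt p) x) (h (srt p) y)"
    by (simp add: under_def)
next
  fix p q x y assume "x \<in> car (under K B) p" "y \<in> car (under K B) q"
  then have "h (srt (p + q)) (smul (under K B) p q x y) = tev K B' (srt p + srt q) (p + q) (Mul (Var (mi p q)) (Var (1 - mi p q)))
      (\<lambda>i. h (srt (gr (srt p + srt q) i)) (if i = mi p q then x else y))"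
    using thom_tev[OF h B fam_mul[OF B(1)] wt_binary(2)] by (simp add: under_def)
  also have "\<dots> = tev K B' (srt p + srt q) (p + q) (Mul (Var (mi p q)) (Var (1 - mi p q))) (\<lambda>i. if i = mi p q then h (srt p) x else h (srt q) y)"
    by (rule tev_cong) (auto dest: less_2_mi)
  finally show "h (srt (p + q)) (smul (under K B) p q x y) = smul (under K B') p q (h (srt p) x) (h (srt q) y)"
    by (simp add: under_def)
qed

end

section \<open>Restriction along a morphism of theories\<close>

lemma fob_comp_functor[simp]: "fob (comp_functor B F) X = fob B (fob F X)"
  and fmap_comp_functor[simp]: "fmap (comp_functor B F) X Y f = fmap B (fob F X) (fob F Y) (fmap F X Y f)"
  by (simp_all add: comp_functor_def)

context theory_morphism
begin

declare fob_id[simp]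

lemma \<tau>_hom[simp]: "f \<in> Hom S X Y \<Longrightarrow> fmap \<tau> X Y f \<in> Hom T X Y"
  using fmap_in_hom[of X Y f] by simp

lemma \<tau>_comp: "f \<in> Hom S X Y \<Longrightarrow> g \<in> Hom S Y Z \<Longrightarrow>
    fmap \<tau> X Z (Comp S X Y Z g f) = Comp T X Y Z (fmap \<tau> Y Z g) (fmap \<tau> X Y f)"
  using fmap_comp[of X Y Z f g] by simp

lemma crd_pull[simp]: "i < len X \<Longrightarrow> crd S (comp_functor B \<tau>) X x i = crd T B X x i"
  by (simp add: crd_def fmap_proj)

lemma fam_pull[simp]: "fam (comp_functor B \<tau>) X a = fam B X a"
  by (simp add: fam_def)

lemma mk_pull[simp]: "mk S (comp_functor B \<tau>) X a = mk T B X a"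
  by (simp add: mk_def cong: conj_cong)

lemma ev_pull[simp]: "ev S (comp_functor B \<tau>) X p f a = ev T B X p (fmap \<tau> X (srt p) f) a"
  by (simp add: ev_def)

text \<open>
  Coordinates are unchanged under restriction, so restriction preserves algebras.
\<close>

lemma pull_obj[simp]:
  assumes B: "B \<in> Obj (Alg T)"
  shows "comp_functor B \<tau> \<in> Obj (Alg S)"
proof (rule src.preserves_finite_products_if_coordinates)
  have "category S" by unfold_locales
  then show "cat_functor S set_cat (comp_functor B \<tau>)"
    unfolding cat_functor_set_cat_iff
    using tgt.alg_fmap_PiE[OF B] B by (simp add: \<tau>_comp fmap_ident)
  fix X a assume "fam (comp_functor B \<tau>) X a"
  then show "\<exists>!x. x \<in> fob (comp_functor B \<tau>) X \<and> (\<forall>i<len X. crd S (comp_functor B \<tau>) X x i = a i)"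
    using tgt.mk_ex1[OF B, of X a] by (simp cong: conj_cong)
qed

lemma thom_pull: "thom T B B' h \<Longrightarrow> thom S (comp_functor B \<tau>) (comp_functor B' \<tau>) h"
  by (simp add: thom_def)

end

section \<open>The structure map over the ground ring\<close>

lemma rat_superring_simps[simp]:
  "szero rat_superring p = 0" "sone rat_superring = 1"
  by (simp_all add: rat_superring_def)

lemma closed_rat: "closed_superring rat_superring"
proof
  show "smul rat_superring p q c d \<in> car rat_superring (p + q)"
    if "c \<in> car rat_superring p" "d \<in> car rat_superring q" for p q c d
    using that bit_cases[of p] bit_cases[of q] by (auto simp: rat_superring_def)
qed (auto simp: rat_superring_def)

sublocale super_fermat_theory \<subseteq> Q: closed_superring rat_superring
  by (rule closed_rat)

context super_fermat_theory
begin

text \<open>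
  The rational superalgebra underlying an \<open>S\<close>-algebra.
\<close>

abbreviation NN :: "('s, 'v) alg \<Rightarrow> 'v superring" where
  "NN B \<equiv> under rat_superring (comp_functor B \<tau>)"

lemma NN_super: "B \<in> Obj (Alg S) \<Longrightarrow> supercommutative (NN B)"
  using Q.supercommutative_under[OF pull_obj] .

lemma NN_shom: "thom S B B' h \<Longrightarrow> B \<in> Obj (Alg S) \<Longrightarrow> B' \<in> Obj (Alg S) \<Longrightarrow> shom (NN B) (NN B') (\<lambda>p. h (srt p))"
  using Q.shom_thom[OF thom_pull, of B B' h] by simp

abbreviation op_add :: "bit \<Rightarrow> 's" where
  "op_add p \<equiv> fmap \<tau> (srt p + srt p) (srt p) [cls rat_superring (srt p + srt p) p (Add (Var 0) (Var 1))]"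

abbreviation op_mul :: "bit \<Rightarrow> bit \<Rightarrow> 's" where
  "op_mul p q \<equiv> fmap \<tau> (srt p + srt q) (srt (p + q))
    [cls rat_superring (srt p + srt q) (p + q) (Mul (Var (mi p q)) (Var (1 - mi p q)))]"

lemma NN_sadd: "sadd (NN B) p x y = ev S B (srt p + srt p) p (op_add p) (\<lambda>i. if i = 0 then x else y)"
  and NN_smul: "smul (NN B) p q x y = ev S B (srt p + srt q) (p + q) (op_mul p q) (\<lambda>k. if k = mi p q then x else y)"
  by (simp_all add: under_def tev_def)

lemma op_add_hom[simp]: "op_add p \<in> Hom S (srt p + srt p) (srt p)"
  using Q.wt_binary by (intro \<tau>_hom) (simp add: Q.cls_hom)

lemma op_mul_hom[simp]: "op_mul p q \<in> Hom S (srt p + srt q) (srt (p + q))"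
  using Q.wt_binary by (intro \<tau>_hom) (simp add: Q.cls_hom)

lemma fam_rep_add: "f \<in> Hom S X (srt p) \<Longrightarrow> g \<in> Hom S X (srt p) \<Longrightarrow>
    fam (rep S X) (srt p + srt p) (\<lambda>i. if i = 0 then f else g)"
  by (auto simp: fam_def less_Suc_eq)

lemma fam_rep_mul: "f \<in> Hom S X (srt p) \<Longrightarrow> g \<in> Hom S X (srt q) \<Longrightarrow>
    fam (rep S X) (srt p + srt q) (\<lambda>i. if i = mi p q then f else g)"
  by (auto simp: fam_def dest: less_2_mi)

lemma oadd_eq: "f \<in> Hom S X (srt p) \<Longrightarrow> g \<in> Hom S X (srt p) \<Longrightarrow> oadd S \<tau> X p f g = sadd (NN (rep S X)) p f g"
  by (simp only: NN_sadd tgt.ev_rep fam_rep_add) (simp add: oadd_def Let_def)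

lemma omul_eq: "f \<in> Hom S X (srt p) \<Longrightarrow> g \<in> Hom S X (srt q) \<Longrightarrow> omul S \<tau> X p q f g = smul (NN (rep S X)) p q f g"
  by (simp only: NN_smul tgt.ev_rep fam_rep_mul) (simp add: omul_def Let_def mi_def[symmetric])

text \<open>
  Substitution is a homomorphism of free \<open>S\<close>-algebras, hence of the underlying superalgebras.
\<close>

lemma rep_shom: "h \<in> Hom S W X \<Longrightarrow> shom (NN (rep S X)) (NN (rep S W)) (\<lambda>p g. Comp S W X (srt p) g h)"
  using NN_shom[OF tgt.thom_rep[of "rep S W" h X]] by simp

lemma oneg_hom: "f \<in> Hom S X (srt p) \<Longrightarrow> oneg S \<tau> X p f \<in> Hom S X (srt p)"
  and oneg_add: "f \<in> Hom S X (srt p) \<Longrightarrow> sadd (NN (rep S X)) p (oneg S \<tau> X p f) f = szero (NN (rep S X)) p"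
proof -
  assume f: "f \<in> Hom S X (srt p)"
  have fam: "fam (comp_functor (rep S X) \<tau>) (srt p) (\<lambda>_. f)" using f by (simp add: fam_def)
  have w: "wt rat_superring (srt p) p (Var 0)" using wt_Var[of 0 "srt p"] by simp
  have "tev rat_superring (comp_functor (rep S X) \<tau>) (srt p) p (Neg (Var 0)) (\<lambda>_. f) = oneg S \<tau> X p f"
    using f fam w by (simp add: tev_def tgt.ev_rep oneg_def tgt.tup_srt)
  then show "oneg S \<tau> X p f \<in> Hom S X (srt p)"
    "sadd (NN (rep S X)) p (oneg S \<tau> X p f) f = szero (NN (rep S X)) p"
    using Q.tev_Neg[OF pull_obj fam w] Q.tev_in[OF pull_obj fam wt_Neg[OF w]] fam by auto
qed

abbreviation KK :: "'s superring" where
  "KK \<equiv> ground S \<tau>"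

text \<open>
  The arrow to the terminal object \<open>(0|0)\<close>, along which constants become elements of \<open>S(X)\<close>.
\<close>

definition bang :: "nat \<times> nat \<Rightarrow> 's" where
  "bang X = tup S X (0, 0) (\<lambda>_. undefined)"

lemma bang_hom[simp]: "bang X \<in> Hom S X (0, 0)"
  unfolding bang_def by (rule tgt.tup_hom) simp

lemma bang_eqI: "f \<in> Hom S X (0, 0) \<Longrightarrow> f = bang X"
  by (rule tgt.arrow_eqI) auto

lemma bang_00[simp]: "bang (0, 0) = Ident S (0, 0)"
  using bang_eqI[of "Ident S (0,0)" "(0,0)"] by simp

lemma bang_comp[simp]: "h \<in> Hom S W X \<Longrightarrow> Comp S W X (0, 0) (bang X) h = bang W"
  by (rule bang_eqI) simp

lemma ground_simps:
  "car KK p = Hom S (0, 0) (srt p)" "sadd KK p = oadd S \<tau> (0, 0) p" "smul KK p q = omul S \<tau> (0, 0) p q"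
  by (simp_all add: ground_def)

lemma rep_szero: "szero (NN (rep S X)) p = Comp S X (0, 0) (srt p) (szero KK p) (bang X)"
  and rep_sone: "sone (NN (rep S X)) = Comp S X (0, 0) (srt 0) (sone KK) (bang X)"
  by (simp_all add: under_def tev_def tgt.ev_rep fam_def ground_def bang_def)

lemma szero_KK_hom[simp]: "szero KK p \<in> Hom S (0, 0) (srt p)"
  and sone_KK_hom[simp]: "sone KK \<in> Hom S (0, 0) (srt 0)"
  using Q.szero_car[of p] Q.sone_car by (auto simp: ground_def intro!: \<tau>_hom Q.cls_hom wt_Cst)

lemma closed_KK: "closed_superring KK"
proof
  interpret N: supercommutative "NN (rep S (0,0))" by (rule NN_super) simp
  show "sadd KK p c d \<in> car KK p" if "c \<in> car KK p" "d \<in> car KK p" for p c d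
    using that N.sadd_car[of c p d] by (simp add: ground_simps oadd_eq)
  show "smul KK p q c d \<in> car KK (p + q)" if "c \<in> car KK p" "d \<in> car KK q" for p q c d
    using that N.smul_car[of c p d q] by (simp add: ground_simps omul_eq)
qed (simp_all add: ground_simps)

sublocale K: closed_superring KK
  by (rule closed_KK)

lemma interp_hom[simp]: "wt KK X p t \<Longrightarrow> interp S \<tau> X t \<in> Hom S X (srt p)"
proof (induction rule: wt.induct)
  interpret N: supercommutative "NN (rep S X)" by (rule NN_super) simp
  {
    case (wt_Cst c p) then show ?case by (auto simp: ground_simps bang_def[symmetric])
  next
    case (wt_Add p t u) then show ?case
      using N.sadd_car[of "interp S \<tau> X t" p "interp S \<tau> X u"] by (simp add: wt_tgr oadd_eq)
  next
    case (wt_Neg p t) then show ?case by (simp add: wt_tgr oneg_hom)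
  next
    case (wt_Mul p t q u) then show ?case
      using N.smul_car[of "interp S \<tau> X t" p "interp S \<tau> X u" q] by (simp add: wt_tgr omul_eq)
  }
qed simp

lemma interp_Add: "wt KK X p t \<Longrightarrow> wt KK X p u \<Longrightarrow>
    interp S \<tau> X (Add t u) = sadd (NN (rep S X)) p (interp S \<tau> X t) (interp S \<tau> X u)"
  and interp_Mul: "wt KK X p t \<Longrightarrow> wt KK X q u \<Longrightarrow>
    interp S \<tau> X (Mul t u) = smul (NN (rep S X)) p q (interp S \<tau> X t) (interp S \<tau> X u)"
  and interp_Neg: "wt KK X p t \<Longrightarrow>
    sadd (NN (rep S X)) p (interp S \<tau> X (Neg t)) (interp S \<tau> X t) = szero (NN (rep S X)) p"
  and interp_Cst: "interp S \<tau> X (Cst p c) = Comp S X (0, 0) (srt p) c (bang X)"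
  by (simp_all add: wt_tgr oadd_eq omul_eq oneg_add bang_def)

text \<open>
  The free algebra \<open>S(X)\<close> is supercommutative and constants form a subring of it, so the axioms of
  supercommutative \<open>K\<close>-algebras hold under the interpretation.
\<close>

lemma interp_teq: "teq KK X p t u \<Longrightarrow> interp S \<tau> X t = interp S \<tau> X u"
proof (induction rule: teq.induct)
  interpret N: supercommutative "NN (rep S X)" by (rule NN_super) simp
  note [simp del] = interp.simps
  {
    case (teq_Add p t t' u u')
    then show ?case using K.teq_wt[OF teq_Add(1)] K.teq_wt[OF teq_Add(2)] by (simp add: interp_Add[where p = p])
  next
    case (teq_Neg p t t')
    then show ?case using K.teq_wt[OF teq_Neg(1)] by (simp add: interp.simps wt_tgr[of KK X p])
  next
    case (teq_Mul p t t' q u u')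
    then show ?case using K.teq_wt[OF teq_Mul(1)] K.teq_wt[OF teq_Mul(2)] by (simp add: interp_Mul[of X p _ q])
  next
    case (teq_add_assoc p t u v)
    note w = teq_add_assoc wt_Add[OF teq_add_assoc(1,2)] wt_Add[OF teq_add_assoc(2,3)]
    show ?case
      unfolding interp_Add[OF w(4,3)] interp_Add[OF w(1,2)] interp_Add[OF w(1,5)] interp_Add[OF w(2,3)]
      by (rule N.sadd_assoc) (use w in simp_all)
  next
    case (teq_add_comm p t u)
    show ?case
      unfolding interp_Add[OF teq_add_comm] interp_Add[OF teq_add_comm(2,1)]
      by (rule N.sadd_comm) (use teq_add_comm in simp_all)
  next
    case (teq_add_zero p t)
    show ?case
      unfolding interp_Add[OF wt_Cst[OF K.szero_car] teq_add_zero] interp_Cst rep_szero[symmetric]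
      by (rule N.szero_add) (use teq_add_zero in simp)
  next
    case (teq_add_neg p t)
    show ?case
      unfolding interp_Add[OF wt_Neg[OF teq_add_neg] teq_add_neg] interp_Neg[OF teq_add_neg] interp_Cst rep_szero ..
  next
    case (teq_mul_assoc p t q u r v)
    note w = teq_mul_assoc wt_Mul[OF teq_mul_assoc(1,2)] wt_Mul[OF teq_mul_assoc(2,3)]
    show ?case
      unfolding interp_Mul[OF w(4,3)] interp_Mul[OF w(1,2)] interp_Mul[OF w(1,5)] interp_Mul[OF w(2,3)]
      by (rule N.smul_assoc) (use w in simp_all)
  next
    case (teq_mul_one p t)
    show ?case
      unfolding interp_Mul[OF wt_Cst[OF K.sone_car] teq_mul_one] interp_Cst rep_sone[symmetric]
      by (rule N.sone_mul) (use teq_mul_one in simp)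
  next
    case (teq_mul_add p t q u v)
    note w = teq_mul_add wt_Mul[OF teq_mul_add(1,2)] wt_Mul[OF teq_mul_add(1,3)] wt_Add[OF teq_mul_add(2,3)]
    show ?case
      unfolding interp_Mul[OF w(1,6)] interp_Add[OF w(2,3)] interp_Add[OF w(4,5)] interp_Mul[OF w(1,2)] interp_Mul[OF w(1,3)]
      by (rule N.smul_add) (use w in simp_all)
  next
    case (teq_mul_supercomm p t q u)
    note m = interp_Mul[OF teq_mul_supercomm] interp_Mul[OF teq_mul_supercomm(2,1)]
    show ?case
    proof (cases "p = 1 \<and> q = 1")
      case False
      then have "p = 0 \<or> q = 0" by auto
      then show ?thesis using False m N.smul_comm teq_mul_supercomm by auto
    next
      case True
      have c: "interp S \<tau> X t \<in> car (NN (rep S X)) 1" "interp S \<tau> X u \<in> car (NN (rep S X)) 1"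
        using True teq_mul_supercomm by auto
      have w: "wt KK X 0 (Mul u t)" "wt KK X 0 (Neg (Mul u t))"
        using wt_Mul[OF teq_mul_supercomm(2,1)] True by (auto intro: wt_Neg)
      show ?thesis
        using True m N.smul_anticomm[OF c] interp_Neg[OF w(1)] interp_hom[OF w(1)] interp_hom[OF w(2)]
          N.mul_closed(4)[OF c] N.mul_closed(4)[OF c(2,1)]
          N.add_eq_zeroD[of "smul (NN (rep S X)) 1 1 (interp S \<tau> X t) (interp S \<tau> X u)" 0
             "interp S \<tau> X (Neg (Mul u t))" "smul (NN (rep S X)) 1 1 (interp S \<tau> X u) (interp S \<tau> X t)"]
        by simp
    qed
  next
    case (teq_cst_add c p d)
    then show ?case using rep_shom[OF bang_hom[of X]]
      by (simp add: interp_Add[where p = p] wt_Cst interp_Cst shom_def ground_simps oadd_eq)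
  next
    case (teq_cst_mul c p d q)
    then show ?case using rep_shom[OF bang_hom[of X]] interp_Mul[OF wt_Cst[OF teq_cst_mul(1)] wt_Cst[OF teq_cst_mul(2)], of X]
      by (simp add: interp_Cst shom_def ground_simps omul_eq)
  }
qed auto

lemma interp_subst:
  assumes "wt KK Y q t" and s: "\<And>i. i < len Y \<Longrightarrow> wt KK X (gr Y i) (s i)"
  shows "interp S \<tau> X (subst s t) = Comp S X Y (srt q) (interp S \<tau> Y t) (tup S X Y (\<lambda>i. interp S \<tau> X (s i)))"
  using assms(1)
proof (induction rule: wt.induct)
  interpret NX: supercommutative "NN (rep S X)" by (rule NN_super) simp
  interpret NY: supercommutative "NN (rep S Y)" by (rule NN_super) simp
  let ?h = "tup S X Y (\<lambda>i. interp S \<tau> X (s i))"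
  have h[simp]: "?h \<in> Hom S X Y" using s by simp
  note sh = rep_shom[OF h, unfolded shom_def]
  note [simp del] = interp.simps
  {
    case (wt_Var i)
    then show ?case using s by (simp add: interp.simps)
  next
    case (wt_Cst c p)
    then show ?case by (simp add: interp_Cst ground_simps tgt.assoc[symmetric])
  next
    case (wt_Add p t u)
    then show ?case using sh s by (simp add: interp_Add[where p = p] wt_subst)
  next
    case (wt_Mul p t q u)
    then show ?case using sh s interp_Mul[OF wt_subst[OF wt_Mul(1) s] wt_subst[OF wt_Mul(2) s]] interp_Mul[OF wt_Mul(1,2)] by simp
  next
    case (wt_Neg p t)
    have w: "wt KK X p (subst s t)" using wt_subst[OF wt_Neg(1) s] .
    have i: "interp S \<tau> Y t \<in> Hom S Y (srt p)" "interp S \<tau> Y (Neg t) \<in> Hom S Y (srt p)"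
      using interp_hom[OF wt_Neg(1)] interp_hom[OF wt.wt_Neg[OF wt_Neg(1)]] .
    have "sadd (NN (rep S X)) p (Comp S X Y (srt p) (interp S \<tau> Y (Neg t)) ?h) (Comp S X Y (srt p) (interp S \<tau> Y t) ?h)
      = Comp S X Y (srt p) (sadd (NN (rep S Y)) p (interp S \<tau> Y (Neg t)) (interp S \<tau> Y t)) ?h"
      using sh i by simp
    also have "\<dots> = szero (NN (rep S X)) p"
      using sh interp_Neg[OF wt_Neg(1)] by simp
    finally have z: "sadd (NN (rep S X)) p (Comp S X Y (srt p) (interp S \<tau> Y (Neg t)) ?h) (interp S \<tau> X (subst s t))
      = szero (NN (rep S X)) p" using wt_Neg by simp
    have "interp S \<tau> X (Neg (subst s t)) = Comp S X Y (srt p) (interp S \<tau> Y (Neg t)) ?h"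
      by (rule NX.add_eq_zeroD[OF _ _ _ interp_Neg[OF w] z])
        (use i w wt.wt_Neg[OF w] in \<open>simp_all del: subst.simps\<close>)
    then show ?case by simp
  }
qed

abbreviation \<sigma> :: "(nat \<times> nat, 's trm set list, nat \<times> nat, 's) fnctr" where
  "\<sigma> \<equiv> structure_map S \<tau>"

text \<open>
  By \<open>interp_teq\<close> the interpretation of a class of terms does not depend on the representative.
\<close>

lemma \<sigma>_arr:
  assumes "K.wts X Y t"
  shows "fmap \<sigma> X Y (K.arr X Y t) = tup S X Y (\<lambda>i. interp S \<tau> X (t i))"
proof -
  have "the_elem (interp S \<tau> X ` (K.arr X Y t ! i)) = interp S \<tau> X (t i)" if "i < len Y" for i
  proof -
    have "interp S \<tau> X u = interp S \<tau> X (t i)" if "u \<in> cls KK X (gr Y i) (t i)" for u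
      using interp_teq[of X "gr Y i" "t i" u] that by (simp add: cls_def)
    moreover have "t i \<in> cls KK X (gr Y i) (t i)"
      using K.in_cls[of X "gr Y i" "t i"] assms that by (simp add: K.wts_def)
    ultimately have "interp S \<tau> X ` cls KK X (gr Y i) (t i) = {interp S \<tau> X (t i)}" by blast
    then show ?thesis using that by (simp add: K.arr_def)
  qed
  then show ?thesis unfolding structure_map_def by (auto intro: tgt.tup_cong)
qed

lemma \<sigma>_single: "wt KK X p t \<Longrightarrow> fmap \<sigma> X (srt p) [cls KK X p t] = interp S \<tau> X t"
  unfolding K.single_arr by (subst \<sigma>_arr) (auto simp: K.wts_srt tgt.tup_srt)

lemma theory_morphism_\<sigma>: "theory_morphism (SCom KK) S \<sigma>"
proof -
  have "cat_functor (SCom KK) S \<sigma>"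
  proof
    fix X Y Z f g
    show "fob \<sigma> X \<in> Obj S" by simp
    have fo: "fob \<sigma> X = X" for X by (simp add: structure_map_def)
    { assume "f \<in> Hom (SCom KK) X Y"
      then obtain t where "K.wts X Y t" "f = K.arr X Y t" unfolding K.SCom_Hom by blast
      then show "fmap \<sigma> X Y f \<in> Hom S (fob \<sigma> X) (fob \<sigma> Y)"
        by (auto simp: \<sigma>_arr fo K.wts_def) }
    { assume "f \<in> Hom (SCom KK) X Y" "g \<in> Hom (SCom KK) Y Z"
      then obtain t u where t: "K.wts X Y t" "f = K.arr X Y t" and u: "K.wts Y Z u" "g = K.arr Y Z u"
        unfolding K.SCom_Hom by blast
      have "Comp S X Y Z (tup S Y Z (\<lambda>i. interp S \<tau> Y (u i))) (tup S X Y (\<lambda>i. interp S \<tau> X (t i)))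
        = tup S X Z (\<lambda>i. Comp S X Y (srt (gr Z i)) (interp S \<tau> Y (u i)) (tup S X Y (\<lambda>i. interp S \<tau> X (t i))))"
        using t u by (intro tgt.tup_precomp) (auto simp: K.wts_def)
      also have "\<dots> = tup S X Z (\<lambda>i. interp S \<tau> X (subst t (u i)))"
        using t u by (intro tgt.tup_cong interp_subst[symmetric]) (simp_all add: K.wts_def)
      finally show "fmap \<sigma> X Z (Comp (SCom KK) X Y Z g f) = Comp S (fob \<sigma> X) (fob \<sigma> Y) (fob \<sigma> Z) (fmap \<sigma> Y Z g) (fmap \<sigma> X Y f)"
        using t u by (simp add: fo K.comp_arr \<sigma>_arr K.wts_subst) }
    show "fmap \<sigma> X X (Ident (SCom KK) X) = Ident S (fob \<sigma> X)"
      using K.wts_Var by (simp add: fo K.Ident_SCom \<sigma>_arr)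
  qed
  then interpret F: cat_functor "SCom KK" S \<sigma> .
  show ?thesis
    by unfold_locales (auto simp: structure_map_def[of S \<tau>] K.proj_SCom \<sigma>_single[unfolded structure_map_def, simplified] wt_Var)
qed

sublocale M: theory_morphism "SCom KK" S \<sigma>
  by (rule theory_morphism_\<sigma>)

text \<open>
  The \<open>K\<close>-algebra underlying an \<open>S\<close>-algebra has the sums and products of the underlying rational
  superalgebra.
\<close>

lemma under_\<sigma>: "under KK (comp_functor B \<sigma>) = NN B"
proof -
  have a: "fmap \<sigma> (srt p + srt p) (srt p) [cls KK (srt p + srt p) p (Add (Var 0) (Var 1))] = op_add p" for p
  proof -
    let ?D = "srt p + srt p"
    have w: "wt KK ?D p (Var 0)" "wt KK ?D p (Var 1)"
      using wt_Var[of 0 ?D KK] wt_Var[of 1 ?D KK] by simp_all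
    have "tup S ?D ?D (\<lambda>i. if i = 0 then proj S ?D 0 else proj S ?D (Suc 0)) = Ident S ?D"
      unfolding tgt.tup_ident[symmetric] by (rule tgt.tup_cong) (auto simp: less_Suc_eq)
    then show ?thesis
      using w fam_rep_add[of "proj S ?D 0" ?D p "proj S ?D (Suc 0)"] tgt.proj_hom[of 0 ?D] tgt.proj_hom[of 1 ?D] op_add_hom[of p]
      by (subst \<sigma>_single[OF wt_Add[OF w]]) (simp add: oadd_eq NN_sadd tgt.ev_rep del: op_add_hom)
  qed
  have m: "fmap \<sigma> (srt p + srt q) (srt (p + q)) [cls KK (srt p + srt q) (p + q) (Mul (Var (mi p q)) (Var (Suc 0 - mi p q)))] = op_mul p q" for p q
  proof -
    let ?D = "srt p + srt q" and ?i = "mi p q"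
    have w: "wt KK ?D p (Var ?i)" "wt KK ?D q (Var (Suc 0 - ?i))"
      using wt_Var[of ?i ?D KK] wt_Var[of "Suc 0 - ?i" ?D KK] by simp_all
    have "tup S ?D ?D (\<lambda>i. if i = ?i then proj S ?D ?i else proj S ?D (Suc 0 - ?i)) = Ident S ?D"
      unfolding tgt.tup_ident[symmetric] by (rule tgt.tup_cong) (auto dest: less_2_mi)
    then show ?thesis
      using w fam_rep_mul[of "proj S ?D ?i" ?D p "proj S ?D (Suc 0 - ?i)" q] tgt.proj_hom[of ?i ?D] tgt.proj_hom[of "Suc 0 - ?i" ?D] op_mul_hom[of p q]
      by (subst \<sigma>_single[OF wt_Mul[OF w]]) (simp add: omul_eq NN_smul tgt.ev_rep del: op_mul_hom)
  qed
  have z: "fmap \<sigma> (0, 0) (srt p) [cls KK (0, 0) p (Cst p (szero KK p))] = fmap \<tau> (0, 0) (srt p) [cls rat_superring (0, 0) p (Cst p 0)]" for p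
    unfolding \<sigma>_single[OF wt_Cst[OF K.szero_car[of p]], of "(0,0)"] interp_Cst bang_00 tgt.comp_id_right[OF szero_KK_hom]
    by (simp add: ground_def)
  have o: "fmap \<sigma> (0, 0) (srt 0) [cls KK (0, 0) 0 (Cst 0 (sone KK))] = fmap \<tau> (0, 0) (srt 0) [cls rat_superring (0, 0) 0 (Cst 0 1)]"
    unfolding \<sigma>_single[OF wt_Cst[OF K.sone_car], of "(0,0)"] interp_Cst bang_00 tgt.comp_id_right[OF sone_KK_hom]
    by (simp add: ground_def)
  show ?thesis
    unfolding under_def tev_def by (simp add: a[unfolded One_nat_def] m[unfolded One_nat_def] z o)
qed

end

section \<open>Ring-theoretic preliminaries\<close>

lemma (in ring) minus_eq_iff:
  "a \<in> carrier R \<Longrightarrow> b \<in> carrier R \<Longrightarrow> c \<in> carrier R \<Longrightarrow> a \<ominus> b = c \<longleftrightarrow> a = b \<oplus> c"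
  using a_lcomm[of b a "\<ominus> b"] by (auto simp: minus_eq a_comm[of b c] a_assoc r_neg l_neg)

lemma (in ring) minus_self: "a \<in> carrier R \<Longrightarrow> a \<ominus> a = \<zero>"
  by (simp add: minus_eq r_neg)

lemma (in ring) minus_zero_iff: "a \<in> carrier R \<Longrightarrow> b \<in> carrier R \<Longrightarrow> a \<ominus> b = \<zero> \<longleftrightarrow> a = b"
  by (simp add: minus_eq_iff)

lemma (in ring) minus_r_distr: "x \<in> carrier R \<Longrightarrow> y \<in> carrier R \<Longrightarrow> z \<in> carrier R \<Longrightarrow>
    z \<otimes> (x \<ominus> y) = z \<otimes> x \<ominus> z \<otimes> y"
  by (simp add: minus_eq r_distr r_minus)

lemma ring_hom_zero':
  assumes "ring R" "ring S" "h \<in> ring_hom R S"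
  shows "h \<zero>\<^bsub>R\<^esub> = \<zero>\<^bsub>S\<^esub>"
proof -
  interpret R: ring R by fact
  interpret S: ring S by fact
  have "h \<zero>\<^bsub>R\<^esub> \<oplus>\<^bsub>S\<^esub> h \<zero>\<^bsub>R\<^esub> = h \<zero>\<^bsub>R\<^esub>" using ring_hom_add[OF assms(3), of "\<zero>\<^bsub>R\<^esub>" "\<zero>\<^bsub>R\<^esub>"] by simp
  then show ?thesis using ring_hom_closed[OF assms(3) R.zero_closed] by (simp add: S.add.l_cancel_one)
qed

lemma ring_hom_a_inv':
  assumes "ring R" "ring S" "h \<in> ring_hom R S" "x \<in> carrier R"
  shows "h (\<ominus>\<^bsub>R\<^esub> x) = \<ominus>\<^bsub>S\<^esub> h x"
proof -
  interpret R: ring R by fact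
  interpret S: ring S by fact
  have "h (\<ominus>\<^bsub>R\<^esub> x) \<oplus>\<^bsub>S\<^esub> h x = \<zero>\<^bsub>S\<^esub>"
    using ring_hom_add[OF assms(3), of "\<ominus>\<^bsub>R\<^esub> x" x] assms ring_hom_zero'[OF assms(1-3)] by (simp add: R.l_neg)
  then show ?thesis using ring_hom_closed[OF assms(3)] assms(4)
    by (intro S.minus_equality[symmetric]) auto
qed

lemma ring_hom_minus':
  assumes "ring R" "ring S" "h \<in> ring_hom R S" "x \<in> carrier R" "y \<in> carrier R"
  shows "h (x \<ominus>\<^bsub>R\<^esub> y) = h x \<ominus>\<^bsub>S\<^esub> h y"
proof -
  interpret R: ring R by fact
  interpret S: ring S by fact
  show ?thesis using assms ring_hom_closed[OF assms(3)]
    by (simp add: R.minus_eq S.minus_eq ring_hom_a_inv' ring_hom_add[OF assms(3)])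
qed

lemma ring_hom_finsum':
  assumes "ring R" "ring S" "h \<in> ring_hom R S" "finite A" "\<And>i. i \<in> A \<Longrightarrow> f i \<in> carrier R"
  shows "h (\<Oplus>\<^bsub>R\<^esub>i\<in>A. f i) = (\<Oplus>\<^bsub>S\<^esub>i\<in>A. h (f i))"
proof -
  interpret R: ring R by fact
  interpret S: ring S by fact
  show ?thesis using assms(4,5)
  proof (induction A rule: finite_induct)
    case empty then show ?case using ring_hom_zero'[OF assms(1-3)] by simp
  next
    case (insert a A)
    have "f \<in> A \<rightarrow> carrier R" "(\<lambda>i. h (f i)) \<in> A \<rightarrow> carrier S" "h (f a) \<in> carrier S"
      using insert ring_hom_closed[OF assms(3)] by auto
    then show ?case using insert
      by (simp add: R.finsum_insert S.finsum_insert ring_hom_add[OF assms(3)] R.finsum_closed)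
  qed
qed

context supercommutative
begin

abbreviation RN where "RN \<equiv> tot N"

text \<open>
  Homogeneous elements of parity \<open>p\<close>.
\<close>

definition hmg :: "bit \<Rightarrow> 'v \<times> 'v \<Rightarrow> bool" where
  "hmg p z \<longleftrightarrow> z \<in> carrier RN \<and> inc N p (cmp p z) = z"

lemma hmg_iff: "hmg p z \<longleftrightarrow> (\<exists>x\<in>car N p. z = inc N p x)"
  unfolding hmg_def using inc_carrier cmp_car cmp_inc by metis

lemma hmg_inc[simp]: "x \<in> car N p \<Longrightarrow> hmg p (inc N p x)"
  unfolding hmg_iff by blast

lemma hmg_carrier: "hmg p z \<Longrightarrow> z \<in> carrier RN"
  by (simp add: hmg_def)

lemma hmg_cmp: "hmg p z \<Longrightarrow> inc N p (cmp p z) = z"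
  by (simp add: hmg_def)

lemma hmg_add: "hmg p x \<Longrightarrow> hmg p y \<Longrightarrow> hmg p (x \<oplus>\<^bsub>RN\<^esub> y)"
  unfolding hmg_iff using inc_sadd sadd_car by metis

lemma hmg_zero: "hmg p \<zero>\<^bsub>RN\<^esub>"
  unfolding hmg_iff using inc_szero szero_car by metis

lemma hmg_neg: assumes "hmg p x" shows "hmg p (\<ominus>\<^bsub>RN\<^esub> x)"
proof -
  obtain a where a: "a \<in> car N p" "x = inc N p a" using assms hmg_iff by blast
  obtain b where b: "b \<in> car N p" "sadd N p b a = szero N p" using sneg_ex[OF a(1)] by blast
  have "inc N p b \<oplus>\<^bsub>RN\<^esub> x = \<zero>\<^bsub>RN\<^esub>" using a b by (simp flip: inc_sadd)
  then have "\<ominus>\<^bsub>RN\<^esub> x = inc N p b" using a b by (intro R.minus_equality) auto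
  then show ?thesis using b by simp
qed

lemma hmg_minus: "hmg p x \<Longrightarrow> hmg p y \<Longrightarrow> hmg p (x \<ominus>\<^bsub>RN\<^esub> y)"
  by (simp add: R.minus_eq hmg_add hmg_neg)

lemma hmg_mult: "hmg p x \<Longrightarrow> hmg q y \<Longrightarrow> r = p + q \<Longrightarrow> hmg r (x \<otimes>\<^bsub>RN\<^esub> y)"
  unfolding hmg_iff using inc_smul smul_car by metis

lemma hmg_finsum: "finite A \<Longrightarrow> (\<And>i. i \<in> A \<Longrightarrow> hmg p (f i)) \<Longrightarrow> hmg p (\<Oplus>\<^bsub>RN\<^esub>i\<in>A. f i)"
proof (induction A rule: finite_induct)
  case empty then show ?case by (simp add: hmg_zero)
next
  case (insert a A)
  have "f i \<in> carrier RN" if "i \<in> insert a A" for i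
    using hmg_carrier[OF insert(4)[OF that]] .
  then have "f \<in> A \<rightarrow> carrier RN" "f a \<in> carrier RN" by auto
  then show ?case using insert by (simp add: R.finsum_insert hmg_add)
qed

definition ssub :: "bit \<Rightarrow> 'v \<Rightarrow> 'v \<Rightarrow> 'v" where
  "ssub p x y = cmp p (inc N p x \<ominus>\<^bsub>RN\<^esub> inc N p y)"

lemma ssub_car[simp]: "x \<in> car N p \<Longrightarrow> y \<in> car N p \<Longrightarrow> ssub p x y \<in> car N p"
  and inc_ssub: "x \<in> car N p \<Longrightarrow> y \<in> car N p \<Longrightarrow> inc N p (ssub p x y) = inc N p x \<ominus>\<^bsub>RN\<^esub> inc N p y"
  using hmg_minus[of p "inc N p x" "inc N p y"] by (simp_all add: ssub_def hmg_cmp)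

lemma sadd_ssub: "x \<in> car N p \<Longrightarrow> y \<in> car N p \<Longrightarrow> sadd N p y (ssub p x y) = x"
  using inc_sadd[of y p "ssub p x y"] R.minus_eq_iff[of "inc N p x" "inc N p y" "inc N p (ssub p x y)"] inc_ssub[of x p y]
  by simp

text \<open>
  Supercommutativity makes the left ideal and the right ideal of a homogeneous element coincide.
\<close>

lemma commute_past:
  assumes "e \<in> car N p" "r \<in> carrier RN"
  shows "\<exists>r'\<in>carrier RN. r \<otimes>\<^bsub>RN\<^esub> inc N p e = inc N p e \<otimes>\<^bsub>RN\<^esub> r'"
proof -
  let ?e = "inc N p e"
  have 1: "\<exists>z\<in>carrier RN. inc N q x \<otimes>\<^bsub>RN\<^esub> ?e = ?e \<otimes>\<^bsub>RN\<^esub> z" if "x \<in> car N q" for q x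
  proof (cases "p = 1 \<and> q = 1")
    case True
    then show ?thesis using inc_anticomm[of x e] assms that
      by (intro bexI[of _ "\<ominus>\<^bsub>RN\<^esub> inc N q x"]) (auto simp: R.r_minus)
  next
    case False
    then have "q = 0 \<or> p = 0" by auto
    then show ?thesis using inc_comm[OF that assms(1)] that by (intro bexI[of _ "inc N q x"]) auto
  qed
  obtain z0 z1 where z: "z0 \<in> carrier RN" "z1 \<in> carrier RN"
    "inc N 0 (cmp 0 r) \<otimes>\<^bsub>RN\<^esub> ?e = ?e \<otimes>\<^bsub>RN\<^esub> z0" "inc N 1 (cmp 1 r) \<otimes>\<^bsub>RN\<^esub> ?e = ?e \<otimes>\<^bsub>RN\<^esub> z1"
    using 1[of "cmp 0 r" 0] 1[of "cmp 1 r" 1] assms by auto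
  have "r \<otimes>\<^bsub>RN\<^esub> ?e = (inc N 0 (cmp 0 r) \<oplus>\<^bsub>RN\<^esub> inc N 1 (cmp 1 r)) \<otimes>\<^bsub>RN\<^esub> ?e"
    using inc_decomp[OF assms(2)] by simp
  also have "\<dots> = ?e \<otimes>\<^bsub>RN\<^esub> (z0 \<oplus>\<^bsub>RN\<^esub> z1)" using z assms by (simp add: R.l_distr R.r_distr)
  finally show ?thesis using z by blast
qed

text \<open>
  Anticommutativity gives \<open>2x\<^sup>2 = 0\<close>, and \<open>2\<close> is invertible.
\<close>

lemma odd_square_zero:
  assumes half: "h \<in> car N 0" "sadd N 0 h h = sone N" and x: "x \<in> car N 1"
  shows "inc N 1 x \<otimes>\<^bsub>RN\<^esub> inc N 1 x = \<zero>\<^bsub>RN\<^esub>"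
proof -
  let ?z = "inc N 1 x \<otimes>\<^bsub>RN\<^esub> inc N 1 x"
  have z: "?z \<in> carrier RN" using x by simp
  have "?z = \<ominus>\<^bsub>RN\<^esub> ?z" using inc_anticomm[OF x x] .
  then have "?z \<oplus>\<^bsub>RN\<^esub> ?z = \<zero>\<^bsub>RN\<^esub>" using z by (metis R.r_neg)
  moreover have "inc N 0 h \<oplus>\<^bsub>RN\<^esub> inc N 0 h = \<one>\<^bsub>RN\<^esub>" using half inc_sadd[of h 0 h] by simp
  then have "?z = inc N 0 h \<otimes>\<^bsub>RN\<^esub> (?z \<oplus>\<^bsub>RN\<^esub> ?z)"
    using z half R.l_one[OF z] by (metis R.l_distr R.r_distr inc_carrier)
  ultimately show ?thesis using half by simp
qed

end

section \<open>Difference quotients\<close>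

context super_fermat_theory
begin

abbreviation RR :: "('s, 'v) alg \<Rightarrow> ('v \<times> 'v) ring" where "RR B \<equiv> tot (NN B)"
abbreviation io :: "('s, 'v) alg \<Rightarrow> bit \<Rightarrow> 'v \<Rightarrow> 'v \<times> 'v" where "io B \<equiv> inc (NN B)"

lemma io_carrier[simp]: "B \<in> Obj (Alg S) \<Longrightarrow> x \<in> fob B (srt p) \<Longrightarrow> io B p x \<in> carrier (RR B)"
  using supercommutative.inc_carrier[OF NN_super, of B x p] by simp

lemma NN_half:
  assumes B: "B \<in> Obj (Alg S)"
  shows "\<exists>h\<in>fob B (srt 0). sadd (NN B) 0 h h = sone (NN B)"
proof -
  let ?B = "comp_functor B \<tau>" and ?c = "Cst 0 (1/2 :: rat)"
  have c: "(1/2 :: rat) \<in> car rat_superring 0" by (simp add: rat_superring_def)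
  have w: "wt rat_superring (0,0) 0 ?c" using c by (rule wt_Cst)
  have "teq rat_superring (0,0) 0 (Add ?c ?c) (Cst 0 (sadd rat_superring 0 (1/2) (1/2)))" using c c by (rule teq_cst_add)
  also have "sadd rat_superring 0 (1/2) (1/2) = (1 :: rat)" by (simp add: rat_superring_def)
  finally have "tev rat_superring ?B (0,0) 0 (Add ?c ?c) (\<lambda>_. undefined) = tev rat_superring ?B (0,0) 0 (Cst 0 1) (\<lambda>_. undefined)"
    by (rule Q.tev_eq)
  then have "sadd (NN B) 0 (tev rat_superring ?B (0,0) 0 ?c (\<lambda>_. undefined)) (tev rat_superring ?B (0,0) 0 ?c (\<lambda>_. undefined)) = sone (NN B)"
    using Q.tev_Add[OF pull_obj[OF B] _ w w, of "\<lambda>_. undefined"] by (simp add: under_def fam_def)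
  moreover have "tev rat_superring ?B (0,0) 0 ?c (\<lambda>_. undefined) \<in> fob B (srt 0)"
    using Q.tev_in[OF pull_obj[OF B] _ w, of "\<lambda>_. undefined"] by (simp add: fam_def)
  ultimately show ?thesis by blast
qed

text \<open>Evaluation of the elements of a free algebra, extended to the total rings.\<close>

definition evr :: "('s, 'v) alg \<Rightarrow> nat \<times> nat \<Rightarrow> (nat \<Rightarrow> 'v) \<Rightarrow> 's \<times> 's \<Rightarrow> 'v \<times> 'v" where
  "evr B X a = totmap (\<lambda>p g. ev S B X p g a)"

lemma ring_RR[simp]: "B \<in> Obj (Alg S) \<Longrightarrow> ring (RR B)"
  using supercommutative.ring_tot[OF NN_super] .

lemma ev_shom: "B \<in> Obj (Alg S) \<Longrightarrow> fam B X a \<Longrightarrow> shom (NN (rep S X)) (NN B) (\<lambda>p g. ev S B X p g a)"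
  using NN_shom[OF tgt.thom_rep[of B "mk S B X a" X]] by (simp add: ev_def)

lemma evr_hom: "B \<in> Obj (Alg S) \<Longrightarrow> fam B X a \<Longrightarrow> evr B X a \<in> ring_hom (RR (rep S X)) (RR B)"
  unfolding evr_def by (intro totmap_ring_hom NN_super ev_shom) simp_all

lemma evr_io: "B \<in> Obj (Alg S) \<Longrightarrow> fam B X a \<Longrightarrow> evr B X a (io (rep S X) p g) = io B p (ev S B X p g a)"
  unfolding evr_def by (rule totmap_inc[OF ev_shom])

lemma ev_szero: "B \<in> Obj (Alg S) \<Longrightarrow> fam B X a \<Longrightarrow> ev S B X p (szero (NN (rep S X)) p) a = szero (NN B) p"
  and ev_sone: "B \<in> Obj (Alg S) \<Longrightarrow> fam B X a \<Longrightarrow> ev S B X 0 (sone (NN (rep S X))) a = sone (NN B)"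
  and ev_sadd: "B \<in> Obj (Alg S) \<Longrightarrow> fam B X a \<Longrightarrow> f \<in> Hom S X (srt p) \<Longrightarrow> g \<in> Hom S X (srt p) \<Longrightarrow>
    ev S B X p (sadd (NN (rep S X)) p f g) a = sadd (NN B) p (ev S B X p f a) (ev S B X p g a)"
  and ev_smul: "B \<in> Obj (Alg S) \<Longrightarrow> fam B X a \<Longrightarrow> f \<in> Hom S X (srt p) \<Longrightarrow> g \<in> Hom S X (srt q) \<Longrightarrow>
    ev S B X (p + q) (smul (NN (rep S X)) p q f g) a = smul (NN B) p q (ev S B X p f a) (ev S B X q g a)"
  using ev_shom[of B X a] by (simp_all add: shom_def)

lemma szero_in[simp]: "B \<in> Obj (Alg S) \<Longrightarrow> szero (NN B) p \<in> fob B (srt p)"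
  using supercommutative.axioms(1)[OF NN_super] closed_superring.szero_car by fastforce

lemma szero_hom[simp]: "szero (NN (rep S X)) p \<in> Hom S X (srt p)"
  using szero_in[of "rep S X" p] by simp

lemma sone_in[simp]: "B \<in> Obj (Alg S) \<Longrightarrow> sone (NN B) \<in> fob B (srt 0)"
  using supercommutative.axioms(1)[OF NN_super] closed_superring.sone_car by fastforce

lemma sone_hom[simp]: "sone (NN (rep S X)) \<in> Hom S X (srt 0)"
  using sone_in[of "rep S X"] by simp

lemma sadd_in[simp]: "B \<in> Obj (Alg S) \<Longrightarrow> x \<in> fob B (srt p) \<Longrightarrow> y \<in> fob B (srt p) \<Longrightarrow> sadd (NN B) p x y \<in> fob B (srt p)"
  using closed_superring.sadd_car[OF supercommutative.axioms(1)[OF NN_super], of B x p y] by simp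

lemma sadd_hom[simp]: "x \<in> Hom S X (srt p) \<Longrightarrow> y \<in> Hom S X (srt p) \<Longrightarrow> sadd (NN (rep S X)) p x y \<in> Hom S X (srt p)"
  using sadd_in[of "rep S X" x p y] by simp

lemma io_osub:
  assumes "f \<in> Hom S X (srt p)" "g \<in> Hom S X (srt p)"
  shows "osub S \<tau> X p f g \<in> Hom S X (srt p)"
    "io (rep S X) p (osub S \<tau> X p f g) = io (rep S X) p f \<ominus>\<^bsub>RR (rep S X)\<^esub> io (rep S X) p g"
proof -
  interpret N: supercommutative "NN (rep S X)" by (rule NN_super) simp
  have g: "oneg S \<tau> X p g \<in> Hom S X (srt p)" using assms oneg_hom by simp
  show "osub S \<tau> X p f g \<in> Hom S X (srt p)" using assms g by (simp add: osub_def oadd_eq)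
  have "io (rep S X) p (oneg S \<tau> X p g) \<oplus>\<^bsub>RR (rep S X)\<^esub> io (rep S X) p g = \<zero>\<^bsub>RR (rep S X)\<^esub>"
    using oneg_add[OF assms(2)] N.inc_sadd[of "oneg S \<tau> X p g" p g] assms g by simp
  then have "\<ominus>\<^bsub>RR (rep S X)\<^esub> io (rep S X) p g = io (rep S X) p (oneg S \<tau> X p g)"
    using assms g by (intro N.R.minus_equality) auto
  then show "io (rep S X) p (osub S \<tau> X p f g) = io (rep S X) p f \<ominus>\<^bsub>RR (rep S X)\<^esub> io (rep S X) p g"
    using assms g by (simp add: osub_def oadd_eq N.R.minus_eq N.inc_sadd)
qed

lemma io_omul:
  assumes "f \<in> Hom S X (srt p)" "g \<in> Hom S X (srt q)"
  shows "omul S \<tau> X p q f g \<in> Hom S X (srt (p + q))"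
    "io (rep S X) (p + q) (omul S \<tau> X p q f g) = io (rep S X) p f \<otimes>\<^bsub>RR (rep S X)\<^esub> io (rep S X) q g"
proof -
  interpret N: supercommutative "NN (rep S X)" by (rule NN_super) simp
  show "omul S \<tau> X p q f g \<in> Hom S X (srt (p + q))" using assms N.smul_car[of f p g q] by (simp add: omul_eq)
  show "io (rep S X) (p + q) (omul S \<tau> X p q f g) = io (rep S X) p f \<otimes>\<^bsub>RR (rep S X)\<^esub> io (rep S X) q g"
    using assms N.inc_smul[of f p g q] by (simp add: omul_eq)
qed

lemma io_eq_iff: "io B p x = io B p y \<longleftrightarrow> x = y"
  by (auto simp: inc_def)

text \<open>
  Fresh variables of parity \<open>p\<close> stand at the positions \<open>off p X\<close> and \<open>off p X + 1\<close> of
  \<open>X + srt p + srt p\<close>; the maps \<open>keep1\<close> and \<open>keep2\<close> embed the coordinates of \<open>X + srt p\<close>, using the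
  first or the second fresh variable, and \<open>emb\<close> embeds the coordinates of \<open>X\<close>.
\<close>

definition off :: "bit \<Rightarrow> nat \<times> nat \<Rightarrow> nat" where "off p X = (if p = 0 then 0 else fst X)"
definition keep1 :: "bit \<Rightarrow> nat \<times> nat \<Rightarrow> nat \<Rightarrow> nat" where "keep1 p X i = (if i \<le> off p X then i else i + 1)"
definition keep2 :: "bit \<Rightarrow> nat \<times> nat \<Rightarrow> nat \<Rightarrow> nat" where "keep2 p X i = (if i < off p X then i else i + 1)"
definition emb :: "bit \<Rightarrow> nat \<times> nat \<Rightarrow> nat \<Rightarrow> nat" where "emb p X i = (if i < off p X then i else i + 2)"

abbreviation X1 :: "bit \<Rightarrow> nat \<times> nat \<Rightarrow> nat \<times> nat" where "X1 p X \<equiv> X + srt p"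
abbreviation X2 :: "bit \<Rightarrow> nat \<times> nat \<Rightarrow> nat \<times> nat" where "X2 p X \<equiv> X + srt p + srt p"

lemma fresh_off[simp]:
  "off p X < len (X1 p X)" "gr (X1 p X) (off p X) = p"
  "off p X < len (X2 p X)" "gr (X2 p X) (off p X) = p"
  "Suc (off p X) < len (X2 p X)" "gr (X2 p X) (Suc (off p X)) = p"
  "keep1 p X (off p X) = off p X" "keep2 p X (off p X) = Suc (off p X)"
  "keep1 p X (keep2 p X i) = emb p X i" "keep2 p X (keep2 p X i) = emb p X i"
  "keep2 p X i \<noteq> off p X" "emb p X i \<noteq> off p X" "emb p X i \<noteq> Suc (off p X)"
  using bit_cases[of p]
  by (auto simp: off_def keep1_def keep2_def emb_def len_def gr_def srt_def)

lemma emb_ix: "i < len X \<Longrightarrow> emb p X i < len (X2 p X) \<and> gr (X2 p X) (emb p X i) = gr X i"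
  and keep_ix: "i < len X \<Longrightarrow> keep2 p X i < len (X1 p X) \<and> gr (X1 p X) (keep2 p X i) = gr X i"
  and keep1_ix: "i < len (X1 p X) \<Longrightarrow> keep1 p X i < len (X2 p X) \<and> gr (X2 p X) (keep1 p X i) = gr (X1 p X) i"
  and keep2_ix: "i < len (X1 p X) \<Longrightarrow> keep2 p X i < len (X2 p X) \<and> gr (X2 p X) (keep2 p X i) = gr (X1 p X) i"
  using bit_cases[of p]
  by (auto simp: off_def keep1_def keep2_def emb_def len_def gr_def srt_def)

lemma fam_reindex:
  assumes "fam B Y c" "\<And>i. i < len X \<Longrightarrow> k i < len Y \<and> gr Y (k i) = gr X i"
  shows "fam B X (\<lambda>i. c (k i))"
  using assms by (metis fam_def)

lemma proj_reindex:
  assumes "\<And>i. i < len X \<Longrightarrow> k i < len Y \<and> gr Y (k i) = gr X i"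
  shows "i < len X \<Longrightarrow> proj S Y (k i) \<in> Hom S Y (srt (gr X i))"
  using assms tgt.proj_hom by metis

lemma ev_reindex:
  assumes B: "B \<in> Obj (Alg S)" "fam B Y c" "f \<in> Hom S X (srt p)"
    and k: "\<And>i. i < len X \<Longrightarrow> k i < len Y \<and> gr Y (k i) = gr X i"
  shows "ev S B Y p (Comp S Y X (srt p) f (tup S Y X (\<lambda>i. proj S Y (k i)))) c = ev S B X p f (\<lambda>i. c (k i))"
proof -
  have "ev S B Y p (Comp S Y X (srt p) f (tup S Y X (\<lambda>i. proj S Y (k i)))) c
    = ev S B X p f (\<lambda>i. ev S B Y (gr X i) (proj S Y (k i)) c)"
    using proj_reindex[OF k] by (intro tgt.ev_comp_tup B) auto
  also have "\<dots> = ev S B X p f (\<lambda>i. c (k i))"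
    using k B by (intro tgt.ev_cong) auto
  finally show ?thesis .
qed

abbreviation reix :: "nat \<times> nat \<Rightarrow> nat \<times> nat \<Rightarrow> bit \<Rightarrow> (nat \<Rightarrow> nat) \<Rightarrow> 's \<Rightarrow> 's" where
  "reix Y X p k f \<equiv> Comp S Y X (srt p) f (tup S Y X (\<lambda>i. proj S Y (k i)))"

lemma fermat_even_X:
  assumes "f \<in> Hom S (X1 0 X) (srt s)"
  shows "\<exists>!g. g \<in> Hom S (X2 0 X) (srt s) \<and>
    osub S \<tau> (X2 0 X) s (reix (X2 0 X) (X1 0 X) s (keep1 0 X) f) (reix (X2 0 X) (X1 0 X) s (keep2 0 X) f)
    = omul S \<tau> (X2 0 X) 0 s (osub S \<tau> (X2 0 X) 0 (proj S (X2 0 X) (off 0 X)) (proj S (X2 0 X) (Suc (off 0 X)))) g"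
proof -
  obtain m n where X: "X = (m, n)" by force
  have X1: "X1 0 X = (1 + m, n)" and X2: "X2 0 X = (2 + m, n)" by (simp_all add: X srt_def)
  have k: "keep1 0 X = (\<lambda>i. if i = 0 then 0 else i + 1)" "keep2 0 X = (\<lambda>i. i + 1)" "off 0 X = 0"
    by (auto simp: keep1_def keep2_def off_def fun_eq_iff)
  show ?thesis using fermat_even[of f m n s] assms unfolding X2 unfolding X1 k Let_def by simp
qed

lemma fermat_odd_X:
  assumes "f \<in> Hom S (X1 1 X) (srt s)"
  shows "\<exists>!h. h \<in> Hom S X (srt (s + 1)) \<and>
    osub S \<tau> (X2 1 X) s (reix (X2 1 X) (X1 1 X) s (keep1 1 X) f) (reix (X2 1 X) (X1 1 X) s (keep2 1 X) f)
    = omul S \<tau> (X2 1 X) 1 (s + 1) (osub S \<tau> (X2 1 X) 1 (proj S (X2 1 X) (off 1 X)) (proj S (X2 1 X) (Suc (off 1 X))))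
        (reix (X2 1 X) X (s + 1) (emb 1 X) h)"
proof -
  obtain m n where X: "X = (m, n)" by force
  have X1: "X1 1 X = (m, 1 + n)" and X2: "X2 1 X = (m, 2 + n)" by (simp_all add: X srt_def)
  have k: "keep1 1 X = (\<lambda>i. if i \<le> m then i else i + 1)" "keep2 1 X = (\<lambda>i. if i < m then i else i + 1)" "off 1 X = m"
    "emb 1 X = (\<lambda>i. if i < m then i else i + 2)"
    by (auto simp: keep1_def keep2_def off_def emb_def fun_eq_iff X)
  show ?thesis using fermat_odd[of f m n s] assms unfolding X2 unfolding X1 k Let_def X[symmetric] by simp
qed

text \<open>
  In the even case the quotient \<open>(f(x, z) - f(y, z)) / (x - y)\<close> depends on both fresh variables, in the
  odd case it does not involve them.
\<close>

definition quo_even :: "nat \<times> nat \<Rightarrow> bit \<Rightarrow> 's \<Rightarrow> 's" where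
  "quo_even X s f = (THE g. g \<in> Hom S (X2 0 X) (srt s) \<and>
    osub S \<tau> (X2 0 X) s (reix (X2 0 X) (X1 0 X) s (keep1 0 X) f) (reix (X2 0 X) (X1 0 X) s (keep2 0 X) f)
    = omul S \<tau> (X2 0 X) 0 s (osub S \<tau> (X2 0 X) 0 (proj S (X2 0 X) (off 0 X)) (proj S (X2 0 X) (Suc (off 0 X)))) g)"

definition quo_odd :: "nat \<times> nat \<Rightarrow> bit \<Rightarrow> 's \<Rightarrow> 's" where
  "quo_odd X s f = (THE h. h \<in> Hom S X (srt (s + 1)) \<and>
    osub S \<tau> (X2 1 X) s (reix (X2 1 X) (X1 1 X) s (keep1 1 X) f) (reix (X2 1 X) (X1 1 X) s (keep2 1 X) f)
    = omul S \<tau> (X2 1 X) 1 (s + 1) (osub S \<tau> (X2 1 X) 1 (proj S (X2 1 X) (off 1 X)) (proj S (X2 1 X) (Suc (off 1 X))))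
        (reix (X2 1 X) X (s + 1) (emb 1 X) h))"

lemma reix_hom: "f \<in> Hom S X (srt p) \<Longrightarrow> (\<And>i. i < len X \<Longrightarrow> k i < len Y \<and> gr Y (k i) = gr X i) \<Longrightarrow>
    reix Y X p k f \<in> Hom S Y (srt p)"
  using proj_reindex[of X k Y] by auto

lemma X2_projs: "proj S (X2 p X) (off p X) \<in> Hom S (X2 p X) (srt p)"
    "proj S (X2 p X) (Suc (off p X)) \<in> Hom S (X2 p X) (srt p)"
  using tgt.proj_hom[of "off p X" "X2 p X"] tgt.proj_hom[of "Suc (off p X)" "X2 p X"] by (simp_all del: tgt.proj_hom len_add)

text \<open>
  The defining equations hold between elements of a free algebra, and evaluation of such elements is a
  ring homomorphism into any algebra; hence the equations hold for all values of the variables.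
\<close>

lemma quo_even:
  assumes f: "f \<in> Hom S (X1 0 X) (srt s)"
  shows quo_even_hom: "quo_even X s f \<in> Hom S (X2 0 X) (srt s)"
    and quo_even_ev: "B \<in> Obj (Alg S) \<Longrightarrow> fam B (X2 0 X) c \<Longrightarrow>
      io B s (ev S B (X1 0 X) s f (\<lambda>i. c (keep1 0 X i))) \<ominus>\<^bsub>RR B\<^esub> io B s (ev S B (X1 0 X) s f (\<lambda>i. c (keep2 0 X i)))
      = (io B 0 (c (off 0 X)) \<ominus>\<^bsub>RR B\<^esub> io B 0 (c (Suc (off 0 X)))) \<otimes>\<^bsub>RR B\<^esub> io B s (ev S B (X2 0 X) s (quo_even X s f) c)"
proof -
  let ?V = "X2 0 X" and ?g = "quo_even X s f"
  let ?f1 = "reix ?V (X1 0 X) s (keep1 0 X) f" and ?f2 = "reix ?V (X1 0 X) s (keep2 0 X) f"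
  let ?x = "proj S ?V (off 0 X)" and ?y = "proj S ?V (Suc (off 0 X))"
  have g: "?g \<in> Hom S ?V (srt s)" and eq: "osub S \<tau> ?V s ?f1 ?f2 = omul S \<tau> ?V 0 s (osub S \<tau> ?V 0 ?x ?y) ?g"
    using theI'[OF fermat_even_X[OF f]] unfolding quo_even_def by blast+
  show "?g \<in> Hom S ?V (srt s)" by (rule g)
  have ff: "?f1 \<in> Hom S ?V (srt s)" "?f2 \<in> Hom S ?V (srt s)" by (rule reix_hom[OF f keep1_ix]; assumption) (rule reix_hom[OF f keep2_ix]; assumption)
  note xy = X2_projs[of X 0]
  have "io (rep S ?V) s ?f1 \<ominus>\<^bsub>RR (rep S ?V)\<^esub> io (rep S ?V) s ?f2 =
     (io (rep S ?V) 0 ?x \<ominus>\<^bsub>RR (rep S ?V)\<^esub> io (rep S ?V) 0 ?y) \<otimes>\<^bsub>RR (rep S ?V)\<^esub> io (rep S ?V) s ?g"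
    using io_osub[OF ff] io_osub[OF xy] io_omul[OF io_osub(1)[OF xy] g] eq by simp
  then have E: "evr B ?V c (io (rep S ?V) s ?f1 \<ominus>\<^bsub>RR (rep S ?V)\<^esub> io (rep S ?V) s ?f2) =
     evr B ?V c ((io (rep S ?V) 0 ?x \<ominus>\<^bsub>RR (rep S ?V)\<^esub> io (rep S ?V) 0 ?y) \<otimes>\<^bsub>RR (rep S ?V)\<^esub> io (rep S ?V) s ?g)"
    for B :: "('s, 'w) alg" and c by (rule arg_cong)
  assume B: "B \<in> Obj (Alg S)" "fam B ?V c"
  interpret V: ring "RR (rep S ?V)" by simp
  have C: "io (rep S ?V) s ?f1 \<in> carrier (RR (rep S ?V))" "io (rep S ?V) s ?f2 \<in> carrier (RR (rep S ?V))"
    "io (rep S ?V) 0 ?x \<in> carrier (RR (rep S ?V))" "io (rep S ?V) 0 ?y \<in> carrier (RR (rep S ?V))"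
    "io (rep S ?V) s ?g \<in> carrier (RR (rep S ?V))" using ff xy g by simp_all
  note h = ring_hom_minus'[OF V.ring_axioms ring_RR[OF B(1)] evr_hom[OF B]] ring_hom_mult[OF evr_hom[OF B]]
  have e: "ev S B ?V s ?f1 c = ev S B (X1 0 X) s f (\<lambda>i. c (keep1 0 X i))"
    "ev S B ?V s ?f2 c = ev S B (X1 0 X) s f (\<lambda>i. c (keep2 0 X i))"
    "ev S B ?V 0 ?x c = c (off 0 X)" "ev S B ?V 0 ?y c = c (Suc (off 0 X))"
    using ev_reindex[OF B f keep1_ix] ev_reindex[OF B f keep2_ix] B by (simp_all del: len_add)
  show "io B s (ev S B (X1 0 X) s f (\<lambda>i. c (keep1 0 X i))) \<ominus>\<^bsub>RR B\<^esub> io B s (ev S B (X1 0 X) s f (\<lambda>i. c (keep2 0 X i)))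
      = (io B 0 (c (off 0 X)) \<ominus>\<^bsub>RR B\<^esub> io B 0 (c (Suc (off 0 X)))) \<otimes>\<^bsub>RR B\<^esub> io B s (ev S B ?V s ?g c)"
    using E[of B c] C by (simp add: h evr_io[OF B] e)
qed

lemma quo_odd:
  assumes f: "f \<in> Hom S (X1 1 X) (srt s)"
  shows quo_odd_hom: "quo_odd X s f \<in> Hom S X (srt (s + 1))"
    and quo_odd_ev: "B \<in> Obj (Alg S) \<Longrightarrow> fam B (X2 1 X) c \<Longrightarrow>
      io B s (ev S B (X1 1 X) s f (\<lambda>i. c (keep1 1 X i))) \<ominus>\<^bsub>RR B\<^esub> io B s (ev S B (X1 1 X) s f (\<lambda>i. c (keep2 1 X i)))
      = (io B 1 (c (off 1 X)) \<ominus>\<^bsub>RR B\<^esub> io B 1 (c (Suc (off 1 X)))) \<otimes>\<^bsub>RR B\<^esub> io B (s + 1) (ev S B X (s + 1) (quo_odd X s f) (\<lambda>i. c (emb 1 X i)))"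
proof -
  let ?V = "X2 1 X" and ?g = "quo_odd X s f"
  let ?f1 = "reix ?V (X1 1 X) s (keep1 1 X) f" and ?f2 = "reix ?V (X1 1 X) s (keep2 1 X) f"
  let ?x = "proj S ?V (off 1 X)" and ?y = "proj S ?V (Suc (off 1 X))" and ?h = "reix ?V X (s + 1) (emb 1 X) ?g"
  have g: "?g \<in> Hom S X (srt (s + 1))" and eq: "osub S \<tau> ?V s ?f1 ?f2 = omul S \<tau> ?V 1 (s + 1) (osub S \<tau> ?V 1 ?x ?y) ?h"
    using theI'[OF fermat_odd_X[OF f]] unfolding quo_odd_def by blast+
  show "?g \<in> Hom S X (srt (s + 1))" by (rule g)
  have ff: "?f1 \<in> Hom S ?V (srt s)" "?f2 \<in> Hom S ?V (srt s)" "?h \<in> Hom S ?V (srt (s + 1))"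
    by ((rule reix_hom[OF f keep1_ix] reix_hom[OF f keep2_ix] reix_hom[OF g emb_ix]; assumption)+)
  note xy = X2_projs[of X 1]
  have "1 + (s + 1) = s" by (cases s) auto
  then have "io (rep S ?V) s ?f1 \<ominus>\<^bsub>RR (rep S ?V)\<^esub> io (rep S ?V) s ?f2 =
     (io (rep S ?V) 1 ?x \<ominus>\<^bsub>RR (rep S ?V)\<^esub> io (rep S ?V) 1 ?y) \<otimes>\<^bsub>RR (rep S ?V)\<^esub> io (rep S ?V) (s + 1) ?h"
    using io_osub[OF ff(1,2)] io_osub[OF xy] io_omul[OF io_osub(1)[OF xy] ff(3)] eq by simp
  then have E: "evr B ?V c (io (rep S ?V) s ?f1 \<ominus>\<^bsub>RR (rep S ?V)\<^esub> io (rep S ?V) s ?f2) =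
     evr B ?V c ((io (rep S ?V) 1 ?x \<ominus>\<^bsub>RR (rep S ?V)\<^esub> io (rep S ?V) 1 ?y) \<otimes>\<^bsub>RR (rep S ?V)\<^esub> io (rep S ?V) (s + 1) ?h)"
    for B :: "('s, 'w) alg" and c by (rule arg_cong)
  assume B: "B \<in> Obj (Alg S)" "fam B ?V c"
  interpret V: ring "RR (rep S ?V)" by simp
  have C: "io (rep S ?V) s ?f1 \<in> carrier (RR (rep S ?V))" "io (rep S ?V) s ?f2 \<in> carrier (RR (rep S ?V))"
    "io (rep S ?V) 1 ?x \<in> carrier (RR (rep S ?V))" "io (rep S ?V) 1 ?y \<in> carrier (RR (rep S ?V))"
    "io (rep S ?V) (s + 1) ?h \<in> carrier (RR (rep S ?V))" using ff xy by simp_all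
  note h = ring_hom_minus'[OF V.ring_axioms ring_RR[OF B(1)] evr_hom[OF B]] ring_hom_mult[OF evr_hom[OF B]]
  have e: "ev S B ?V s ?f1 c = ev S B (X1 1 X) s f (\<lambda>i. c (keep1 1 X i))"
    "ev S B ?V s ?f2 c = ev S B (X1 1 X) s f (\<lambda>i. c (keep2 1 X i))"
    "ev S B ?V (s + 1) ?h c = ev S B X (s + 1) ?g (\<lambda>i. c (emb 1 X i))"
    "ev S B ?V 1 ?x c = c (off 1 X)" "ev S B ?V 1 ?y c = c (Suc (off 1 X))"
    using ev_reindex[OF B f keep1_ix] ev_reindex[OF B f keep2_ix] ev_reindex[OF B g emb_ix] B by (simp_all del: len_add)
  show "io B s (ev S B (X1 1 X) s f (\<lambda>i. c (keep1 1 X i))) \<ominus>\<^bsub>RR B\<^esub> io B s (ev S B (X1 1 X) s f (\<lambda>i. c (keep2 1 X i)))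
      = (io B 1 (c (off 1 X)) \<ominus>\<^bsub>RR B\<^esub> io B 1 (c (Suc (off 1 X)))) \<otimes>\<^bsub>RR B\<^esub> io B (s + 1) (ev S B X (s + 1) ?g (\<lambda>i. c (emb 1 X i)))"
    using E[of B c] C by (simp add: h evr_io[OF B] e)
qed

end

section \<open>Partial derivatives\<close>

lemma (in ring) add_left_cancel_iff:
  "a \<in> carrier R \<Longrightarrow> b \<in> carrier R \<Longrightarrow> c \<in> carrier R \<Longrightarrow> a \<oplus> b = a \<oplus> c \<longleftrightarrow> b = c"
  by (metis r_neg1)

context super_fermat_theory
begin

text \<open>\<open>translate X i s f\<close> is \<open>f\<close> with a fresh variable added to the \<open>i\<close>-th one.\<close>

definition translate :: "nat \<times> nat \<Rightarrow> nat \<Rightarrow> bit \<Rightarrow> 's \<Rightarrow> 's" where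
  "translate X i s f = (let p = gr X i; Y = X1 p X in
    Comp S Y X (srt s) f (tup S Y X (\<lambda>k. if k = i
      then sadd (NN (rep S Y)) p (proj S Y (keep2 p X k)) (proj S Y (off p X)) else proj S Y (keep2 p X k))))"

lemma translate:
  assumes f: "f \<in> Hom S X (srt s)" and i: "i < len X"
  shows translate_hom: "translate X i s f \<in> Hom S (X1 (gr X i) X) (srt s)"
    and translate_ev: "B \<in> Obj (Alg S) \<Longrightarrow> fam B (X1 (gr X i) X) c \<Longrightarrow>
      ev S B (X1 (gr X i) X) s (translate X i s f) c
        = ev S B X s f (\<lambda>k. if k = i then sadd (NN B) (gr X i) (c (keep2 (gr X i) X i)) (c (off (gr X i) X)) else c (keep2 (gr X i) X k))"
proof -
  let ?p = "gr X i"
  let ?Y = "X1 ?p X"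
  let ?t = "\<lambda>k. if k = i then sadd (NN (rep S ?Y)) ?p (proj S ?Y (keep2 ?p X k)) (proj S ?Y (off ?p X)) else proj S ?Y (keep2 ?p X k)"
  have pk: "proj S ?Y (keep2 ?p X k) \<in> Hom S ?Y (srt (gr X k))" if "k < len X" for k
    by (rule proj_reindex[OF keep_ix that])
  have po: "proj S ?Y (off ?p X) \<in> Hom S ?Y (srt ?p)"
    using tgt.proj_hom[OF fresh_off(1)[where p = "?p" and X = X]] by simp
  have t: "?t k \<in> Hom S ?Y (srt (gr X k))" if "k < len X" for k
    using pk[OF that] po by auto
  show "translate X i s f \<in> Hom S ?Y (srt s)"
    unfolding translate_def Let_def using t f by (intro tgt.comp_hom tgt.tup_hom) auto
  assume B: "B \<in> Obj (Alg S)" "fam B ?Y c"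
  have "ev S B ?Y s (translate X i s f) c = ev S B X s f (\<lambda>k. ev S B ?Y (gr X k) (?t k) c)"
    unfolding translate_def Let_def using t f by (intro tgt.ev_comp_tup B) auto
  also have "\<dots> = ev S B X s f (\<lambda>k. if k = i then sadd (NN B) ?p (c (keep2 ?p X i)) (c (off ?p X)) else c (keep2 ?p X k))"
  proof (rule tgt.ev_cong)
    fix k assume k: "k < len X"
    have e: "ev S B ?Y (gr X k) (proj S ?Y (keep2 ?p X k)) c = c (keep2 ?p X k)" if "k < len X" for k
      using keep_ix[OF that, of ?p] B by (intro tgt.ev_proj) auto
    have o: "ev S B ?Y ?p (proj S ?Y (off ?p X)) c = c (off ?p X)"
      using B fresh_off(1,2)[where p = "?p" and X = X] by (intro tgt.ev_proj) auto
    show "ev S B ?Y (gr X k) (?t k) c = (if k = i then sadd (NN B) ?p (c (keep2 ?p X i)) (c (off ?p X)) else c (keep2 ?p X k))"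
      using e[OF k] e[OF i] o ev_sadd[OF B pk[OF i] po] by auto
  qed
  finally show "ev S B ?Y s (translate X i s f) c = \<dots>" .
qed

text \<open>
  Both fresh even variables are set to zero; they come first, at the positions 0 and 1.
\<close>

definition at00 :: "nat \<times> nat \<Rightarrow> bit \<Rightarrow> 's \<Rightarrow> 's" where
  "at00 X s g = Comp S X (X2 0 X) (srt s) g
    (tup S X (X2 0 X) (\<lambda>k. if k < 2 then szero (NN (rep S X)) 0 else proj S X (k - 2)))"

text \<open>
  The partial derivative: the difference quotient in the fresh variable that was added to the \<open>i\<close>-th
  coordinate, at the point where both copies of the variable vanish. For an odd coordinate the parity of
  the derivative differs from that of \<open>f\<close>, in general it is \<open>gr X i + s\<close>.
\<close>

definition pd :: "nat \<times> nat \<Rightarrow> nat \<Rightarrow> bit \<Rightarrow> 's \<Rightarrow> 's" where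
  "pd X i s f = (if gr X i = 0 then at00 X s (quo_even X s (translate X i s f))
    else quo_odd X s (translate X i s f))"

lemma gr_X2_even: "k < 2 \<Longrightarrow> gr (X2 0 X) k = 0" "\<not> k < 2 \<Longrightarrow> gr (X2 0 X) k = gr X (k - 2)"
  by (auto simp: gr_def srt_def)

lemma at00:
  assumes g: "g \<in> Hom S (X2 0 X) (srt s)"
  shows at00_hom: "at00 X s g \<in> Hom S X (srt s)"
    and at00_ev: "B \<in> Obj (Alg S) \<Longrightarrow> fam B X b \<Longrightarrow>
      ev S B X s (at00 X s g) b = ev S B (X2 0 X) s g (\<lambda>k. if k < 2 then szero (NN B) 0 else b (k - 2))"
proof -
  let ?t = "\<lambda>k. if k < 2 then szero (NN (rep S X)) 0 else proj S X (k - 2)"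
  have t: "?t k \<in> Hom S X (srt (gr (X2 0 X) k))" if "k < len (X2 0 X)" for k
  proof (cases "k < 2")
    case False then show ?thesis using that tgt.proj_hom[of "k - 2" X] by (auto simp: gr_X2_even)
  qed (auto simp: gr_X2_even)
  show "at00 X s g \<in> Hom S X (srt s)"
    unfolding at00_def using t g by (intro tgt.comp_hom[of _ X "X2 0 X"] tgt.tup_hom) auto
  assume B: "B \<in> Obj (Alg S)" "fam B X b"
  have "ev S B X s (at00 X s g) b = ev S B (X2 0 X) s g (\<lambda>k. ev S B X (gr (X2 0 X) k) (?t k) b)"
    unfolding at00_def using t g by (intro tgt.ev_comp_tup B) auto
  also have "\<dots> = ev S B (X2 0 X) s g (\<lambda>k. if k < 2 then szero (NN B) 0 else b (k - 2))"
    using B by (intro tgt.ev_cong) (auto simp: gr_X2_even ev_szero intro!: tgt.ev_proj)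
  finally show "ev S B X s (at00 X s g) b = \<dots>" .
qed

lemma pd_hom[simp]:
  assumes f: "f \<in> Hom S X (srt s)" and i: "i < len X" and q: "q = gr X i + s"
  shows "pd X i s f \<in> Hom S X (srt q)"
proof (cases "gr X i = 0")
  case True
  then show ?thesis using at00_hom[OF quo_even_hom, of "translate X i s f"] translate_hom[OF f i] q by (simp add: pd_def)
next
  case False
  then show ?thesis using quo_odd_hom[of "translate X i s f" X s] translate_hom[OF f i] q by (simp add: pd_def add.commute)
qed

text \<open>
  For odd \<open>d\<close> there is no remainder at all. For even \<open>d\<close> the difference quotient \<open>g(x, y)\<close> is taken at
  \<open>(d, 0)\<close> instead of \<open>(0, 0)\<close>, and a second difference quotient shows that the error is a multiple of \<open>d\<close>.
\<close>

lemma taylor_one_variable: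
  assumes B: "B \<in> Obj (Alg S)" "fam B X b" and f: "f \<in> Hom S X (srt s)" and i: "i < len X"
    and d: "d \<in> fob B (srt (gr X i))"
  shows "\<exists>r\<in>carrier (RR B). io B s (ev S B X s f (b(i := sadd (NN B) (gr X i) (b i) d)))
    = io B s (ev S B X s f b) \<oplus>\<^bsub>RR B\<^esub> (io B (gr X i) d \<otimes>\<^bsub>RR B\<^esub> io B (gr X i + s) (ev S B X (gr X i + s) (pd X i s f) b)
        \<oplus>\<^bsub>RR B\<^esub> io B (gr X i) d \<otimes>\<^bsub>RR B\<^esub> (io B (gr X i) d \<otimes>\<^bsub>RR B\<^esub> r))"
proof -
  let ?p = "gr X i" and ?f = "translate X i s f"
  interpret N: supercommutative "NN B" by (rule NN_super[OF B(1)])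
  let ?z = "szero (NN B) ?p"
  have bi: "b i \<in> fob B (srt ?p)" using B i by (simp add: fam_def)
  have bz: "sadd (NN B) ?p (b i) ?z = b i" using N.add_szero[of "b i" ?p] bi by simp
  have f1: "?f \<in> Hom S (X1 ?p X) (srt s)" by (rule translate_hom[OF f i])
  \<comment> \<open>the point of \<open>X + srt p + srt p\<close> over \<open>b\<close> with fresh coordinates \<open>d\<close> and \<open>d'\<close>\<close>
  define c where "c d d' k = (if k = off ?p X then d else if k = Suc (off ?p X) then d' else if k < off ?p X then b k else b (k - 2))" for d d' k
  have c_emb: "c d d' (emb ?p X k) = b k" for d d' k by (auto simp: c_def emb_def)
  have c_off: "c d d' (off ?p X) = d" "c d d' (Suc (off ?p X)) = d'" for d d' by (auto simp: c_def)
  have fc: "fam B (X2 ?p X) (c d d')" if "d \<in> fob B (srt ?p)" "d' \<in> fob B (srt ?p)" for d d'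
    unfolding fam_def
  proof (intro allI impI)
    fix k assume k: "k < len (X2 ?p X)"
    consider "k = off ?p X" | "k = Suc (off ?p X)" | j where "j < len X" "k = emb ?p X j"
    proof (cases "k < off ?p X")
      case True
      then have "k < len X" "k = emb ?p X k" by (auto simp: off_def emb_def len_def split: if_splits)
      then show ?thesis using that by blast
    next
      case False
      consider "k = off ?p X" | "k = Suc (off ?p X)" | "Suc (off ?p X) < k" using False by linarith
      then show ?thesis
      proof cases
        case 3
        then have "k - 2 < len X" "k = emb ?p X (k - 2)" using k by (auto simp: emb_def)
        then show ?thesis using that(3) by blast
      qed (use that in auto)
    qed
    then show "c d d' k \<in> fob B (srt (gr (X2 ?p X) k))"
    proof cases
      case (3 j) then show ?thesis using emb_ix[of j X ?p] B by (simp add: c_emb fam_def)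
    qed (use that c_off in auto)
  qed
  have e1: "ev S B (X1 ?p X) s ?f (\<lambda>k. c d d' (keep1 ?p X k)) = ev S B X s f (b(i := sadd (NN B) ?p (b i) d))"
    and e2: "ev S B (X1 ?p X) s ?f (\<lambda>k. c d d' (keep2 ?p X k)) = ev S B X s f (b(i := sadd (NN B) ?p (b i) d'))"
    if "d \<in> fob B (srt ?p)" "d' \<in> fob B (srt ?p)" for d d'
  proof -
    have "ev S B (X1 ?p X) s ?f (\<lambda>k. c d d' (keep1 ?p X k)) = ev S B X s f (\<lambda>k. if k = i then sadd (NN B) ?p (b i) d else b k)"
      using translate_ev[OF f i B(1) fam_reindex[OF fc[OF that] keep1_ix]] by (simp add: c_emb c_off cong: if_cong)
    then show "ev S B (X1 ?p X) s ?f (\<lambda>k. c d d' (keep1 ?p X k)) = ev S B X s f (b(i := sadd (NN B) ?p (b i) d))"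
      by (simp add: fun_upd_def)
    have "ev S B (X1 ?p X) s ?f (\<lambda>k. c d d' (keep2 ?p X k)) = ev S B X s f (\<lambda>k. if k = i then sadd (NN B) ?p (b i) d' else b k)"
      using translate_ev[OF f i B(1) fam_reindex[OF fc[OF that] keep2_ix]] by (simp add: c_emb c_off cong: if_cong)
    then show "ev S B (X1 ?p X) s ?f (\<lambda>k. c d d' (keep2 ?p X k)) = ev S B X s f (b(i := sadd (NN B) ?p (b i) d'))"
      by (simp add: fun_upd_def)
  qed
  have z: "?z \<in> fob B (srt ?p)" by (simp add: B)
  have bu: "fam B X (b(i := sadd (NN B) ?p (b i) d))" using B bi d by (auto simp: fam_def)
  have io_d: "io B ?p d \<in> carrier (RR B)" using d B by simp
  define F1 F0 where "F1 = io B s (ev S B X s f (b(i := sadd (NN B) ?p (b i) d)))" and "F0 = io B s (ev S B X s f b)"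
  have C: "F1 \<in> carrier (RR B)" "F0 \<in> carrier (RR B)"
    using B bu f by (simp_all add: F1_def F0_def)
  have finish: ?thesis if "r \<in> carrier (RR B)" "F1 = F0 \<oplus>\<^bsub>RR B\<^esub> (io B ?p d \<otimes>\<^bsub>RR B\<^esub> io B (?p + s) (ev S B X (?p + s) (pd X i s f) b)
        \<oplus>\<^bsub>RR B\<^esub> io B ?p d \<otimes>\<^bsub>RR B\<^esub> (io B ?p d \<otimes>\<^bsub>RR B\<^esub> r))" for r
    using that unfolding F1_def F0_def by blast
  have D0: "io B ?p d \<ominus>\<^bsub>RR B\<^esub> io B ?p ?z = io B ?p d" using io_d N.inc_szero[of ?p] by (simp add: N.R.minus_eq)
  have F10: "F1 = io B s (ev S B (X1 ?p X) s ?f (\<lambda>k. c d ?z (keep1 ?p X k)))"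
    "F0 = io B s (ev S B (X1 ?p X) s ?f (\<lambda>k. c d ?z (keep2 ?p X k)))"
    unfolding F1_def F0_def e1[OF d z] e2[OF d z] bz by simp_all
  show ?thesis
  proof (cases "?p = 0")
    case False
    then have p: "?p = 1" by simp
    let ?h = "quo_odd X s ?f"
    have h: "?h \<in> Hom S X (srt (s + 1))" using quo_odd_hom[of ?f X s] f1 p by simp
    have hb: "io B (s + 1) (ev S B X (s + 1) ?h b) \<in> carrier (RR B)" using h B by simp
    have "F1 \<ominus>\<^bsub>RR B\<^esub> F0 = (io B ?p d \<ominus>\<^bsub>RR B\<^esub> io B ?p ?z) \<otimes>\<^bsub>RR B\<^esub> io B (s + 1) (ev S B X (s + 1) ?h b)"
      unfolding F10 using quo_odd_ev[OF f1[unfolded p] B(1) fc[OF d z, unfolded p]] by (simp only: p c_off[unfolded p] c_emb[unfolded p])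
    then have "F1 = F0 \<oplus>\<^bsub>RR B\<^esub> io B ?p d \<otimes>\<^bsub>RR B\<^esub> io B (s + 1) (ev S B X (s + 1) ?h b)"
      unfolding D0 using N.R.minus_eq_iff[OF C N.R.m_closed[OF io_d hb]] by blast
    moreover have "pd X i s f = ?h" using False by (simp add: pd_def)
    ultimately show ?thesis using C io_d hb p
      by (intro finish[of "\<zero>\<^bsub>RR B\<^esub>"]) (simp_all add: add.commute)
  next
    case True
    let ?g = "quo_even X s ?f"
    let ?Y = "X1 0 X"
    let ?g2 = "quo_even ?Y s ?g"
    let ?b0 = "\<lambda>k. if k < 2 then ?z else b (k - 2)"
    have g: "?g \<in> Hom S (X2 0 X) (srt s)" using quo_even_hom[of ?f X s] f1 True by simp
    have g2: "?g2 \<in> Hom S (X2 0 ?Y) (srt s)" using quo_even_hom[of ?g ?Y s] g by simp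
    \<comment> \<open>the second quotient has the further fresh variable in front: it compares \<open>(d, 0, b)\<close> with \<open>(0, 0, b)\<close>\<close>
    define c2 where "c2 k = (if k = 0 then d else if k = 1 then ?z else if k = 2 then ?z else b (k - 3))" for k
    have fc2: "fam B (X2 0 ?Y) c2"
      unfolding fam_def
    proof (intro allI impI)
      fix k assume k: "k < len (X2 0 ?Y)"
      have gY: "gr ?Y 0 = 0" "0 < j \<Longrightarrow> gr ?Y j = gr X (j - 1)" for j by (auto simp: gr_def srt_def)
      consider "k < 2" | "k = 2" | "2 < k" by linarith
      then show "c2 k \<in> fob B (srt (gr (X2 0 ?Y) k))"
      proof cases
        case 3
        then show ?thesis using k B gr_X2_even(2)[of k ?Y] gY(2)[of "k - 2"] by (simp add: c2_def fam_def)
      qed (use d z gr_X2_even[of k ?Y] gY True in \<open>auto simp: c2_def\<close>)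
    qed
    have k1: "(\<lambda>k. c2 (keep1 0 ?Y k)) = c d ?z"
      by (auto simp: fun_eq_iff c2_def keep1_def off_def c_def True)
    have k2: "(\<lambda>k. c2 (keep2 0 ?Y k)) = ?b0"
      by (auto simp: fun_eq_iff c2_def keep2_def off_def True)
    have F2: "fam B (X2 0 X) ?b0"
      using B z True by (auto simp: fam_def gr_X2_even)
    have C2: "io B s (ev S B (X2 0 X) s ?g (c d ?z)) \<in> carrier (RR B)" "io B s (ev S B (X2 0 X) s ?g ?b0) \<in> carrier (RR B)"
      "io B s (ev S B (X2 0 ?Y) s ?g2 c2) \<in> carrier (RR B)"
      using B g g2 fc[OF d z] fc2 F2 True by simp_all
    have "F1 \<ominus>\<^bsub>RR B\<^esub> F0 = (io B ?p d \<ominus>\<^bsub>RR B\<^esub> io B ?p ?z) \<otimes>\<^bsub>RR B\<^esub> io B s (ev S B (X2 0 X) s ?g (c d ?z))"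
      unfolding F10 using quo_even_ev[OF f1[unfolded True] B(1) fc[OF d z, unfolded True]] by (simp only: True c_off[unfolded True])
    then have 1: "F1 = F0 \<oplus>\<^bsub>RR B\<^esub> io B ?p d \<otimes>\<^bsub>RR B\<^esub> io B s (ev S B (X2 0 X) s ?g (c d ?z))"
      unfolding D0 using N.R.minus_eq_iff[OF C N.R.m_closed[OF io_d C2(1)]] by blast
    have c20: "c2 (off 0 ?Y) = d" "c2 (Suc (off 0 ?Y)) = ?z" by (simp_all add: off_def c2_def)
    have "io B s (ev S B (X2 0 X) s ?g (c d ?z)) \<ominus>\<^bsub>RR B\<^esub> io B s (ev S B (X2 0 X) s ?g ?b0)
      = (io B ?p d \<ominus>\<^bsub>RR B\<^esub> io B ?p ?z) \<otimes>\<^bsub>RR B\<^esub> io B s (ev S B (X2 0 ?Y) s ?g2 c2)"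
      using quo_even_ev[OF g B(1) fc2] unfolding k1 k2 c20 by (simp only: True)
    then have 2: "io B s (ev S B (X2 0 X) s ?g (c d ?z)) = io B s (ev S B (X2 0 X) s ?g ?b0)
       \<oplus>\<^bsub>RR B\<^esub> io B ?p d \<otimes>\<^bsub>RR B\<^esub> io B s (ev S B (X2 0 ?Y) s ?g2 c2)"
      unfolding D0 using N.R.minus_eq_iff[OF C2(1,2) N.R.m_closed[OF io_d C2(3)]] by blast
    have ps: "?p + s = s" using True by simp
    have 3: "ev S B X s (pd X i s f) b = ev S B (X2 0 X) s ?g ?b0"
      using at00_ev[OF g B] True by (simp add: pd_def cong: if_cong)
    show ?thesis
    proof (rule finish[OF C2(3)])
      show "F1 = F0 \<oplus>\<^bsub>RR B\<^esub> (io B ?p d \<otimes>\<^bsub>RR B\<^esub> io B (?p + s) (ev S B X (?p + s) (pd X i s f) b)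
        \<oplus>\<^bsub>RR B\<^esub> io B ?p d \<otimes>\<^bsub>RR B\<^esub> (io B ?p d \<otimes>\<^bsub>RR B\<^esub> io B s (ev S B (X2 0 ?Y) s ?g2 c2)))"
        unfolding ps 3 1 2 by (subst N.R.r_distr) (use C2 io_d in simp_all)
    qed
  qed
qed

section \<open>Uniqueness of partial derivatives\<close>

abbreviation xs :: "bit \<Rightarrow> nat \<times> nat \<Rightarrow> nat \<Rightarrow> 's" where
  "xs p X k \<equiv> proj S (X2 p X) (emb p X k)"

text \<open>
  The difference of the two fresh variables of \<open>X2 p X\<close>. Increments of the form \<open>\<epsilon> r\<close> in this free
  algebra are generic enough to detect derivatives.
\<close>

definition eps :: "bit \<Rightarrow> nat \<times> nat \<Rightarrow> 's" where
  "eps p X = supercommutative.ssub (NN (rep S (X2 p X))) p (proj S (X2 p X) (off p X)) (proj S (X2 p X) (Suc (off p X)))"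

lemma eps_hom[simp]: "eps p X \<in> Hom S (X2 p X) (srt p)"
  and io_eps: "io (rep S (X2 p X)) p (eps p X) = io (rep S (X2 p X)) p (proj S (X2 p X) (off p X))
    \<ominus>\<^bsub>RR (rep S (X2 p X))\<^esub> io (rep S (X2 p X)) p (proj S (X2 p X) (Suc (off p X)))"
proof -
  interpret N: supercommutative "NN (rep S (X2 p X))" by (rule NN_super) simp
  show "eps p X \<in> Hom S (X2 p X) (srt p)"
    using N.ssub_car[of "proj S (X2 p X) (off p X)" p "proj S (X2 p X) (Suc (off p X))"] X2_projs[of X p]
    by (simp add: eps_def)
  show "io (rep S (X2 p X)) p (eps p X) = io (rep S (X2 p X)) p (proj S (X2 p X) (off p X))
    \<ominus>\<^bsub>RR (rep S (X2 p X))\<^esub> io (rep S (X2 p X)) p (proj S (X2 p X) (Suc (off p X)))"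
    using N.inc_ssub[of "proj S (X2 p X) (off p X)" p "proj S (X2 p X) (Suc (off p X))"] X2_projs[of X p]
    by (simp add: eps_def)
qed

lemma fam_xs[simp]: "fam (rep S (X2 p X)) X (xs p X)"
  using proj_reindex[OF emb_ix] by (simp add: fam_def)

lemma ev_xs: "ev S (rep S (X2 p X)) X q u (xs p X) = reix (X2 p X) X q (emb p X) u"
  by (rule tgt.ev_rep[OF fam_xs])

lemma szero_reix:
  assumes k: "\<And>i. i < len X \<Longrightarrow> k i < len Y \<and> gr Y (k i) = gr X i"
  shows "reix Y X p k (szero (NN (rep S X)) p) = szero (NN (rep S Y)) p"
proof -
  have "fam (rep S Y) X (\<lambda>i. proj S Y (k i))" using proj_reindex[OF k] by (simp add: fam_def)
  then show ?thesis using ev_szero[of "rep S Y" X "\<lambda>i. proj S Y (k i)" p] tgt.ev_rep[of Y X "\<lambda>i. proj S Y (k i)"] by simp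
qed

text \<open>
  If \<open>\<epsilon> g = 0\<close> then both \<open>g\<close> and \<open>0\<close> are difference quotients of the zero function.
\<close>

lemma even_cancel:
  assumes g: "g \<in> Hom S (X2 0 X) (srt s)"
    and z: "io (rep S (X2 0 X)) 0 (eps 0 X) \<otimes>\<^bsub>RR (rep S (X2 0 X))\<^esub> io (rep S (X2 0 X)) s g = \<zero>\<^bsub>RR (rep S (X2 0 X))\<^esub>"
  shows "g = szero (NN (rep S (X2 0 X))) s"
proof -
  let ?V = "X2 0 X"
  interpret N: supercommutative "NN (rep S ?V)" by (rule NN_super) simp
  let ?x = "proj S ?V (off 0 X)" and ?y = "proj S ?V (Suc (off 0 X))" and ?f = "szero (NN (rep S (X1 0 X))) s"
  note xy = X2_projs[of X 0]
  have f: "?f \<in> Hom S (X1 0 X) (srt s)" by simp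
  have k: "reix ?V (X1 0 X) s (keep1 0 X) ?f = szero (NN (rep S ?V)) s" "reix ?V (X1 0 X) s (keep2 0 X) ?f = szero (NN (rep S ?V)) s"
    by (rule szero_reix[OF keep1_ix] szero_reix[OF keep2_ix]; assumption)+
  have L: "io (rep S ?V) s (osub S \<tau> ?V s (szero (NN (rep S ?V)) s) (szero (NN (rep S ?V)) s)) = \<zero>\<^bsub>RR (rep S ?V)\<^esub>"
    using io_osub(2)[OF szero_hom szero_hom, of ?V s] N.inc_szero[of s] by (simp add: N.R.minus_self)
  have R: "omul S \<tau> ?V 0 s (osub S \<tau> ?V 0 ?x ?y) h = osub S \<tau> ?V s (szero (NN (rep S ?V)) s) (szero (NN (rep S ?V)) s)"
    if h: "h \<in> Hom S ?V (srt s)" "io (rep S ?V) 0 (eps 0 X) \<otimes>\<^bsub>RR (rep S ?V)\<^esub> io (rep S ?V) s h = \<zero>\<^bsub>RR (rep S ?V)\<^esub>" for h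
  proof -
    have "io (rep S ?V) s (omul S \<tau> ?V 0 s (osub S \<tau> ?V 0 ?x ?y) h) = \<zero>\<^bsub>RR (rep S ?V)\<^esub>"
      using io_omul(2)[OF io_osub(1)[OF xy] h(1)] io_osub(2)[OF xy] h(2) by (simp add: io_eps)
    then show ?thesis using L io_eq_iff by metis
  qed
  have "io (rep S ?V) 0 (eps 0 X) \<otimes>\<^bsub>RR (rep S ?V)\<^esub> io (rep S ?V) s (szero (NN (rep S ?V)) s) = \<zero>\<^bsub>RR (rep S ?V)\<^esub>"
    using N.inc_szero[of s] by simp
  then show ?thesis using fermat_even_X[OF f, unfolded k] R[OF g z] R[OF szero_hom] g szero_hom by metis
qed

text \<open>
  As in the even case, but here quotients do not involve the fresh variables, so only elements coming
  from \<open>S(X)\<close> can be cancelled.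
\<close>

lemma odd_cancel:
  assumes u: "u \<in> Hom S X (srt q)"
    and z: "io (rep S (X2 1 X)) 1 (eps 1 X) \<otimes>\<^bsub>RR (rep S (X2 1 X))\<^esub> io (rep S (X2 1 X)) q (reix (X2 1 X) X q (emb 1 X) u) = \<zero>\<^bsub>RR (rep S (X2 1 X))\<^esub>"
  shows "u = szero (NN (rep S X)) q"
proof -
  let ?V = "X2 1 X"
  define s where "s = q + 1"
  have q: "s + 1 = q" "1 + q = s" by (cases q; simp add: s_def)+
  interpret N: supercommutative "NN (rep S ?V)" by (rule NN_super) simp
  let ?x = "proj S ?V (off 1 X)" and ?y = "proj S ?V (Suc (off 1 X))" and ?f = "szero (NN (rep S (X1 1 X))) s"
  note xy = X2_projs[of X 1]
  have f: "?f \<in> Hom S (X1 1 X) (srt s)" by simp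
  have k: "reix ?V (X1 1 X) s (keep1 1 X) ?f = szero (NN (rep S ?V)) s" "reix ?V (X1 1 X) s (keep2 1 X) ?f = szero (NN (rep S ?V)) s"
    by (rule szero_reix[OF keep1_ix] szero_reix[OF keep2_ix]; assumption)+
  have L: "io (rep S ?V) s (osub S \<tau> ?V s (szero (NN (rep S ?V)) s) (szero (NN (rep S ?V)) s)) = \<zero>\<^bsub>RR (rep S ?V)\<^esub>"
    using io_osub(2)[OF szero_hom szero_hom, of ?V s] N.inc_szero[of s] by (simp add: N.R.minus_self)
  have R: "omul S \<tau> ?V 1 q (osub S \<tau> ?V 1 ?x ?y) (reix ?V X q (emb 1 X) h) = osub S \<tau> ?V s (szero (NN (rep S ?V)) s) (szero (NN (rep S ?V)) s)"
    if h: "h \<in> Hom S X (srt q)" "io (rep S ?V) 1 (eps 1 X) \<otimes>\<^bsub>RR (rep S ?V)\<^esub> io (rep S ?V) q (reix ?V X q (emb 1 X) h) = \<zero>\<^bsub>RR (rep S ?V)\<^esub>" for h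
  proof -
    have "reix ?V X q (emb 1 X) h \<in> Hom S ?V (srt q)" by (rule reix_hom[OF h(1) emb_ix])
    then have "io (rep S ?V) s (omul S \<tau> ?V 1 q (osub S \<tau> ?V 1 ?x ?y) (reix ?V X q (emb 1 X) h)) = \<zero>\<^bsub>RR (rep S ?V)\<^esub>"
      using io_omul(2)[OF io_osub(1)[OF xy], of "reix ?V X q (emb 1 X) h" q] io_osub(2)[OF xy] h(2) by (simp add: io_eps q)
    then show ?thesis using L io_eq_iff by metis
  qed
  have "io (rep S ?V) 1 (eps 1 X) \<otimes>\<^bsub>RR (rep S ?V)\<^esub> io (rep S ?V) q (reix ?V X q (emb 1 X) (szero (NN (rep S X)) q)) = \<zero>\<^bsub>RR (rep S ?V)\<^esub>"
    using N.inc_szero[of q] szero_reix[OF emb_ix, of X 1 q] by simp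
  then show ?thesis using fermat_odd_X[OF f, unfolded k q] R[OF u z] R[OF szero_hom] u szero_hom by metis
qed

text \<open>
  For even \<open>\<epsilon>\<close>, cancellation gives \<open>u = \<epsilon> r\<close> in the free algebra with the fresh variables, and \<open>\<epsilon>\<close> becomes
  \<open>0\<close> when these are set to zero. For odd \<open>\<epsilon>\<close> the right-hand side vanishes since \<open>\<epsilon>\<^sup>2 = 0\<close>.
\<close>

lemma eps_cancel:
  assumes u: "u \<in> Hom S X (srt q)" and r: "r \<in> carrier (RR (rep S (X2 p X)))"
    and e: "io (rep S (X2 p X)) p (eps p X) \<otimes>\<^bsub>RR (rep S (X2 p X))\<^esub> io (rep S (X2 p X)) q (ev S (rep S (X2 p X)) X q u (xs p X))
      = io (rep S (X2 p X)) p (eps p X) \<otimes>\<^bsub>RR (rep S (X2 p X))\<^esub> (io (rep S (X2 p X)) p (eps p X) \<otimes>\<^bsub>RR (rep S (X2 p X))\<^esub> r)"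
  shows "u = szero (NN (rep S X)) q"
proof (cases "p = 0")
  case True
  let ?V = "X2 0 X"
  let ?B = "rep S ?V"
  interpret N: supercommutative "NN ?B" by (rule NN_super) simp
  let ?e = "io ?B 0 (eps 0 X)" and ?u = "ev S ?B X q u (xs 0 X)"
  have uin: "?u \<in> Hom S ?V (srt q)" using tgt.ev_in[OF tgt.rep_obj u fam_xs] by simp
  have C: "?e \<in> carrier (RR ?B)" "io ?B q ?u \<in> carrier (RR ?B)" "r \<in> carrier (RR ?B)"
    using uin r True by simp_all
  define w where "w = io ?B q ?u \<ominus>\<^bsub>RR ?B\<^esub> ?e \<otimes>\<^bsub>RR ?B\<^esub> r"
  have w: "w \<in> carrier (RR ?B)" using C by (simp add: w_def)
  have ew: "?e \<otimes>\<^bsub>RR ?B\<^esub> w = \<zero>\<^bsub>RR ?B\<^esub>" using e True C by (simp add: w_def N.R.minus_r_distr N.R.minus_self)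
  have g: "cmp q w \<in> Hom S ?V (srt q)" using N.cmp_car[OF w, of q] by simp
  have "smul (NN ?B) 0 q (eps 0 X) (cmp q w) = cmp q (\<zero>\<^bsub>RR ?B\<^esub>)"
    using N.cmp_mul_inc[of "eps 0 X" 0 w q] w ew by simp
  then have "?e \<otimes>\<^bsub>RR ?B\<^esub> io ?B q (cmp q w) = \<zero>\<^bsub>RR ?B\<^esub>"
    using N.inc_smul[of "eps 0 X" 0 "cmp q w" q] g N.cmp_inc[of q "szero (NN ?B) q"] N.inc_szero[of q] by simp
  then have "cmp q w = szero (NN ?B) q" using even_cancel[OF g] by simp
  moreover have "io ?B q ?u = w \<oplus>\<^bsub>RR ?B\<^esub> ?e \<otimes>\<^bsub>RR ?B\<^esub> r"
    using C w N.R.minus_eq_iff[of "io ?B q ?u" "?e \<otimes>\<^bsub>RR ?B\<^esub> r" w] by (simp add: w_def N.R.a_comm)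
  then have "?u = sadd (NN ?B) q (cmp q w) (cmp q (?e \<otimes>\<^bsub>RR ?B\<^esub> r))"
    using N.cmp_add[OF w, of "?e \<otimes>\<^bsub>RR ?B\<^esub> r" q] C by (metis N.R.m_closed N.cmp_inc)
  ultimately have "?u = smul (NN ?B) 0 q (eps 0 X) (cmp q r)"
    using N.cmp_mul_inc[of "eps 0 X" 0 r q] C N.szero_add[of "smul (NN ?B) 0 q (eps 0 X) (cmp q r)" q]
      N.smul_car[of "eps 0 X" 0 "cmp q r" q] N.cmp_car[OF C(3), of q] by simp
  then have E: "io ?B q ?u = ?e \<otimes>\<^bsub>RR ?B\<^esub> io ?B q (cmp q r)"
    using N.inc_smul[of "eps 0 X" 0 "cmp q r" q] N.cmp_car[OF C(3), of q] by simp
  \<comment> \<open>put the two fresh variables equal to zero\<close>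
  let ?A = "rep S X"
  interpret A: supercommutative "NN ?A" by (rule NN_super) simp
  define a where "a k = (if k < 2 then szero (NN ?A) 0 else proj S X (k - 2))" for k
  have fa: "fam ?A ?V a" by (auto simp: fam_def a_def gr_X2_even)
  note hom = evr_hom[OF tgt.rep_obj fa]
  have a0: "a (off 0 X) = szero (NN ?A) 0" "a (Suc (off 0 X)) = szero (NN ?A) 0" by (simp_all add: a_def off_def)
  have ex: "ev S ?A ?V 0 (proj S ?V (off 0 X)) a = szero (NN ?A) 0" "ev S ?A ?V 0 (proj S ?V (Suc (off 0 X))) a = szero (NN ?A) 0"
    using tgt.ev_proj[OF tgt.rep_obj fa, of "off 0 X" 0] tgt.ev_proj[OF tgt.rep_obj fa, of "Suc (off 0 X)" 0] fresh_off(3-6)[where p = "0" and X = X] a0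
    by (simp_all del: len_add)
  have "evr ?A ?V a ?e = \<zero>\<^bsub>RR ?A\<^esub>"
    unfolding io_eps using X2_projs[of X 0] N.R.ring_axioms
    by (simp add: ring_hom_minus'[OF _ _ hom] evr_io[OF tgt.rep_obj fa] ex A.R.minus_self)
  then have "evr ?A ?V a (io ?B q ?u) = \<zero>\<^bsub>RR ?A\<^esub>"
    unfolding E using C ring_hom_mult[OF hom, of ?e "io ?B q (cmp q r)"] ring_hom_closed[OF hom, of "io ?B q (cmp q r)"] N.cmp_car[OF C(3), of q]
    by simp
  then have "io ?A q (ev S ?A ?V q ?u a) = \<zero>\<^bsub>RR ?A\<^esub>" by (simp add: evr_io[OF tgt.rep_obj fa])
  moreover have "ev S ?A ?V q ?u a = ev S ?A X q u (\<lambda>i. a (emb 0 X i))"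
    unfolding ev_xs by (rule ev_reindex[OF tgt.rep_obj fa u emb_ix])
  moreover have "(\<lambda>i. a (emb 0 X i)) = proj S X" by (auto simp: a_def emb_def off_def)
  moreover have "ev S ?A X q u (proj S X) = u" using u by (subst tgt.ev_rep) (auto simp: fam_def)
  ultimately have "io ?A q u = io ?A q (szero (NN ?A) q)" using A.inc_szero by simp
  then show ?thesis by (rule io_eq_iff[THEN iffD1])
next
  case False
  then have p: "p = 1" by simp
  let ?V = "X2 1 X"
  let ?B = "rep S ?V"
  interpret N: supercommutative "NN ?B" by (rule NN_super) simp
  let ?e = "io ?B 1 (eps 1 X)"
  obtain h where h: "h \<in> fob ?B (srt 0)" "sadd (NN ?B) 0 h h = sone (NN ?B)" using NN_half[OF tgt.rep_obj] by blast
  have "?e \<otimes>\<^bsub>RR ?B\<^esub> ?e = \<zero>\<^bsub>RR ?B\<^esub>" using N.odd_square_zero[of h "eps 1 X"] h by simp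
  then have "?e \<otimes>\<^bsub>RR ?B\<^esub> (?e \<otimes>\<^bsub>RR ?B\<^esub> r) = \<zero>\<^bsub>RR ?B\<^esub>"
    using r p N.R.m_assoc[of ?e ?e r] by simp
  then show ?thesis using odd_cancel[OF u] e p by (simp add: ev_xs)
qed

text \<open>
  The derivative is the only coefficient for which the expansion in the direction of \<open>\<epsilon>\<close> holds modulo \<open>\<epsilon>\<^sup>2\<close>:
  the difference \<open>u\<close> of two such coefficients satisfies \<open>\<epsilon> u = \<epsilon>\<^sup>2 r\<close>.
\<close>

lemma pd_unique:
  assumes f: "f \<in> Hom S X (srt s)" and i: "i < len X" and g: "g \<in> Hom S X (srt (gr X i + s))"
    and V: "V = X2 (gr X i) X" and r: "r \<in> carrier (RR (rep S V))"
    and eq: "io (rep S V) s (ev S (rep S V) X s f ((xs (gr X i) X)(i := sadd (NN (rep S V)) (gr X i) (xs (gr X i) X i) (eps (gr X i) X))))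
      = io (rep S V) s (ev S (rep S V) X s f (xs (gr X i) X)) \<oplus>\<^bsub>RR (rep S V)\<^esub>
        (io (rep S V) (gr X i) (eps (gr X i) X) \<otimes>\<^bsub>RR (rep S V)\<^esub> io (rep S V) (gr X i + s) (ev S (rep S V) X (gr X i + s) g (xs (gr X i) X))
        \<oplus>\<^bsub>RR (rep S V)\<^esub> io (rep S V) (gr X i) (eps (gr X i) X) \<otimes>\<^bsub>RR (rep S V)\<^esub> (io (rep S V) (gr X i) (eps (gr X i) X) \<otimes>\<^bsub>RR (rep S V)\<^esub> r))"
  shows "pd X i s f = g"
proof -
  let ?p = "gr X i" and ?q = "gr X i + s" and ?B = "rep S V" and ?A = "rep S X"
  let ?x = "xs ?p X" and ?e = "io ?B ?p (eps ?p X)"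
  interpret N: supercommutative "NN ?B" by (rule NN_super) simp
  interpret A: supercommutative "NN ?A" by (rule NN_super) simp
  have fx: "fam ?B X ?x" unfolding V by simp
  have ein: "eps ?p X \<in> Hom S V (srt ?p)" unfolding V by simp
  obtain r' where r': "r' \<in> carrier (RR ?B)" and eq': "io ?B s (ev S ?B X s f (?x(i := sadd (NN ?B) ?p (?x i) (eps ?p X))))
    = io ?B s (ev S ?B X s f ?x) \<oplus>\<^bsub>RR ?B\<^esub> (?e \<otimes>\<^bsub>RR ?B\<^esub> io ?B ?q (ev S ?B X ?q (pd X i s f) ?x) \<oplus>\<^bsub>RR ?B\<^esub> ?e \<otimes>\<^bsub>RR ?B\<^esub> (?e \<otimes>\<^bsub>RR ?B\<^esub> r'))"
    using taylor_one_variable[OF tgt.rep_obj fx f i, of "eps ?p X"] ein by auto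
  have pdh: "pd X i s f \<in> Hom S X (srt ?q)" using f i by simp
  have C: "io ?B s (ev S ?B X s f ?x) \<in> carrier (RR ?B)" "?e \<in> carrier (RR ?B)"
    "io ?B ?q (ev S ?B X ?q (pd X i s f) ?x) \<in> carrier (RR ?B)" "io ?B ?q (ev S ?B X ?q g ?x) \<in> carrier (RR ?B)"
    using ein tgt.ev_in[OF tgt.rep_obj _ fx] f pdh g by simp_all
  let ?d = "io ?B ?q (ev S ?B X ?q (pd X i s f) ?x)" and ?d' = "io ?B ?q (ev S ?B X ?q g ?x)"
  have "?e \<otimes>\<^bsub>RR ?B\<^esub> ?d \<oplus>\<^bsub>RR ?B\<^esub> ?e \<otimes>\<^bsub>RR ?B\<^esub> (?e \<otimes>\<^bsub>RR ?B\<^esub> r') = ?e \<otimes>\<^bsub>RR ?B\<^esub> ?d' \<oplus>\<^bsub>RR ?B\<^esub> ?e \<otimes>\<^bsub>RR ?B\<^esub> (?e \<otimes>\<^bsub>RR ?B\<^esub> r)"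
    using eq eq' C r r' N.R.add_left_cancel_iff[of "io ?B s (ev S ?B X s f ?x)"] by simp
  then have "?e \<otimes>\<^bsub>RR ?B\<^esub> (?d \<ominus>\<^bsub>RR ?B\<^esub> ?d') = ?e \<otimes>\<^bsub>RR ?B\<^esub> (?e \<otimes>\<^bsub>RR ?B\<^esub> (r \<ominus>\<^bsub>RR ?B\<^esub> r'))"
  proof -
    assume h: "?e \<otimes>\<^bsub>RR ?B\<^esub> ?d \<oplus>\<^bsub>RR ?B\<^esub> ?e \<otimes>\<^bsub>RR ?B\<^esub> (?e \<otimes>\<^bsub>RR ?B\<^esub> r') = ?e \<otimes>\<^bsub>RR ?B\<^esub> ?d' \<oplus>\<^bsub>RR ?B\<^esub> ?e \<otimes>\<^bsub>RR ?B\<^esub> (?e \<otimes>\<^bsub>RR ?B\<^esub> r)"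
    have gen: "a \<ominus>\<^bsub>RR ?B\<^esub> c = d \<ominus>\<^bsub>RR ?B\<^esub> b" if "a \<oplus>\<^bsub>RR ?B\<^esub> b = c \<oplus>\<^bsub>RR ?B\<^esub> d"
      "a \<in> carrier (RR ?B)" "b \<in> carrier (RR ?B)" "c \<in> carrier (RR ?B)" "d \<in> carrier (RR ?B)" for a b c d
    proof -
      have "a = (c \<oplus>\<^bsub>RR ?B\<^esub> d) \<ominus>\<^bsub>RR ?B\<^esub> b" using that by (metis N.R.minus_eq_iff N.R.a_comm N.R.a_closed)
      then have "a = c \<oplus>\<^bsub>RR ?B\<^esub> (d \<ominus>\<^bsub>RR ?B\<^esub> b)" using that by (simp add: N.R.minus_eq N.R.a_assoc)
      then show ?thesis using that N.R.minus_eq_iff[of a c "d \<ominus>\<^bsub>RR ?B\<^esub> b"] by simp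
    qed
    show ?thesis using gen[OF h] C r r' by (simp add: N.R.minus_r_distr)
  qed
  moreover define u where "u = A.ssub ?q (pd X i s f) g"
  have u: "u \<in> Hom S X (srt ?q)" "io ?A ?q u = io ?A ?q (pd X i s f) \<ominus>\<^bsub>RR ?A\<^esub> io ?A ?q g"
    using A.ssub_car[of "pd X i s f" ?q g] A.inc_ssub[of "pd X i s f" ?q g] pdh g by (simp_all add: u_def)
  have "evr ?B X ?x (io ?A ?q u) = evr ?B X ?x (io ?A ?q (pd X i s f)) \<ominus>\<^bsub>RR ?B\<^esub> evr ?B X ?x (io ?A ?q g)"
    unfolding u(2) using pdh g by (intro ring_hom_minus'[OF _ _ evr_hom[OF tgt.rep_obj fx]]) simp_all
  then have "io ?B ?q (ev S ?B X ?q u ?x) = ?d \<ominus>\<^bsub>RR ?B\<^esub> ?d'"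
    by (simp add: evr_io[OF tgt.rep_obj fx])
  ultimately have "u = szero (NN ?A) ?q"
    by (intro eps_cancel[OF u(1), where p = ?p and r = "r \<ominus>\<^bsub>RR ?B\<^esub> r'"]) (use r r' in \<open>simp_all add: V[symmetric]\<close>)
  then have "io ?A ?q (pd X i s f) \<ominus>\<^bsub>RR ?A\<^esub> io ?A ?q g = \<zero>\<^bsub>RR ?A\<^esub>" using u(2) A.inc_szero by simp
  then have "io ?A ?q (pd X i s f) = io ?A ?q g" using pdh g by (subst (asm) A.R.minus_zero_iff) simp_all
  then show ?thesis by (rule io_eq_iff[THEN iffD1])
qed

end

section \<open>Taylor expansion and the chain rule\<close>

text \<open>
  The remainder of an expansion in several variables accumulates by addition.
\<close>

definition add_closed :: "('a, 'm) ring_scheme \<Rightarrow> 'a set \<Rightarrow> bool" where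
  "add_closed R J \<longleftrightarrow> J \<subseteq> carrier R \<and> \<zero>\<^bsub>R\<^esub> \<in> J \<and> (\<forall>x\<in>J. \<forall>y\<in>J. x \<oplus>\<^bsub>R\<^esub> y \<in> J)"

context super_fermat_theory
begin

lemma fam_partial:
  assumes B: "B \<in> Obj (Alg S)" and b: "fam B X b" and d: "fam B X d"
  shows "fam B X (\<lambda>i. if i < n then sadd (NN B) (gr X i) (b i) (d i) else b i)"
  using assms by (auto simp: fam_def)

context
  fixes B :: "('s, 'v) alg" and X b d I
  assumes B: "B \<in> Obj (Alg S)" and b: "fam B X b" and d: "fam B X d"
    and I: "add_closed (RR B) I" and I_mult: "\<And>x r. x \<in> I \<Longrightarrow> r \<in> carrier (RR B) \<Longrightarrow> x \<otimes>\<^bsub>RR B\<^esub> r \<in> I"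
    and dI: "\<And>i. i < len X \<Longrightarrow> io B (gr X i) (d i) \<in> I"
begin

interpretation N: supercommutative "NN B"
  by (rule NN_super[OF B])

text \<open>
  The coordinates are displaced one after the other.
\<close>

lemma partial_step:
  assumes f: "f \<in> Hom S X (srt s)" and n: "n < len X"
  shows "\<exists>r\<in>carrier (RR B). io B s (ev S B X s f (\<lambda>i. if i < Suc n then sadd (NN B) (gr X i) (b i) (d i) else b i))
    = io B s (ev S B X s f (\<lambda>i. if i < n then sadd (NN B) (gr X i) (b i) (d i) else b i)) \<oplus>\<^bsub>RR B\<^esub>
      (io B (gr X n) (d n) \<otimes>\<^bsub>RR B\<^esub> io B (gr X n + s) (ev S B X (gr X n + s) (pd X n s f) (\<lambda>i. if i < n then sadd (NN B) (gr X i) (b i) (d i) else b i))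
        \<oplus>\<^bsub>RR B\<^esub> io B (gr X n) (d n) \<otimes>\<^bsub>RR B\<^esub> (io B (gr X n) (d n) \<otimes>\<^bsub>RR B\<^esub> r))"
proof -
  let ?b = "\<lambda>i. if i < n then sadd (NN B) (gr X i) (b i) (d i) else b i"
  have "(\<lambda>i. if i < Suc n then sadd (NN B) (gr X i) (b i) (d i) else b i) = ?b(n := sadd (NN B) (gr X n) (?b n) (d n))"
    by (auto simp: fun_eq_iff less_Suc_eq)
  then show ?thesis using taylor_one_variable[OF B fam_partial[OF B b d] f n, of "d n" n] d n by (auto simp: fam_def)
qed

text \<open>
  The coarse estimate: \<open>f(b + d) - f(b)\<close> lies in an ideal containing the increments. It is applied to
  the derivatives of \<open>f\<close> in the proof of \<open>taylor_partial\<close>.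
\<close>

lemma taylor_ideal_partial:
  assumes f: "f \<in> Hom S X (srt s)" and n: "n \<le> len X"
  shows "\<exists>t\<in>I. io B s (ev S B X s f (\<lambda>i. if i < n then sadd (NN B) (gr X i) (b i) (d i) else b i))
    = io B s (ev S B X s f b) \<oplus>\<^bsub>RR B\<^esub> t"
  using n
proof (induction n)
  case 0
  then show ?case using I B b f by (intro bexI[of _ "\<zero>\<^bsub>RR B\<^esub>"]) (auto simp: add_closed_def)
next
  case (Suc n)
  then obtain t where t: "t \<in> I" "io B s (ev S B X s f (\<lambda>i. if i < n then sadd (NN B) (gr X i) (b i) (d i) else b i))
    = io B s (ev S B X s f b) \<oplus>\<^bsub>RR B\<^esub> t" by auto
  let ?D = "io B (gr X n + s) (ev S B X (gr X n + s) (pd X n s f) (\<lambda>i. if i < n then sadd (NN B) (gr X i) (b i) (d i) else b i))"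
  let ?d = "io B (gr X n) (d n)"
  obtain r where r: "r \<in> carrier (RR B)" and eq: "io B s (ev S B X s f (\<lambda>i. if i < Suc n then sadd (NN B) (gr X i) (b i) (d i) else b i))
    = (io B s (ev S B X s f b) \<oplus>\<^bsub>RR B\<^esub> t) \<oplus>\<^bsub>RR B\<^esub> (?d \<otimes>\<^bsub>RR B\<^esub> ?D \<oplus>\<^bsub>RR B\<^esub> ?d \<otimes>\<^bsub>RR B\<^esub> (?d \<otimes>\<^bsub>RR B\<^esub> r))"
    using partial_step[OF f, of n] Suc.prems unfolding t(2) by auto
  have D: "?D \<in> carrier (RR B)" using B f Suc.prems fam_partial[OF B b d, of n] by simp
  have dd: "?d \<in> I" using dI Suc.prems by simp
  have ddr: "?d \<in> carrier (RR B)" using dd I by (auto simp: add_closed_def)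
  define t' where "t' = ?d \<otimes>\<^bsub>RR B\<^esub> ?D \<oplus>\<^bsub>RR B\<^esub> ?d \<otimes>\<^bsub>RR B\<^esub> (?d \<otimes>\<^bsub>RR B\<^esub> r)"
  have t': "t' \<in> I" unfolding t'_def using I I_mult[OF dd D] I_mult[OF dd N.R.m_closed[OF ddr r]] by (simp add: add_closed_def)
  have "t \<in> carrier (RR B)" "t' \<in> carrier (RR B)" "io B s (ev S B X s f b) \<in> carrier (RR B)"
    using t t' I B b f by (auto simp: add_closed_def)
  then have "io B s (ev S B X s f (\<lambda>i. if i < Suc n then sadd (NN B) (gr X i) (b i) (d i) else b i))
    = io B s (ev S B X s f b) \<oplus>\<^bsub>RR B\<^esub> (t \<oplus>\<^bsub>RR B\<^esub> t')"
    unfolding eq t'_def[symmetric] by (simp add: N.R.a_assoc)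
  moreover have "t \<oplus>\<^bsub>RR B\<^esub> t' \<in> I" using I t t' by (simp add: add_closed_def)
  ultimately show ?case by blast
qed

text \<open>
  Displacing the next coordinate contributes \<open>d\<^sub>n (\<partial>\<^sub>n f)\<close> at a point that is already partly displaced; by
  \<open>taylor_ideal_partial\<close> moving it back to \<open>b\<close> costs only a product of two elements of \<open>I\<close>.
\<close>

lemma taylor_partial:
  assumes J: "add_closed (RR B) J" and IJ: "\<And>x y. x \<in> I \<Longrightarrow> y \<in> I \<Longrightarrow> x \<otimes>\<^bsub>RR B\<^esub> y \<in> J"
    and f: "f \<in> Hom S X (srt s)" and n: "n \<le> len X"
  shows "\<exists>t\<in>J. io B s (ev S B X s f (\<lambda>i. if i < n then sadd (NN B) (gr X i) (b i) (d i) else b i))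
    = io B s (ev S B X s f b) \<oplus>\<^bsub>RR B\<^esub> (\<Oplus>\<^bsub>RR B\<^esub>i\<in>{..<n}. io B (gr X i) (d i) \<otimes>\<^bsub>RR B\<^esub> io B (gr X i + s) (ev S B X (gr X i + s) (pd X i s f) b)) \<oplus>\<^bsub>RR B\<^esub> t"
  using n
proof (induction n)
  case 0
  then show ?case using J B b f by (intro bexI[of _ "\<zero>\<^bsub>RR B\<^esub>"]) (auto simp: add_closed_def)
next
  case (Suc n)
  let ?F = "io B s (ev S B X s f b)"
  let ?m = "\<lambda>i. io B (gr X i) (d i) \<otimes>\<^bsub>RR B\<^esub> io B (gr X i + s) (ev S B X (gr X i + s) (pd X i s f) b)"
  let ?\<Sigma> = "\<Oplus>\<^bsub>RR B\<^esub>i\<in>{..<n}. ?m i"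
  let ?D = "io B (gr X n + s) (ev S B X (gr X n + s) (pd X n s f) b)"
  let ?d = "io B (gr X n) (d n)"
  have pdn: "pd X n s f \<in> Hom S X (srt (gr X n + s))" using f Suc.prems by simp
  obtain t where t: "t \<in> J" "io B s (ev S B X s f (\<lambda>i. if i < n then sadd (NN B) (gr X i) (b i) (d i) else b i))
    = ?F \<oplus>\<^bsub>RR B\<^esub> ?\<Sigma> \<oplus>\<^bsub>RR B\<^esub> t" using Suc by auto
  obtain u where u: "u \<in> I" "io B (gr X n + s) (ev S B X (gr X n + s) (pd X n s f) (\<lambda>i. if i < n then sadd (NN B) (gr X i) (b i) (d i) else b i))
     = ?D \<oplus>\<^bsub>RR B\<^esub> u" using taylor_ideal_partial[OF pdn, of n] Suc.prems by auto
  obtain r where r: "r \<in> carrier (RR B)" and eq: "io B s (ev S B X s f (\<lambda>i. if i < Suc n then sadd (NN B) (gr X i) (b i) (d i) else b i))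
    = (?F \<oplus>\<^bsub>RR B\<^esub> ?\<Sigma> \<oplus>\<^bsub>RR B\<^esub> t) \<oplus>\<^bsub>RR B\<^esub> (?d \<otimes>\<^bsub>RR B\<^esub> (?D \<oplus>\<^bsub>RR B\<^esub> u) \<oplus>\<^bsub>RR B\<^esub> ?d \<otimes>\<^bsub>RR B\<^esub> (?d \<otimes>\<^bsub>RR B\<^esub> r))"
    using partial_step[OF f, of n] Suc.prems unfolding t(2) u(2) by auto
  have dd: "?d \<in> I" using dI Suc.prems by simp
  have m: "?m i \<in> carrier (RR B)" if "i < len X" for i
    using dI[OF that] I B b f that by (auto simp: add_closed_def)
  have C: "?D \<in> carrier (RR B)" "?d \<in> carrier (RR B)" "?F \<in> carrier (RR B)" "t \<in> carrier (RR B)" "u \<in> carrier (RR B)"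
    using dd I J t u B b f pdn by (auto simp: add_closed_def)
  have \<Sigma>: "?\<Sigma> \<in> carrier (RR B)" using m Suc.prems by (intro N.R.finsum_closed) auto
  have S': "(\<Oplus>\<^bsub>RR B\<^esub>i\<in>{..<Suc n}. ?m i) = ?m n \<oplus>\<^bsub>RR B\<^esub> ?\<Sigma>"
    unfolding lessThan_Suc using m Suc.prems by (intro N.R.finsum_insert) auto
  define t' where "t' = ?d \<otimes>\<^bsub>RR B\<^esub> u \<oplus>\<^bsub>RR B\<^esub> ?d \<otimes>\<^bsub>RR B\<^esub> (?d \<otimes>\<^bsub>RR B\<^esub> r)"
  have t': "t' \<in> J" unfolding t'_def using J IJ[OF dd u(1)] IJ[OF dd I_mult[OF dd r]] by (simp add: add_closed_def)
  have gen: "(F \<oplus>\<^bsub>RR B\<^esub> s1 \<oplus>\<^bsub>RR B\<^esub> t) \<oplus>\<^bsub>RR B\<^esub> ((a \<oplus>\<^bsub>RR B\<^esub> c) \<oplus>\<^bsub>RR B\<^esub> e) = F \<oplus>\<^bsub>RR B\<^esub> (a \<oplus>\<^bsub>RR B\<^esub> s1) \<oplus>\<^bsub>RR B\<^esub> (t \<oplus>\<^bsub>RR B\<^esub> (c \<oplus>\<^bsub>RR B\<^esub> e))"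
    if "F \<in> carrier (RR B)" "s1 \<in> carrier (RR B)" "t \<in> carrier (RR B)" "a \<in> carrier (RR B)" "c \<in> carrier (RR B)" "e \<in> carrier (RR B)" for F s1 t a c e
    using that by (simp add: N.R.a_ac)
  have "io B s (ev S B X s f (\<lambda>i. if i < Suc n then sadd (NN B) (gr X i) (b i) (d i) else b i))
    = ?F \<oplus>\<^bsub>RR B\<^esub> (?m n \<oplus>\<^bsub>RR B\<^esub> ?\<Sigma>) \<oplus>\<^bsub>RR B\<^esub> (t \<oplus>\<^bsub>RR B\<^esub> t')"
    unfolding eq t'_def N.R.r_distr[OF C(1) C(5) C(2)] using C r \<Sigma> by (intro gen) auto
  moreover have "t \<oplus>\<^bsub>RR B\<^esub> t' \<in> J" using J t t' by (simp add: add_closed_def)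
  ultimately show ?case unfolding S' by blast
qed

lemma taylor:
  assumes J: "add_closed (RR B) J" and IJ: "\<And>x y. x \<in> I \<Longrightarrow> y \<in> I \<Longrightarrow> x \<otimes>\<^bsub>RR B\<^esub> y \<in> J"
    and f: "f \<in> Hom S X (srt s)"
  shows "\<exists>t\<in>J. io B s (ev S B X s f (\<lambda>i. sadd (NN B) (gr X i) (b i) (d i)))
    = io B s (ev S B X s f b) \<oplus>\<^bsub>RR B\<^esub> (\<Oplus>\<^bsub>RR B\<^esub>i\<in>{..<len X}. io B (gr X i) (d i) \<otimes>\<^bsub>RR B\<^esub> io B (gr X i + s) (ev S B X (gr X i + s) (pd X i s f) b)) \<oplus>\<^bsub>RR B\<^esub> t"
proof -
  have "ev S B X s f (\<lambda>i. sadd (NN B) (gr X i) (b i) (d i)) = ev S B X s f (\<lambda>i. if i < len X then sadd (NN B) (gr X i) (b i) (d i) else b i)"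
    by (rule tgt.ev_cong) simp
  then show ?thesis using taylor_partial[OF J IJ f order_refl] by simp
qed

end

text \<open>
  The Taylor expansions of the inner arrows in the direction of \<open>\<epsilon>\<close> are inserted into the one of the outer
  arrow. All increments lie in the ideal \<open>I\<close> of multiples of \<open>\<epsilon>\<close>, so the remainder is in \<open>J = \<epsilon>\<^sup>2 R\<close>, and
  \<open>pd_unique\<close> identifies the coefficient of \<open>\<epsilon>\<close> with the derivative of the composite.
\<close>

lemma pd_chain:
  assumes f: "\<And>j. j < len Y \<Longrightarrow> f j \<in> Hom S X (srt (gr Y j))" and g: "g \<in> Hom S Y (srt s)" and i: "i < len X"
  shows "io (rep S X) (gr X i + s) (pd X i s (Comp S X Y (srt s) g (tup S X Y f)))
    = (\<Oplus>\<^bsub>RR (rep S X)\<^esub>j\<in>{..<len Y}. io (rep S X) (gr X i + gr Y j) (pd X i (gr Y j) (f j)) \<otimes>\<^bsub>RR (rep S X)\<^esub>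
        io (rep S X) (gr Y j + s) (Comp S X Y (srt (gr Y j + s)) (pd Y j s g) (tup S X Y f)))"
proof -
  let ?p = "gr X i" and ?A = "rep S X" and ?V = "X2 (gr X i) X"
  let ?B = "rep S ?V" and ?gf = "Comp S X Y (srt s) g (tup S X Y f)"
  let ?h = "\<lambda>j. Comp S X Y (srt (gr Y j + s)) (pd Y j s g) (tup S X Y f)"
  interpret N: supercommutative "NN ?B" by (rule NN_super) simp
  interpret A: supercommutative "NN ?A" by (rule NN_super) simp
  let ?x = "xs ?p X"
  let ?x' = "?x(i := sadd (NN ?B) ?p (?x i) (eps ?p X))"
  let ?e = "io ?B ?p (eps ?p X)"
  have fx: "fam ?B X ?x" by simp
  have fx': "fam ?B X ?x'" using fx i by (auto simp: fam_def)
  have e: "?e \<in> carrier (RR ?B)" by simp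
  have tf: "tup S X Y f \<in> Hom S X Y" using f by simp
  have h: "?h j \<in> Hom S X (srt (gr Y j + s))" if "j < len Y" for j using that g tf by simp
  have pf: "pd X i (gr Y j) (f j) \<in> Hom S X (srt (?p + gr Y j))" if "j < len Y" for j using that f i by simp
  define z where "z = (\<Oplus>\<^bsub>RR ?A\<^esub>j\<in>{..<len Y}. io ?A (?p + gr Y j) (pd X i (gr Y j) (f j)) \<otimes>\<^bsub>RR ?A\<^esub> io ?A (gr Y j + s) (?h j))"
  have hz: "A.hmg (?p + s) z" unfolding z_def
  proof (rule A.hmg_finsum)
    fix j assume "j \<in> {..<len Y}"
    then have "A.hmg (?p + gr Y j) (io ?A (?p + gr Y j) (pd X i (gr Y j) (f j)))" "A.hmg (gr Y j + s) (io ?A (gr Y j + s) (?h j))"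
      using pf h by (auto intro!: A.hmg_inc)
    moreover have "?p + s = (?p + gr Y j) + (gr Y j + s)" by (simp add: add.assoc)
    ultimately show "A.hmg (?p + s) (io ?A (?p + gr Y j) (pd X i (gr Y j) (f j)) \<otimes>\<^bsub>RR ?A\<^esub> io ?A (gr Y j + s) (?h j))"
      by (rule A.hmg_mult)
  qed simp
  define D where "D = cmp (?p + s) z"
  have D: "D \<in> Hom S X (srt (?p + s))" "io ?A (?p + s) D = z"
    using A.cmp_car[OF A.hmg_carrier[OF hz], of "?p + s"] A.hmg_cmp[OF hz] by (simp_all add: D_def)
  \<comment> \<open>the components of the inner arrow, expanded in the direction of the fresh variable\<close>
  let ?a = "\<lambda>j. io ?B (?p + gr Y j) (ev S ?B X (?p + gr Y j) (pd X i (gr Y j) (f j)) ?x)"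
  let ?c = "\<lambda>j. io ?B (gr Y j + s) (ev S ?B X (gr Y j + s) (?h j) ?x)"
  let ?b = "\<lambda>j. ev S ?B X (gr Y j) (f j) ?x" and ?b' = "\<lambda>j. ev S ?B X (gr Y j) (f j) ?x'"
  have "\<forall>j\<in>{..<len Y}. \<exists>r. r \<in> carrier (RR ?B) \<and> io ?B (gr Y j) (?b' j) = io ?B (gr Y j) (?b j) \<oplus>\<^bsub>RR ?B\<^esub> (?e \<otimes>\<^bsub>RR ?B\<^esub> ?a j \<oplus>\<^bsub>RR ?B\<^esub> ?e \<otimes>\<^bsub>RR ?B\<^esub> (?e \<otimes>\<^bsub>RR ?B\<^esub> r))"
    using taylor_one_variable[OF tgt.rep_obj fx f i, of _ "eps ?p X"] by auto
  from bchoice[OF this] obtain r where rr: "\<forall>j\<in>{..<len Y}. r j \<in> carrier (RR ?B) \<and> io ?B (gr Y j) (?b' j) = io ?B (gr Y j) (?b j) \<oplus>\<^bsub>RR ?B\<^esub> (?e \<otimes>\<^bsub>RR ?B\<^esub> ?a j \<oplus>\<^bsub>RR ?B\<^esub> ?e \<otimes>\<^bsub>RR ?B\<^esub> (?e \<otimes>\<^bsub>RR ?B\<^esub> r j))" ..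
  have r: "\<And>j. j < len Y \<Longrightarrow> r j \<in> carrier (RR ?B)" and
    br: "\<And>j. j < len Y \<Longrightarrow> io ?B (gr Y j) (?b' j) = io ?B (gr Y j) (?b j) \<oplus>\<^bsub>RR ?B\<^esub> (?e \<otimes>\<^bsub>RR ?B\<^esub> ?a j \<oplus>\<^bsub>RR ?B\<^esub> ?e \<otimes>\<^bsub>RR ?B\<^esub> (?e \<otimes>\<^bsub>RR ?B\<^esub> r j))"
    using rr by blast+
  have a: "?a j \<in> carrier (RR ?B)" if "j < len Y" for j using tgt.ev_in[OF tgt.rep_obj pf[OF that] fx] by simp
  have c: "?c j \<in> carrier (RR ?B)" if "j < len Y" for j using tgt.ev_in[OF tgt.rep_obj h[OF that] fx] by simp
  have fb: "fam ?B Y ?b" "fam ?B Y ?b'" using f fx fx' by (auto intro!: tgt.fam_ev)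
  have bin: "?b j \<in> car (NN ?B) (gr Y j)" "?b' j \<in> car (NN ?B) (gr Y j)" if "j < len Y" for j
    using fb that by (auto simp: fam_def)
  define d where "d j = N.ssub (gr Y j) (?b' j) (?b j)" for j
  have fd: "fam ?B Y d" using N.ssub_car[OF bin(2) bin(1)] by (simp add: fam_def d_def)
  have bd: "sadd (NN ?B) (gr Y j) (?b j) (d j) = ?b' j" if "j < len Y" for j
    unfolding d_def by (rule N.sadd_ssub[OF bin(2,1)[OF that]])
  have iod: "io ?B (gr Y j) (d j) = ?e \<otimes>\<^bsub>RR ?B\<^esub> ?a j \<oplus>\<^bsub>RR ?B\<^esub> ?e \<otimes>\<^bsub>RR ?B\<^esub> (?e \<otimes>\<^bsub>RR ?B\<^esub> r j)" if "j < len Y" for j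
    unfolding d_def N.inc_ssub[OF bin(2,1)[OF that]]
    by (rule N.R.minus_eq_iff[THEN iffD2, OF _ _ _ br[OF that]])
      (use N.inc_carrier[OF bin(1)[OF that]] N.inc_carrier[OF bin(2)[OF that]] a[OF that] e r[OF that] in simp_all)
  define I where "I = {?e \<otimes>\<^bsub>RR ?B\<^esub> r | r. r \<in> carrier (RR ?B)}"
  define J where "J = {?e \<otimes>\<^bsub>RR ?B\<^esub> (?e \<otimes>\<^bsub>RR ?B\<^esub> r) | r. r \<in> carrier (RR ?B)}"
  have I: "add_closed (RR ?B) I" unfolding add_closed_def I_def
  proof (intro conjI ballI)
    show "\<zero>\<^bsub>RR ?B\<^esub> \<in> {?e \<otimes>\<^bsub>RR ?B\<^esub> r | r. r \<in> carrier (RR ?B)}" using e by (auto intro!: exI[of _ "\<zero>\<^bsub>RR ?B\<^esub>"])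
  qed (use e in \<open>auto simp: N.R.r_distr[symmetric]\<close>)
  have J: "add_closed (RR ?B) J" unfolding add_closed_def J_def
  proof (intro conjI ballI)
    show "\<zero>\<^bsub>RR ?B\<^esub> \<in> {?e \<otimes>\<^bsub>RR ?B\<^esub> (?e \<otimes>\<^bsub>RR ?B\<^esub> r) | r. r \<in> carrier (RR ?B)}" using e by (auto intro!: exI[of _ "\<zero>\<^bsub>RR ?B\<^esub>"])
  qed (use e in \<open>auto simp: N.R.r_distr[symmetric]\<close>)
  have I_mult: "x \<otimes>\<^bsub>RR ?B\<^esub> r \<in> I" if "x \<in> I" "r \<in> carrier (RR ?B)" for x r
    using that e by (auto simp: I_def N.R.m_assoc)
  have IJ: "x \<otimes>\<^bsub>RR ?B\<^esub> y \<in> J" if xy: "x \<in> I" "y \<in> I" for x y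
  proof -
    obtain u v where u: "u \<in> carrier (RR ?B)" "x = ?e \<otimes>\<^bsub>RR ?B\<^esub> u" and v: "v \<in> carrier (RR ?B)" "y = ?e \<otimes>\<^bsub>RR ?B\<^esub> v"
      using xy by (auto simp: I_def)
    obtain u' where u': "u' \<in> carrier (RR ?B)" "u \<otimes>\<^bsub>RR ?B\<^esub> ?e = ?e \<otimes>\<^bsub>RR ?B\<^esub> u'"
      using N.commute_past[of "eps ?p X" ?p u] u by auto
    have "x \<otimes>\<^bsub>RR ?B\<^esub> y = ?e \<otimes>\<^bsub>RR ?B\<^esub> ((u \<otimes>\<^bsub>RR ?B\<^esub> ?e) \<otimes>\<^bsub>RR ?B\<^esub> v)" using u v e by (simp add: N.R.m_assoc)
    also have "\<dots> = ?e \<otimes>\<^bsub>RR ?B\<^esub> (?e \<otimes>\<^bsub>RR ?B\<^esub> (u' \<otimes>\<^bsub>RR ?B\<^esub> v))" unfolding u'(2) using u' v e by (simp add: N.R.m_assoc)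
    finally show ?thesis using u' v by (auto simp: J_def)
  qed
  have dI: "io ?B (gr Y j) (d j) \<in> I" if j: "j < len Y" for j
  proof -
    have "io ?B (gr Y j) (d j) = ?e \<otimes>\<^bsub>RR ?B\<^esub> (?a j \<oplus>\<^bsub>RR ?B\<^esub> ?e \<otimes>\<^bsub>RR ?B\<^esub> r j)"
      unfolding iod[OF j] using e a[OF j] r[OF j] by (simp add: N.R.r_distr)
    then show ?thesis unfolding I_def using e a[OF j] r[OF j] by blast
  qed
  have gb: "ev S ?B X s ?gf y = ev S ?B Y s g (\<lambda>j. ev S ?B X (gr Y j) (f j) y)" if "fam ?B X y" for y
    by (rule tgt.ev_comp_tup[OF tgt.rep_obj that f g])
  have hb: "ev S ?B Y (gr Y j + s) (pd Y j s g) ?b = ev S ?B X (gr Y j + s) (?h j) ?x" if "j < len Y" for j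
    using tgt.ev_comp_tup[OF tgt.rep_obj fx f, of "pd Y j s g" "gr Y j + s"] g that by simp
  obtain t where "t \<in> J" and t: "io ?B s (ev S ?B Y s g (\<lambda>j. sadd (NN ?B) (gr Y j) (?b j) (d j)))
    = io ?B s (ev S ?B Y s g ?b) \<oplus>\<^bsub>RR ?B\<^esub> (\<Oplus>\<^bsub>RR ?B\<^esub>j\<in>{..<len Y}. io ?B (gr Y j) (d j) \<otimes>\<^bsub>RR ?B\<^esub> io ?B (gr Y j + s) (ev S ?B Y (gr Y j + s) (pd Y j s g) ?b)) \<oplus>\<^bsub>RR ?B\<^esub> t"
    using taylor[OF tgt.rep_obj fb(1) fd I I_mult dI J IJ g] by blast
  then obtain \<rho> where \<rho>: "\<rho> \<in> carrier (RR ?B)" "t = ?e \<otimes>\<^bsub>RR ?B\<^esub> (?e \<otimes>\<^bsub>RR ?B\<^esub> \<rho>)" by (auto simp: J_def)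
  let ?T = "\<Oplus>\<^bsub>RR ?B\<^esub>j\<in>{..<len Y}. ?a j \<otimes>\<^bsub>RR ?B\<^esub> ?c j" and ?U = "\<Oplus>\<^bsub>RR ?B\<^esub>j\<in>{..<len Y}. r j \<otimes>\<^bsub>RR ?B\<^esub> ?c j"
  have TU: "?T \<in> carrier (RR ?B)" "?U \<in> carrier (RR ?B)" using a c r by (auto intro!: N.R.finsum_closed)
  have ac: "(\<lambda>j. ?a j \<otimes>\<^bsub>RR ?B\<^esub> ?c j) \<in> {..<len Y} \<rightarrow> carrier (RR ?B)" "(\<lambda>j. r j \<otimes>\<^bsub>RR ?B\<^esub> ?c j) \<in> {..<len Y} \<rightarrow> carrier (RR ?B)"
    "(\<lambda>j. ?e \<otimes>\<^bsub>RR ?B\<^esub> (?a j \<otimes>\<^bsub>RR ?B\<^esub> ?c j)) \<in> {..<len Y} \<rightarrow> carrier (RR ?B)"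
    "(\<lambda>j. ?e \<otimes>\<^bsub>RR ?B\<^esub> (?e \<otimes>\<^bsub>RR ?B\<^esub> (r j \<otimes>\<^bsub>RR ?B\<^esub> ?c j))) \<in> {..<len Y} \<rightarrow> carrier (RR ?B)"
    "(\<lambda>j. ?e \<otimes>\<^bsub>RR ?B\<^esub> (r j \<otimes>\<^bsub>RR ?B\<^esub> ?c j)) \<in> {..<len Y} \<rightarrow> carrier (RR ?B)"
    using a c r e by auto
  have "(\<Oplus>\<^bsub>RR ?B\<^esub>j\<in>{..<len Y}. io ?B (gr Y j) (d j) \<otimes>\<^bsub>RR ?B\<^esub> io ?B (gr Y j + s) (ev S ?B Y (gr Y j + s) (pd Y j s g) ?b))
    = (\<Oplus>\<^bsub>RR ?B\<^esub>j\<in>{..<len Y}. ?e \<otimes>\<^bsub>RR ?B\<^esub> (?a j \<otimes>\<^bsub>RR ?B\<^esub> ?c j) \<oplus>\<^bsub>RR ?B\<^esub> ?e \<otimes>\<^bsub>RR ?B\<^esub> (?e \<otimes>\<^bsub>RR ?B\<^esub> (r j \<otimes>\<^bsub>RR ?B\<^esub> ?c j)))"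
  proof (rule N.R.finsum_cong')
    fix j assume "j \<in> {..<len Y}"
    then have j: "j < len Y" by simp
    show "io ?B (gr Y j) (d j) \<otimes>\<^bsub>RR ?B\<^esub> io ?B (gr Y j + s) (ev S ?B Y (gr Y j + s) (pd Y j s g) ?b)
      = ?e \<otimes>\<^bsub>RR ?B\<^esub> (?a j \<otimes>\<^bsub>RR ?B\<^esub> ?c j) \<oplus>\<^bsub>RR ?B\<^esub> ?e \<otimes>\<^bsub>RR ?B\<^esub> (?e \<otimes>\<^bsub>RR ?B\<^esub> (r j \<otimes>\<^bsub>RR ?B\<^esub> ?c j))"
      unfolding hb[OF j] iod[OF j] using a[OF j] c[OF j] r[OF j] e by (simp add: N.R.l_distr N.R.m_assoc)
  qed (use ac in auto)
  also have "\<dots> = ?e \<otimes>\<^bsub>RR ?B\<^esub> ?T \<oplus>\<^bsub>RR ?B\<^esub> ?e \<otimes>\<^bsub>RR ?B\<^esub> (?e \<otimes>\<^bsub>RR ?B\<^esub> ?U)"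
    using N.R.finsum_addf[OF ac(3,4)] N.R.finsum_rdistr[OF _ e ac(1)] N.R.finsum_rdistr[OF _ e ac(2)] N.R.finsum_rdistr[OF _ e ac(5)]
    by simp
  finally have sum: "(\<Oplus>\<^bsub>RR ?B\<^esub>j\<in>{..<len Y}. io ?B (gr Y j) (d j) \<otimes>\<^bsub>RR ?B\<^esub> io ?B (gr Y j + s) (ev S ?B Y (gr Y j + s) (pd Y j s g) ?b))
    = ?e \<otimes>\<^bsub>RR ?B\<^esub> ?T \<oplus>\<^bsub>RR ?B\<^esub> ?e \<otimes>\<^bsub>RR ?B\<^esub> (?e \<otimes>\<^bsub>RR ?B\<^esub> ?U)" .
  have "ev S ?B Y s g (\<lambda>j. sadd (NN ?B) (gr Y j) (?b j) (d j)) = ev S ?B X s ?gf ?x'"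
    unfolding gb[OF fx'] by (rule tgt.ev_cong) (simp add: bd)
  then have E: "io ?B s (ev S ?B X s ?gf ?x') = io ?B s (ev S ?B X s ?gf ?x) \<oplus>\<^bsub>RR ?B\<^esub> (?e \<otimes>\<^bsub>RR ?B\<^esub> ?T \<oplus>\<^bsub>RR ?B\<^esub> ?e \<otimes>\<^bsub>RR ?B\<^esub> (?e \<otimes>\<^bsub>RR ?B\<^esub> ?U)) \<oplus>\<^bsub>RR ?B\<^esub> ?e \<otimes>\<^bsub>RR ?B\<^esub> (?e \<otimes>\<^bsub>RR ?B\<^esub> \<rho>)"
    using t unfolding sum \<rho>(2) gb[OF fx] by simp
  have gf: "?gf \<in> Hom S X (srt s)" using g tf by simp
  have F: "io ?B s (ev S ?B X s ?gf ?x) \<in> carrier (RR ?B)" using tgt.ev_in[OF tgt.rep_obj gf fx] by simp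
  have E2: "io ?B s (ev S ?B X s ?gf ?x') = io ?B s (ev S ?B X s ?gf ?x) \<oplus>\<^bsub>RR ?B\<^esub> (?e \<otimes>\<^bsub>RR ?B\<^esub> ?T \<oplus>\<^bsub>RR ?B\<^esub> ?e \<otimes>\<^bsub>RR ?B\<^esub> (?e \<otimes>\<^bsub>RR ?B\<^esub> (?U \<oplus>\<^bsub>RR ?B\<^esub> \<rho>)))"
    unfolding E using F TU e \<rho>(1) by (simp add: N.R.a_assoc N.R.r_distr)
  have "evr ?B X ?x z = (\<Oplus>\<^bsub>RR ?B\<^esub>j\<in>{..<len Y}. evr ?B X ?x (io ?A (?p + gr Y j) (pd X i (gr Y j) (f j)) \<otimes>\<^bsub>RR ?A\<^esub> io ?A (gr Y j + s) (?h j)))"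
    unfolding z_def using pf h by (intro ring_hom_finsum'[OF _ _ evr_hom[OF tgt.rep_obj fx]]) simp_all
  also have "\<dots> = ?T"
  proof (rule N.R.finsum_cong')
    fix j assume "j \<in> {..<len Y}"
    then have j: "j < len Y" by simp
    show "evr ?B X ?x (io ?A (?p + gr Y j) (pd X i (gr Y j) (f j)) \<otimes>\<^bsub>RR ?A\<^esub> io ?A (gr Y j + s) (?h j)) = ?a j \<otimes>\<^bsub>RR ?B\<^esub> ?c j"
      using ring_hom_mult[OF evr_hom[OF tgt.rep_obj fx], of "io ?A (?p + gr Y j) (pd X i (gr Y j) (f j))" "io ?A (gr Y j + s) (?h j)"] pf[OF j] h[OF j]
      by (simp add: evr_io[OF tgt.rep_obj fx])
  qed (use ac in auto)
  finally have "io ?B (?p + s) (ev S ?B X (?p + s) D ?x) = ?T"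
    unfolding D(2)[symmetric] evr_io[OF tgt.rep_obj fx] .
  then have "pd X i s ?gf = D"
    using pd_unique[OF gf i D(1) refl, of "?U \<oplus>\<^bsub>RR ?B\<^esub> \<rho>"] E2 TU \<rho>(1) by simp
  then show ?thesis using D(2) unfolding z_def by simp
qed

lemma pd_proj_same: "i < len X \<Longrightarrow> pd X i (gr X i) (proj S X i) = sone (NN (rep S X))"
proof -
  assume i: "i < len X"
  let ?p = "gr X i" and ?B = "rep S (X2 (gr X i) X)"
  interpret N: supercommutative "NN ?B" by (rule NN_super) simp
  let ?x = "xs ?p X" let ?x' = "?x(i := sadd (NN ?B) ?p (?x i) (eps ?p X))"
  have fx: "fam ?B X ?x" by simp
  have xi: "?x i \<in> Hom S (X2 ?p X) (srt ?p)" using fx i unfolding fam_def by simp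
  have fx': "fam ?B X ?x'" using fx i by (auto simp: fam_def)
  have 1: "ev S ?B X ?p (proj S X i) ?x' = sadd (NN ?B) ?p (?x i) (eps ?p X)"
    using tgt.ev_proj[OF tgt.rep_obj fx' i refl] by simp
  have 2: "ev S ?B X ?p (proj S X i) ?x = ?x i"
    using tgt.ev_proj[OF tgt.rep_obj fx i refl] by simp
  have 3: "ev S ?B X 0 (sone (NN (rep S X))) ?x = sone (NN ?B)" by (rule ev_sone[OF tgt.rep_obj fx])
  show ?thesis
  proof (rule pd_unique[OF _ i _ refl N.R.zero_closed])
    show "proj S X i \<in> Hom S X (srt ?p)" using i by simp
    show "sone (NN (rep S X)) \<in> Hom S X (srt (?p + ?p))" by simp
  qed (use N.inc_sadd[of "?x i" ?p "eps ?p X"] N.inc_sone xi in \<open>simp add: 1 2 3\<close>)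
qed

lemma pd_proj_other:
  assumes i: "i < len X" and k: "k < len X" and ik: "i \<noteq> k"
  shows "pd X i (gr X k) (proj S X k) = szero (NN (rep S X)) (gr X i + gr X k)"
proof -
  let ?p = "gr X i" and ?B = "rep S (X2 (gr X i) X)"
  interpret N: supercommutative "NN ?B" by (rule NN_super) simp
  let ?x = "xs ?p X" let ?x' = "?x(i := sadd (NN ?B) ?p (?x i) (eps ?p X))"
  have fx: "fam ?B X ?x" by simp
  have xk: "?x k \<in> Hom S (X2 ?p X) (srt (gr X k))" using fx k unfolding fam_def by simp
  have fx': "fam ?B X ?x'" using fx i by (auto simp: fam_def)
  have 1: "ev S ?B X (gr X k) (proj S X k) ?x' = ?x k"
    using tgt.ev_proj[OF tgt.rep_obj fx' k refl] ik by simp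
  have 2: "ev S ?B X (gr X k) (proj S X k) ?x = ?x k"
    using tgt.ev_proj[OF tgt.rep_obj fx k refl] by simp
  have 3: "ev S ?B X q (szero (NN (rep S X)) q) ?x = szero (NN ?B) q" for q by (rule ev_szero[OF tgt.rep_obj fx])
  show ?thesis
  proof (rule pd_unique[OF _ i _ refl N.R.zero_closed])
    show "proj S X k \<in> Hom S X (srt (gr X k))" using k by simp
    show "szero (NN (rep S X)) (?p + gr X k) \<in> Hom S X (srt (?p + gr X k))" by simp
  qed (use N.inc_szero xk in \<open>simp add: 1 2 3\<close>)
qed

lemma ev_op_add: "ev S B (srt p + srt p) p (op_add p) a = sadd (NN B) p (a 0) (a (Suc 0))"
  unfolding NN_sadd by (rule tgt.ev_cong) (auto simp: less_Suc_eq)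

lemma ev_op_mul: "ev S B (srt p + srt q) (p + q) (op_mul p q) a = smul (NN B) p q (a (mi p q)) (a (Suc 0 - mi p q))"
  unfolding NN_smul by (rule tgt.ev_cong) (auto dest: less_2_mi)

lemma pd_op_add: "i < 2 \<Longrightarrow> pd (srt p + srt p) i p (op_add p) = sone (NN (rep S (srt p + srt p)))"
proof -
  assume i: "i < 2"
  let ?X = "srt p + srt p"
  have il: "i < len ?X" using i by simp
  have g: "gr ?X i = p" using i by (cases "i = 0") (auto simp: less_Suc_eq numeral_2_eq_2)
  let ?B = "rep S (X2 p ?X)"
  interpret N: supercommutative "NN ?B" by (rule NN_super) simp
  let ?x = "xs p ?X" let ?x' = "?x(i := sadd (NN ?B) p (?x i) (eps p ?X))"
  have fx: "fam ?B ?X ?x" by simp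
  have x01: "?x 0 \<in> car (NN ?B) p" "?x (Suc 0) \<in> car (NN ?B) p" using fx[unfolded fam_def, rule_format, of 0] fx[unfolded fam_def, rule_format, of "Suc 0"] by simp_all
  have ep: "eps p ?X \<in> car (NN ?B) p" by simp
  have 3: "ev S ?B ?X 0 (sone (NN (rep S ?X))) ?x = sone (NN ?B)" by (rule ev_sone[OF tgt.rep_obj fx])
  have C: "io ?B p (?x 0) \<in> carrier (RR ?B)" "io ?B p (?x (Suc 0)) \<in> carrier (RR ?B)" "io ?B p (eps p ?X) \<in> carrier (RR ?B)"
    using x01 ep by (simp_all del: car_under)
  consider "i = 0" | "i = Suc 0" using i by linarith
  then have "io ?B p (sadd (NN ?B) p (?x' 0) (?x' (Suc 0))) = io ?B p (sadd (NN ?B) p (?x 0) (?x (Suc 0))) \<oplus>\<^bsub>RR ?B\<^esub> io ?B p (eps p ?X)"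
    by cases (use x01 ep C in \<open>simp_all add: N.inc_sadd N.R.a_ac del: car_under\<close>)
  then show ?thesis
    by (intro pd_unique[OF op_add_hom il _ _ N.R.zero_closed])
      (use C N.inc_sone ep in \<open>simp_all add: g ev_op_add[unfolded One_nat_def] 3 del: car_under fun_upd_apply\<close>)
qed

lemma pd_op_mul_left:
  "pd (srt p + srt q) (mi p q) (p + q) (op_mul p q) = proj S (srt p + srt q) (Suc 0 - mi p q)"
proof -
  let ?X = "srt p + srt q" and ?i = "mi p q" and ?k = "Suc 0 - mi p q"
  have il: "?i < len ?X" "?k < len ?X" by simp_all
  let ?B = "rep S (X2 p ?X)"
  interpret N: supercommutative "NN ?B" by (rule NN_super) simp
  let ?x = "xs p ?X" let ?x' = "?x(?i := sadd (NN ?B) p (?x ?i) (eps p ?X))"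
  have fx: "fam ?B ?X ?x" by simp
  have x01: "?x ?i \<in> car (NN ?B) p" "?x ?k \<in> car (NN ?B) q" using fx[unfolded fam_def, rule_format, OF il(1)] fx[unfolded fam_def, rule_format, OF il(2)] by simp_all
  have ep: "eps p ?X \<in> car (NN ?B) p" by simp
  have 3: "ev S ?B ?X q (proj S ?X ?k) ?x = ?x ?k" using tgt.ev_proj[OF tgt.rep_obj fx il(2), of q] by simp
  have C: "io ?B p (?x ?i) \<in> carrier (RR ?B)" "io ?B q (?x ?k) \<in> carrier (RR ?B)" "io ?B p (eps p ?X) \<in> carrier (RR ?B)"
    using x01 ep by (simp_all del: car_under)
  have "io ?B (p + q) (smul (NN ?B) p q (?x' ?i) (?x' ?k)) = io ?B (p + q) (smul (NN ?B) p q (?x ?i) (?x ?k)) \<oplus>\<^bsub>RR ?B\<^esub> io ?B p (eps p ?X) \<otimes>\<^bsub>RR ?B\<^esub> io ?B q (?x ?k)"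
    using x01 ep C by (simp add: N.inc_smul N.inc_sadd N.R.l_distr del: car_under)
  then show ?thesis
    using x01 C by (intro pd_unique[OF op_mul_hom il(1) _ _ N.R.zero_closed])
      (use tgt.proj_hom[OF il(2)] N.inc_smul[OF x01] in \<open>simp_all add: ev_op_mul[unfolded One_nat_def] 3 del: car_under fun_upd_apply\<close>)
qed

text \<open>
  The increment has to be moved to the left past the first factor, which costs a sign if both are odd.
\<close>

lemma pd_op_mul_right:
  assumes B: "B \<in> Obj (Alg S)" and a: "fam B (srt p + srt q) a"
  shows "io B p (ev S B (srt p + srt q) p (pd (srt p + srt q) (Suc 0 - mi p q) (p + q) (op_mul p q)) a)
    = (if p = 1 \<and> q = 1 then \<ominus>\<^bsub>RR B\<^esub> io B p (a (mi p q)) else io B p (a (mi p q)))"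
proof -
  let ?X = "srt p + srt q" and ?i = "mi p q" and ?k = "Suc 0 - mi p q"
  have il: "?i < len ?X" "?k < len ?X" by simp_all
  have qpq: "q + (p + q) = p" by (simp add: add.left_commute)
  let ?A = "rep S ?X"
  let ?y = "proj S ?X ?i"
  interpret A: supercommutative "NN ?A" by (rule NN_super) simp
  define D where "D = (if p = 1 \<and> q = 1 then A.ssub p (szero (NN ?A) p) ?y else ?y)"
  have y: "?y \<in> Hom S ?X (srt p)" using tgt.proj_hom[OF il(1)] by simp
  have D: "D \<in> Hom S ?X (srt p)"
  proof -
    have "A.ssub p (szero (NN ?A) p) ?y \<in> Hom S ?X (srt p)"
      using A.ssub_car[of "szero (NN ?A) p" p ?y] y by simp
    moreover have "D = A.ssub p (szero (NN ?A) p) ?y \<or> D = ?y" by (simp only: D_def) (rule if_split[THEN iffD2], blast)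
    ultimately show ?thesis using y by (elim disjE) (simp_all only:)
  qed
  have Dv: "io C p (ev S C ?X p D a) = (if p = 1 \<and> q = 1 then \<ominus>\<^bsub>RR C\<^esub> io C p (a ?i) else io C p (a ?i))"
    if C: "C \<in> Obj (Alg S)" "fam C ?X a" for C :: "('s, 'w) alg" and a
  proof -
    have ey: "ev S C ?X p ?y a = a ?i" using tgt.ev_proj[OF C(1,2) il(1), of p] by simp
    show ?thesis
    proof (cases "p = 1 \<and> q = 1")
      case True
      have "io ?A p D = \<ominus>\<^bsub>RR ?A\<^esub> io ?A p ?y"
      proof -
        have "D = A.ssub p (szero (NN ?A) p) ?y" unfolding D_def by (rule if_P[OF True])
        then show ?thesis using A.inc_ssub[of "szero (NN ?A) p" p ?y] y A.inc_szero[of p] by (simp add: A.R.minus_eq)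
      qed
      then have "evr C ?X a (io ?A p D) = \<ominus>\<^bsub>RR C\<^esub> evr C ?X a (io ?A p ?y)"
        using ring_hom_a_inv'[OF _ _ evr_hom[OF C(1,2)], of "io ?A p ?y"] y C by simp
      then have "io C p (ev S C ?X p D a) = \<ominus>\<^bsub>RR C\<^esub> io C p (a ?i)"
        by (simp add: evr_io[OF C(1,2)] ey)
      then show ?thesis unfolding if_P[OF True] .
    next
      case False
      then show ?thesis unfolding if_not_P[OF False] D_def using ey by simp
    qed
  qed
  have Dev: "io C q d \<otimes>\<^bsub>RR C\<^esub> io C p (ev S C ?X p D a) = io C p (a ?i) \<otimes>\<^bsub>RR C\<^esub> io C q d"
    if C: "C \<in> Obj (Alg S)" "fam C ?X a" "d \<in> fob C (srt q)" for C :: "('s, 'w) alg" and a d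
  proof -
    interpret C: supercommutative "NN C" by (rule NN_super[OF C(1)])
    have ai: "a ?i \<in> fob C (srt p)" using C(2)[unfolded fam_def, rule_format, OF il(1)] by simp
    show ?thesis
    proof (cases "p = 1 \<and> q = 1")
      case True
      then show ?thesis using Dv[OF C(1,2)] C.inc_anticomm[of "a ?i" d] ai C by (simp add: C.R.r_minus)
    next
      case False
      then have "p = 0 \<or> q = 0" by auto
      then show ?thesis using Dv[OF C(1,2)] False C.inc_comm[of "a ?i" p d q] ai C by auto
    qed
  qed
  let ?B = "rep S (X2 q ?X)"
  interpret N: supercommutative "NN ?B" by (rule NN_super) simp
  let ?x = "xs q ?X" let ?x' = "?x(?k := sadd (NN ?B) q (?x ?k) (eps q ?X))"
  have fx: "fam ?B ?X ?x" by simp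
  have x01: "?x ?i \<in> car (NN ?B) p" "?x ?k \<in> car (NN ?B) q" using fx[unfolded fam_def, rule_format, OF il(1)] fx[unfolded fam_def, rule_format, OF il(2)] by simp_all
  have ep: "eps q ?X \<in> car (NN ?B) q" by simp
  have C: "io ?B p (?x ?i) \<in> carrier (RR ?B)" "io ?B q (?x ?k) \<in> carrier (RR ?B)" "io ?B q (eps q ?X) \<in> carrier (RR ?B)"
    using x01 ep by (simp_all del: car_under)
  have "io ?B (p + q) (smul (NN ?B) p q (?x' ?i) (?x' ?k)) = io ?B (p + q) (smul (NN ?B) p q (?x ?i) (?x ?k)) \<oplus>\<^bsub>RR ?B\<^esub> io ?B q (eps q ?X) \<otimes>\<^bsub>RR ?B\<^esub> io ?B p (ev S ?B ?X p D ?x)"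
    using x01 ep C Dev[OF tgt.rep_obj fx, of "eps q ?X"] by (simp add: N.inc_smul N.inc_sadd N.R.r_distr mi_neq[symmetric] del: car_under mi_neq)
  then have "pd ?X ?k (p + q) (op_mul p q) = D"
    using x01 C D tgt.ev_in[OF tgt.rep_obj D fx] by (intro pd_unique[OF op_mul_hom il(2) _ _ N.R.zero_closed])
      (use N.inc_smul[OF x01] in \<open>simp_all add: ev_op_mul[unfolded One_nat_def] qpq del: car_under fun_upd_apply\<close>)
  then show ?thesis using Dv[OF B a] by simp
qed

end

section \<open>Slices of categories of algebras\<close>

lemma slice_Obj: "(X, f) \<in> Obj (slice C A) \<longleftrightarrow> X \<in> Obj C \<and> f \<in> Hom C X A"
  and slice_Hom: "h \<in> Hom (slice C A) (X, f) (Y, g) \<longleftrightarrow> h \<in> Hom C X Y \<and> Comp C X Y A g h = f"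
  and slice_Comp: "Comp (slice C A) (X, f) (Y, g) (Z, k) = Comp C X Y Z"
  and slice_Ident: "Ident (slice C A) (X, f) = Ident C X"
  by (simp_all add: slice_def)

text \<open>
  Elementwise form of the universal property of the fibre product \<open>C \<times>\<^sub>A C\<close>.
\<close>

definition pw_square :: "('s, 'u) alg \<Rightarrow> (nat \<times> nat \<Rightarrow> 'u \<Rightarrow> 'u) \<Rightarrow> ('s, 'u) alg \<Rightarrow> (nat \<Rightarrow> nat \<times> nat \<Rightarrow> 'u \<Rightarrow> 'u) \<Rightarrow> bool" where
  "pw_square C p P \<pi> \<longleftrightarrow> (\<forall>X. \<forall>x\<in>fob C X. \<forall>y\<in>fob C X. p X x = p X y \<longrightarrow>
    (\<exists>!w. w \<in> fob P X \<and> \<pi> 0 X w = x \<and> \<pi> 1 X w = y))"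

context lawvere_theory
begin

lemma Comp_Alg_in:
  "A \<in> Obj (Alg T) \<Longrightarrow> B \<in> Obj (Alg T) \<Longrightarrow> C \<in> Obj (Alg T) \<Longrightarrow> f \<in> Hom (Alg T) A B \<Longrightarrow> g \<in> Hom (Alg T) B C \<Longrightarrow>
    Comp (Alg T) A B C g f \<in> Hom (Alg T) A C"
  using category.comp_in_hom[OF category_Alg] by blast

context
  fixes A :: "('s, 'u) alg"
  assumes A: "A \<in> Obj (Alg T)"
begin

lemma slice_Hom_pw:
  assumes "(C, p) \<in> Obj (slice (Alg T) A)" "(D, q) \<in> Obj (slice (Alg T) A)"
  shows "h \<in> Hom (slice (Alg T) A) (C, p) (D, q) \<longleftrightarrow>
    h \<in> Hom (Alg T) C D \<and> (\<forall>X. \<forall>x\<in>fob C X. q X (h X x) = p X x)"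
proof -
  have *: "Comp (Alg T) C D A q h = p \<longleftrightarrow> (\<forall>X. \<forall>x\<in>fob C X. q X (h X x) = p X x)" if h: "h \<in> Hom (Alg T) C D"
  proof
    assume "Comp (Alg T) C D A q h = p"
    then show "\<forall>X. \<forall>x\<in>fob C X. q X (h X x) = p X x" by (auto simp flip: Comp_Alg_app)
  next
    assume "\<forall>X. \<forall>x\<in>fob C X. q X (h X x) = p X x"
    then show "Comp (Alg T) C D A q h = p"
      using assms h A by (intro Hom_Alg_eqI[of C A]) (auto simp: slice_Obj intro: Comp_Alg_in)
  qed
  then show ?thesis by (auto simp: slice_Hom)
qed

lemma slice_thom:
  assumes "(C, p) \<in> Obj (slice (Alg T) A)" "(D, q) \<in> Obj (slice (Alg T) A)" "h \<in> Hom (slice (Alg T) A) (C, p) (D, q)"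
  shows "thom T C D h" "x \<in> fob C X \<Longrightarrow> q X (h X x) = p X x"
  using assms slice_Hom_pw[OF assms(1,2)] by (auto simp: slice_Obj intro: Hom_Alg_thom)

lemma slice_obj_thom: "(C, p) \<in> Obj (slice (Alg T) A) \<Longrightarrow> C \<in> Obj (Alg T) \<and> thom T C A p"
  using A by (auto simp: slice_Obj intro: Hom_Alg_thom)

lemma slice_Hom_eqI:
  assumes "(C, p) \<in> Obj (slice (Alg T) A)" "(D, q) \<in> Obj (slice (Alg T) A)"
    "h \<in> Hom (slice (Alg T) A) (C, p) (D, q)" "k \<in> Hom (slice (Alg T) A) (C, p) (D, q)"
    "\<And>X x. x \<in> fob C X \<Longrightarrow> h X x = k X x"
  shows "h = k"
  using assms slice_Hom_pw[OF assms(1,2)] by (intro Hom_Alg_eqI[of C D]) (auto simp: slice_Obj)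

lemma slice_HomI:
  assumes "(C, p) \<in> Obj (slice (Alg T) A)" "(D, q) \<in> Obj (slice (Alg T) A)" "thom T C D h"
    "\<And>X x. x \<in> fob C X \<Longrightarrow> q X (h X x) = p X x"
  shows "(\<lambda>X. restrict (h X) (fob C X)) \<in> Hom (slice (Alg T) A) (C, p) (D, q)"
  using assms by (subst slice_Hom_pw) (auto simp: slice_Obj intro: Hom_AlgI)

lemma slice_Comp_Hom:
  assumes "(C, p) \<in> Obj (slice (Alg T) A)" "(D, q) \<in> Obj (slice (Alg T) A)" "(E, r) \<in> Obj (slice (Alg T) A)"
    "h \<in> Hom (slice (Alg T) A) (C, p) (D, q)" "k \<in> Hom (slice (Alg T) A) (D, q) (E, r)"
  shows "Comp (slice (Alg T) A) (C, p) (D, q) (E, r) k h \<in> Hom (slice (Alg T) A) (C, p) (E, r)"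
    "x \<in> fob C X \<Longrightarrow> Comp (slice (Alg T) A) (C, p) (D, q) (E, r) k h X x = k X (h X x)"
  using assms slice_Hom_pw[OF assms(1,2)] slice_Hom_pw[OF assms(2,3)] slice_Hom_pw[OF assms(1,3)]
    slice_thom[OF assms(1,2,4)]
  by (auto simp: slice_Obj slice_Comp thom_in intro!: Comp_Alg_in)

lemma slice_Ident_Hom:
  assumes "(C, p) \<in> Obj (slice (Alg T) A)"
  shows "Ident (slice (Alg T) A) (C, p) \<in> Hom (slice (Alg T) A) (C, p) (C, p)"
    "x \<in> fob C X \<Longrightarrow> Ident (slice (Alg T) A) (C, p) X x = x"
  using slice_HomI[OF assms assms thom_id] assms by (auto simp: slice_Ident Ident_Alg slice_Obj)

text \<open>
  All algebras have their elements in the same type, and pairs of elements of \<open>C\<close> have to be coded in it.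
  This is possible because \<open>C(X) \<times> C(X)\<close> is the value of \<open>C\<close> at the product of \<open>X\<close> with itself.
\<close>

lemma fibre_product_exists:
  assumes Cp: "(C, p) \<in> Obj (slice (Alg T) A)"
  obtains Q r \<rho> where "(Q, r) \<in> Obj (slice (Alg T) A)"
    "\<And>i. \<rho> i \<in> Hom (slice (Alg T) A) (Q, r) (C, p)" "pw_square C p Q \<rho>"
proof -
  have C: "C \<in> Obj (Alg T)" and p: "thom T C A p" using slice_obj_thom[OF Cp] by auto
  have "\<exists>Z q. is_product T {0, 1 :: nat} (\<lambda>_. X) Z q" for X
  proof -
    obtain Z q where "is_product T {0, 1 :: nat} (\<lambda>_. X) Z q"
      by (rule canonical_product[of "{0, 1 :: nat}" "\<lambda>_. X"]) auto
    then show ?thesis by blast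
  qed
  then obtain Z q where Z: "\<And>X. is_product T {0, 1 :: nat} (\<lambda>_. X) (Z X) (q X)" by metis
  have qh: "q X 0 \<in> Hom T (Z X) X" "q X 1 \<in> Hom T (Z X) X" for X using Z[of X] by (auto simp: is_product_def)
  define L where "L X u = fmap C (Z X) X (q X 0) u" for X u
  define R where "R X u = fmap C (Z X) X (q X 1) u" for X u
  have L: "L X u \<in> fob C X" and R: "R X u \<in> fob C X" if "u \<in> fob C (Z X)" for X u
    using qh that C by (auto simp: L_def R_def)
  have ex1: "\<exists>!u. u \<in> fob C (Z X) \<and> L X u = x \<and> R X u = y" if "x \<in> fob C X" "y \<in> fob C X" for X x y
    using alg_product[OF C _ Z[of X], of "\<lambda>i. if i = 0 then x else y"] that by (simp add: L_def R_def)
  define pr where "pr X x y = (THE u. u \<in> fob C (Z X) \<and> L X u = x \<and> R X u = y)" for X x y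
  have pr: "pr X x y \<in> fob C (Z X)" "L X (pr X x y) = x" "R X (pr X x y) = y" if "x \<in> fob C X" "y \<in> fob C X" for X x y
    using theI'[OF ex1[OF that]] by (auto simp: pr_def)
  have eqI: "u = v" if "u \<in> fob C (Z X)" "v \<in> fob C (Z X)" "L X u = L X v" "R X u = R X v" for X u v
    using ex1[OF L[OF that(1)] R[OF that(1)]] that by metis
  define Q where "Q = \<lparr>fob = (\<lambda>X. {u \<in> fob C (Z X). p X (L X u) = p X (R X u)}),
    fmap = (\<lambda>X Y f. \<lambda>u\<in>{u \<in> fob C (Z X). p X (L X u) = p X (R X u)}. pr Y (fmap C X Y f (L X u)) (fmap C X Y f (R X u)))\<rparr>"
  have Qin: "u \<in> fob Q X \<longleftrightarrow> u \<in> fob C (Z X) \<and> p X (L X u) = p X (R X u)" for X u by (simp add: Q_def)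
  have Qmap: "fmap Q X Y f u = pr Y (fmap C X Y f (L X u)) (fmap C X Y f (R X u))" if "u \<in> fob Q X" for X Y f u
    using that by (simp add: Q_def)
  have prQ: "pr X x y \<in> fob Q X" if "x \<in> fob C X" "y \<in> fob C X" "p X x = p X y" for X x y
    using pr that by (simp add: Qin)
  have Qm: "fmap Q X Y f u \<in> fob Q Y" "L Y (fmap Q X Y f u) = fmap C X Y f (L X u)" "R Y (fmap Q X Y f u) = fmap C X Y f (R X u)"
    if "u \<in> fob Q X" "f \<in> Hom T X Y" for X Y f u
    using that C L R thom_fmap[OF p that(2)] by (auto simp: Qmap Qin pr intro!: prQ[unfolded Qin, THEN conjunct1])
  have cat: "category T" by unfold_locales
  have Qf: "cat_functor T set_cat Q"
    unfolding cat_functor_set_cat_iff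
  proof (intro conjI ballI cat)
    fix X Y Z' f g u
    show "f \<in> Hom T X Y \<Longrightarrow> fmap Q X Y f \<in> fob Q X \<rightarrow>\<^sub>E fob Q Y" for f Y
      using Qm(1) by (auto simp: Q_def)
    show "u \<in> fob Q X \<Longrightarrow> fmap Q X X (Ident T X) u = u"
      by (rule eqI[of _ X]) (use Qm[of u X "Ident T X" X] C L R in \<open>auto simp: Qin\<close>)
    show "f \<in> Hom T X Y \<Longrightarrow> g \<in> Hom T Y Z' \<Longrightarrow> u \<in> fob Q X \<Longrightarrow>
      fmap Q X Z' (Comp T X Y Z' g f) u = fmap Q Y Z' g (fmap Q X Y f u)"
      by (rule eqI[of _ Z']) (use Qm[of u X "Comp T X Y Z' g f" Z'] Qm[of u X f Y] Qm[of "fmap Q X Y f u" Y g Z'] C L R in \<open>auto simp: Qin\<close>)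
  qed
  have Lc: "L (srt (gr X i)) (crd T Q X u i) = crd T C X (L X u) i" "R (srt (gr X i)) (crd T Q X u i) = crd T C X (R X u) i"
    if "u \<in> fob Q X" "i < len X" for X u i
    using Qm[OF that(1), of "proj T X i"] that by (auto simp: crd_def)
  have Qo: "Q \<in> Obj (Alg T)"
  proof (rule preserves_finite_products_if_coordinates[OF Qf])
    fix X a assume a: "fam Q X a"
    have ai: "a i \<in> fob Q (srt (gr X i))" if "i < len X" for i using a that by (simp add: fam_def)
    have f: "fam C X (\<lambda>i. L (srt (gr X i)) (a i))" "fam C X (\<lambda>i. R (srt (gr X i)) (a i))"
      using ai L R by (auto simp: fam_def Qin)
    let ?l = "mk T C X (\<lambda>i. L (srt (gr X i)) (a i))" and ?r = "mk T C X (\<lambda>i. R (srt (gr X i)) (a i))"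
    have lr: "?l \<in> fob C X" "?r \<in> fob C X" using C f by auto
    have "p X ?l = p X ?r"
    proof (rule alg_eqI[OF A])
      fix i assume i: "i < len X"
      show "crd T A X (p X ?l) i = crd T A X (p X ?r) i"
        using thom_crd[OF p C lr(1) i] thom_crd[OF p C lr(2) i] C f i ai[OF i] by (simp add: Qin)
    qed (use lr thom_in[OF p] in auto)
    then have u: "pr X ?l ?r \<in> fob Q X" using prQ lr by simp
    show "\<exists>!u. u \<in> fob Q X \<and> (\<forall>i<len X. crd T Q X u i = a i)"
    proof (intro ex1I[of _ "pr X ?l ?r"] conjI allI impI u)
      fix i assume i: "i < len X"
      show "crd T Q X (pr X ?l ?r) i = a i"
      proof (rule eqI[of _ "srt (gr X i)"])
        show "crd T Q X (pr X ?l ?r) i \<in> fob C (Z (srt (gr X i)))"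
          using Qm(1)[OF u proj_hom[OF i]] by (simp add: crd_def Qin)
      qed (use Lc[OF u i] pr lr C f i ai[OF i] in \<open>auto simp: Qin\<close>)
    next
      fix v assume v: "v \<in> fob Q X \<and> (\<forall>i<len X. crd T Q X v i = a i)"
      have "?l = L X v" by (rule mk_eqI[OF C]) (use v Lc[of v X] L in \<open>auto simp: Qin\<close>)
      moreover have "?r = R X v" by (rule mk_eqI[OF C]) (use v Lc[of v X] R in \<open>auto simp: Qin\<close>)
      ultimately show "v = pr X ?l ?r" by (intro eqI[of v X "pr X ?l ?r"]) (use v u pr lr in \<open>auto simp: Qin\<close>)
    qed
  qed
  have tL: "thom T Q C L" and tR: "thom T Q C R" using L R Qm by (auto simp: thom_def Qin)
  define r where "r X = restrict (\<lambda>u. p X (L X u)) (fob Q X)" for X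
  have "r \<in> Hom (Alg T) Q A" using Hom_AlgI[OF Qo A thom_comp[OF tL p]] by (simp add: r_def[abs_def])
  then have Qr: "(Q, r) \<in> Obj (slice (Alg T) A)" using Qo by (simp add: slice_Obj)
  define \<rho> where "\<rho> i = (if i = (0 :: nat) then (\<lambda>X. restrict (L X) (fob Q X)) else (\<lambda>X. restrict (R X) (fob Q X)))" for i
  have "\<rho> i \<in> Hom (slice (Alg T) A) (Q, r) (C, p)" for i
    using slice_HomI[OF Qr Cp tL] slice_HomI[OF Qr Cp tR] by (auto simp: \<rho>_def r_def Qin)
  moreover have "pw_square C p Q \<rho>" unfolding pw_square_def
  proof (intro allI ballI impI)
    fix X x y assume xy: "x \<in> fob C X" "y \<in> fob C X" "p X x = p X y"
    show "\<exists>!w. w \<in> fob Q X \<and> \<rho> 0 X w = x \<and> \<rho> 1 X w = y"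
    proof (rule ex1I[of _ "pr X x y"])
      show "pr X x y \<in> fob Q X \<and> \<rho> 0 X (pr X x y) = x \<and> \<rho> 1 X (pr X x y) = y"
        using prQ[OF xy] pr[OF xy(1,2)] by (simp add: \<rho>_def)
      fix w assume w: "w \<in> fob Q X \<and> \<rho> 0 X w = x \<and> \<rho> 1 X w = y"
      show "w = pr X x y" by (rule eqI[of _ X]) (use w pr[OF xy(1,2)] in \<open>auto simp: \<rho>_def Qin\<close>)
    qed
  qed
  ultimately show ?thesis using that Qr by blast
qed

lemma product_if_pw_square:
  assumes Cp: "(C, p) \<in> Obj (slice (Alg T) A)" and Pr: "(P, r) \<in> Obj (slice (Alg T) A)"
    and \<pi>: "\<pi> 0 \<in> Hom (slice (Alg T) A) (P, r) (C, p)" "\<pi> 1 \<in> Hom (slice (Alg T) A) (P, r) (C, p)"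
    and sq: "pw_square C p P \<pi>"
  shows "is_product (slice (Alg T) A) {0, 1} (\<lambda>_. (C, p)) (P, r) \<pi>"
  unfolding is_product_def
proof (intro conjI ballI allI impI)
  fix Yk and f :: "nat \<Rightarrow> nat \<times> nat \<Rightarrow> 'u \<Rightarrow> 'u"
  assume Yk': "Yk \<in> Obj (slice (Alg T) A)" and f': "\<forall>i\<in>{0, 1}. f i \<in> Hom (slice (Alg T) A) Yk (C, p)"
  obtain Y k where [simp]: "Yk = (Y, k)" by force
  have Yk: "(Y, k) \<in> Obj (slice (Alg T) A)" using Yk' by simp
  have f: "f 0 \<in> Hom (slice (Alg T) A) (Y, k) (C, p)" "f 1 \<in> Hom (slice (Alg T) A) (Y, k) (C, p)" using f' by auto
  note tf0 = slice_thom[OF Yk Cp f(1)] and tf1 = slice_thom[OF Yk Cp f(2)]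
  note t0 = slice_thom[OF Pr Cp \<pi>(1)] and t1 = slice_thom[OF Pr Cp \<pi>(2)]
  have ex1: "\<exists>!w. w \<in> fob P X \<and> \<pi> 0 X w = f 0 X y \<and> \<pi> 1 X w = f 1 X y" if "y \<in> fob Y X" for X y
    using sq thom_in[OF tf0(1) that] thom_in[OF tf1(1) that] tf0(2)[OF that] tf1(2)[OF that] by (auto simp: pw_square_def)
  define h where "h X y = (THE w. w \<in> fob P X \<and> \<pi> 0 X w = f 0 X y \<and> \<pi> 1 X w = f 1 X y)" for X y
  have h: "h X y \<in> fob P X" "\<pi> 0 X (h X y) = f 0 X y" "\<pi> 1 X (h X y) = f 1 X y" if "y \<in> fob Y X" for X y
    using theI'[OF ex1[OF that]] by (auto simp: h_def)
  have hu: "w = h X y" if "y \<in> fob Y X" "w \<in> fob P X" "\<pi> 0 X w = f 0 X y" "\<pi> 1 X w = f 1 X y" for X y w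
    using ex1[OF that(1)] h[OF that(1)] that by blast
  have P: "P \<in> Obj (Alg T)" "Y \<in> Obj (Alg T)" using Pr Yk by (auto simp: slice_Obj)
  have th: "thom T Y P h" unfolding thom_def
  proof (intro conjI allI ballI)
    fix X Z g y assume g: "g \<in> Hom T X Z" and y: "y \<in> fob Y X"
    show "h Z (fmap Y X Z g y) = fmap P X Z g (h X y)"
      using g y P h[OF y] thom_fmap[OF tf0(1) g y] thom_fmap[OF tf1(1) g y] thom_fmap[OF t0(1) g] thom_fmap[OF t1(1) g]
      by (intro hu[symmetric]) simp_all
  qed (use h in auto)
  let ?h = "\<lambda>X. restrict (h X) (fob Y X)"
  have hh: "?h \<in> Hom (slice (Alg T) A) (Y, k) (P, r)"
    using slice_HomI[OF Yk Pr th] h t0(2) tf0(2) by metis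
  show "\<exists>!h. h \<in> Hom (slice (Alg T) A) Yk (P, r) \<and> (\<forall>i\<in>{0, 1}. Comp (slice (Alg T) A) Yk (P, r) (C, p) (\<pi> i) h = f i)"
    unfolding \<open>Yk = (Y, k)\<close>
  proof (rule ex1I[of _ ?h])
    have "Comp (slice (Alg T) A) (Y, k) (P, r) (C, p) (\<pi> 0) ?h = f 0" "Comp (slice (Alg T) A) (Y, k) (P, r) (C, p) (\<pi> 1) ?h = f 1"
      by (rule slice_Hom_eqI[OF Yk Cp slice_Comp_Hom(1)[OF Yk Pr Cp hh \<pi>(1)] f(1)]; simp only: slice_Comp_Hom(2)[OF Yk Pr Cp hh \<pi>(1)] h restrict_apply')
         (rule slice_Hom_eqI[OF Yk Cp slice_Comp_Hom(1)[OF Yk Pr Cp hh \<pi>(2)] f(2)]; simp only: slice_Comp_Hom(2)[OF Yk Pr Cp hh \<pi>(2)] h restrict_apply')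
    then show "?h \<in> Hom (slice (Alg T) A) (Y, k) (P, r) \<and> (\<forall>i\<in>{0, 1}. Comp (slice (Alg T) A) (Y, k) (P, r) (C, p) (\<pi> i) ?h = f i)"
      using hh by auto
    fix g assume g: "g \<in> Hom (slice (Alg T) A) (Y, k) (P, r) \<and> (\<forall>i\<in>{0, 1}. Comp (slice (Alg T) A) (Y, k) (P, r) (C, p) (\<pi> i) g = f i)"
    then have g0: "g \<in> Hom (slice (Alg T) A) (Y, k) (P, r)" by blast
    show "g = ?h"
    proof (rule slice_Hom_eqI[OF Yk Pr g0 hh])
      fix X y assume y: "y \<in> fob Y X"
      have "\<pi> 0 X (g X y) = f 0 X y" "\<pi> 1 X (g X y) = f 1 X y"
        using g slice_Comp_Hom(2)[OF Yk Pr Cp g0 \<pi>(1) y] slice_Comp_Hom(2)[OF Yk Pr Cp g0 \<pi>(2) y] by auto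
      then show "g X y = ?h X y" using hu[OF y] thom_in[OF slice_thom(1)[OF Yk Pr g0] y] y by simp
    qed
  qed
qed (use assms in auto)

text \<open>
  A product in the slice category is isomorphic to the fibre product constructed elementwise, so it has
  the elementwise property, too.
\<close>

lemma product_iff_pw_square:
  assumes Cp: "(C, p) \<in> Obj (slice (Alg T) A)" and Pr: "(P, r) \<in> Obj (slice (Alg T) A)"
    and \<pi>: "\<pi> 0 \<in> Hom (slice (Alg T) A) (P, r) (C, p)" "\<pi> 1 \<in> Hom (slice (Alg T) A) (P, r) (C, p)"
  shows "is_product (slice (Alg T) A) {0, 1} (\<lambda>_. (C, p)) (P, r) \<pi> \<longleftrightarrow> pw_square C p P \<pi>"
proof
  let ?sl = "slice (Alg T) A"
  assume prod: "is_product ?sl {0, 1} (\<lambda>_. (C, p)) (P, r) \<pi>"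
  obtain Q k \<rho> where Qk: "(Q, k) \<in> Obj ?sl" and \<rho>: "\<And>i. \<rho> i \<in> Hom ?sl (Q, k) (C, p)" and sq: "pw_square C p Q \<rho>"
    using fibre_product_exists[OF Cp] by metis
  have prodQ: "is_product ?sl {0, 1} (\<lambda>_. (C, p)) (Q, k) \<rho>" by (rule product_if_pw_square[OF Cp Qk \<rho> \<rho> sq])
  have univ: "\<exists>!h. h \<in> Hom ?sl Y (W, v) \<and> (\<forall>i\<in>{0, 1}. Comp ?sl Y (W, v) (C, p) (\<theta> i) h = f i)"
    if "is_product ?sl {0, 1} (\<lambda>_. (C, p)) (W, v) \<theta>" "Y \<in> Obj ?sl" "f 0 \<in> Hom ?sl Y (C, p)" "f 1 \<in> Hom ?sl Y (C, p)" for W v \<theta> Y f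
  proof -
    have "\<forall>i\<in>{0, 1}. f i \<in> Hom ?sl Y (C, p)" using that by auto
    then show ?thesis using that(1,2) unfolding is_product_def by blast
  qed
  obtain h where h: "h \<in> Hom ?sl (Q, k) (P, r)" "\<forall>i\<in>{0, 1}. Comp ?sl (Q, k) (P, r) (C, p) (\<pi> i) h = \<rho> i"
    using univ[OF prod Qk, of \<rho>, OF \<rho> \<rho>] by blast
  obtain g where g: "g \<in> Hom ?sl (P, r) (Q, k)" "\<forall>i\<in>{0, 1}. Comp ?sl (P, r) (Q, k) (C, p) (\<rho> i) g = \<pi> i"
    using univ[OF prodQ Pr, of \<pi>, OF \<pi>] by blast
  have hp: "\<pi> 0 X (h X u) = \<rho> 0 X u" "\<pi> 1 X (h X u) = \<rho> 1 X u" if "u \<in> fob Q X" for X u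
    using slice_Comp_Hom(2)[OF Qk Pr Cp h(1) \<pi>(1) that] slice_Comp_Hom(2)[OF Qk Pr Cp h(1) \<pi>(2) that] h(2) by auto
  have gp: "\<rho> 0 X (g X w) = \<pi> 0 X w" "\<rho> 1 X (g X w) = \<pi> 1 X w" if "w \<in> fob P X" for X w
    using slice_Comp_Hom(2)[OF Pr Qk Cp g(1) \<rho> that, of 0] slice_Comp_Hom(2)[OF Pr Qk Cp g(1) \<rho> that, of 1] g(2) by auto
  note hin = thom_in[OF slice_thom(1)[OF Qk Pr h(1)]] and gin = thom_in[OF slice_thom(1)[OF Pr Qk g(1)]]
  have hg: "Comp ?sl (P, r) (Q, k) (P, r) h g = Ident ?sl (P, r)"
  proof -
    let ?hg = "Comp ?sl (P, r) (Q, k) (P, r) h g"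
    note hgh = slice_Comp_Hom[OF Pr Qk Pr g(1) h(1)] and idh = slice_Ident_Hom[OF Pr]
    have "Comp ?sl (P, r) (P, r) (C, p) (\<pi> i) ?hg = \<pi> i" if "i \<in> {0, 1}" for i
    proof -
      have \<pi>i: "\<pi> i \<in> Hom ?sl (P, r) (C, p)" using that \<pi> by auto
      show ?thesis
        using that by (intro slice_Hom_eqI[OF Pr Cp slice_Comp_Hom(1)[OF Pr Pr Cp hgh(1) \<pi>i] \<pi>i])
          (auto simp: slice_Comp_Hom(2)[OF Pr Pr Cp hgh(1) \<pi>i] hgh(2) hp[unfolded One_nat_def] gp[unfolded One_nat_def] gin)
    qed
    moreover have "Comp ?sl (P, r) (P, r) (C, p) (\<pi> i) (Ident ?sl (P, r)) = \<pi> i" if "i \<in> {0, 1}" for i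
    proof -
      have \<pi>i: "\<pi> i \<in> Hom ?sl (P, r) (C, p)" using that \<pi> by auto
      show ?thesis
        by (intro slice_Hom_eqI[OF Pr Cp slice_Comp_Hom(1)[OF Pr Pr Cp idh(1) \<pi>i] \<pi>i])
          (auto simp: slice_Comp_Hom(2)[OF Pr Pr Cp idh(1) \<pi>i] idh(2))
    qed
    ultimately show ?thesis using univ[OF prod Pr, of \<pi>, OF \<pi>] hgh(1) idh(1) by blast
  qed
  have hgw: "h X (g X w) = w" if "w \<in> fob P X" for X w
    using slice_Comp_Hom(2)[OF Pr Qk Pr g(1) h(1) that] slice_Ident_Hom(2)[OF Pr that] hg by simp
  show "pw_square C p P \<pi>" unfolding pw_square_def
  proof (intro allI ballI impI)
    fix X x y assume "x \<in> fob C X" "y \<in> fob C X" "p X x = p X y"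
    then obtain u where u: "u \<in> fob Q X" "\<rho> 0 X u = x" "\<rho> 1 X u = y"
      and uu: "\<And>v. v \<in> fob Q X \<Longrightarrow> \<rho> 0 X v = x \<Longrightarrow> \<rho> 1 X v = y \<Longrightarrow> v = u"
      using sq unfolding pw_square_def by metis
    show "\<exists>!w. w \<in> fob P X \<and> \<pi> 0 X w = x \<and> \<pi> 1 X w = y"
    proof (intro ex1I[of _ "h X u"] conjI)
      fix w assume w: "w \<in> fob P X \<and> \<pi> 0 X w = x \<and> \<pi> 1 X w = y"
      then have "g X w = u" using uu[of "g X w"] gp[of w X] gin by simp
      then show "w = h X u" using hgw[of w X] w by simp
    qed (use u hp hin in auto)
  qed
next
  assume "pw_square C p P \<pi>"
  then show "is_product (slice (Alg T) A) {0, 1} (\<lambda>_. (C, p)) (P, r) \<pi>" by (rule product_if_pw_square[OF assms])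
qed

lemma thom_inv:
  assumes "C \<in> Obj (Alg T)" "thom T C A h" "\<And>X. bij_betw (h X) (fob C X) (fob A X)"
  shows "thom T A C (\<lambda>X. inv_into (fob C X) (h X))"
  unfolding thom_def
proof (intro conjI allI ballI)
  show "inv_into (fob C X) (h X) \<in> fob A X \<rightarrow> fob C X" for X
    using assms(3)[of X] by (auto simp: bij_betw_def intro: inv_into_into)
  fix X Y f a assume f: "f \<in> Hom T X Y" and a: "a \<in> fob A X"
  have ia: "inv_into (fob C X) (h X) a \<in> fob C X" "h X (inv_into (fob C X) (h X) a) = a"
    using assms(3)[of X] a by (auto simp: bij_betw_def intro: inv_into_into f_inv_into_f)
  have "h Y (fmap C X Y f (inv_into (fob C X) (h X) a)) = fmap A X Y f a"
    using thom_fmap[OF assms(2) f ia(1)] ia(2) by simp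
  then show "inv_into (fob C Y) (h Y) (fmap A X Y f a) = fmap C X Y f (inv_into (fob C X) (h X) a)"
    using assms(3)[of Y] assms(1) f ia(1) by (metis alg_fmap_in bij_betw_def inv_into_f_f)
qed

text \<open>
  A terminal object of the slice category is isomorphic to the identity of \<open>A\<close>.
\<close>

lemma terminal_iff_bij:
  assumes Oo: "(Q, q) \<in> Obj (slice (Alg T) A)"
  shows "is_terminal (slice (Alg T) A) (Q, q) \<longleftrightarrow> (\<forall>X. bij_betw (q X) (fob Q X) (fob A X))"
proof
  let ?sl = "slice (Alg T) A"
  assume tm: "is_terminal ?sl (Q, q)"
  note q = slice_obj_thom[OF Oo]
  have Ai: "(A, Ident (Alg T) A) \<in> Obj ?sl"
    using A category.ident_in_hom[OF category_Alg A] by (simp add: slice_Obj)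
  obtain h where h: "h \<in> Hom ?sl (A, Ident (Alg T) A) (Q, q)" using tm Ai unfolding is_terminal_def by blast
  have qh: "q X (h X a) = a" "h X a \<in> fob Q X" if "a \<in> fob A X" for X a
    using slice_thom(2)[OF Ai Oo h that] thom_in[OF slice_thom(1)[OF Ai Oo h] that] that by (auto simp: Ident_Alg)
  have hq: "thom T Q Q (\<lambda>X x. h X (q X x))" using thom_comp[of T Q A q Q h] q slice_thom(1)[OF Ai Oo h] by blast
  have "(\<lambda>X. restrict (\<lambda>x. h X (q X x)) (fob Q X)) \<in> Hom ?sl (Q, q) (Q, q)"
    by (rule slice_HomI[OF Oo Oo hq]) (simp add: qh(1) thom_in[OF conjunct2[OF q]])
  then have "(\<lambda>X. restrict (\<lambda>x. h X (q X x)) (fob Q X)) = Ident ?sl (Q, q)"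
    using slice_Ident_Hom(1)[OF Oo] tm Oo unfolding is_terminal_def by blast
  then have hq: "h X (q X x) = x" if "x \<in> fob Q X" for X x
    using slice_Ident_Hom(2)[OF Oo that] that by (metis restrict_apply')
  show "\<forall>X. bij_betw (q X) (fob Q X) (fob A X)"
  proof
    fix X show "bij_betw (q X) (fob Q X) (fob A X)"
      by (rule bij_betwI[of _ _ _ "h X"]) (auto simp: qh hq thom_in[OF conjunct2[OF q]])
  qed
next
  let ?sl = "slice (Alg T) A"
  assume bij: "\<forall>X. bij_betw (q X) (fob Q X) (fob A X)"
  note q = slice_obj_thom[OF Oo]
  have inv: "thom T A Q (\<lambda>X. inv_into (fob Q X) (q X))" using thom_inv q bij by blast
  show "is_terminal ?sl (Q, q)" unfolding is_terminal_def
  proof (intro conjI Oo ballI)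
    fix Yk assume "Yk \<in> Obj ?sl"
    then obtain Y k where Yk[simp]: "Yk = (Y, k)" and Y: "(Y, k) \<in> Obj ?sl" by (metis surj_pair)
    have k: "thom T Y A k" using slice_obj_thom[OF Y] by blast
    have h: "(\<lambda>X. restrict (\<lambda>y. inv_into (fob Q X) (q X) (k X y)) (fob Y X)) \<in> Hom ?sl (Y, k) (Q, q)"
    proof (rule slice_HomI[OF Y Oo thom_comp[OF k inv]])
      show "q X (inv_into (fob Q X) (q X) (k X y)) = k X y" if "y \<in> fob Y X" for X y
        using bij thom_in[OF k that] by (simp add: bij_betw_def f_inv_into_f)
    qed
    show "\<exists>!h. h \<in> Hom ?sl Yk (Q, q)" unfolding Yk
    proof (rule ex1I, rule h)
      fix g assume g: "g \<in> Hom ?sl (Y, k) (Q, q)"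
      show "g = (\<lambda>X. restrict (\<lambda>y. inv_into (fob Q X) (q X) (k X y)) (fob Y X))"
      proof (rule slice_Hom_eqI[OF Y Oo g h])
        fix X y assume y: "y \<in> fob Y X"
        have "q X (g X y) = k X y" "g X y \<in> fob Q X"
          using slice_thom(2)[OF Y Oo g y] thom_in[OF slice_thom(1)[OF Y Oo g] y] by auto
        then show "g X y = restrict (\<lambda>y. inv_into (fob Q X) (q X) (k X y)) (fob Y X) y"
          using inv_into_f_f[of "q X" "fob Q X" "g X y"] bij y by (simp add: bij_betw_def)
      qed
    qed
  qed
qed

end

end

section \<open>Abelian group objects over an algebra\<close>

text \<open>
  The axioms of an abelian group object are split into the types of the arrows and the conditions that
  can be checked on elements. The latter do not refer to the theory, hence they pass between
  \<open>S\<close>-algebras and \<open>K\<close>-algebras without change. Associativity is omitted from them because it follows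
  from the ring structure.
\<close>

definition ab_data :: "('s, 'x) thy_scheme \<Rightarrow> ('s, 'u) alg \<Rightarrow>
    (('s, 'u) alg \<times> (nat \<times> nat \<Rightarrow> 'u \<Rightarrow> 'u), nat \<times> nat \<Rightarrow> 'u \<Rightarrow> 'u) abobj \<Rightarrow> bool" where
  "ab_data T A G \<longleftrightarrow> (let sl = slice (Alg T) A in
    ab_carrier G \<in> Obj sl \<and> ab_one G \<in> Obj sl \<and> ab_square G \<in> Obj sl \<and>
    ab_pr G 0 \<in> Hom sl (ab_square G) (ab_carrier G) \<and> ab_pr G 1 \<in> Hom sl (ab_square G) (ab_carrier G) \<and>
    ab_add G \<in> Hom sl (ab_square G) (ab_carrier G) \<and> ab_zero G \<in> Hom sl (ab_one G) (ab_carrier G) \<and>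
    ab_neg G \<in> Hom sl (ab_carrier G) (ab_carrier G))"

definition ab_pw :: "('s, 'u) alg \<Rightarrow>
    (('s, 'u) alg \<times> (nat \<times> nat \<Rightarrow> 'u \<Rightarrow> 'u), nat \<times> nat \<Rightarrow> 'u \<Rightarrow> 'u) abobj \<Rightarrow> bool" where
  "ab_pw A G \<longleftrightarrow>
    (\<forall>X. bij_betw (snd (ab_one G) X) (fob (fst (ab_one G)) X) (fob A X)) \<and>
    pw_square (fst (ab_carrier G)) (snd (ab_carrier G)) (fst (ab_square G)) (ab_pr G) \<and>
    (\<forall>X. \<forall>w\<in>fob (fst (ab_square G)) X. \<forall>w'\<in>fob (fst (ab_square G)) X.
      ab_pr G 0 X w' = ab_pr G 1 X w \<longrightarrow> ab_pr G 1 X w' = ab_pr G 0 X w \<longrightarrow> ab_add G X w' = ab_add G X w) \<and>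
    (\<forall>X. \<forall>w\<in>fob (fst (ab_square G)) X. \<forall>z\<in>fob (fst (ab_one G)) X.
      ab_pr G 0 X w = ab_zero G X z \<longrightarrow> ab_add G X w = ab_pr G 1 X w) \<and>
    (\<forall>X. \<forall>w\<in>fob (fst (ab_square G)) X. \<forall>z\<in>fob (fst (ab_one G)) X.
      ab_pr G 0 X w = ab_neg G X (ab_pr G 1 X w) \<longrightarrow> snd (ab_one G) X z = snd (ab_carrier G) X (ab_pr G 1 X w) \<longrightarrow>
      ab_add G X w = ab_zero G X z)"

text \<open>
  The neutral elements of the fibres, as a section of the carrier over \<open>A\<close>.
\<close>

definition sec :: "(('s, 'u) alg \<times> (nat \<times> nat \<Rightarrow> 'u \<Rightarrow> 'u), nat \<times> nat \<Rightarrow> 'u \<Rightarrow> 'u) abobj \<Rightarrow> nat \<times> nat \<Rightarrow> 'u \<Rightarrow> 'u" where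
  "sec G X a = ab_zero G X (inv_into (fob (fst (ab_one G)) X) (snd (ab_one G) X) a)"

text \<open>
  The data of a group object with the carrier, the terminal object and the square taken apart.
\<close>

locale ab_setting = lawvere_theory T for T :: "('s, 'x) thy_scheme" +
  fixes A :: "('s, 'u) alg" and G C p E e P r
  assumes A: "A \<in> Obj (Alg T)" and data: "ab_data T A G"
    and car[simp]: "ab_carrier G = (C, p)" and one[simp]: "ab_one G = (E, e)" and squ[simp]: "ab_square G = (P, r)"
    and bij: "\<And>X. bij_betw (e X) (fob E X) (fob A X)" and sq: "pw_square C p P (ab_pr G)"
begin

abbreviation sl where "sl \<equiv> slice (Alg T) A"

lemma objs: "(C, p) \<in> Obj sl" "(E, e) \<in> Obj sl" "(P, r) \<in> Obj sl"
  and homs: "ab_pr G 0 \<in> Hom sl (P, r) (C, p)" "ab_pr G 1 \<in> Hom sl (P, r) (C, p)"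
    "ab_add G \<in> Hom sl (P, r) (C, p)" "ab_zero G \<in> Hom sl (E, e) (C, p)" "ab_neg G \<in> Hom sl (C, p) (C, p)"
  using data[unfolded ab_data_def Let_def car one squ] by blast+

lemma algs: "C \<in> Obj (Alg T)" "E \<in> Obj (Alg T)" "P \<in> Obj (Alg T)"
  using objs by (auto simp: slice_Obj)

lemma thoms: "thom T P C (ab_pr G 0)" "thom T P C (ab_pr G 1)" "thom T P C (ab_add G)" "thom T E C (ab_zero G)"
    "thom T C C (ab_neg G)" "thom T C A p" "thom T E A e" "thom T P A r"
  using slice_thom(1)[OF A objs(3,1) homs(1)] slice_thom(1)[OF A objs(3,1) homs(2)]
    slice_thom(1)[OF A objs(3,1) homs(3)] slice_thom(1)[OF A objs(2,1) homs(4)]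
    slice_thom(1)[OF A objs(1,1) homs(5)] slice_obj_thom[OF A objs(1)] slice_obj_thom[OF A objs(2)] slice_obj_thom[OF A objs(3)]
  by auto

lemmas ins = thom_in[OF thoms(1)] thom_in[OF thoms(2)] thom_in[OF thoms(3)] thom_in[OF thoms(4)]
  thom_in[OF thoms(5)] thom_in[OF thoms(6)] thom_in[OF thoms(7)]

lemma over: "w \<in> fob P X \<Longrightarrow> p X (ab_pr G 0 X w) = r X w" "w \<in> fob P X \<Longrightarrow> p X (ab_pr G 1 X w) = r X w"
  "w \<in> fob P X \<Longrightarrow> p X (ab_add G X w) = r X w" "z \<in> fob E X \<Longrightarrow> p X (ab_zero G X z) = e X z"
  "x \<in> fob C X \<Longrightarrow> p X (ab_neg G X x) = p X x"
  using slice_thom(2)[OF A objs(3,1) homs(1)] slice_thom(2)[OF A objs(3,1) homs(2)]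
    slice_thom(2)[OF A objs(3,1) homs(3)] slice_thom(2)[OF A objs(2,1) homs(4)] slice_thom(2)[OF A objs(1,1) homs(5)]
  by auto

lemma pair_ex: "x \<in> fob C X \<Longrightarrow> y \<in> fob C X \<Longrightarrow> p X x = p X y \<Longrightarrow> \<exists>w\<in>fob P X. ab_pr G 0 X w = x \<and> ab_pr G 1 X w = y"
  using sq unfolding pw_square_def by blast

lemma pair_eq: "w \<in> fob P X \<Longrightarrow> w' \<in> fob P X \<Longrightarrow> ab_pr G 0 X w = ab_pr G 0 X w' \<Longrightarrow> ab_pr G 1 X w = ab_pr G 1 X w' \<Longrightarrow> w = w'"
proof -
  assume w: "w \<in> fob P X" "w' \<in> fob P X" "ab_pr G 0 X w = ab_pr G 0 X w'" "ab_pr G 1 X w = ab_pr G 1 X w'"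
  have "\<exists>!v. v \<in> fob P X \<and> ab_pr G 0 X v = ab_pr G 0 X w \<and> ab_pr G 1 X v = ab_pr G 1 X w"
    using sq ins(1,2)[OF w(1)] over(1,2)[OF w(1)] unfolding pw_square_def by simp
  then show "w = w'" using w by metis
qed

lemma product: "is_product sl {0, 1} (\<lambda>_. ab_carrier G) (ab_square G) (ab_pr G)"
  using product_iff_pw_square[OF A objs(1,3) homs(1,2)] sq by simp

lemma terminal: "is_terminal sl (ab_one G)"
  using terminal_iff_bij[OF A objs(2)] bij by simp

lemma product_ex1:
  assumes "Y \<in> Obj sl" "\<forall>i\<in>{0, 1}. f i \<in> Hom sl Y (C, p)"
  shows "\<exists>!h. h \<in> Hom sl Y (P, r) \<and> (\<forall>i\<in>{0, 1}. Comp sl Y (P, r) (C, p) (ab_pr G i) h = f i)"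
  using product assms unfolding is_product_def car squ by blast

lemma pair_pw:
  assumes Y: "(Y, k) \<in> Obj sl" and f: "f \<in> Hom sl (Y, k) (C, p)" and g: "g \<in> Hom sl (Y, k) (C, p)"
  shows "ab_pair sl G (Y, k) f g \<in> Hom sl (Y, k) (P, r)"
    "y \<in> fob Y X \<Longrightarrow> ab_pr G 0 X (ab_pair sl G (Y, k) f g X y) = f X y"
    "y \<in> fob Y X \<Longrightarrow> ab_pr G 1 X (ab_pair sl G (Y, k) f g X y) = g X y"
proof -
  let ?f = "\<lambda>i :: nat. if i = 0 then f else g" and ?h = "ab_pair sl G (Y, k) f g"
  have "\<forall>i\<in>{0, 1}. ?f i \<in> Hom sl (Y, k) (C, p)" using f g by auto
  then have "\<exists>!h. h \<in> Hom sl (Y, k) (P, r) \<and> (\<forall>i\<in>{0, 1}. Comp sl (Y, k) (P, r) (C, p) (ab_pr G i) h = ?f i)"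
    by (rule product_ex1[OF Y])
  from theI'[OF this] have h: "?h \<in> Hom sl (Y, k) (P, r)"
    "Comp sl (Y, k) (P, r) (C, p) (ab_pr G 0) ?h = f" "Comp sl (Y, k) (P, r) (C, p) (ab_pr G 1) ?h = g"
    unfolding ab_pair_def tuple_def car squ by auto
  show "?h \<in> Hom sl (Y, k) (P, r)" by (rule h)
  show "ab_pr G 0 X (?h X y) = f X y" "ab_pr G 1 X (?h X y) = g X y" if "y \<in> fob Y X"
    using slice_Comp_Hom(2)[OF A Y objs(3,1) h(1) homs(1) that] slice_Comp_Hom(2)[OF A Y objs(3,1) h(1) homs(2) that] h(2,3) by auto
qed

lemma sum_pw:
  assumes Y: "(Y, k) \<in> Obj sl" and f: "f \<in> Hom sl (Y, k) (C, p)" and g: "g \<in> Hom sl (Y, k) (C, p)"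
  shows "ab_sum sl G (Y, k) f g \<in> Hom sl (Y, k) (C, p)"
    "y \<in> fob Y X \<Longrightarrow> w \<in> fob P X \<Longrightarrow> ab_pr G 0 X w = f X y \<Longrightarrow> ab_pr G 1 X w = g X y \<Longrightarrow> ab_sum sl G (Y, k) f g X y = ab_add G X w"
proof -
  note h = pair_pw[OF Y f g]
  note ch = slice_Comp_Hom[OF A Y objs(3,1) h(1) homs(3)]
  show "ab_sum sl G (Y, k) f g \<in> Hom sl (Y, k) (C, p)" using ch(1) by (simp add: ab_sum_def)
  assume y: "y \<in> fob Y X" and w: "w \<in> fob P X" "ab_pr G 0 X w = f X y" "ab_pr G 1 X w = g X y"
  have "ab_pair sl G (Y, k) f g X y = w"
    by (rule pair_eq[OF thom_in[OF slice_thom(1)[OF A Y objs(3) h(1)] y] w(1)]) (simp_all only: h(2,3)[OF y] w(2,3))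
  then show "ab_sum sl G (Y, k) f g X y = ab_add G X w" using ch(2)[OF y] by (simp add: ab_sum_def)
qed

lemma sum_pair:
  assumes Y: "(Y, k) \<in> Obj sl" and f: "f \<in> Hom sl (Y, k) (C, p)" and g: "g \<in> Hom sl (Y, k) (C, p)" and y: "y \<in> fob Y X"
  obtains w where "w \<in> fob P X" "ab_pr G 0 X w = f X y" "ab_pr G 1 X w = g X y" "ab_sum sl G (Y, k) f g X y = ab_add G X w"
  using pair_pw[OF Y f g] sum_pw[OF Y f g] thom_in[OF slice_thom(1)[OF A Y objs(3) pair_pw(1)[OF Y f g]] y] y by metis

lemma null_pw:
  assumes Y: "(Y, k) \<in> Obj sl"
  shows "ab_null sl G (Y, k) \<in> Hom sl (Y, k) (C, p)"
    "y \<in> fob Y X \<Longrightarrow> z \<in> fob E X \<Longrightarrow> e X z = k X y \<Longrightarrow> ab_null sl G (Y, k) X y = ab_zero G X z"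
proof -
  have "\<exists>!h. h \<in> Hom sl (Y, k) (E, e)" using terminal Y unfolding is_terminal_def one by blast
  from theI'[OF this] have h: "(THE h. h \<in> Hom sl (Y, k) (E, e)) \<in> Hom sl (Y, k) (E, e)" .
  note ch = slice_Comp_Hom[OF A Y objs(2,1) h homs(4)]
  show "ab_null sl G (Y, k) \<in> Hom sl (Y, k) (C, p)" using ch(1) by (simp add: ab_null_def)
  assume y: "y \<in> fob Y X" and z: "z \<in> fob E X" "e X z = k X y"
  have "(THE h. h \<in> Hom sl (Y, k) (E, e)) X y = z"
    using slice_thom[OF A Y objs(2) h] z y bij[of X] by (metis bij_betw_def inj_onD thom_in)
  then show "ab_null sl G (Y, k) X y = ab_zero G X z" using ch(2)[OF y] by (simp add: ab_null_def)
qed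

lemma e_inv: "a \<in> fob A X \<Longrightarrow> inv_into (fob E X) (e X) a \<in> fob E X" "a \<in> fob A X \<Longrightarrow> e X (inv_into (fob E X) (e X) a) = a"
  using bij[of X] by (auto simp: bij_betw_def intro: inv_into_into f_inv_into_f)

lemma thom_sec: "thom T A C (sec G)"
  using thom_comp[OF thom_inv[OF A algs(2) thoms(7) bij] thoms(4)] by (simp add: sec_def[abs_def])

lemma sec_in: "a \<in> fob A X \<Longrightarrow> sec G X a \<in> fob C X"
  and p_sec: "a \<in> fob A X \<Longrightarrow> p X (sec G X a) = a"
  using thom_in[OF thom_sec] over(4) e_inv by (auto simp: sec_def)

end

lemma (in lawvere_theory) ab_settingI:
  assumes A: "A \<in> Obj (Alg T)" and "abelian_group_object (slice (Alg T) A) G"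
    and c: "ab_carrier G = (C, p)" "ab_one G = (E, e)" "ab_square G = (P, r)"
  shows "ab_setting T A G C p E e P r"
proof -
  interpret g: abelian_group_object "slice (Alg T) A" G by fact
  have sqo: "ab_square G \<in> Obj (slice (Alg T) A)" "ab_one G \<in> Obj (slice (Alg T) A)"
    using g.square_product g.one_terminal by (auto simp: is_product_def is_terminal_def)
  have d: "ab_data T A G"
    using g.carrier_obj g.square_product g.one_terminal g.add_in_hom g.zero_in_hom g.neg_in_hom sqo
    by (auto simp: ab_data_def Let_def is_product_def)
  show ?thesis
  proof
    show "bij_betw (e X) (fob E X) (fob A X)" for X
      using terminal_iff_bij[OF A, of E e] g.one_terminal sqo c by auto
    show "pw_square C p P (ab_pr G)"
      using product_iff_pw_square[OF A, of C p P r "ab_pr G"] g.square_product d c by (simp add: ab_data_def Let_def)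
  qed (use A d c in auto)
qed

lemma (in lawvere_theory) ab_pw_if_group:
  assumes A: "A \<in> Obj (Alg T)" and G: "abelian_group_object (slice (Alg T) A) G"
  shows "ab_data T A G \<and> ab_pw A G"
proof -
  interpret g: abelian_group_object "slice (Alg T) A" G by fact
  obtain C p E e P r where c: "ab_carrier G = (C, p)" "ab_one G = (E, e)" "ab_square G = (P, r)" by (metis surj_pair)
  interpret s: ab_setting T A G C p E e P r by (rule ab_settingI[OF A G c])
  have 1: "ab_add G X w' = ab_add G X w" if "w \<in> fob P X" "w' \<in> fob P X"
    "ab_pr G 0 X w' = ab_pr G 1 X w" "ab_pr G 1 X w' = ab_pr G 0 X w" for X w w'
    using s.sum_pw(2)[OF s.objs(3) s.homs(2,1) that] g.ab_add_comm by simp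
  have idc: "Ident s.sl (C, p) \<in> Hom s.sl (C, p) (C, p)" "\<And>x X. x \<in> fob C X \<Longrightarrow> Ident s.sl (C, p) X x = x"
    using slice_Ident_Hom[OF A s.objs(1)] by auto
  have 2: "ab_add G X w = ab_pr G 1 X w" if w: "w \<in> fob P X" "z \<in> fob E X" "ab_pr G 0 X w = ab_zero G X z" for X w z
  proof -
    have y: "ab_pr G 1 X w \<in> fob C X" using s.ins w by blast
    have "e X z = p X (ab_pr G 1 X w)" using s.over(1,2)[OF w(1)] s.over(4)[OF w(2)] w(3) by simp
    then have "ab_null s.sl G (C, p) X (ab_pr G 1 X w) = ab_pr G 0 X w" using s.null_pw(2)[OF s.objs(1) y w(2)] w(3) by simp
    then show ?thesis
      using s.sum_pw(2)[OF s.objs(1) s.null_pw(1)[OF s.objs(1)] idc(1) y w(1)] idc(2)[OF y] g.ab_add_zero by simp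
  qed
  have 3: "ab_add G X w = ab_zero G X z" if w: "w \<in> fob P X" "z \<in> fob E X" "ab_pr G 0 X w = ab_neg G X (ab_pr G 1 X w)"
     "e X z = p X (ab_pr G 1 X w)" for X w z
  proof -
    have y: "ab_pr G 1 X w \<in> fob C X" using s.ins w by blast
    show ?thesis
      using s.sum_pw(2)[OF s.objs(1) s.homs(5) idc(1) y w(1)] idc(2)[OF y] w g.ab_add_neg
        s.null_pw(2)[OF s.objs(1) y w(2,4)] by simp
  qed
  have "ab_pw A G"
    unfolding ab_pw_def c fst_conv snd_conv
    by (intro conjI allI ballI impI) (rule s.bij s.sq 1 2 3; assumption)+
  then show ?thesis using s.data by blast
qed

text \<open>
  Theories whose algebras have an underlying supercommutative \<open>K\<close>-algebra. The two instances of interest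
  are \<open>S\<close> and the theory of supercommutative \<open>K\<close>-algebras itself.
\<close>

locale kalg_theory = closed_superring K + theory_morphism "SCom K" T \<sigma>
  for K :: "('k, 'z) superring_scheme" and T :: "('s, 'x) thy_scheme" and \<sigma>
begin

abbreviation UU where "UU B \<equiv> under K (comp_functor B \<sigma>)"

lemma UU_super: "B \<in> Obj (Alg T) \<Longrightarrow> supercommutative (UU B)"
  using supercommutative_under[OF pull_obj] .

lemma UU_shom: "thom T B B' h \<Longrightarrow> B \<in> Obj (Alg T) \<Longrightarrow> B' \<in> Obj (Alg T) \<Longrightarrow> shom (UU B) (UU B') (\<lambda>p. h (srt p))"
  using shom_thom[OF thom_pull, of B B' h] by simp

lemma UU_rules:
  assumes "thom T B B' h" "B \<in> Obj (Alg T)" "B' \<in> Obj (Alg T)"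
  shows UU_sadd: "x \<in> fob B (srt q) \<Longrightarrow> y \<in> fob B (srt q) \<Longrightarrow> h (srt q) (sadd (UU B) q x y) = sadd (UU B') q (h (srt q) x) (h (srt q) y)"
    and UU_smul: "x \<in> fob B (srt q) \<Longrightarrow> y \<in> fob B (srt r) \<Longrightarrow> h (srt (q + r)) (smul (UU B) q r x y) = smul (UU B') q r (h (srt q) x) (h (srt r) y)"
    and UU_szero: "h (srt q) (szero (UU B) q) = szero (UU B') q"
  using UU_shom[OF assms] by (auto simp: shom_def)

lemma UU_in:
  assumes "B \<in> Obj (Alg T)"
  shows "x \<in> fob B (srt q) \<Longrightarrow> y \<in> fob B (srt q) \<Longrightarrow> sadd (UU B) q x y \<in> fob B (srt q)"
    "x \<in> fob B (srt q) \<Longrightarrow> y \<in> fob B (srt r) \<Longrightarrow> smul (UU B) q r x y \<in> fob B (srt (q + r))"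
    "szero (UU B) q \<in> fob B (srt q)"
proof -
  interpret N: supercommutative "UU B" by (rule UU_super[OF assms])
  show "x \<in> fob B (srt q) \<Longrightarrow> y \<in> fob B (srt q) \<Longrightarrow> sadd (UU B) q x y \<in> fob B (srt q)" using N.sadd_car[of x q y] by simp
  show "x \<in> fob B (srt q) \<Longrightarrow> y \<in> fob B (srt r) \<Longrightarrow> smul (UU B) q r x y \<in> fob B (srt (q + r))" using N.smul_car[of x q y r] by simp
  show "szero (UU B) q \<in> fob B (srt q)" using N.szero_car[of q] by simp
qed

end

locale ab_kalg = kalg_theory K T \<sigma> + s: ab_setting T A G C p E e P r
  for K :: "('k, 'z) superring_scheme" and T :: "('s, 'x) thy_scheme" and \<sigma>
    and A :: "('s, 'u) alg" and G C p E e P r +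
  assumes pw: "ab_pw A G"
begin

lemma comm: "w \<in> fob P X \<Longrightarrow> w' \<in> fob P X \<Longrightarrow>
      ab_pr G 0 X w' = ab_pr G 1 X w \<Longrightarrow> ab_pr G 1 X w' = ab_pr G 0 X w \<Longrightarrow> ab_add G X w' = ab_add G X w"
  and zero_left: "w \<in> fob P X \<Longrightarrow> z \<in> fob E X \<Longrightarrow> ab_pr G 0 X w = ab_zero G X z \<Longrightarrow> ab_add G X w = ab_pr G 1 X w"
  and neg_left: "w \<in> fob P X \<Longrightarrow> z \<in> fob E X \<Longrightarrow> ab_pr G 0 X w = ab_neg G X (ab_pr G 1 X w) \<Longrightarrow>
      e X z = p X (ab_pr G 1 X w) \<Longrightarrow> ab_add G X w = ab_zero G X z"
  using pw unfolding ab_pw_def s.car s.one s.squ fst_conv snd_conv by blast+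

lemma add_sec_left:
  assumes "w \<in> fob P X" "a \<in> fob A X" "ab_pr G 0 X w = sec G X a"
  shows "ab_add G X w = ab_pr G 1 X w"
  using zero_left[OF assms(1) s.e_inv(1)[OF assms(2)]] assms(3) by (simp add: sec_def)

lemma add_sec_right:
  assumes w: "w \<in> fob P X" and a: "a \<in> fob A X" and eq: "ab_pr G 1 X w = sec G X a"
  shows "ab_add G X w = ab_pr G 0 X w"
proof -
  have x: "ab_pr G 0 X w \<in> fob C X" "ab_pr G 1 X w \<in> fob C X" using s.ins w by auto
  obtain w' where w': "w' \<in> fob P X" "ab_pr G 0 X w' = ab_pr G 1 X w" "ab_pr G 1 X w' = ab_pr G 0 X w"
    using s.pair_ex[OF x(2,1)] s.over(1,2)[OF w] by auto
  then have "ab_add G X w = ab_add G X w'" using comm[OF w w'] by simp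
  also have "\<dots> = ab_pr G 0 X w" using add_sec_left[OF w'(1) a] w' eq by simp
  finally show ?thesis .
qed

text \<open>
  In the square, \<open>(x, y) + (e, e) = (x, e) + (e, y)\<close>, where \<open>e\<close> is the neutral element of the fibre; the
  group law is additive and \<open>e\<close> is neutral for it.
\<close>

lemma add_formula:
  assumes w: "w \<in> fob P (srt q)"
  shows "sadd (UU C) q (ab_add G (srt q) w) (sec G (srt q) (r (srt q) w)) = sadd (UU C) q (ab_pr G 0 (srt q) w) (ab_pr G 1 (srt q) w)"
proof -
  interpret N: supercommutative "UU C" by (rule UU_super[OF s.algs(1)])
  let ?X = "srt q"
  let ?x = "ab_pr G 0 ?X w" and ?y = "ab_pr G 1 ?X w" and ?a = "r ?X w"
  let ?e = "sec G ?X ?a"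
  have a: "?a \<in> fob A ?X" using thom_in[OF s.thoms(8) w] .
  have xy: "?x \<in> fob C ?X" "?y \<in> fob C ?X" "?e \<in> fob C ?X" using s.ins w s.sec_in[OF a] by auto
  have p: "p ?X ?x = ?a" "p ?X ?y = ?a" "p ?X ?e = ?a" using s.over(1,2)[OF w] s.p_sec[OF a] by auto
  obtain w1 where w1: "w1 \<in> fob P ?X" "ab_pr G 0 ?X w1 = ?x" "ab_pr G 1 ?X w1 = ?e" using s.pair_ex[OF xy(1,3)] p by auto
  obtain w2 where w2: "w2 \<in> fob P ?X" "ab_pr G 0 ?X w2 = ?e" "ab_pr G 1 ?X w2 = ?y" using s.pair_ex[OF xy(3,2)] p by auto
  obtain w0 where w0: "w0 \<in> fob P ?X" "ab_pr G 0 ?X w0 = ?e" "ab_pr G 1 ?X w0 = ?e" using s.pair_ex[OF xy(3,3)] p by auto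
  note P = s.algs(3) and C = s.algs(1)
  note h0 = UU_sadd[OF s.thoms(1) P C] and h1 = UU_sadd[OF s.thoms(2) P C] and ha = UU_sadd[OF s.thoms(3) P C]
  have "sadd (UU P) q w w0 = sadd (UU P) q w1 w2"
  proof (rule s.pair_eq[of _ ?X])
    show "ab_pr G 0 ?X (sadd (UU P) q w w0) = ab_pr G 0 ?X (sadd (UU P) q w1 w2)"
      unfolding h0[OF w w0(1)] h0[OF w1(1) w2(1)] w0 w1 w2 ..
    show "ab_pr G 1 ?X (sadd (UU P) q w w0) = ab_pr G 1 ?X (sadd (UU P) q w1 w2)"
      unfolding h1[OF w w0(1)] h1[OF w1(1) w2(1)] w0 w1 w2 using N.sadd_comm[of ?y q ?e] xy by simp
  qed (use UU_in(1)[OF P] w w0 w1 w2 in auto)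
  then have "sadd (UU C) q (ab_add G ?X w) (ab_add G ?X w0) = sadd (UU C) q (ab_add G ?X w1) (ab_add G ?X w2)"
    using ha[OF w w0(1)] ha[OF w1(1) w2(1)] by simp
  then show ?thesis
    using add_sec_left[OF w0(1) a w0(2)] add_sec_right[OF w1(1) a w1(3)] add_sec_left[OF w2(1) a w2(2)] w0 w1 w2 by simp
qed

text \<open>
  In the square, \<open>(m, 0) (0, n) = (0, 0)\<close>, and the group law sends \<open>(m, 0)\<close> to \<open>m\<close> and \<open>(0, n)\<close> to \<open>n\<close>.
\<close>

lemma kernel_square_zero:
  assumes m: "m \<in> fob C (srt q)" "p (srt q) m = szero (UU A) q"
    and n: "n \<in> fob C (srt t)" "p (srt t) n = szero (UU A) t"
  shows "smul (UU C) q t m n = szero (UU C) (q + t)"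
proof -
  interpret N: supercommutative "UU C" by (rule UU_super[OF s.algs(1)])
  note P = s.algs(3) and C = s.algs(1)
  have z: "szero (UU C) q \<in> fob C (srt q)" "p (srt q) (szero (UU C) q) = szero (UU A) q"
     "sec G (srt q) (szero (UU A) q) = szero (UU C) q" "szero (UU A) q \<in> fob A (srt q)" for q
    using UU_szero[OF s.thoms(6) C s.A] UU_szero[OF s.thom_sec s.A C] UU_in(3)[OF C] UU_in(3)[OF s.A] by auto
  obtain w1 where w1: "w1 \<in> fob P (srt q)" "ab_pr G 0 (srt q) w1 = m" "ab_pr G 1 (srt q) w1 = szero (UU C) q"
    using s.pair_ex[OF m(1) z(1)] m(2) z(2)[of q] by auto
  obtain w2 where w2: "w2 \<in> fob P (srt t)" "ab_pr G 0 (srt t) w2 = szero (UU C) t" "ab_pr G 1 (srt t) w2 = n"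
    using s.pair_ex[OF z(1) n(1)] n(2) z(2)[of t] by auto
  note h0 = UU_rules[OF s.thoms(1) P C] and h1 = UU_rules[OF s.thoms(2) P C] and ha = UU_rules[OF s.thoms(3) P C]
  have "smul (UU P) q t w1 w2 = szero (UU P) (q + t)"
  proof (rule s.pair_eq[of _ "srt (q + t)"])
    show "ab_pr G 0 (srt (q + t)) (smul (UU P) q t w1 w2) = ab_pr G 0 (srt (q + t)) (szero (UU P) (q + t))"
      unfolding h0(2)[OF w1(1) w2(1)] h0(3) w1 w2 using N.smul_szero[of m q t] m by simp
    show "ab_pr G 1 (srt (q + t)) (smul (UU P) q t w1 w2) = ab_pr G 1 (srt (q + t)) (szero (UU P) (q + t))"
      unfolding h1(2)[OF w1(1) w2(1)] h1(3) w1 w2 using N.szero_smul[of n t q] n by simp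
  qed (use UU_in[OF P] w1 w2 in auto)
  then have "smul (UU C) q t (ab_add G (srt q) w1) (ab_add G (srt t) w2) = szero (UU C) (q + t)"
    using ha(2)[OF w1(1) w2(1)] ha(3) by simp
  moreover have "ab_add G (srt q) w1 = m" using add_sec_right[OF w1(1) z(4)] w1 z(3) by simp
  moreover have "ab_add G (srt t) w2 = n" using add_sec_left[OF w2(1) z(4)] w2 z(3) by simp
  ultimately show ?thesis by simp
qed

text \<open>
  By \<open>add_formula\<close>, associativity of the group law is associativity of addition.
\<close>

lemma add_assoc_sort:
  assumes "w1 \<in> fob P (srt q)" "w2 \<in> fob P (srt q)" "w3 \<in> fob P (srt q)" "w4 \<in> fob P (srt q)"
    "ab_pr G 0 (srt q) w2 = ab_add G (srt q) w1" "ab_pr G 0 (srt q) w3 = ab_pr G 1 (srt q) w1"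
    "ab_pr G 1 (srt q) w3 = ab_pr G 1 (srt q) w2" "ab_pr G 0 (srt q) w4 = ab_pr G 0 (srt q) w1"
    "ab_pr G 1 (srt q) w4 = ab_add G (srt q) w3"
  shows "ab_add G (srt q) w2 = ab_add G (srt q) w4"
proof -
  interpret N: supercommutative "UU C" by (rule UU_super[OF s.algs(1)])
  let ?X = "srt q"
  have ov: "r ?X w2 = r ?X w1" "r ?X w3 = r ?X w1" "r ?X w4 = r ?X w1"
    using s.over[of w1 ?X] s.over[of w2 ?X] s.over[of w3 ?X] s.over[of w4 ?X] assms by metis+
  let ?e = "sec G ?X (r ?X w1)"
  have c: "?e \<in> car (UU C) q" "ab_pr G 0 ?X w1 \<in> car (UU C) q" "ab_pr G 1 ?X w1 \<in> car (UU C) q" "ab_pr G 1 ?X w2 \<in> car (UU C) q"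
     "ab_add G ?X w1 \<in> car (UU C) q" "ab_add G ?X w2 \<in> car (UU C) q" "ab_add G ?X w3 \<in> car (UU C) q" "ab_add G ?X w4 \<in> car (UU C) q"
    using assms s.ins s.sec_in[OF thom_in[OF s.thoms(8) assms(1)]] by auto
  note f1 = add_formula[OF assms(1)] and f2 = add_formula[OF assms(2), unfolded ov assms(5)]
    and f3 = add_formula[OF assms(3), unfolded ov assms(6,7)] and f4 = add_formula[OF assms(4), unfolded ov assms(8,9)]
  have "sadd (UU C) q (sadd (UU C) q (ab_add G ?X w2) ?e) ?e = sadd (UU C) q (sadd (UU C) q (ab_add G ?X w1) (ab_pr G 1 ?X w2)) ?e"
    unfolding f2 ..
  also have "\<dots> = sadd (UU C) q (sadd (UU C) q (ab_add G ?X w1) ?e) (ab_pr G 1 ?X w2)" using c by (simp only: N.sadd_ac)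
  also have "\<dots> = sadd (UU C) q (ab_pr G 0 ?X w1) (sadd (UU C) q (ab_pr G 1 ?X w1) (ab_pr G 1 ?X w2))"
    unfolding f1 using c by (intro N.sadd_assoc)
  also have "\<dots> = sadd (UU C) q (ab_pr G 0 ?X w1) (sadd (UU C) q (ab_add G ?X w3) ?e)" unfolding f3 ..
  also have "\<dots> = sadd (UU C) q (sadd (UU C) q (ab_pr G 0 ?X w1) (ab_add G ?X w3)) ?e" using c by (intro N.sadd_assoc[symmetric])
  also have "\<dots> = sadd (UU C) q (sadd (UU C) q (ab_add G ?X w4) ?e) ?e" unfolding f4 ..
  finally have *: "sadd (UU C) q (sadd (UU C) q (ab_add G ?X w2) ?e) ?e = sadd (UU C) q (sadd (UU C) q (ab_add G ?X w4) ?e) ?e" .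
  obtain e' where e': "e' \<in> car (UU C) q" "sadd (UU C) q e' ?e = szero (UU C) q" using N.sneg_ex[OF c(1)] by blast
  have cancel: "x = y" if "x \<in> car (UU C) q" "y \<in> car (UU C) q" "sadd (UU C) q x ?e = sadd (UU C) q y ?e" for x y
  proof -
    have "x = sadd (UU C) q (sadd (UU C) q x ?e) e'" "y = sadd (UU C) q (sadd (UU C) q y ?e) e'"
      using that e' c N.sadd_comm[of e' q ?e] N.add_szero[of _ q] N.sadd_assoc by metis+
    then show ?thesis using that(3) by simp
  qed
  have "sadd (UU C) q (ab_add G ?X w2) ?e \<in> car (UU C) q" "sadd (UU C) q (ab_add G ?X w4) ?e \<in> car (UU C) q"
    using c by (auto intro: N.sadd_car simp del: car_under)
  from cancel[OF c(6,8) cancel[OF this *]] show ?thesis .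
qed

lemma add_assoc_pw:
  assumes w: "w1 \<in> fob P X" "w2 \<in> fob P X" "w3 \<in> fob P X" "w4 \<in> fob P X"
    and eq: "ab_pr G 0 X w2 = ab_add G X w1" "ab_pr G 0 X w3 = ab_pr G 1 X w1"
    "ab_pr G 1 X w3 = ab_pr G 1 X w2" "ab_pr G 0 X w4 = ab_pr G 0 X w1" "ab_pr G 1 X w4 = ab_add G X w3"
  shows "ab_add G X w2 = ab_add G X w4"
proof (rule tgt.alg_eqI[OF s.algs(1)])
  fix i assume i: "i < len X"
  note c0 = tgt.thom_crd[OF s.thoms(1) s.algs(3) _ i] and c1 = tgt.thom_crd[OF s.thoms(2) s.algs(3) _ i]
    and ca = tgt.thom_crd[OF s.thoms(3) s.algs(3) _ i]
  show "crd T C X (ab_add G X w2) i = crd T C X (ab_add G X w4) i"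
    unfolding ca[OF w(2)] ca[OF w(4)]
    by (rule add_assoc_sort[of "crd T P X w1 i" _ _ "crd T P X w3 i"])
      (use w eq i s.algs(3) in \<open>simp_all flip: c0[OF w(1)] c0[OF w(2)] c0[OF w(3)] c0[OF w(4)] c1[OF w(1), unfolded One_nat_def] c1[OF w(2), unfolded One_nat_def] c1[OF w(3), unfolded One_nat_def] c1[OF w(4), unfolded One_nat_def] ca[OF w(1)] ca[OF w(3)]\<close>)
qed (use s.ins w in auto)

text \<open>
  Except for associativity, the axioms are the elementwise conditions, composed with arrows into the carrier.
\<close>

lemma group: "abelian_group_object s.sl G"
proof
  note objs = s.objs and homs = s.homs and A = s.A
  show "ab_carrier G \<in> Obj s.sl" using objs by simp
  show "is_terminal s.sl (ab_one G)" by (rule s.terminal)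
  show "is_product s.sl {0, 1} (\<lambda>_. ab_carrier G) (ab_square G) (ab_pr G)" by (rule s.product)
  show "ab_add G \<in> Hom s.sl (ab_square G) (ab_carrier G)" "ab_zero G \<in> Hom s.sl (ab_one G) (ab_carrier G)"
    "ab_neg G \<in> Hom s.sl (ab_carrier G) (ab_carrier G)" using homs by simp_all
  have idc: "Ident s.sl (C, p) \<in> Hom s.sl (C, p) (C, p)" "\<And>x X. x \<in> fob C X \<Longrightarrow> Ident s.sl (C, p) X x = x"
    using tgt.slice_Ident_Hom[OF A objs(1)] by auto
  note null = s.null_pw[OF objs(1)]
  have "ab_sum s.sl G (P, r) (ab_pr G 1) (ab_pr G 0) = ab_add G"
  proof (rule tgt.slice_Hom_eqI[OF A objs(3,1) s.sum_pw(1)[OF objs(3) homs(2,1)] homs(3)])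
    fix X x assume x: "x \<in> fob P X"
    obtain w where "w \<in> fob P X" "ab_pr G 0 X w = ab_pr G 1 X x" "ab_pr G 1 X w = ab_pr G 0 X x"
      "ab_sum s.sl G (P, r) (ab_pr G 1) (ab_pr G 0) X x = ab_add G X w"
      using s.sum_pair[OF objs(3) homs(2,1) x] .
    then show "ab_sum s.sl G (P, r) (ab_pr G 1) (ab_pr G 0) X x = ab_add G X x" using comm[OF x] by simp
  qed
  then show "ab_sum s.sl G (ab_square G) (ab_pr G 1) (ab_pr G 0) = ab_add G" by simp
  have "ab_sum s.sl G (C, p) (ab_null s.sl G (C, p)) (Ident s.sl (C, p)) = Ident s.sl (C, p)"
  proof (rule tgt.slice_Hom_eqI[OF A objs(1,1) s.sum_pw(1)[OF objs(1) null(1) idc(1)] idc(1)])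
    fix X x assume x: "x \<in> fob C X"
    let ?z = "inv_into (fob E X) (e X) (p X x)"
    have z: "?z \<in> fob E X" "e X ?z = p X x" using s.e_inv s.ins x by auto
    obtain w where "w \<in> fob P X" "ab_pr G 0 X w = ab_null s.sl G (C, p) X x" "ab_pr G 1 X w = Ident s.sl (C, p) X x"
      "ab_sum s.sl G (C, p) (ab_null s.sl G (C, p)) (Ident s.sl (C, p)) X x = ab_add G X w"
      using s.sum_pair[OF objs(1) null(1) idc(1) x] .
    then show "ab_sum s.sl G (C, p) (ab_null s.sl G (C, p)) (Ident s.sl (C, p)) X x = Ident s.sl (C, p) X x"
      using zero_left[of w X ?z] null(2)[OF x z] z by simp
  qed
  then show "ab_sum s.sl G (ab_carrier G) (ab_null s.sl G (ab_carrier G)) (Ident s.sl (ab_carrier G)) = Ident s.sl (ab_carrier G)" by simp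
  have "ab_sum s.sl G (C, p) (ab_neg G) (Ident s.sl (C, p)) = ab_null s.sl G (C, p)"
  proof (rule tgt.slice_Hom_eqI[OF A objs(1,1) s.sum_pw(1)[OF objs(1) homs(5) idc(1)] null(1)])
    fix X x assume x: "x \<in> fob C X"
    let ?z = "inv_into (fob E X) (e X) (p X x)"
    have z: "?z \<in> fob E X" "e X ?z = p X x" using s.e_inv s.ins x by auto
    obtain w where "w \<in> fob P X" "ab_pr G 0 X w = ab_neg G X x" "ab_pr G 1 X w = Ident s.sl (C, p) X x"
      "ab_sum s.sl G (C, p) (ab_neg G) (Ident s.sl (C, p)) X x = ab_add G X w"
      using s.sum_pair[OF objs(1) homs(5) idc(1) x] .
    then show "ab_sum s.sl G (C, p) (ab_neg G) (Ident s.sl (C, p)) X x = ab_null s.sl G (C, p) X x"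
      using neg_left[of w X ?z] null(2)[OF x z] z idc(2)[OF x] by simp
  qed
  then show "ab_sum s.sl G (ab_carrier G) (ab_neg G) (Ident s.sl (ab_carrier G)) = ab_null s.sl G (ab_carrier G)" by simp
  fix Yk f g h
  assume Yk: "Yk \<in> Obj s.sl" and fgh: "f \<in> Hom s.sl Yk (ab_carrier G)" "g \<in> Hom s.sl Yk (ab_carrier G)" "h \<in> Hom s.sl Yk (ab_carrier G)"
  obtain Y k where Yk': "Yk = (Y, k)" by (metis surj_pair)
  have Y: "(Y, k) \<in> Obj s.sl" and f: "f \<in> Hom s.sl (Y, k) (C, p)" and g: "g \<in> Hom s.sl (Y, k) (C, p)" and h: "h \<in> Hom s.sl (Y, k) (C, p)"
    using Yk fgh Yk' by auto
  note fg = s.sum_pw(1)[OF Y f g] and gh = s.sum_pw(1)[OF Y g h]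
  have "ab_sum s.sl G (Y, k) (ab_sum s.sl G (Y, k) f g) h = ab_sum s.sl G (Y, k) f (ab_sum s.sl G (Y, k) g h)"
  proof (rule tgt.slice_Hom_eqI[OF A Y objs(1) s.sum_pw(1)[OF Y fg h] s.sum_pw(1)[OF Y f gh]])
    fix X y assume y: "y \<in> fob Y X"
    obtain w1 where w1: "w1 \<in> fob P X" "ab_pr G 0 X w1 = f X y" "ab_pr G 1 X w1 = g X y" "ab_sum s.sl G (Y, k) f g X y = ab_add G X w1"
      using s.sum_pair[OF Y f g y] .
    obtain w2 where w2: "w2 \<in> fob P X" "ab_pr G 0 X w2 = ab_sum s.sl G (Y, k) f g X y" "ab_pr G 1 X w2 = h X y"
      "ab_sum s.sl G (Y, k) (ab_sum s.sl G (Y, k) f g) h X y = ab_add G X w2" using s.sum_pair[OF Y fg h y] .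
    obtain w3 where w3: "w3 \<in> fob P X" "ab_pr G 0 X w3 = g X y" "ab_pr G 1 X w3 = h X y" "ab_sum s.sl G (Y, k) g h X y = ab_add G X w3"
      using s.sum_pair[OF Y g h y] .
    obtain w4 where w4: "w4 \<in> fob P X" "ab_pr G 0 X w4 = f X y" "ab_pr G 1 X w4 = ab_sum s.sl G (Y, k) g h X y"
      "ab_sum s.sl G (Y, k) f (ab_sum s.sl G (Y, k) g h) X y = ab_add G X w4" using s.sum_pair[OF Y f gh y] .
    show "ab_sum s.sl G (Y, k) (ab_sum s.sl G (Y, k) f g) h X y = ab_sum s.sl G (Y, k) f (ab_sum s.sl G (Y, k) g h) X y"
      unfolding w2(4) w4(4) by (rule add_assoc_pw[OF w1(1) w2(1) w3(1) w4(1)]) (use w1 w2 w3 w4 in simp_all)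
  qed
  then show "ab_sum s.sl G Yk (ab_sum s.sl G Yk f g) h = ab_sum s.sl G Yk f (ab_sum s.sl G Yk g h)" by (simp add: Yk')
qed

end

section \<open>The category of modules\<close>

lemma (in supercommutative) sadd_cancel:
  assumes "x \<in> car N q" "y \<in> car N q" "e \<in> car N q" "sadd N q x e = sadd N q y e"
  shows "x = y"
proof -
  obtain e' where e': "e' \<in> car N q" "sadd N q e' e = szero N q" using sneg_ex[OF assms(3)] by blast
  have "x = sadd N q (sadd N q x e) e'" "y = sadd N q (sadd N q y e) e'"
    using assms(1-3) e' sadd_comm[of e' q e] add_szero[of _ q] sadd_assoc by metis+
  then show ?thesis using assms(4) by simp
qed

lemma Mod_simps:
  "Obj (Mod C A) = {G. abelian_group_object (slice C A) G}"
  "Ident (Mod C A) G = Ident (slice C A) (ab_carrier G)"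
  "Comp (Mod C A) G H L = Comp (slice C A) (ab_carrier G) (ab_carrier H) (ab_carrier L)"
  "Hom (Mod C A) G H = {u \<in> Hom (slice C A) (ab_carrier G) (ab_carrier H).
        Comp (slice C A) (ab_square G) (ab_carrier G) (ab_carrier H) u (ab_add G)
          = ab_sum (slice C A) H (ab_square G)
              (Comp (slice C A) (ab_square G) (ab_carrier G) (ab_carrier H) u (ab_pr G 0))
              (Comp (slice C A) (ab_square G) (ab_carrier G) (ab_carrier H) u (ab_pr G 1))}"
  by (simp_all add: Mod_def Ab_def)

context kalg_theory
begin

lemma ab_kalgI:
  assumes "A \<in> Obj (Alg T)" "abelian_group_object (slice (Alg T) A) G"
    "ab_carrier G = (C, p)" "ab_one G = (E, e)" "ab_square G = (P, r)"
  shows "ab_kalg K T \<sigma> A G C p E e P r"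
proof -
  interpret s: ab_setting T A G C p E e P r by (rule tgt.ab_settingI[OF assms])
  show ?thesis by unfold_locales (use tgt.ab_pw_if_group[OF assms(1,2)] in blast)
qed

text \<open>
  By \<open>add_formula\<close> the group laws are determined by the neutral elements and addition, which every
  homomorphism preserves.
\<close>

lemma Mod_Hom:
  assumes A: "A \<in> Obj (Alg T)" and G: "G \<in> Obj (Mod (Alg T) A)" and H: "H \<in> Obj (Mod (Alg T) A)"
  shows "u \<in> Hom (Mod (Alg T) A) G H \<longleftrightarrow>
    u \<in> Hom (slice (Alg T) A) (ab_carrier G) (ab_carrier H) \<and> (\<forall>X. \<forall>a\<in>fob A X. u X (sec G X a) = sec H X a)"
proof -
  let ?sl = "slice (Alg T) A"
  have GH: "abelian_group_object ?sl G" "abelian_group_object ?sl H" using G H by (simp_all add: Mod_simps)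
  obtain C p E e P r where c: "ab_carrier G = (C, p)" "ab_one G = (E, e)" "ab_square G = (P, r)" by (metis surj_pair)
  obtain C' p' E' e' P' r' where c': "ab_carrier H = (C', p')" "ab_one H = (E', e')" "ab_square H = (P', r')" by (metis surj_pair)
  interpret g: ab_kalg K T \<sigma> A G C p E e P r by (rule ab_kalgI[OF A GH(1) c])
  interpret h: ab_kalg K T \<sigma> A H C' p' E' e' P' r' by (rule ab_kalgI[OF A GH(2) c'])
  have "(Comp ?sl (P, r) (C, p) (C', p') u (ab_add G)
          = ab_sum ?sl H (P, r) (Comp ?sl (P, r) (C, p) (C', p') u (ab_pr G 0)) (Comp ?sl (P, r) (C, p) (C', p') u (ab_pr G 1)))
      \<longleftrightarrow> (\<forall>X. \<forall>a\<in>fob A X. u X (sec G X a) = sec H X a)" (is "?l = ?r") if u: "u \<in> Hom ?sl (C, p) (C', p')"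
  proof -
    note tu = tgt.slice_thom[OF A g.s.objs(1) h.s.objs(1) u]
    note cu = tgt.slice_Comp_Hom[OF A g.s.objs(3,1) h.s.objs(1) _ u]
    note ca = cu[OF g.s.homs(3)] and c0 = cu[OF g.s.homs(1)] and c1 = cu[OF g.s.homs(2)]
    interpret N: supercommutative "UU C'" by (rule UU_super[OF h.s.algs(1)])
    show ?thesis
    proof
      assume l: ?l
      have srt: "u (srt q) (sec G (srt q) a) = sec H (srt q) a" if a: "a \<in> fob A (srt q)" for q a
      proof -
        let ?e = "sec G (srt q) a"
        have e: "?e \<in> fob C (srt q)" "p (srt q) ?e = a" using g.s.sec_in[OF a] g.s.p_sec[OF a] by auto
        have ue: "u (srt q) ?e \<in> fob C' (srt q)" "p' (srt q) (u (srt q) ?e) = a" using thom_in[OF tu(1) e(1)] tu(2)[OF e(1)] e by auto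
        obtain w where w: "w \<in> fob P (srt q)" "ab_pr G 0 (srt q) w = ?e" "ab_pr G 1 (srt q) w = ?e" using g.s.pair_ex[OF e(1) e(1)] by auto
        obtain w' where w': "w' \<in> fob P' (srt q)" "ab_pr H 0 (srt q) w' = u (srt q) ?e" "ab_pr H 1 (srt q) w' = u (srt q) ?e" using h.s.pair_ex[OF ue(1) ue(1)] by auto
        have "u (srt q) (ab_add G (srt q) w) = ab_add H (srt q) w'"
          using h.s.sum_pw(2)[OF g.s.objs(3) c0(1) c1(1) w(1) w'(1)] c0(2)[OF w(1)] c1(2)[OF w(1)] ca(2)[OF w(1)] l w w' by simp
        then have ue': "ab_add H (srt q) w' = u (srt q) ?e" using g.add_sec_left[OF w(1) a w(2)] w by simp
        have rw: "r' (srt q) w' = a" using h.s.over(1)[OF w'(1)] w' ue by simp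
        have "sadd (UU C') q (u (srt q) ?e) (sec H (srt q) a) = sadd (UU C') q (u (srt q) ?e) (u (srt q) ?e)"
          using h.add_formula[OF w'(1)] ue' rw w' by simp
        then have "sadd (UU C') q (sec H (srt q) a) (u (srt q) ?e) = sadd (UU C') q (u (srt q) ?e) (u (srt q) ?e)"
          using N.sadd_comm[of "u (srt q) ?e" q "sec H (srt q) a"] ue h.s.sec_in[OF a] by simp
        then show ?thesis using N.sadd_cancel[of "sec H (srt q) a" q "u (srt q) ?e" "u (srt q) ?e"] ue h.s.sec_in[OF a] by simp
      qed
      show ?r
      proof (intro allI ballI)
        fix X a assume a: "a \<in> fob A X"
        show "u X (sec G X a) = sec H X a"
        proof (rule tgt.alg_eqI[OF h.s.algs(1)])
          fix i assume i: "i < len X"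
          show "crd T C' X (u X (sec G X a)) i = crd T C' X (sec H X a) i"
            using tgt.thom_crd[OF tu(1) g.s.algs(1) g.s.sec_in[OF a] i] tgt.thom_crd[OF g.s.thom_sec A a i]
              tgt.thom_crd[OF h.s.thom_sec A a i] srt[of "crd T A X a i" "gr X i"] tgt.crd_in[OF A a i] by simp
        qed (use a g.s.sec_in h.s.sec_in thom_in[OF tu(1)] in auto)
      qed
    next
      assume s: ?r
      have srt: "u (srt q) (ab_add G (srt q) w) = ab_add H (srt q) w'"
        if w: "w \<in> fob P (srt q)" "w' \<in> fob P' (srt q)" "ab_pr H 0 (srt q) w' = u (srt q) (ab_pr G 0 (srt q) w)"
          "ab_pr H 1 (srt q) w' = u (srt q) (ab_pr G 1 (srt q) w)" for q w w'
      proof -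
        let ?a = "r (srt q) w"
        have a: "?a \<in> fob A (srt q)" using thom_in[OF g.s.thoms(8) w(1)] .
        have xy: "ab_pr G 0 (srt q) w \<in> fob C (srt q)" "ab_pr G 1 (srt q) w \<in> fob C (srt q)" "ab_add G (srt q) w \<in> fob C (srt q)"
          "sec G (srt q) ?a \<in> fob C (srt q)" using g.s.ins w(1) g.s.sec_in[OF a] by auto
        have ra: "r' (srt q) w' = ?a" using h.s.over(1)[OF w(2)] w(3) tu(2)[OF xy(1)] g.s.over(1)[OF w(1)] by simp
        note us = UU_sadd[OF tu(1) g.s.algs(1) h.s.algs(1)]
        have "sadd (UU C') q (u (srt q) (ab_add G (srt q) w)) (sec H (srt q) ?a) = sadd (UU C') q (ab_add H (srt q) w') (sec H (srt q) ?a)"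
          using us[OF xy(3,4)] us[OF xy(1,2)] g.add_formula[OF w(1)] h.add_formula[OF w(2)] s a w ra by simp
        then show ?thesis
          using N.sadd_cancel[of "u (srt q) (ab_add G (srt q) w)" q "ab_add H (srt q) w'" "sec H (srt q) ?a"]
            thom_in[OF tu(1) xy(3)] h.s.ins(3)[OF w(2)] h.s.sec_in[OF a] by simp
      qed
      show ?l
      proof (rule tgt.slice_Hom_eqI[OF A g.s.objs(3) h.s.objs(1) ca(1) h.s.sum_pw(1)[OF g.s.objs(3) c0(1) c1(1)]])
        fix X w assume w: "w \<in> fob P X"
        obtain w' where w': "w' \<in> fob P' X" "ab_pr H 0 X w' = Comp ?sl (P, r) (C, p) (C', p') u (ab_pr G 0) X w"
          "ab_pr H 1 X w' = Comp ?sl (P, r) (C, p) (C', p') u (ab_pr G 1) X w"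
          "ab_sum ?sl H (P, r) (Comp ?sl (P, r) (C, p) (C', p') u (ab_pr G 0)) (Comp ?sl (P, r) (C, p) (C', p') u (ab_pr G 1)) X w = ab_add H X w'"
          using h.s.sum_pair[OF g.s.objs(3) c0(1) c1(1) w] .
        have "u X (ab_add G X w) = ab_add H X w'"
        proof (rule tgt.alg_eqI[OF h.s.algs(1)])
          fix i assume i: "i < len X"
          note k = tgt.thom_crd[OF _ _ _ i]
          have w'0: "ab_pr H 0 X w' = u X (ab_pr G 0 X w)" and w'1: "ab_pr H 1 X w' = u X (ab_pr G 1 X w)"
            using w'(2,3) c0(2)[OF w] c1(2)[OF w] by auto
          have "ab_pr H 0 (srt (gr X i)) (crd T P' X w' i) = u (srt (gr X i)) (ab_pr G 0 (srt (gr X i)) (crd T P X w i))"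
            unfolding k[OF h.s.thoms(1) h.s.algs(3) w'(1), symmetric] k[OF g.s.thoms(1) g.s.algs(3) w, symmetric]
              w'0 k[OF tu(1) g.s.algs(1) g.s.ins(1)[OF w]] ..
          moreover have "ab_pr H 1 (srt (gr X i)) (crd T P' X w' i) = u (srt (gr X i)) (ab_pr G 1 (srt (gr X i)) (crd T P X w i))"
            unfolding k[OF h.s.thoms(2) h.s.algs(3) w'(1), symmetric] k[OF g.s.thoms(2) g.s.algs(3) w, symmetric]
              w'1 k[OF tu(1) g.s.algs(1) g.s.ins(2)[OF w]] ..
          ultimately have "u (srt (gr X i)) (ab_add G (srt (gr X i)) (crd T P X w i)) = ab_add H (srt (gr X i)) (crd T P' X w' i)"
            using tgt.crd_in[OF g.s.algs(3) w i] tgt.crd_in[OF h.s.algs(3) w'(1) i] by (intro srt)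
          then show "crd T C' X (u X (ab_add G X w)) i = crd T C' X (ab_add H X w') i"
            unfolding k[OF tu(1) g.s.algs(1) g.s.ins(3)[OF w]] k[OF g.s.thoms(3) g.s.algs(3) w] k[OF h.s.thoms(3) h.s.algs(3) w'(1)] .
        qed (use w w' g.s.ins h.s.ins thom_in[OF tu(1)] in auto)
        then show "Comp ?sl (P, r) (C, p) (C', p') u (ab_add G) X w = ab_sum ?sl H (P, r) (Comp ?sl (P, r) (C, p) (C', p') u (ab_pr G 0)) (Comp ?sl (P, r) (C, p) (C', p') u (ab_pr G 1)) X w"
          using ca(2)[OF w] w'(4) by simp
      qed
    qed
  qed
  then show ?thesis unfolding Mod_simps c c' by auto
qed

lemma carrier_obj_Mod:
  assumes A: "A \<in> Obj (Alg T)" and G: "G \<in> Obj (Mod (Alg T) A)"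
  obtains C p where "ab_carrier G = (C, p)" "(C, p) \<in> Obj (slice (Alg T) A)" "C \<in> Obj (Alg T)"
    "\<And>X a. a \<in> fob A X \<Longrightarrow> sec G X a \<in> fob C X"
proof -
  have g: "abelian_group_object (slice (Alg T) A) G" using G by (simp add: Mod_simps)
  obtain C p E e P r where c: "ab_carrier G = (C, p)" "ab_one G = (E, e)" "ab_square G = (P, r)" by (metis surj_pair)
  interpret g: ab_kalg K T \<sigma> A G C p E e P r by (rule ab_kalgI[OF A g c])
  show ?thesis using that[OF c(1) g.s.objs(1) g.s.algs(1) g.s.sec_in] .
qed

lemma category_Mod:
  assumes A: "A \<in> Obj (Alg T)"
  shows "category (Mod (Alg T) A)"
proof
  let ?sl = "slice (Alg T) A"
  interpret C: category "Alg T" by (rule tgt.category_Alg)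
  fix G H L M u v w
  show "Ident (Mod (Alg T) A) G \<in> Hom (Mod (Alg T) A) G G" if G: "G \<in> Obj (Mod (Alg T) A)"
  proof -
    obtain C p where c: "ab_carrier G = (C, p)" "(C, p) \<in> Obj ?sl" "C \<in> Obj (Alg T)" "\<And>X a. a \<in> fob A X \<Longrightarrow> sec G X a \<in> fob C X"
      using carrier_obj_Mod[OF A G] by metis
    show ?thesis unfolding Mod_Hom[OF A G G]
      using tgt.slice_Ident_Hom[OF A c(2)] c(4) by (simp add: Mod_simps c(1))
  qed
  assume G: "G \<in> Obj (Mod (Alg T) A)" and H: "H \<in> Obj (Mod (Alg T) A)"
  obtain C p where c: "ab_carrier G = (C, p)" "(C, p) \<in> Obj ?sl" "C \<in> Obj (Alg T)" "\<And>X a. a \<in> fob A X \<Longrightarrow> sec G X a \<in> fob C X"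
    using carrier_obj_Mod[OF A G] by metis
  obtain D q where d: "ab_carrier H = (D, q)" "(D, q) \<in> Obj ?sl" "D \<in> Obj (Alg T)" "\<And>X a. a \<in> fob A X \<Longrightarrow> sec H X a \<in> fob D X"
    using carrier_obj_Mod[OF A H] by metis
  { assume "u \<in> Hom (Mod (Alg T) A) G H"
    then have "u \<in> Hom (Alg T) C D" by (simp add: Mod_simps c d slice_Hom)
    then show "Comp (Mod (Alg T) A) G H H (Ident (Mod (Alg T) A) H) u = u" "Comp (Mod (Alg T) A) G G H u (Ident (Mod (Alg T) A) G) = u"
      using c d C.ident_left C.ident_right by (simp_all add: Mod_simps slice_Comp slice_Ident) }
  assume L: "L \<in> Obj (Mod (Alg T) A)"
  obtain E r where e: "ab_carrier L = (E, r)" "(E, r) \<in> Obj ?sl" "E \<in> Obj (Alg T)" "\<And>X a. a \<in> fob A X \<Longrightarrow> sec L X a \<in> fob E X"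
    using carrier_obj_Mod[OF A L] by metis
  { assume u: "u \<in> Hom (Mod (Alg T) A) G H" and v: "v \<in> Hom (Mod (Alg T) A) H L"
    then have uv: "u \<in> Hom ?sl (C, p) (D, q)" "v \<in> Hom ?sl (D, q) (E, r)" by (simp_all add: Mod_simps c d e)
    show "Comp (Mod (Alg T) A) G H L v u \<in> Hom (Mod (Alg T) A) G L"
      unfolding Mod_Hom[OF A G L]
      using tgt.slice_Comp_Hom[OF A c(2) d(2) e(2) uv] c(4) u v unfolding Mod_Hom[OF A G H] Mod_Hom[OF A H L]
      by (simp add: Mod_simps c(1) d(1) e(1)) }
  assume M: "M \<in> Obj (Mod (Alg T) A)"
  obtain F t where f: "ab_carrier M = (F, t)" "F \<in> Obj (Alg T)"
    using carrier_obj_Mod[OF A M] by metis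
  assume "u \<in> Hom (Mod (Alg T) A) G H" "v \<in> Hom (Mod (Alg T) A) H L" "w \<in> Hom (Mod (Alg T) A) L M"
  then have "u \<in> Hom (Alg T) C D" "v \<in> Hom (Alg T) D E" "w \<in> Hom (Alg T) E F" by (simp_all add: Mod_simps c d e f slice_Hom)
  then show "Comp (Mod (Alg T) A) G L M w (Comp (Mod (Alg T) A) G H L v u) = Comp (Mod (Alg T) A) G H M (Comp (Mod (Alg T) A) H L M w v) u"
    using c d e f C.comp_assoc by (simp add: Mod_simps slice_Comp)
qed

end

section \<open>Square-zero extensions\<close>

sublocale super_fermat_theory \<subseteq> L: kalg_theory KK S \<sigma>
  by unfold_locales

context closed_superring
begin

lemma theory_morphism_id: "theory_morphism (SCom K) (SCom K) id_functor"
  by unfold_locales (simp_all add: id_functor_def)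

lemma comp_functor_id[simp]: "comp_functor B id_functor = B"
  by (simp add: comp_functor_def id_functor_def)

sublocale I: kalg_theory K "SCom K" id_functor
proof -
  interpret theory_morphism "SCom K" "SCom K" id_functor by (rule theory_morphism_id)
  show "kalg_theory K (SCom K) id_functor" by unfold_locales
qed

end

text \<open>
  Split extensions \<open>E\<close> of the supercommutative \<open>K\<close>-algebra underlying \<open>A\<close>, in which products of elements
  of the kernel of the projection \<open>p\<close> vanish; \<open>s\<close> is the section.
\<close>

locale split_ext = super_fermat_theory S \<tau> for S :: "('s, 'x) thy_scheme" and \<tau> +
  fixes A :: "('s, 'u) alg" and E :: "('s trm set list, 'v) alg"
    and p :: "nat \<times> nat \<Rightarrow> 'v \<Rightarrow> 'u" and s :: "nat \<times> nat \<Rightarrow> 'u \<Rightarrow> 'v"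
  assumes A: "A \<in> Obj (Alg S)" and E: "E \<in> Obj (Alg (SCom KK))"
    and p: "thom (SCom KK) E (comp_functor A \<sigma>) p" and s: "thom (SCom KK) (comp_functor A \<sigma>) E s"
    and ps: "\<And>X a. a \<in> fob A X \<Longrightarrow> p X (s X a) = a"
    and sqz: "\<And>q t m n. m \<in> fob E (srt q) \<Longrightarrow> n \<in> fob E (srt t) \<Longrightarrow> p (srt q) m = szero (NN A) q \<Longrightarrow>
      p (srt t) n = szero (NN A) t \<Longrightarrow> smul (under KK E) q t m n = szero (under KK E) (q + t)"
begin

abbreviation UE where "UE \<equiv> under KK E"
abbreviation RE where "RE \<equiv> tot UE"
abbreviation ie where "ie \<equiv> inc UE"

sublocale U: supercommutative UE
  by (rule K.supercommutative_under[OF E])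

lemma A\<sigma>: "comp_functor A \<sigma> \<in> Obj (Alg (SCom KK))"
  using A by simp

lemma p_in: "x \<in> fob E X \<Longrightarrow> p X x \<in> fob A X" and s_in: "a \<in> fob A X \<Longrightarrow> s X a \<in> fob E X"
  using thom_in[OF p] thom_in[OF s] by simp_all

text \<open>
  Section and projection on the total rings.
\<close>

definition sr :: "'u \<times> 'u \<Rightarrow> 'v \<times> 'v" where "sr = totmap (\<lambda>q. s (srt q))"
definition pr :: "'v \<times> 'v \<Rightarrow> 'u \<times> 'u" where "pr = totmap (\<lambda>q. p (srt q))"

lemma sr_hom: "sr \<in> ring_hom (RR A) RE" and pr_hom: "pr \<in> ring_hom RE (RR A)"
  and sr_io: "sr (io A q a) = ie q (s (srt q) a)" and pr_ie: "pr (ie q x) = io A q (p (srt q) x)"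
proof -
  have sh: "shom (NN A) UE (\<lambda>q. s (srt q))" and ph: "shom UE (NN A) (\<lambda>q. p (srt q))"
    using K.shom_thom[OF s A\<sigma> E] K.shom_thom[OF p E A\<sigma>] by (simp_all add: under_\<sigma>)
  show "sr \<in> ring_hom (RR A) RE" "pr \<in> ring_hom RE (RR A)"
    unfolding sr_def pr_def using sh ph by (auto intro!: totmap_ring_hom NN_super[OF A] U.supercommutative_axioms)
  show "sr (io A q a) = ie q (s (srt q) a)" "pr (ie q x) = io A q (p (srt q) x)"
    unfolding sr_def pr_def by (rule totmap_inc[OF sh] totmap_inc[OF ph])+
qed

lemma sr_in[simp]: "a \<in> carrier (RR A) \<Longrightarrow> sr a \<in> carrier RE"
  by (rule ring_hom_closed[OF sr_hom])

interpretation RA: ring "RR A"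
  by (simp add: A)

lemma ker_mult:
  assumes "x \<in> carrier RE" "y \<in> carrier RE" "pr x = \<zero>\<^bsub>RR A\<^esub>" "pr y = \<zero>\<^bsub>RR A\<^esub>"
  shows "x \<otimes>\<^bsub>RE\<^esub> y = \<zero>\<^bsub>RE\<^esub>"
proof -
  have x: "fst x \<in> fob E (srt 0)" "snd x \<in> fob E (srt 1)" "p (srt 0) (fst x) = szero (NN A) 0" "p (srt 1) (snd x) = szero (NN A) 1"
    using assms(1,3) by (auto simp: tot_def pr_def totmap_def)
  have y: "fst y \<in> fob E (srt 0)" "snd y \<in> fob E (srt 1)" "p (srt 0) (fst y) = szero (NN A) 0" "p (srt 1) (snd y) = szero (NN A) 1"
    using assms(2,4) by (auto simp: tot_def pr_def totmap_def)
  show ?thesis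
    using sqz[OF x(1) y(1) x(3) y(3)] sqz[OF x(1) y(2) x(3) y(4)] sqz[OF x(2) y(1) x(4) y(3)] sqz[OF x(2) y(2) x(4) y(4)]
    by (simp add: tot_def U.szero_add[OF U.szero_car])
qed

text \<open>
  An element \<open>c\<^sub>i\<close> of \<open>E\<close> is the sum of \<open>s a\<^sub>i\<close> with \<open>a\<^sub>i = p c\<^sub>i\<close> the base part and of an element of the
  kernel. With \<open>sec_ev f c = s(f(a))\<close>, the operation
  \<open>lifted_op f c = s(f(a)) + \<Sum>\<^sub>i (c\<^sub>i - s a\<^sub>i) s((\<partial>\<^sub>i f)(a))\<close> is the Taylor expansion of \<open>f(s a + (c - s a))\<close>,
  in which all terms of higher order vanish. It is computed in the total ring (\<open>lifted_op_tot\<close>).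
\<close>

definition base_part :: "nat \<times> nat \<Rightarrow> (nat \<Rightarrow> 'v) \<Rightarrow> nat \<Rightarrow> 'u" where
  "base_part X c i = p (srt (gr X i)) (c i)"

definition kernel_part :: "nat \<times> nat \<Rightarrow> (nat \<Rightarrow> 'v) \<Rightarrow> nat \<Rightarrow> 'v \<times> 'v" where
  "kernel_part X c i = ie (gr X i) (c i) \<ominus>\<^bsub>RE\<^esub> ie (gr X i) (s (srt (gr X i)) (base_part X c i))"

definition sec_ev :: "nat \<times> nat \<Rightarrow> bit \<Rightarrow> 's \<Rightarrow> (nat \<Rightarrow> 'v) \<Rightarrow> 'v \<times> 'v" where
  "sec_ev X q f c = sr (io A q (ev S A X q f (base_part X c)))"

definition lifted_op_tot :: "nat \<times> nat \<Rightarrow> bit \<Rightarrow> 's \<Rightarrow> (nat \<Rightarrow> 'v) \<Rightarrow> 'v \<times> 'v" where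
  "lifted_op_tot X q f c = sec_ev X q f c \<oplus>\<^bsub>RE\<^esub> (\<Oplus>\<^bsub>RE\<^esub>i\<in>{..<len X}. kernel_part X c i \<otimes>\<^bsub>RE\<^esub> sec_ev X (gr X i + q) (pd X i q f) c)"

definition lifted_op :: "nat \<times> nat \<Rightarrow> bit \<Rightarrow> 's \<Rightarrow> (nat \<Rightarrow> 'v) \<Rightarrow> 'v" where
  "lifted_op X q f c = cmp q (lifted_op_tot X q f c)"

lemma fam_base_part: "fam E X c \<Longrightarrow> fam A X (base_part X c)"
  using K.SC.thom_fam[OF p, of X c] by (simp add: fam_def base_part_def)

lemma hmg_sec_ev: "fam E X c \<Longrightarrow> f \<in> Hom S X (srt q) \<Longrightarrow> U.hmg q (sec_ev X q f c)"
  using tgt.ev_in[OF A _ fam_base_part, of f X q c] s_in by (auto simp: sec_ev_def sr_io intro!: U.hmg_inc)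

lemma hmg_kernel_part: "fam E X c \<Longrightarrow> i < len X \<Longrightarrow> U.hmg (gr X i) (kernel_part X c i)"
  unfolding kernel_part_def using fam_base_part[of X c] s_in by (intro U.hmg_minus U.hmg_inc) (auto simp: fam_def)

lemma pr_kernel_part: "fam E X c \<Longrightarrow> i < len X \<Longrightarrow> pr (kernel_part X c i) = \<zero>\<^bsub>RR A\<^esub>"
proof -
  assume c: "fam E X c" "i < len X"
  have d: "base_part X c i \<in> fob A (srt (gr X i))" "c i \<in> fob E (srt (gr X i))" using fam_base_part[OF c(1)] c by (auto simp: fam_def)
  have "pr (kernel_part X c i) = pr (ie (gr X i) (c i)) \<ominus>\<^bsub>RR A\<^esub> pr (ie (gr X i) (s (srt (gr X i)) (base_part X c i)))"
    unfolding kernel_part_def using d s_in by (intro ring_hom_minus'[OF U.ring_tot _ pr_hom]) (auto simp: A)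
  also have "\<dots> = \<zero>\<^bsub>RR A\<^esub>"
    using d ps[OF d(1)] by (simp add: pr_ie base_part_def[symmetric] RA.minus_self A)
  finally show ?thesis .
qed

lemma hmg_lifted_op_tot:
  assumes c: "fam E X c" and f: "f \<in> Hom S X (srt q)"
  shows "U.hmg q (lifted_op_tot X q f c)"
  unfolding lifted_op_tot_def
proof (intro U.hmg_add hmg_sec_ev c f U.hmg_finsum)
  fix i assume "i \<in> {..<len X}"
  then have i: "i < len X" by simp
  have pf: "pd X i q f \<in> Hom S X (srt (gr X i + q))" using f i by simp
  show "U.hmg q (kernel_part X c i \<otimes>\<^bsub>RE\<^esub> sec_ev X (gr X i + q) (pd X i q f) c)"
    by (rule U.hmg_mult[OF hmg_kernel_part[OF c i] hmg_sec_ev[OF c pf]]) simp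
qed simp

lemma lifted_op_in: "fam E X c \<Longrightarrow> f \<in> Hom S X (srt q) \<Longrightarrow> lifted_op X q f c \<in> fob E (srt q)"
  and ie_lifted_op: "fam E X c \<Longrightarrow> f \<in> Hom S X (srt q) \<Longrightarrow> ie q (lifted_op X q f c) = lifted_op_tot X q f c"
  using U.cmp_car[OF U.hmg_carrier[OF hmg_lifted_op_tot], of X c f q q] U.hmg_cmp[OF hmg_lifted_op_tot, of X c f q] by (simp_all add: lifted_op_def)

lemma ie_eq_iff: "ie q x = ie q y \<longleftrightarrow> x = y"
  by (rule U.inc_eq_iff)

lemma sec_ev_in: "fam E X c \<Longrightarrow> f \<in> Hom S X (srt q) \<Longrightarrow> sec_ev X q f c \<in> carrier RE"
  by (rule U.hmg_carrier[OF hmg_sec_ev])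

lemma kernel_part_in: "fam E X c \<Longrightarrow> i < len X \<Longrightarrow> kernel_part X c i \<in> carrier RE"
  by (rule U.hmg_carrier[OF hmg_kernel_part])

lemma pd_sec_ev_in: "fam E X c \<Longrightarrow> f \<in> Hom S X (srt q) \<Longrightarrow> i < len X \<Longrightarrow> sec_ev X (gr X i + q) (pd X i q f) c \<in> carrier RE"
  by (rule sec_ev_in) simp_all

lemma p_lifted_op:
  assumes c: "fam E X c" and f: "f \<in> Hom S X (srt q)"
  shows "p (srt q) (lifted_op X q f c) = ev S A X q f (base_part X c)"
proof -
  have rE: "ring RE" by (rule U.ring_tot)
  have eA: "ev S A X q f (base_part X c) \<in> fob A (srt q)" using tgt.ev_in[OF A f fam_base_part[OF c]] .
  have t: "kernel_part X c i \<otimes>\<^bsub>RE\<^esub> sec_ev X (gr X i + q) (pd X i q f) c \<in> carrier RE" if "i < len X" for i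
    using kernel_part_in[OF c that] pd_sec_ev_in[OF c f that] by simp
  have "pr (\<Oplus>\<^bsub>RE\<^esub>i\<in>{..<len X}. kernel_part X c i \<otimes>\<^bsub>RE\<^esub> sec_ev X (gr X i + q) (pd X i q f) c)
     = (\<Oplus>\<^bsub>RR A\<^esub>i\<in>{..<len X}. pr (kernel_part X c i \<otimes>\<^bsub>RE\<^esub> sec_ev X (gr X i + q) (pd X i q f) c))"
    using t by (intro ring_hom_finsum'[OF rE _ pr_hom]) (auto simp: A)
  also have "\<dots> = (\<Oplus>\<^bsub>RR A\<^esub>i\<in>{..<len X}. \<zero>\<^bsub>RR A\<^esub>)"
  proof (rule RA.finsum_cong')
    fix i assume "i \<in> {..<len X}"
    then have i: "i < len X" by simp
    show "pr (kernel_part X c i \<otimes>\<^bsub>RE\<^esub> sec_ev X (gr X i + q) (pd X i q f) c) = \<zero>\<^bsub>RR A\<^esub>"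
      using ring_hom_mult[OF pr_hom kernel_part_in[OF c i] pd_sec_ev_in[OF c f i]] pr_kernel_part[OF c i] ring_hom_closed[OF pr_hom pd_sec_ev_in[OF c f i]] by simp
  qed auto
  also have "\<dots> = \<zero>\<^bsub>RR A\<^esub>" by (simp add: RA.finsum_zero)
  finally have "pr (lifted_op_tot X q f c) = pr (sec_ev X q f c) \<oplus>\<^bsub>RR A\<^esub> \<zero>\<^bsub>RR A\<^esub>"
    unfolding lifted_op_tot_def using ring_hom_add[OF pr_hom sec_ev_in[OF c f], of "\<Oplus>\<^bsub>RE\<^esub>i\<in>{..<len X}. kernel_part X c i \<otimes>\<^bsub>RE\<^esub> sec_ev X (gr X i + q) (pd X i q f) c"] t
    by (auto intro!: U.R.finsum_closed)
  also have "\<dots> = io A q (ev S A X q f (base_part X c))"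
    using eA ps[OF eA] by (simp add: sec_ev_def sr_io pr_ie A)
  finally have "io A q (p (srt q) (lifted_op X q f c)) = io A q (ev S A X q f (base_part X c))"
    unfolding pr_ie[symmetric] ie_lifted_op[OF c f] .
  then show ?thesis by (rule io_eq_iff[THEN iffD1])
qed

lemma lifted_op_sec:
  assumes a: "fam A X a" and f: "f \<in> Hom S X (srt q)"
  shows "lifted_op X q f (\<lambda>i. s (srt (gr X i)) (a i)) = s (srt q) (ev S A X q f a)"
proof -
  let ?c = "\<lambda>i. s (srt (gr X i)) (a i)"
  have c: "fam E X ?c" using a s_in by (simp add: fam_def)
  have d: "base_part X ?c i = a i" if "i < len X" for i using a that ps by (simp add: base_part_def fam_def)
  have e: "ev S A X q f (base_part X ?c) = ev S A X q f a" by (rule tgt.ev_cong[OF d])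
  have m: "kernel_part X ?c i = \<zero>\<^bsub>RE\<^esub>" if "i < len X" for i
    using d[OF that] c that by (simp add: kernel_part_def fam_def U.R.minus_self)
  have "(\<Oplus>\<^bsub>RE\<^esub>i\<in>{..<len X}. kernel_part X ?c i \<otimes>\<^bsub>RE\<^esub> sec_ev X (gr X i + q) (pd X i q f) ?c) = (\<Oplus>\<^bsub>RE\<^esub>i\<in>{..<len X}. \<zero>\<^bsub>RE\<^esub>)"
    by (rule U.R.finsum_cong') (auto simp: m pd_sec_ev_in[OF c f])
  then have "lifted_op_tot X q f ?c = sec_ev X q f ?c \<oplus>\<^bsub>RE\<^esub> \<zero>\<^bsub>RE\<^esub>" unfolding lifted_op_tot_def by (simp add: U.R.finsum_zero)
  then have "ie q (lifted_op X q f ?c) = ie q (s (srt q) (ev S A X q f a))"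
    using ie_lifted_op[OF c f] sec_ev_in[OF c f] by (simp add: sec_ev_def sr_io e)
  then show ?thesis by (rule ie_eq_iff[THEN iffD1])
qed

lemma finsum_single:
  fixes k n :: nat
  assumes "k < n" "z \<in> carrier RE" "\<And>i. i < n \<Longrightarrow> i \<noteq> k \<Longrightarrow> g i = \<zero>\<^bsub>RE\<^esub>" "g k = z"
  shows "(\<Oplus>\<^bsub>RE\<^esub>i\<in>{..<n}. g i) = z"
proof -
  have "(\<Oplus>\<^bsub>RE\<^esub>i\<in>{..<n}. g i) = (\<Oplus>\<^bsub>RE\<^esub>i\<in>{..<n}. if k = i then z else \<zero>\<^bsub>RE\<^esub>)"
    by (rule U.R.finsum_cong') (use assms in auto)
  also have "\<dots> = z" using assms by (intro U.R.add.finprod_singleton[of k "{..<n}" "\<lambda>_. z", unfolded finsum_def[symmetric]]) auto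
  finally show ?thesis .
qed

lemma ie_split: "fam E X c \<Longrightarrow> i < len X \<Longrightarrow> ie (gr X i) (c i) = sr (io A (gr X i) (base_part X c i)) \<oplus>\<^bsub>RE\<^esub> kernel_part X c i"
proof -
  assume c: "fam E X c" "i < len X"
  have d: "base_part X c i \<in> fob A (srt (gr X i))" "c i \<in> fob E (srt (gr X i))" using fam_base_part[OF c(1)] c by (auto simp: fam_def)
  show ?thesis using U.R.minus_eq_iff[of "ie (gr X i) (c i)" "sr (io A (gr X i) (base_part X c i))" "kernel_part X c i"] d s_in kernel_part_in[OF c]
    by (simp add: kernel_part_def sr_io)
qed

lemma lifted_op_proj:
  assumes c: "fam E X c" and i: "i < len X"
  shows "lifted_op X (gr X i) (proj S X i) c = c i"
proof -
  have f: "proj S X i \<in> Hom S X (srt (gr X i))" using i by simp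
  have d: "fam A X (base_part X c)" by (rule fam_base_part[OF c])
  have "(\<Oplus>\<^bsub>RE\<^esub>k\<in>{..<len X}. kernel_part X c k \<otimes>\<^bsub>RE\<^esub> sec_ev X (gr X k + gr X i) (pd X k (gr X i) (proj S X i)) c) = kernel_part X c i"
  proof (rule finsum_single[OF i kernel_part_in[OF c i]])
    have "sec_ev X (gr X i + gr X i) (pd X i (gr X i) (proj S X i)) c = \<one>\<^bsub>RE\<^esub>"
      using ev_sone[OF A d] ring_hom_one[OF sr_hom] supercommutative.inc_sone[OF NN_super[OF A]]
      by (simp add: sec_ev_def pd_proj_same[OF i])
    then show "kernel_part X c i \<otimes>\<^bsub>RE\<^esub> sec_ev X (gr X i + gr X i) (pd X i (gr X i) (proj S X i)) c = kernel_part X c i"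
      using kernel_part_in[OF c i] by simp
    fix k assume k: "k < len X" "k \<noteq> i"
    have "sec_ev X (gr X k + gr X i) (pd X k (gr X i) (proj S X i)) c = \<zero>\<^bsub>RE\<^esub>"
      using ev_szero[OF A d] ring_hom_zero'[OF RA.ring_axioms U.ring_tot sr_hom] supercommutative.inc_szero[OF NN_super[OF A]]
      by (simp add: sec_ev_def pd_proj_other[OF k(1) i k(2)])
    then show "kernel_part X c k \<otimes>\<^bsub>RE\<^esub> sec_ev X (gr X k + gr X i) (pd X k (gr X i) (proj S X i)) c = \<zero>\<^bsub>RE\<^esub>"
      using kernel_part_in[OF c k(1)] by simp
  qed
  then have "ie (gr X i) (lifted_op X (gr X i) (proj S X i) c) = ie (gr X i) (c i)"
    unfolding ie_lifted_op[OF c f] lifted_op_tot_def sec_ev_def ie_split[OF c i] using tgt.ev_proj[OF A d i refl] by simp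
  then show ?thesis by (rule ie_eq_iff[THEN iffD1])
qed

lemma finsum_swap:
  assumes "finite I" "finite J" "\<And>i j. i \<in> I \<Longrightarrow> j \<in> J \<Longrightarrow> g i j \<in> carrier RE"
  shows "(\<Oplus>\<^bsub>RE\<^esub>i\<in>I. \<Oplus>\<^bsub>RE\<^esub>j\<in>J. g i j) = (\<Oplus>\<^bsub>RE\<^esub>j\<in>J. \<Oplus>\<^bsub>RE\<^esub>i\<in>I. g i j)"
  using assms(1,3)
proof (induction I rule: finite_induct)
  case empty then show ?case by (simp add: U.R.finsum_zero)
next
  case (insert a I)
  have "(\<Oplus>\<^bsub>RE\<^esub>i\<in>insert a I. \<Oplus>\<^bsub>RE\<^esub>j\<in>J. g i j) = (\<Oplus>\<^bsub>RE\<^esub>j\<in>J. g a j) \<oplus>\<^bsub>RE\<^esub> (\<Oplus>\<^bsub>RE\<^esub>j\<in>J. \<Oplus>\<^bsub>RE\<^esub>i\<in>I. g i j)"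
    using insert by (subst U.R.finsum_insert) (auto intro!: U.R.finsum_closed)
  also have "\<dots> = (\<Oplus>\<^bsub>RE\<^esub>j\<in>J. g a j \<oplus>\<^bsub>RE\<^esub> (\<Oplus>\<^bsub>RE\<^esub>i\<in>I. g i j))"
    using insert by (intro U.R.finsum_addf[symmetric]) (auto intro!: U.R.finsum_closed)
  also have "\<dots> = (\<Oplus>\<^bsub>RE\<^esub>j\<in>J. \<Oplus>\<^bsub>RE\<^esub>i\<in>insert a I. g i j)"
    using insert by (intro U.R.finsum_cong' refl) (auto intro!: U.R.finsum_closed U.R.finsum_insert[symmetric])
  finally show ?case .
qed

text \<open>
  Expanding the left-hand side by \<open>pd_chain\<close> gives a double sum over the coordinates of \<open>X\<close> and \<open>Y\<close>;
  the kernel part of \<open>lifted_op (f j) c\<close> is the part of it that belongs to \<open>j\<close>.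
\<close>

lemma lifted_op_chain:
  assumes c: "fam E X c" and f: "\<And>j. j < len Y \<Longrightarrow> f j \<in> Hom S X (srt (gr Y j))" and g: "g \<in> Hom S Y (srt q)"
  shows "lifted_op X q (Comp S X Y (srt q) g (tup S X Y f)) c = lifted_op Y q g (\<lambda>j. lifted_op X (gr Y j) (f j) c)"
proof -
  let ?gf = "Comp S X Y (srt q) g (tup S X Y f)" and ?c = "\<lambda>j. lifted_op X (gr Y j) (f j) c"
  let ?h = "\<lambda>j. Comp S X Y (srt (gr Y j + q)) (pd Y j q g) (tup S X Y f)"
  have tf: "tup S X Y f \<in> Hom S X Y" using f by simp
  have gf: "?gf \<in> Hom S X (srt q)" using g tf by simp
  have h: "?h j \<in> Hom S X (srt (gr Y j + q))" if "j < len Y" for j using that g tf by simp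
  have pf: "pd X i (gr Y j) (f j) \<in> Hom S X (srt (gr X i + gr Y j))" if "i < len X" "j < len Y" for i j using that f by simp
  have d: "fam A X (base_part X c)" by (rule fam_base_part[OF c])
  have fc: "fam E Y ?c" using lifted_op_in[OF c f] by (simp add: fam_def)
  have dc: "base_part Y ?c j = ev S A X (gr Y j) (f j) (base_part X c)" if "j < len Y" for j
    unfolding base_part_def[of Y] by (rule p_lifted_op[OF c f[OF that]])
  have evc: "ev S A Y t k (base_part Y ?c) = ev S A X t (Comp S X Y (srt t) k (tup S X Y f)) (base_part X c)" if "k \<in> Hom S Y (srt t)" for t k
  proof -
    have "ev S A X t (Comp S X Y (srt t) k (tup S X Y f)) (base_part X c) = ev S A Y t k (\<lambda>j. ev S A X (gr Y j) (f j) (base_part X c))"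
      by (rule tgt.ev_comp_tup[OF A d f that])
    also have "\<dots> = ev S A Y t k (base_part Y ?c)" by (rule tgt.ev_cong) (simp add: dc)
    finally show ?thesis by simp
  qed
  have sevc: "sec_ev Y t k ?c = sec_ev X t (Comp S X Y (srt t) k (tup S X Y f)) c" if "k \<in> Hom S Y (srt t)" for t k
    unfolding sec_ev_def evc[OF that] ..
  let ?D = "\<lambda>i j. sec_ev X (gr X i + gr Y j) (pd X i (gr Y j) (f j)) c" and ?G = "\<lambda>j. sec_ev X (gr Y j + q) (?h j) c"
  have D: "?D i j \<in> carrier RE" if "i < len X" "j < len Y" for i j by (rule sec_ev_in[OF c pf[OF that]])
  have G: "?G j \<in> carrier RE" if "j < len Y" for j by (rule sec_ev_in[OF c h[OF that]])
  have muY: "kernel_part Y ?c j = (\<Oplus>\<^bsub>RE\<^esub>i\<in>{..<len X}. kernel_part X c i \<otimes>\<^bsub>RE\<^esub> ?D i j)" if j: "j < len Y" for j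
  proof -
    have "ie (gr Y j) (?c j) = sec_ev X (gr Y j) (f j) c \<oplus>\<^bsub>RE\<^esub> (\<Oplus>\<^bsub>RE\<^esub>i\<in>{..<len X}. kernel_part X c i \<otimes>\<^bsub>RE\<^esub> ?D i j)"
      unfolding ie_lifted_op[OF c f[OF j]] lifted_op_tot_def ..
    moreover have "sec_ev X (gr Y j) (f j) c = ie (gr Y j) (s (srt (gr Y j)) (base_part Y ?c j))"
      unfolding sec_ev_def sr_io dc[OF j] ..
    ultimately show ?thesis
      unfolding kernel_part_def[of Y] using sec_ev_in[OF c f[OF j]] kernel_part_in[OF c] D[OF _ j] fc j
      by (subst U.R.minus_eq_iff) (auto simp: fam_def intro!: U.R.finsum_closed)
  qed
  have pdgf: "sec_ev X (gr X i + q) (pd X i q ?gf) c = (\<Oplus>\<^bsub>RE\<^esub>j\<in>{..<len Y}. ?D i j \<otimes>\<^bsub>RE\<^esub> ?G j)" if i: "i < len X" for i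
  proof -
    have rX: "ring (RR (rep S X))" by simp
    have "sec_ev X (gr X i + q) (pd X i q ?gf) c = sr (evr A X (base_part X c) (io (rep S X) (gr X i + q) (pd X i q ?gf)))"
      unfolding sec_ev_def evr_io[OF A d] ..
    also have "io (rep S X) (gr X i + q) (pd X i q ?gf) = (\<Oplus>\<^bsub>RR (rep S X)\<^esub>j\<in>{..<len Y}. io (rep S X) (gr X i + gr Y j) (pd X i (gr Y j) (f j)) \<otimes>\<^bsub>RR (rep S X)\<^esub> io (rep S X) (gr Y j + q) (?h j))"
      by (rule pd_chain[OF f g i])
    also have "evr A X (base_part X c) \<dots> = (\<Oplus>\<^bsub>RR A\<^esub>j\<in>{..<len Y}. evr A X (base_part X c) (io (rep S X) (gr X i + gr Y j) (pd X i (gr Y j) (f j)) \<otimes>\<^bsub>RR (rep S X)\<^esub> io (rep S X) (gr Y j + q) (?h j)))"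
      using pf[OF i] h by (intro ring_hom_finsum'[OF rX RA.ring_axioms evr_hom[OF A d]]) (auto intro!: ring.ring_simprules(5)[OF rX])
    also have "sr \<dots> = (\<Oplus>\<^bsub>RE\<^esub>j\<in>{..<len Y}. sr (evr A X (base_part X c) (io (rep S X) (gr X i + gr Y j) (pd X i (gr Y j) (f j)) \<otimes>\<^bsub>RR (rep S X)\<^esub> io (rep S X) (gr Y j + q) (?h j))))"
      using pf[OF i] h by (intro ring_hom_finsum'[OF RA.ring_axioms U.ring_tot sr_hom]) (auto intro!: ring_hom_closed[OF evr_hom[OF A d]] ring.ring_simprules(5)[OF rX])
    also have "\<dots> = (\<Oplus>\<^bsub>RE\<^esub>j\<in>{..<len Y}. ?D i j \<otimes>\<^bsub>RE\<^esub> ?G j)"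
    proof (rule U.R.finsum_cong')
      fix j assume "j \<in> {..<len Y}"
      then have j: "j < len Y" by simp
      have 1: "io (rep S X) (gr X i + gr Y j) (pd X i (gr Y j) (f j)) \<in> carrier (RR (rep S X))" "io (rep S X) (gr Y j + q) (?h j) \<in> carrier (RR (rep S X))"
        using pf[OF i j] h[OF j] by simp_all
      show "sr (evr A X (base_part X c) (io (rep S X) (gr X i + gr Y j) (pd X i (gr Y j) (f j)) \<otimes>\<^bsub>RR (rep S X)\<^esub> io (rep S X) (gr Y j + q) (?h j))) = ?D i j \<otimes>\<^bsub>RE\<^esub> ?G j"
        unfolding ring_hom_mult[OF evr_hom[OF A d] 1] ring_hom_mult[OF sr_hom ring_hom_closed[OF evr_hom[OF A d] 1(1)] ring_hom_closed[OF evr_hom[OF A d] 1(2)]]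
        unfolding evr_io[OF A d] sec_ev_def ..
    qed (use D[OF i] G in auto)
    finally show ?thesis .
  qed
  have "(\<Oplus>\<^bsub>RE\<^esub>j\<in>{..<len Y}. kernel_part Y ?c j \<otimes>\<^bsub>RE\<^esub> sec_ev Y (gr Y j + q) (pd Y j q g) ?c)
     = (\<Oplus>\<^bsub>RE\<^esub>j\<in>{..<len Y}. \<Oplus>\<^bsub>RE\<^esub>i\<in>{..<len X}. kernel_part X c i \<otimes>\<^bsub>RE\<^esub> (?D i j \<otimes>\<^bsub>RE\<^esub> ?G j))"
  proof (rule U.R.finsum_cong')
    fix j assume "j \<in> {..<len Y}"
    then have j: "j < len Y" by simp
    have pg: "pd Y j q g \<in> Hom S Y (srt (gr Y j + q))" using g j by simp
    have "kernel_part Y ?c j \<otimes>\<^bsub>RE\<^esub> sec_ev Y (gr Y j + q) (pd Y j q g) ?c = (\<Oplus>\<^bsub>RE\<^esub>i\<in>{..<len X}. (kernel_part X c i \<otimes>\<^bsub>RE\<^esub> ?D i j) \<otimes>\<^bsub>RE\<^esub> ?G j)"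
      unfolding muY[OF j] sevc[OF pg] using kernel_part_in[OF c] D[OF _ j] G[OF j] by (intro U.R.finsum_ldistr) auto
    also have "\<dots> = (\<Oplus>\<^bsub>RE\<^esub>i\<in>{..<len X}. kernel_part X c i \<otimes>\<^bsub>RE\<^esub> (?D i j \<otimes>\<^bsub>RE\<^esub> ?G j))"
      using kernel_part_in[OF c] D[OF _ j] G[OF j] by (intro U.R.finsum_cong') (auto simp: U.R.m_assoc)
    finally show "kernel_part Y ?c j \<otimes>\<^bsub>RE\<^esub> sec_ev Y (gr Y j + q) (pd Y j q g) ?c = (\<Oplus>\<^bsub>RE\<^esub>i\<in>{..<len X}. kernel_part X c i \<otimes>\<^bsub>RE\<^esub> (?D i j \<otimes>\<^bsub>RE\<^esub> ?G j))" .
  qed (use kernel_part_in[OF c] D G in \<open>auto intro!: U.R.finsum_closed\<close>)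
  also have "\<dots> = (\<Oplus>\<^bsub>RE\<^esub>i\<in>{..<len X}. \<Oplus>\<^bsub>RE\<^esub>j\<in>{..<len Y}. kernel_part X c i \<otimes>\<^bsub>RE\<^esub> (?D i j \<otimes>\<^bsub>RE\<^esub> ?G j))"
    using kernel_part_in[OF c] D G by (intro finsum_swap) auto
  also have "\<dots> = (\<Oplus>\<^bsub>RE\<^esub>i\<in>{..<len X}. kernel_part X c i \<otimes>\<^bsub>RE\<^esub> sec_ev X (gr X i + q) (pd X i q ?gf) c)"
  proof (rule U.R.finsum_cong')
    fix i assume "i \<in> {..<len X}"
    then have i: "i < len X" by simp
    show "(\<Oplus>\<^bsub>RE\<^esub>j\<in>{..<len Y}. kernel_part X c i \<otimes>\<^bsub>RE\<^esub> (?D i j \<otimes>\<^bsub>RE\<^esub> ?G j)) = kernel_part X c i \<otimes>\<^bsub>RE\<^esub> sec_ev X (gr X i + q) (pd X i q ?gf) c"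
      unfolding pdgf[OF i] using kernel_part_in[OF c i] D[OF i] G by (intro U.R.finsum_rdistr[symmetric]) auto
  qed (use kernel_part_in[OF c] pd_sec_ev_in[OF c gf] in auto)
  finally have "lifted_op_tot Y q g ?c = lifted_op_tot X q ?gf c" unfolding lifted_op_tot_def sevc[OF g] by simp
  then show ?thesis by (simp add: lifted_op_def)
qed

lemma finsum_two: "a \<in> carrier RE \<Longrightarrow> b \<in> carrier RE \<Longrightarrow> g k = a \<Longrightarrow> g (Suc 0 - k) = b \<Longrightarrow> k < Suc (Suc 0) \<Longrightarrow>
  (\<Oplus>\<^bsub>RE\<^esub>i\<in>{..<Suc (Suc 0)}. g i) = a \<oplus>\<^bsub>RE\<^esub> b"
proof -
  assume a: "a \<in> carrier RE" "b \<in> carrier RE" "g k = a" "g (Suc 0 - k) = b" "k < Suc (Suc 0)"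
  have k: "{..<Suc (Suc 0)} = {k, Suc 0 - k}" "k \<noteq> Suc 0 - k" using a(5) by (fastforce, arith)
  have "g \<in> {Suc 0 - k} \<rightarrow> carrier RE" "g k \<in> carrier RE" using a by auto
  then have "(\<Oplus>\<^bsub>RE\<^esub>i\<in>{k, Suc 0 - k}. g i) = g k \<oplus>\<^bsub>RE\<^esub> (\<Oplus>\<^bsub>RE\<^esub>i\<in>{Suc 0 - k}. g i)"
    using k(2) by (intro U.R.finsum_insert) auto
  also have "(\<Oplus>\<^bsub>RE\<^esub>i\<in>{Suc 0 - k}. g i) = b" using a by (subst U.R.finsum_insert) auto
  finally show ?thesis using a k by simp
qed

lemma lifted_op_op_add:
  assumes c: "fam E (srt q + srt q) c"
  shows "lifted_op (srt q + srt q) q (op_add q) c = sadd UE q (c 0) (c (Suc 0))"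
proof -
  let ?X = "srt q + srt q"
  have d: "fam A ?X (base_part ?X c)" by (rule fam_base_part[OF c])
  have l: "0 < len ?X" "Suc 0 < len ?X" by simp_all
  have g: "gr ?X i = q" if "i < 2" for i using that by (cases "i = 0") (auto simp: less_Suc_eq numeral_2_eq_2)
  have cin: "c 0 \<in> car UE q" "c (Suc 0) \<in> car UE q" "base_part ?X c 0 \<in> fob A (srt q)" "base_part ?X c (Suc 0) \<in> fob A (srt q)"
    using c[unfolded fam_def, rule_format, OF l(1)] c[unfolded fam_def, rule_format, OF l(2)]
      d[unfolded fam_def, rule_format, OF l(1)] d[unfolded fam_def, rule_format, OF l(2)] by simp_all
  have one: "sec_ev ?X (gr ?X i + q) (pd ?X i q (op_add q)) c = \<one>\<^bsub>RE\<^esub>" if "i < 2" for i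
    using ev_sone[OF A d] ring_hom_one[OF sr_hom] supercommutative.inc_sone[OF NN_super[OF A]] that
    by (simp add: sec_ev_def pd_op_add[unfolded One_nat_def] g)
  note m = kernel_part_in[OF c l(1)] kernel_part_in[OF c l(2)]
  have "(\<Oplus>\<^bsub>RE\<^esub>i\<in>{..<Suc (Suc 0)}. kernel_part ?X c i \<otimes>\<^bsub>RE\<^esub> sec_ev ?X (gr ?X i + q) (pd ?X i q (op_add q)) c) = kernel_part ?X c 0 \<oplus>\<^bsub>RE\<^esub> kernel_part ?X c (Suc 0)"
    by (rule finsum_two[where k = 0]) (use m one[of 0] one[of "Suc 0"] in simp_all)
  moreover have "sec_ev ?X q (op_add q) c = sr (io A q (base_part ?X c 0)) \<oplus>\<^bsub>RE\<^esub> sr (io A q (base_part ?X c (Suc 0)))"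
    using supercommutative.inc_sadd[OF NN_super[OF A], of "base_part ?X c 0" q "base_part ?X c (Suc 0)"] cin
      ring_hom_add[OF sr_hom, of "io A q (base_part ?X c 0)" "io A q (base_part ?X c (Suc 0))"]
    unfolding sec_ev_def ev_op_add by (simp add: A)
  ultimately have "ie q (lifted_op ?X q (op_add q) c) = (sr (io A q (base_part ?X c 0)) \<oplus>\<^bsub>RE\<^esub> sr (io A q (base_part ?X c (Suc 0)))) \<oplus>\<^bsub>RE\<^esub> (kernel_part ?X c 0 \<oplus>\<^bsub>RE\<^esub> kernel_part ?X c (Suc 0))"
    unfolding ie_lifted_op[OF c op_add_hom] lifted_op_tot_def by simp
  also have "\<dots> = ie q (c 0) \<oplus>\<^bsub>RE\<^esub> ie q (c (Suc 0))"
    using ie_split[OF c l(1)] ie_split[OF c l(2)] m cin by (simp add: U.R.a_ac A)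
  also have "\<dots> = ie q (sadd UE q (c 0) (c (Suc 0)))" using U.inc_sadd[OF cin(1,2)] by simp
  finally show ?thesis by (rule ie_eq_iff[THEN iffD1])
qed

text \<open>
  Leibniz rule: \<open>(x + m)(y + n) = x y + m y + x n\<close> for \<open>m\<close> and \<open>n\<close> in the kernel.
\<close>

lemma lifted_op_op_mul:
  assumes c: "fam E (srt q + srt t) c"
  shows "lifted_op (srt q + srt t) (q + t) (op_mul q t) c = smul UE q t (c (mi q t)) (c (Suc 0 - mi q t))"
proof -
  let ?X = "srt q + srt t" and ?i = "mi q t" and ?k = "Suc 0 - mi q t"
  have d: "fam A ?X (base_part ?X c)" by (rule fam_base_part[OF c])
  have l: "?i < len ?X" "?k < len ?X" by simp_all
  have cin: "c ?i \<in> car UE q" "c ?k \<in> car UE t" "base_part ?X c ?i \<in> fob A (srt q)" "base_part ?X c ?k \<in> fob A (srt t)"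
    using c[unfolded fam_def, rule_format, OF l(1)] c[unfolded fam_def, rule_format, OF l(2)]
      d[unfolded fam_def, rule_format, OF l(1)] d[unfolded fam_def, rule_format, OF l(2)] by simp_all
  let ?x = "sr (io A q (base_part ?X c ?i))" and ?y = "sr (io A t (base_part ?X c ?k))" and ?mx = "kernel_part ?X c ?i" and ?my = "kernel_part ?X c ?k"
  have C: "?x \<in> carrier RE" "?y \<in> carrier RE" "?mx \<in> carrier RE" "?my \<in> carrier RE"
    using cin kernel_part_in[OF c l(1)] kernel_part_in[OF c l(2)] by (simp_all add: A)
  have t1: "t + (q + t) = q" "q + (q + t) = t" by (simp_all add: add.left_commute)
  have 1: "sec_ev ?X (gr ?X ?i + (q + t)) (pd ?X ?i (q + t) (op_mul q t)) c = ?y"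
    unfolding sec_ev_def pd_op_mul_left using tgt.ev_proj[OF A d l(2), of t] by (simp add: t1)
  have 2: "?my \<otimes>\<^bsub>RE\<^esub> sec_ev ?X (gr ?X ?k + (q + t)) (pd ?X ?k (q + t) (op_mul q t)) c = ?x \<otimes>\<^bsub>RE\<^esub> ?my"
  proof -
    obtain y' where y': "y' \<in> car UE t" "?my = ie t y'" using hmg_kernel_part[OF c l(2)] U.hmg_iff by auto
    have sx: "?x = ie q (s (srt q) (base_part ?X c ?i))" "s (srt q) (base_part ?X c ?i) \<in> car UE q" using sr_io s_in cin by simp_all
    have e: "sec_ev ?X (gr ?X ?k + (q + t)) (pd ?X ?k (q + t) (op_mul q t)) c = sr (io A q (ev S A ?X q (pd ?X ?k (q + t) (op_mul q t)) (base_part ?X c)))"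
      by (simp add: sec_ev_def t1)
    show ?thesis
    proof (cases "q = 1 \<and> t = 1")
      case True
      have "sr (io A q (ev S A ?X q (pd ?X ?k (q + t) (op_mul q t)) (base_part ?X c))) = \<ominus>\<^bsub>RE\<^esub> ?x"
        unfolding pd_op_mul_right[OF A d] if_P[OF True] by (rule ring_hom_a_inv'[OF RA.ring_axioms U.ring_tot sr_hom]) (use cin A in simp)
      then show ?thesis unfolding e using U.inc_anticomm[of "s (srt q) (base_part ?X c ?i)" y'] y' sx True C by (simp add: U.R.r_minus)
    next
      case False
      then have "q = 0 \<or> t = 0" by auto
      then show ?thesis unfolding e pd_op_mul_right[OF A d] if_not_P[OF False] using U.inc_comm[of y' t "s (srt q) (base_part ?X c ?i)" q] y' sx by auto
    qed
  qed
  have "(\<Oplus>\<^bsub>RE\<^esub>i\<in>{..<Suc (Suc 0)}. kernel_part ?X c i \<otimes>\<^bsub>RE\<^esub> sec_ev ?X (gr ?X i + (q + t)) (pd ?X i (q + t) (op_mul q t)) c) = ?mx \<otimes>\<^bsub>RE\<^esub> ?y \<oplus>\<^bsub>RE\<^esub> ?x \<otimes>\<^bsub>RE\<^esub> ?my"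
    by (rule finsum_two[of _ _ _ ?i]) (use C 1 2 in simp_all)
  moreover have "sec_ev ?X (q + t) (op_mul q t) c = ?x \<otimes>\<^bsub>RE\<^esub> ?y"
    using supercommutative.inc_smul[OF NN_super[OF A], of "base_part ?X c ?i" q "base_part ?X c ?k" t] cin
      ring_hom_mult[OF sr_hom, of "io A q (base_part ?X c ?i)" "io A t (base_part ?X c ?k)"]
    unfolding sec_ev_def ev_op_mul by (simp add: A)
  ultimately have "ie (q + t) (lifted_op ?X (q + t) (op_mul q t) c) = ?x \<otimes>\<^bsub>RE\<^esub> ?y \<oplus>\<^bsub>RE\<^esub> (?mx \<otimes>\<^bsub>RE\<^esub> ?y \<oplus>\<^bsub>RE\<^esub> ?x \<otimes>\<^bsub>RE\<^esub> ?my)"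
    unfolding ie_lifted_op[OF c op_mul_hom] lifted_op_tot_def by simp
  also have "\<dots> = (?x \<oplus>\<^bsub>RE\<^esub> ?mx) \<otimes>\<^bsub>RE\<^esub> (?y \<oplus>\<^bsub>RE\<^esub> ?my)"
    using C ker_mult[OF C(3,4) pr_kernel_part[OF c l(1)] pr_kernel_part[OF c l(2)]] by (simp add: U.R.l_distr U.R.r_distr U.R.a_ac)
  also have "\<dots> = ie q (c ?i) \<otimes>\<^bsub>RE\<^esub> ie t (c ?k)" using ie_split[OF c l(1)] ie_split[OF c l(2)] by simp
  also have "\<dots> = ie (q + t) (smul UE q t (c ?i) (c ?k))" using U.inc_smul[OF cin(1,2)] by simp
  finally show ?thesis by (rule ie_eq_iff[THEN iffD1])
qed

lemma lifted_op_cong: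
  assumes fc: "fam E X c" and f: "f \<in> Hom S X (srt q)" and c: "\<And>i. i < len X \<Longrightarrow> c i = c' i"
  shows "lifted_op X q f c = lifted_op X q f c'"
proof -
  have e: "ev S A X t g (base_part X c) = ev S A X t g (base_part X c')" for t g by (rule tgt.ev_cong) (simp add: base_part_def c)
  have sv: "sec_ev X t g c = sec_ev X t g c'" for t g by (simp add: sec_ev_def e)
  have m: "kernel_part X c i = kernel_part X c' i" if "i < len X" for i using c[OF that] by (simp add: kernel_part_def base_part_def)
  have "(\<Oplus>\<^bsub>RE\<^esub>i\<in>{..<len X}. kernel_part X c i \<otimes>\<^bsub>RE\<^esub> sec_ev X (gr X i + q) (pd X i q f) c) = (\<Oplus>\<^bsub>RE\<^esub>i\<in>{..<len X}. kernel_part X c' i \<otimes>\<^bsub>RE\<^esub> sec_ev X (gr X i + q) (pd X i q f) c')"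
  proof (rule U.R.finsum_cong')
    show "(\<lambda>i. kernel_part X c' i \<otimes>\<^bsub>RE\<^esub> sec_ev X (gr X i + q) (pd X i q f) c') \<in> {..<len X} \<rightarrow> carrier RE"
      using kernel_part_in[OF fc] pd_sec_ev_in[OF fc f] m by (auto simp: sv[symmetric])
  qed (simp_all add: m sv)
  then show ?thesis by (simp add: lifted_op_def lifted_op_tot_def sv)
qed

end

context split_ext
begin

lemma lifted_op_const:
  assumes c: "fam E X c" and k: "k \<in> Hom S (0, 0) (srt q)"
  shows "lifted_op X q (Comp S X (0, 0) (srt q) k (bang X)) c = s (srt q) (ev S A (0, 0) q k (\<lambda>_. undefined))"
proof -
  have "lifted_op X q (Comp S X (0, 0) (srt q) k (bang X)) c = lifted_op (0, 0) q k (\<lambda>j. lifted_op X (gr (0, 0) j) undefined c)"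
    unfolding bang_def by (rule lifted_op_chain[OF c _ k]) simp
  also have "\<dots> = lifted_op (0, 0) q k (\<lambda>i. s (srt (gr (0, 0) i)) undefined)"
    by (rule lifted_op_cong[OF _ k]) (simp_all add: fam_def)
  also have "\<dots> = s (srt q) (ev S A (0, 0) q k (\<lambda>_. undefined))"
    by (rule lifted_op_sec[OF _ k]) (simp add: fam_def)
  finally show ?thesis .
qed

lemma lifted_op_Cst:
  assumes c: "fam E X c" and k: "k \<in> car KK q"
  shows "lifted_op X q (interp S \<tau> X (Cst q k)) c = tev KK E X q (Cst q k) c"
proof -
  have kh: "k \<in> Hom S (0, 0) (srt q)" using k by (simp add: ground_simps)
  have w: "wt KK (0, 0) q (Cst q k)" using k by (rule wt_Cst)
  have "tev KK E X q (Cst q k) c = tev KK E (0, 0) q (Cst q k) (\<lambda>i. s (srt (gr (0, 0) i)) undefined)"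
    unfolding K.tev_Cst[OF E c k] by (rule K.tev_cong) simp
  also have "\<dots> = s (srt q) (tev KK (comp_functor A \<sigma>) (0, 0) q (Cst q k) (\<lambda>_. undefined))"
    by (rule K.thom_tev[OF s A\<sigma> E _ w, symmetric]) (simp add: fam_def)
  also have "tev KK (comp_functor A \<sigma>) (0, 0) q (Cst q k) (\<lambda>_. undefined) = ev S A (0, 0) q k (\<lambda>_. undefined)"
    unfolding tev_def M.ev_pull \<sigma>_single[OF w] interp_Cst using kh by simp
  finally show ?thesis unfolding interp_Cst lifted_op_const[OF c kh] by (rule sym)
qed

lemma lifted_op_sadd:
  assumes c: "fam E X c" and f: "f \<in> Hom S X (srt q)" and g: "g \<in> Hom S X (srt q)"
  shows "lifted_op X q (sadd (NN (rep S X)) q f g) c = sadd UE q (lifted_op X q f c) (lifted_op X q g c)"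
proof -
  let ?h = "\<lambda>i::nat. if i = 0 then f else g" and ?Y = "srt q + srt q"
  have h: "?h j \<in> Hom S X (srt (gr ?Y j))" if "j < len ?Y" for j
    using that f g less_Suc_eq[of j "Suc 0"] by auto
  have fc: "fam E ?Y (\<lambda>j. lifted_op X (gr ?Y j) (?h j) c)" using lifted_op_in[OF c h] unfolding fam_def by blast
  have "lifted_op X q (sadd (NN (rep S X)) q f g) c = lifted_op ?Y q (op_add q) (\<lambda>j. lifted_op X (gr ?Y j) (?h j) c)"
    unfolding NN_sadd tgt.ev_rep[OF fam_rep_add[OF f g]] by (rule lifted_op_chain[OF c h op_add_hom])
  then show ?thesis unfolding lifted_op_op_add[OF fc] by simp
qed

lemma lifted_op_smul:
  assumes c: "fam E X c" and f: "f \<in> Hom S X (srt q)" and g: "g \<in> Hom S X (srt t)"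
  shows "lifted_op X (q + t) (smul (NN (rep S X)) q t f g) c = smul UE q t (lifted_op X q f c) (lifted_op X t g c)"
proof -
  let ?h = "\<lambda>i::nat. if i = mi q t then f else g" and ?Y = "srt q + srt t"
  have h: "?h j \<in> Hom S X (srt (gr ?Y j))" if "j < len ?Y" for j
  proof (cases "j = mi q t")
    case False
    then have "j = Suc 0 - mi q t" using that by (intro less_2_mi) simp_all
    then show ?thesis using g by simp
  qed (use f in simp)
  have fc: "fam E ?Y (\<lambda>j. lifted_op X (gr ?Y j) (?h j) c)" using lifted_op_in[OF c h] unfolding fam_def by blast
  have "lifted_op X (q + t) (smul (NN (rep S X)) q t f g) c = lifted_op ?Y (q + t) (op_mul q t) (\<lambda>j. lifted_op X (gr ?Y j) (?h j) c)"
    unfolding NN_smul tgt.ev_rep[OF fam_rep_mul[OF f g]] by (rule lifted_op_chain[OF c h op_mul_hom])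
  then show ?thesis unfolding lifted_op_op_mul[OF fc] by simp
qed

text \<open>
  The lifted operations are compatible with sums and products by the chain rule, and with constants since
  these have no coordinates to expand; negatives are determined by sums.
\<close>

lemma lifted_op_interp:
  assumes "wt KK X q t" and c: "fam E X c"
  shows "lifted_op X q (interp S \<tau> X t) c = tev KK E X q t c"
  using assms(1)
proof (induction rule: wt.induct)
  case (wt_Var i)
  then show ?case using lifted_op_proj[OF c] K.tev_Var[OF E c] by simp
next
  case (wt_Cst k q)
  then show ?case by (rule lifted_op_Cst[OF c])
next
  case (wt_Add q t u)
  show ?case unfolding interp_Add[OF wt_Add.hyps] K.tev_Add[OF E c wt_Add.hyps] wt_Add.IH[symmetric]
    by (rule lifted_op_sadd[OF c interp_hom[OF wt_Add.hyps(1)] interp_hom[OF wt_Add.hyps(2)]])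
next
  case (wt_Neg q t)
  have n: "wt KK X q (Neg t)" by (rule wt.wt_Neg[OF wt_Neg.hyps])
  have z: "wt KK X q (Cst q (szero KK q))" by (rule wt.wt_Cst) simp
  have "sadd UE q (lifted_op X q (interp S \<tau> X (Neg t)) c) (lifted_op X q (interp S \<tau> X t) c) = lifted_op X q (interp S \<tau> X (Add (Neg t) t)) c"
    unfolding interp_Add[OF n wt_Neg.hyps] by (rule lifted_op_sadd[OF c interp_hom[OF n] interp_hom[OF wt_Neg.hyps], symmetric])
  also have "\<dots> = lifted_op X q (interp S \<tau> X (Cst q (szero KK q))) c"
    unfolding interp_teq[OF teq_add_neg[OF wt_Neg.hyps]] ..
  also have "\<dots> = tev KK E X q (Cst q (szero KK q)) c" by (rule lifted_op_Cst[OF c]) simp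
  also have "\<dots> = szero UE q" by (rule K.tev_szero[OF E c])
  finally have 1: "sadd UE q (lifted_op X q (interp S \<tau> X (Neg t)) c) (tev KK E X q t c) = szero UE q" unfolding wt_Neg.IH .
  show ?case
    by (rule U.add_eq_zeroD[OF _ _ _ 1 K.tev_Neg[OF E c wt_Neg.hyps]])
      (use lifted_op_in[OF c interp_hom[OF n]] K.tev_in[OF E c n] K.tev_in[OF E c wt_Neg.hyps] in simp_all)
next
  case (wt_Mul q t r u)
  show ?case unfolding interp_Mul[OF wt_Mul.hyps] K.tev_Mul[OF E c wt_Mul.hyps refl] wt_Mul.IH[symmetric]
    by (rule lifted_op_smul[OF c interp_hom[OF wt_Mul.hyps(1)] interp_hom[OF wt_Mul.hyps(2)]])
qed

text \<open>
  If \<open>E\<close> underlies an \<open>S\<close>-algebra over and under \<open>A\<close>, its operations are the lifted ones: this is \<open>taylor\<close>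
  at \<open>s a\<close> with increments in the kernel \<open>I\<close> of \<open>p\<close>, whose square is contained in \<open>J = 0\<close>.
\<close>

lemma op_of_algebra:
  assumes EB: "E = comp_functor B \<sigma>" and B: "B \<in> Obj (Alg S)" and pS: "thom S B A p" and sS: "thom S A B s"
    and b: "fam B X b" and f: "f \<in> Hom S X (srt q)"
  shows "ev S B X q f b = lifted_op X q f b"
proof -
  have UB: "UE = NN B" unfolding EB by (rule under_\<sigma>)
  have bE: "fam E X b" using b by (simp add: EB)
  have fobE: "fob E Y = fob B Y" for Y by (simp add: EB)
  define b' where "b' i = s (srt (gr X i)) (base_part X b i)" for i
  define d where "d i = U.ssub (gr X i) (b i) (b' i)" for i
  have base_part: "fam A X (base_part X b)" by (rule fam_base_part[OF bE])
  have b'f: "fam B X b'" using tgt.thom_fam[OF sS base_part] by (simp add: b'_def[abs_def])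
  have bi: "b i \<in> car UE (gr X i)" "b' i \<in> car UE (gr X i)" if "i < len X" for i
    using b b'f that by (simp_all add: fam_def fobE)
  have d: "fam B X d" unfolding fam_def
  proof (intro allI impI)
    fix i assume "i < len X"
    from U.ssub_car[OF bi[OF this]] show "d i \<in> fob B (srt (gr X i))" by (simp add: d_def fobE)
  qed
  have dmu: "io B (gr X i) (d i) = kernel_part X b i" if "i < len X" for i
    using U.inc_ssub[OF bi[OF that]] by (simp add: kernel_part_def d_def b'_def UB[symmetric])
  have evb: "ev S B X t g b' = s (srt t) (ev S A X t g (base_part X b))" if "g \<in> Hom S X (srt t)" for t g
    using tgt.thom_ev[OF sS A B base_part that] by (simp add: b'_def[abs_def])
  have evs: "io B t (ev S B X t g b') = sec_ev X t g b" if "g \<in> Hom S X (srt t)" for t g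
    unfolding sec_ev_def sr_io evb[OF that] UB ..
  have sum: "ev S B X q f (\<lambda>i. sadd (NN B) (gr X i) (b' i) (d i)) = ev S B X q f b"
    by (rule tgt.ev_cong) (use U.sadd_ssub[OF bi] in \<open>simp add: d_def UB[symmetric]\<close>)
  let ?I = "{x \<in> carrier RE. pr x = \<zero>\<^bsub>RR A\<^esub>}"
  interpret RA: ring "RR A" by (simp add: A)
  have I: "add_closed (RR B) ?I"
    unfolding add_closed_def UB[symmetric] using ring_hom_zero'[OF U.ring_tot RA.ring_axioms pr_hom] ring_hom_add[OF pr_hom] by simp
  have I_mult: "x \<otimes>\<^bsub>RR B\<^esub> r \<in> ?I" if "x \<in> ?I" "r \<in> carrier (RR B)" for x r
    using that ring_hom_mult[OF pr_hom, of x r] ring_hom_closed[OF pr_hom, of r] by (simp add: UB[symmetric])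
  have dI: "io B (gr X i) (d i) \<in> ?I" if "i < len X" for i
    unfolding dmu[OF that] using kernel_part_in[OF bE that] pr_kernel_part[OF bE that] by simp
  have J: "add_closed (RR B) {\<zero>\<^bsub>RR B\<^esub>}" unfolding add_closed_def UB[symmetric] by simp
  have IJ: "x \<otimes>\<^bsub>RR B\<^esub> y \<in> {\<zero>\<^bsub>RR B\<^esub>}" if "x \<in> ?I" "y \<in> ?I" for x y
    using that ker_mult[of x y] by (simp add: UB[symmetric])
  have sin: "io B (gr X i) (d i) \<otimes>\<^bsub>RE\<^esub> io B (gr X i + q) (ev S B X (gr X i + q) (pd X i q f) b') = kernel_part X b i \<otimes>\<^bsub>RE\<^esub> sec_ev X (gr X i + q) (pd X i q f) b"
    if "i < len X" for i unfolding dmu[OF that] using evs[OF pd_hom[OF f that]] by simp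
  have "io B q (ev S B X q f b) = io B q (ev S B X q f b') \<oplus>\<^bsub>RE\<^esub>
     (\<Oplus>\<^bsub>RE\<^esub>i\<in>{..<len X}. io B (gr X i) (d i) \<otimes>\<^bsub>RE\<^esub> io B (gr X i + q) (ev S B X (gr X i + q) (pd X i q f) b')) \<oplus>\<^bsub>RE\<^esub> \<zero>\<^bsub>RE\<^esub>"
    using taylor[OF B b'f d I I_mult dI J IJ f] unfolding sum unfolding UB[symmetric] by simp
  also have "(\<Oplus>\<^bsub>RE\<^esub>i\<in>{..<len X}. io B (gr X i) (d i) \<otimes>\<^bsub>RE\<^esub> io B (gr X i + q) (ev S B X (gr X i + q) (pd X i q f) b'))
    = (\<Oplus>\<^bsub>RE\<^esub>i\<in>{..<len X}. kernel_part X b i \<otimes>\<^bsub>RE\<^esub> sec_ev X (gr X i + q) (pd X i q f) b)"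
    by (rule U.R.finsum_cong') (use sin kernel_part_in[OF bE] pd_sec_ev_in[OF bE f] in auto)
  also have "io B q (ev S B X q f b') = sec_ev X q f b" by (rule evs[OF f])
  also have "sec_ev X q f b \<oplus>\<^bsub>RE\<^esub> (\<Oplus>\<^bsub>RE\<^esub>i\<in>{..<len X}. kernel_part X b i \<otimes>\<^bsub>RE\<^esub> sec_ev X (gr X i + q) (pd X i q f) b) \<oplus>\<^bsub>RE\<^esub> \<zero>\<^bsub>RE\<^esub> = lifted_op_tot X q f b"
    using U.hmg_carrier[OF hmg_lifted_op_tot[OF bE f]] unfolding lifted_op_tot_def[symmetric] by simp
  also have "\<dots> = ie q (lifted_op X q f b)" by (rule ie_lifted_op[OF bE f, symmetric])
  finally show ?thesis unfolding UB[symmetric] by (rule ie_eq_iff[THEN iffD1])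
qed

text \<open>
  The \<open>S\<close>-algebra on the sets of \<open>E\<close> with the lifted operations as coordinates of its arrows.
\<close>

definition lift :: "('s, 'v) alg" where
  "lift = \<lparr>fob = fob E, fmap = (\<lambda>X Y f. \<lambda>c\<in>fob E X. mk (SCom KK) E Y
     (\<lambda>j. lifted_op X (gr Y j) (Comp S X Y (srt (gr Y j)) (proj S Y j) f) (crd (SCom KK) E X c)))\<rparr>"

lemma fob_lift[simp]: "fob lift X = fob E X"
  by (simp add: lift_def)

lemma fam_lift[simp]: "fam lift X c = fam E X c"
  by (simp add: fam_def)

lemma proj_comp_hom: "f \<in> Hom S X Y \<Longrightarrow> j < len Y \<Longrightarrow> Comp S X Y (srt (gr Y j)) (proj S Y j) f \<in> Hom S X (srt (gr Y j))"
  by simp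

lemma fmap_lift:
  assumes f: "f \<in> Hom S X Y" and c: "c \<in> fob E X"
  shows "fmap lift X Y f c \<in> fob E Y"
    and "j < len Y \<Longrightarrow> crd (SCom KK) E Y (fmap lift X Y f c) j
      = lifted_op X (gr Y j) (Comp S X Y (srt (gr Y j)) (proj S Y j) f) (crd (SCom KK) E X c)"
proof -
  have "fam E Y (\<lambda>j. lifted_op X (gr Y j) (Comp S X Y (srt (gr Y j)) (proj S Y j) f) (crd (SCom KK) E X c))"
    using lifted_op_in[OF K.SC.fam_crd[OF E c] proj_comp_hom[OF f]] by (simp add: fam_def)
  then show "fmap lift X Y f c \<in> fob E Y" "j < len Y \<Longrightarrow> crd (SCom KK) E Y (fmap lift X Y f c) j
      = lifted_op X (gr Y j) (Comp S X Y (srt (gr Y j)) (proj S Y j) f) (crd (SCom KK) E X c)"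
    using c by (simp_all add: lift_def E)
qed

lemma functor_lift: "cat_functor S set_cat lift"
  unfolding cat_functor_set_cat_iff
proof (intro conjI ballI)
  show "category S" by (rule tgt.category_axioms)
next
  fix X Y f assume f: "f \<in> Hom S X Y"
  have "fmap lift X Y f \<in> extensional (fob lift X)" by (simp add: lift_def)
  then show "fmap lift X Y f \<in> fob lift X \<rightarrow>\<^sub>E fob lift Y"
    using fmap_lift(1)[OF f] by (auto simp: PiE_iff)
next
  fix X x assume x: "x \<in> fob lift X"
  show "fmap lift X X (Ident S X) x = x"
  proof (rule K.SC.alg_eqI[OF E])
    fix i assume i: "i < len X"
    show "crd (SCom KK) E X (fmap lift X X (Ident S X) x) i = crd (SCom KK) E X x i"
      using fmap_lift(2)[OF tgt.id_hom _ i, of x] lifted_op_proj[OF K.SC.fam_crd[OF E] i, of x] x i by simp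
  qed (use x fmap_lift(1)[OF tgt.id_hom] in simp_all)
next
  fix X Y Z f g x
  assume f: "f \<in> Hom S X Y" and g: "g \<in> Hom S Y Z" and x: "x \<in> fob lift X"
  have x': "x \<in> fob E X" using x by simp
  have gf: "Comp S X Y Z g f \<in> Hom S X Z" using f g by simp
  let ?f = "\<lambda>j. Comp S X Y (srt (gr Y j)) (proj S Y j) f"
  have tf: "tup S X Y ?f = f" by (rule tgt.tup_eqI[OF f]) simp
  show "fmap lift X Z (Comp S X Y Z g f) x = fmap lift Y Z g (fmap lift X Y f x)"
  proof (rule K.SC.alg_eqI[OF E fmap_lift(1)[OF gf x'] fmap_lift(1)[OF g fmap_lift(1)[OF f x']]])
    fix i assume i: "i < len Z"
    let ?g = "Comp S Y Z (srt (gr Z i)) (proj S Z i) g"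
    have g': "?g \<in> Hom S Y (srt (gr Z i))" by (rule proj_comp_hom[OF g i])
    have "crd (SCom KK) E Z (fmap lift X Z (Comp S X Y Z g f) x) i = lifted_op X (gr Z i) (Comp S X Y (srt (gr Z i)) ?g (tup S X Y ?f)) (crd (SCom KK) E X x)"
      unfolding fmap_lift(2)[OF gf x' i] tf using tgt.assoc[OF f g tgt.proj_hom[OF i]] by simp
    also have "\<dots> = lifted_op Y (gr Z i) ?g (\<lambda>j. lifted_op X (gr Y j) (?f j) (crd (SCom KK) E X x))"
      by (rule lifted_op_chain[OF K.SC.fam_crd[OF E x'] proj_comp_hom[OF f] g'])
    also have "\<dots> = lifted_op Y (gr Z i) ?g (crd (SCom KK) E Y (fmap lift X Y f x))"
    proof (rule lifted_op_cong[OF _ g'])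
      show "fam E Y (\<lambda>j. lifted_op X (gr Y j) (?f j) (crd (SCom KK) E X x))"
        using lifted_op_in[OF K.SC.fam_crd[OF E x'] proj_comp_hom[OF f]] unfolding fam_def by blast
    qed (rule fmap_lift(2)[OF f x', symmetric])
    also have "\<dots> = crd (SCom KK) E Z (fmap lift Y Z g (fmap lift X Y f x)) i"
      by (rule fmap_lift(2)[OF g fmap_lift(1)[OF f x'] i, symmetric])
    finally show "crd (SCom KK) E Z (fmap lift X Z (Comp S X Y Z g f) x) i = crd (SCom KK) E Z (fmap lift Y Z g (fmap lift X Y f x)) i" .
  qed
qed

lemma fmap_lift_srt:
  assumes f: "f \<in> Hom S X (srt q)" and x: "x \<in> fob E X"
  shows "fmap lift X (srt q) f x = lifted_op X q f (crd (SCom KK) E X x)"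
proof -
  have m: "fmap lift X (srt q) f x \<in> fob E (srt q)" by (rule fmap_lift(1)[OF f x])
  have "crd (SCom KK) E (srt q) (fmap lift X (srt q) f x) 0 = fmap lift X (srt q) f x"
    unfolding crd_def K.SC.proj_srt gr_srt by (rule K.SC.alg_fmap_ident[OF E m])
  moreover have "crd (SCom KK) E (srt q) (fmap lift X (srt q) f x) 0 = lifted_op X q f (crd (SCom KK) E X x)"
    using fmap_lift(2)[OF f x, of 0] f by (simp add: tgt.proj_srt)
  ultimately show ?thesis by simp
qed

lemma crd_lift: "x \<in> fob E X \<Longrightarrow> i < len X \<Longrightarrow> crd S lift X x i = crd (SCom KK) E X x i"
  unfolding crd_def[of S] using fmap_lift_srt[OF tgt.proj_hom] lifted_op_proj[OF K.SC.fam_crd[OF E]] by simp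

lemma lift_obj[simp]: "lift \<in> Obj (Alg S)"
proof (rule tgt.preserves_finite_products_if_coordinates[OF functor_lift])
  fix X and a :: "nat \<Rightarrow> 'v" assume a: "fam lift X a"
  then have "\<exists>!x. x \<in> fob E X \<and> (\<forall>i<len X. crd (SCom KK) E X x i = a i)" by (intro K.SC.mk_ex1[OF E]) simp
  moreover have "x \<in> fob lift X \<and> (\<forall>i<len X. crd S lift X x i = a i) \<longleftrightarrow> x \<in> fob E X \<and> (\<forall>i<len X. crd (SCom KK) E X x i = a i)" for x
    using crd_lift[of x X] by auto
  ultimately show "\<exists>!x. x \<in> fob lift X \<and> (\<forall>i<len X. crd S lift X x i = a i)" by simp
qed

lemma ev_lift:
  assumes a: "fam E X a" and f: "f \<in> Hom S X (srt q)"
  shows "ev S lift X q f a = lifted_op X q f a"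
proof -
  have m: "mk S lift X a = mk (SCom KK) E X a"
    by (rule tgt.mk_eqI[OF lift_obj]) (use a E crd_lift in simp_all)
  have i: "mk (SCom KK) E X a \<in> fob E X" using a E by simp
  show ?thesis unfolding ev_def m fmap_lift_srt[OF f i]
    by (rule lifted_op_cong[OF K.SC.fam_crd[OF E i] f]) (use a E in simp)
qed

text \<open>
  Restricting the lifted structure to \<open>K\<close>-algebra operations gives \<open>E\<close> back.
\<close>

lemma lift_extends:
  assumes g: "g \<in> Hom (SCom KK) X Y" and x: "x \<in> fob E X"
  shows "fmap lift X Y (fmap \<sigma> X Y g) x = fmap E X Y g x"
proof -
  have sg: "fmap \<sigma> X Y g \<in> Hom S X Y" using M.\<tau>_hom[OF g] by simp
  show ?thesis
  proof (rule K.SC.alg_eqI[OF E fmap_lift(1)[OF sg x] K.SC.alg_fmap_in[OF E g x]])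
    fix i assume i: "i < len Y"
    let ?k = "Comp (SCom KK) X Y (srt (gr Y i)) (proj (SCom KK) Y i) g"
    have k: "?k \<in> Hom (SCom KK) X (srt (gr Y i))" using g i by simp
    then obtain t where t: "K.wts X (srt (gr Y i)) t" "?k = K.arr X (srt (gr Y i)) t" using K.SCom_Hom by auto
    have w: "wt KK X (gr Y i) (t 0)" using t(1) by (simp add: K.wts_srt)
    have kt: "?k = [cls KK X (gr Y i) (t 0)]" using t(2) by (simp add: K.arr_srt)
    have "Comp S X Y (srt (gr Y i)) (proj S Y i) (fmap \<sigma> X Y g) = fmap \<sigma> X (srt (gr Y i)) ?k"
      unfolding M.\<tau>_comp[OF g K.SC.proj_hom[OF i]] M.fmap_proj[OF i] ..
    also have "\<dots> = interp S \<tau> X (t 0)" unfolding kt by (rule \<sigma>_single[OF w])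
    finally have "crd (SCom KK) E Y (fmap lift X Y (fmap \<sigma> X Y g) x) i = tev KK E X (gr Y i) (t 0) (crd (SCom KK) E X x)"
      unfolding fmap_lift(2)[OF sg x i] using lifted_op_interp[OF w K.SC.fam_crd[OF E x]] by simp
    then show "crd (SCom KK) E Y (fmap lift X Y (fmap \<sigma> X Y g) x) i = crd (SCom KK) E Y (fmap E X Y g x) i"
      unfolding K.SC.crd_fmap[OF E x g i] tev_def kt .
  qed
qed

lemma thom_p_lift: "thom S lift A p"
proof (rule tgt.thom_if_ev[OF lift_obj A])
  fix X x assume "x \<in> fob lift X" then show "p X x \<in> fob A X" using p_in by simp
next
  fix X x and i :: nat assume x: "x \<in> fob lift X" and i: "i < len X"
  then show "crd S A X (p X x) i = p (srt (gr X i)) (crd S lift X x i)"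
    using K.SC.thom_crd[OF p E _ i, of x] by (simp add: crd_lift M.crd_pull)
next
  fix X q f x assume x: "x \<in> fob lift X" and f: "f \<in> Hom S X (srt q)"
  have x': "x \<in> fob E X" using x by simp
  have fc: "fam E X (crd S lift X x)" using tgt.fam_crd[OF lift_obj x] by simp
  show "p (srt q) (ev S lift X q f (crd S lift X x)) = ev S A X q f (crd S A X (p X x))"
    unfolding ev_lift[OF fc f] p_lifted_op[OF fc f]
    by (rule tgt.ev_cong) (use K.SC.thom_crd[OF p E x'] x' in \<open>simp add: base_part_def crd_lift M.crd_pull\<close>)
qed

lemma thom_lift_iso: "thom (SCom KK) E (comp_functor lift \<sigma>) (\<lambda>X x. x)" "thom (SCom KK) (comp_functor lift \<sigma>) E (\<lambda>X x. x)"
  unfolding thom_def using lift_extends by simp_all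

end

context super_fermat_theory
begin

text \<open>
  The formula for the lifted operations involves only the ring structure, the section, the projection and
  the operations of \<open>A\<close>; homomorphisms compatible with these commute with it.
\<close>

lemma lifted_op_natural:
  assumes 1: "split_ext S \<tau> A E p s" and 2: "split_ext S \<tau> A E' p' s'"
    and h: "thom (SCom KK) E E' h" and hp: "\<And>X x. x \<in> fob E X \<Longrightarrow> p' X (h X x) = p X x"
    and hs: "\<And>X a. a \<in> fob A X \<Longrightarrow> h X (s X a) = s' X a"
    and c: "fam E X c" and f: "f \<in> Hom S X (srt q)"
  shows "h (srt q) (split_ext.lifted_op S \<tau> A E p s X q f c) = split_ext.lifted_op S \<tau> A E' p' s' X q f (\<lambda>i. h (srt (gr X i)) (c i))"
proof -
  interpret E: split_ext S \<tau> A E p s by fact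
  interpret E': split_ext S \<tau> A E' p' s' by fact
  let ?c = "\<lambda>i. h (srt (gr X i)) (c i)"
  have c': "fam E' X ?c" by (rule K.SC.thom_fam[OF h c])
  have sh: "shom E.UE E'.UE (\<lambda>q. h (srt q))" by (rule K.shom_thom[OF h E.E E'.E])
  let ?h = "totmap (\<lambda>q. h (srt q))"
  have hr: "?h \<in> ring_hom E.RE E'.RE"
    by (rule totmap_ring_hom[OF E.U.supercommutative_axioms E'.U.supercommutative_axioms sh])
  have hi: "?h (E.ie q x) = E'.ie q (h (srt q) x)" for q x by (rule totmap_inc[OF sh])
  have base_part: "E'.base_part X ?c i = E.base_part X c i" if "i < len X" for i
    using hp c that by (simp add: E.base_part_def E'.base_part_def fam_def)
  have sv: "?h (E.sec_ev X t g c) = E'.sec_ev X t g ?c" if g: "g \<in> Hom S X (srt t)" for t g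
  proof -
    have e: "ev S A X t g (E'.base_part X ?c) = ev S A X t g (E.base_part X c)" by (rule tgt.ev_cong[OF base_part])
    have "ev S A X t g (E.base_part X c) \<in> fob A (srt t)" by (rule tgt.ev_in[OF E.A g E.fam_base_part[OF c]])
    then show ?thesis unfolding E.sec_ev_def E'.sec_ev_def e E.sr_io E'.sr_io hi using hs by simp
  qed
  have hm: "?h (E.kernel_part X c i) = E'.kernel_part X ?c i" if i: "i < len X" for i
  proof -
    have d: "E.base_part X c i \<in> fob A (srt (gr X i))" "c i \<in> fob E (srt (gr X i))" using E.fam_base_part[OF c] c i by (auto simp: fam_def)
    have "?h (E.kernel_part X c i) = ?h (E.ie (gr X i) (c i)) \<ominus>\<^bsub>E'.RE\<^esub> ?h (E.ie (gr X i) (s (srt (gr X i)) (E.base_part X c i)))"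
      unfolding E.kernel_part_def by (rule ring_hom_minus'[OF E.U.ring_tot E'.U.ring_tot hr]) (use d E.s_in in simp_all)
    then show ?thesis unfolding E'.kernel_part_def hi base_part[OF i] hs[OF d(1)] .
  qed
  have t: "E.kernel_part X c i \<otimes>\<^bsub>E.RE\<^esub> E.sec_ev X (gr X i + q) (pd X i q f) c \<in> carrier E.RE" if "i < len X" for i
    using E.kernel_part_in[OF c that] E.pd_sec_ev_in[OF c f that] by simp
  have "?h (\<Oplus>\<^bsub>E.RE\<^esub>i\<in>{..<len X}. E.kernel_part X c i \<otimes>\<^bsub>E.RE\<^esub> E.sec_ev X (gr X i + q) (pd X i q f) c)
     = (\<Oplus>\<^bsub>E'.RE\<^esub>i\<in>{..<len X}. ?h (E.kernel_part X c i \<otimes>\<^bsub>E.RE\<^esub> E.sec_ev X (gr X i + q) (pd X i q f) c))"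
    using t by (intro ring_hom_finsum'[OF E.U.ring_tot E'.U.ring_tot hr]) auto
  also have "\<dots> = (\<Oplus>\<^bsub>E'.RE\<^esub>i\<in>{..<len X}. E'.kernel_part X ?c i \<otimes>\<^bsub>E'.RE\<^esub> E'.sec_ev X (gr X i + q) (pd X i q f) ?c)"
  proof (rule E'.U.R.finsum_cong')
    fix i assume "i \<in> {..<len X}"
    then have i: "i < len X" by simp
    have pf: "pd X i q f \<in> Hom S X (srt (gr X i + q))" using f i by simp
    show "?h (E.kernel_part X c i \<otimes>\<^bsub>E.RE\<^esub> E.sec_ev X (gr X i + q) (pd X i q f) c) = E'.kernel_part X ?c i \<otimes>\<^bsub>E'.RE\<^esub> E'.sec_ev X (gr X i + q) (pd X i q f) ?c"
      unfolding ring_hom_mult[OF hr E.kernel_part_in[OF c i] E.pd_sec_ev_in[OF c f i]] hm[OF i] sv[OF pf] ..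
  qed (use E'.kernel_part_in[OF c'] E'.pd_sec_ev_in[OF c' f] in auto)
  finally have "?h (E.lifted_op_tot X q f c) = E'.lifted_op_tot X q f ?c"
    unfolding E.lifted_op_tot_def E'.lifted_op_tot_def
    using ring_hom_add[OF hr E.sec_ev_in[OF c f], of "\<Oplus>\<^bsub>E.RE\<^esub>i\<in>{..<len X}. E.kernel_part X c i \<otimes>\<^bsub>E.RE\<^esub> E.sec_ev X (gr X i + q) (pd X i q f) c"] t sv[OF f]
    by (auto intro!: E.U.R.finsum_closed)
  then have "E'.ie q (h (srt q) (E.lifted_op X q f c)) = E'.ie q (E'.lifted_op X q f ?c)"
    unfolding hi[symmetric] E.ie_lifted_op[OF c f] E'.ie_lifted_op[OF c' f] .
  then show ?thesis by (rule E'.ie_eq_iff[THEN iffD1])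
qed

end

section \<open>The equivalence\<close>

lemma (in kalg_theory) group_if_pw:
  assumes A: "A \<in> Obj (Alg T)" and d: "ab_data T A G" and pw: "ab_pw A G"
  shows "abelian_group_object (slice (Alg T) A) G"
proof -
  obtain C p E e P r where c: "ab_carrier G = (C, p)" "ab_one G = (E, e)" "ab_square G = (P, r)"
    by (metis surj_pair)
  have "ab_setting T A G C p E e P r"
    by unfold_locales (use A d c pw in \<open>simp_all add: ab_pw_def\<close>)
  then have "ab_kalg K T \<sigma> A G C p E e P r"
    using kalg_theory_axioms pw by (simp add: ab_kalg_def ab_kalg_axioms_def)
  then show ?thesis by (rule ab_kalg.group)
qed

context super_fermat_theory
begin

text \<open>
  Coordinates in the lifted algebra are those of \<open>E\<close>, and operations are natural by \<open>lifted_op_natural\<close>.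
\<close>

lemma lift_hom:
  assumes 1: "split_ext S \<tau> A E p s" and 2: "split_ext S \<tau> A E' p' s'"
    and h: "thom (SCom KK) E E' h" and hp: "\<And>X x. x \<in> fob E X \<Longrightarrow> p' X (h X x) = p X x"
    and hs: "\<And>X a. a \<in> fob A X \<Longrightarrow> h X (s X a) = s' X a"
  shows "thom S (split_ext.lift S \<tau> A E p s) (split_ext.lift S \<tau> A E' p' s') h"
proof -
  interpret E: split_ext S \<tau> A E p s by fact
  interpret E': split_ext S \<tau> A E' p' s' by fact
  have c: "crd S E'.lift X (h X x) i = h (srt (gr X i)) (crd S E.lift X x i)" if "x \<in> fob E X" "i < len X" for X x i
    using K.SC.thom_crd[OF h E.E that] thom_in[OF h that(1)] that by (simp add: E.crd_lift E'.crd_lift)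
  show ?thesis
  proof (rule tgt.thom_if_ev[OF E.lift_obj E'.lift_obj])
    fix X x assume "x \<in> fob E.lift X" then show "h X x \<in> fob E'.lift X" using thom_in[OF h, of x X] by simp
  next
    fix X x and i :: nat assume "x \<in> fob E.lift X" "i < len X"
    then show "crd S E'.lift X (h X x) i = h (srt (gr X i)) (crd S E.lift X x i)" using c by simp
  next
    fix X q f x assume x: "x \<in> fob E.lift X" and f: "f \<in> Hom S X (srt q)"
    have x': "x \<in> fob E X" using x by simp
    have hx: "h X x \<in> fob E' X" by (rule thom_in[OF h x'])
    have fc: "fam E X (crd S E.lift X x)" using tgt.fam_crd[OF E.lift_obj x] by simp
    have fc': "fam E' X (crd S E'.lift X (h X x))" using tgt.fam_crd[OF E'.lift_obj, of "h X x" X] hx by simp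
    have "h (srt q) (ev S E.lift X q f (crd S E.lift X x)) = E'.lifted_op X q f (\<lambda>i. h (srt (gr X i)) (crd S E.lift X x i))"
      unfolding E.ev_lift[OF fc f] by (rule lifted_op_natural[OF 1 2 h hp hs fc f])
    also have "\<dots> = E'.lifted_op X q f (crd S E'.lift X (h X x))"
      by (rule E'.lifted_op_cong[OF _ f]) (use fc' c[OF x'] in \<open>simp_all add: fam_def\<close>)
    also have "\<dots> = ev S E'.lift X q f (crd S E'.lift X (h X x))" by (rule E'.ev_lift[OF fc' f, symmetric])
    finally show "h (srt q) (ev S E.lift X q f (crd S E.lift X x)) = ev S E'.lift X q f (crd S E'.lift X (h X x))" .
  qed
qed

text \<open>
  The \<open>S\<close>-operations of both algebras are lifted ones by \<open>op_of_algebra\<close>, and these are natural with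
  respect to homomorphisms of \<open>K\<close>-algebras.
\<close>

lemma thom_if_thom_sections:
  assumes 1: "split_ext S \<tau> A (comp_functor C \<sigma>) p s" and 2: "split_ext S \<tau> A (comp_functor D \<sigma>) q t"
    and C: "C \<in> Obj (Alg S)" "thom S C A p" "thom S A C s" and D: "D \<in> Obj (Alg S)" "thom S D A q" "thom S A D t"
    and h: "thom (SCom KK) (comp_functor C \<sigma>) (comp_functor D \<sigma>) h"
    and hp: "\<And>X x. x \<in> fob C X \<Longrightarrow> q X (h X x) = p X x" and hs: "\<And>X a. a \<in> fob A X \<Longrightarrow> h X (s X a) = t X a"
  shows "thom S C D h"
proof (rule tgt.thom_if_ev[OF C(1) D(1)])
  fix X x assume "x \<in> fob C X" then show "h X x \<in> fob D X" using thom_in[OF h, of x X] by simp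
next
  fix X x and i :: nat assume x: "x \<in> fob C X" and i: "i < len X"
  then show "crd S D X (h X x) i = h (srt (gr X i)) (crd S C X x i)"
    using K.SC.thom_crd[OF h M.pull_obj[OF C(1)] _ i, of x] by (simp add: M.crd_pull)
next
  fix X r f x assume x: "x \<in> fob C X" and f: "f \<in> Hom S X (srt r)"
  have hx: "h X x \<in> fob D X" using thom_in[OF h, of x X] x by simp
  have c: "h (srt (gr X i)) (crd S C X x i) = crd S D X (h X x) i" if "i < len X" for i
    using K.SC.thom_crd[OF h M.pull_obj[OF C(1)] _ that, of x] x that by (simp add: M.crd_pull)
  have fc: "fam C X (crd S C X x)" and fd: "fam D X (crd S D X (h X x))" using x hx C(1) D(1) by simp_all
  have fc': "fam (comp_functor C \<sigma>) X (crd S C X x)" and fd': "fam (comp_functor D \<sigma>) X (crd S D X (h X x))"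
    using fc fd by (simp_all add: M.fam_pull)
  interpret D: split_ext S \<tau> A "comp_functor D \<sigma>" q t by (rule 2)
  have "h (srt r) (ev S C X r f (crd S C X x)) = h (srt r) (split_ext.lifted_op S \<tau> A (comp_functor C \<sigma>) p s X r f (crd S C X x))"
    unfolding split_ext.op_of_algebra[OF 1 refl C fc f] ..
  also have "\<dots> = D.lifted_op X r f (\<lambda>i. h (srt (gr X i)) (crd S C X x i))"
    by (rule lifted_op_natural[OF 1 2 h _ hs fc' f]) (use hp in simp_all)
  also have "\<dots> = D.lifted_op X r f (crd S D X (h X x))"
    by (rule D.lifted_op_cong[OF _ f]) (use fd' c in \<open>simp_all add: fam_def\<close>)
  also have "\<dots> = ev S D X r f (crd S D X (h X x))" by (rule D.op_of_algebra[OF refl D fd f, symmetric])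
  finally show "h (srt r) (ev S C X r f (crd S C X x)) = ev S D X r f (crd S D X (h X x))" .
qed

text \<open>
  As the structure map is the identity on objects, restriction leaves the components of homomorphisms
  unchanged, and acts on a slice object only through the operations of its domain.
\<close>

definition over_pull :: "('s, 'u) alg \<times> (nat \<times> nat \<Rightarrow> 'u \<Rightarrow> 'u) \<Rightarrow> ('s trm set list, 'u) alg \<times> (nat \<times> nat \<Rightarrow> 'u \<Rightarrow> 'u)" where
  "over_pull x = (comp_functor (fst x) \<sigma>, snd x)"

lemma slice_map_\<sigma>:
  "fob (slice_map (pullback_functor \<sigma>) A) x = over_pull x" "fmap (slice_map (pullback_functor \<sigma>) A) x y u = u"
  by (cases x; cases y; simp add: slice_map_def pullback_functor_def over_pull_def)+

abbreviation Mod_pull :: "('s, 'u) alg \<Rightarrow> _" where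
  "Mod_pull A \<equiv> Mod_map (pullback_functor \<sigma>) A"

lemma Mod_pull_simps[simp]:
  "ab_carrier (fob (Mod_pull A) G) = over_pull (ab_carrier G)" "ab_one (fob (Mod_pull A) G) = over_pull (ab_one G)"
  "ab_square (fob (Mod_pull A) G) = over_pull (ab_square G)" "ab_pr (fob (Mod_pull A) G) = ab_pr G"
  "ab_add (fob (Mod_pull A) G) = ab_add G" "ab_zero (fob (Mod_pull A) G) = ab_zero G"
  "ab_neg (fob (Mod_pull A) G) = ab_neg G" "fmap (Mod_pull A) G H u = u"
  by (simp_all add: Mod_map_def Ab_map_def slice_map_\<sigma>)

lemma fst_over_pull[simp]: "fob (fst (over_pull x)) X = fob (fst x) X" and snd_over_pull[simp]: "snd (over_pull x) = snd x"
  by (simp_all add: over_pull_def)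

lemma sec_Mod_pull: "sec (fob (Mod_pull A) G) = sec G"
  by (simp add: sec_def fun_eq_iff)

lemma ab_pw_Mod_pull: "ab_pw (comp_functor A \<sigma>) (fob (Mod_pull A) G) = ab_pw A G"
  by (simp add: ab_pw_def pw_square_def)

context
  fixes A :: "('s, 'u) alg"
  assumes A: "A \<in> Obj (Alg S)"
begin

abbreviation Ash where "Ash \<equiv> comp_functor A \<sigma>"
abbreviation sS where "sS \<equiv> slice (Alg S) A"
abbreviation sK where "sK \<equiv> slice (Alg (SCom KK)) Ash"

lemma Ash: "Ash \<in> Obj (Alg (SCom KK))"
  using A by simp

lemma Hom_pull:
  "C \<in> Obj (Alg S) \<Longrightarrow> D \<in> Obj (Alg S) \<Longrightarrow> u \<in> Hom (Alg S) C D \<Longrightarrow>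
    u \<in> Hom (Alg (SCom KK)) (comp_functor C \<sigma>) (comp_functor D \<sigma>)"
  by (simp add: tgt.Hom_Alg K.SC.Hom_Alg M.thom_pull)

lemma over_pull_obj: "x \<in> Obj sS \<Longrightarrow> over_pull x \<in> Obj sK"
  by (cases x) (simp add: slice_Obj over_pull_def Hom_pull A)

lemma over_pull_hom:
  assumes x: "x \<in> Obj sS" and y: "y \<in> Obj sS" and u: "u \<in> Hom sS x y"
  shows "u \<in> Hom sK (over_pull x) (over_pull y)"
proof -
  obtain C p D q where xy: "x = (C, p)" "y = (D, q)" by (cases x, cases y) blast
  have "C \<in> Obj (Alg S)" "D \<in> Obj (Alg S)" using x y by (simp_all add: xy slice_Obj)
  then show ?thesis
    using tgt.slice_Hom_pw[OF A x[unfolded xy] y[unfolded xy], of u] u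
      K.SC.slice_Hom_pw[OF Ash, of "comp_functor C \<sigma>" p "comp_functor D \<sigma>" q u] over_pull_obj[OF x] over_pull_obj[OF y] Hom_pull[of C D u]
    by (simp add: xy over_pull_def)
qed

lemma Mod_pull_group:
  assumes G: "G \<in> Obj (Mod (Alg S) A)"
  shows "fob (Mod_pull A) G \<in> Obj (Mod (Alg (SCom KK)) Ash)"
proof -
  have g: "ab_data S A G \<and> ab_pw A G" using tgt.ab_pw_if_group[OF A] G by (simp add: Mod_simps)
  have "ab_data (SCom KK) Ash (fob (Mod_pull A) G)"
    using g over_pull_obj over_pull_hom unfolding ab_data_def Let_def by simp
  then show ?thesis using K.I.group_if_pw[OF Ash] g by (simp add: Mod_simps ab_pw_Mod_pull)
qed

text \<open>
  This is \<open>kernel_square_zero\<close>, with the neutral elements as the section.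
\<close>

lemma split_of_group:
  assumes H: "H \<in> Obj (Mod (Alg (SCom KK)) Ash)" and c: "ab_carrier H = (C, p)"
  shows "split_ext S \<tau> A C p (sec H)"
proof -
  obtain E e P r where o: "ab_one H = (E, e)" "ab_square H = (P, r)" by (metis surj_pair)
  interpret h: ab_kalg KK "SCom KK" id_functor Ash H C p E e P r
    using K.I.ab_kalgI[OF Ash _ c o] H by (simp add: Mod_simps)
  show ?thesis
  proof unfold_locales
    show "A \<in> Obj (Alg S)" by (rule A)
    show "C \<in> Obj (Alg (SCom KK))" by (rule h.s.algs(1))
    show "thom (SCom KK) C Ash p" by (rule h.s.thoms(6))
    show "thom (SCom KK) Ash C (sec H)" by (rule h.s.thom_sec)
    show "p X (sec H X a) = a" if "a \<in> fob A X" for X a using h.s.p_sec[of a X] that by simp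
    show "smul (under KK C) q t m n = szero (under KK C) (q + t)"
      if "m \<in> fob C (srt q)" "n \<in> fob C (srt t)" "p (srt q) m = szero (NN A) q" "p (srt t) n = szero (NN A) t" for q t m n
      using h.kernel_square_zero[of m q n t] that by (simp add: under_\<sigma>)
  qed
qed

lemma split_of_group_S:
  assumes G: "G \<in> Obj (Mod (Alg S) A)" and c: "ab_carrier G = (C, p)"
  shows "split_ext S \<tau> A (comp_functor C \<sigma>) p (sec G)" "C \<in> Obj (Alg S)" "thom S C A p" "thom S A C (sec G)"
proof -
  show "split_ext S \<tau> A (comp_functor C \<sigma>) p (sec G)"
    using split_of_group[OF Mod_pull_group[OF G], of "comp_functor C \<sigma>" p] c by (simp add: sec_Mod_pull over_pull_def)
  obtain E e P r where o: "ab_one G = (E, e)" "ab_square G = (P, r)" by (metis surj_pair)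
  interpret g: ab_setting S A G C p E e P r
    using tgt.ab_settingI[OF A _ c o] G by (simp add: Mod_simps)
  show "C \<in> Obj (Alg S)" "thom S C A p" "thom S A C (sec G)" by (rule g.algs(1) g.thoms(6) g.thom_sec)+
qed

text \<open>
  On both sides a morphism is a homomorphism over \<open>A\<close> that preserves the neutral elements, and such
  \<open>K\<close>-algebra homomorphisms are homomorphisms of \<open>S\<close>-algebras.
\<close>

lemma Mod_pull_Hom:
  assumes G: "G \<in> Obj (Mod (Alg S) A)" and H: "H \<in> Obj (Mod (Alg S) A)"
  shows "Hom (Mod (Alg (SCom KK)) Ash) (fob (Mod_pull A) G) (fob (Mod_pull A) H) = Hom (Mod (Alg S) A) G H"
proof -
  obtain C p D q where c: "ab_carrier G = (C, p)" "ab_carrier H = (D, q)" by (metis surj_pair)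
  note sG = split_of_group_S[OF G c(1)] and sH = split_of_group_S[OF H c(2)]
  have ob: "(C, p) \<in> Obj sS" "(D, q) \<in> Obj sS"
    using G H abelian_group_object.carrier_obj[of sS G] abelian_group_object.carrier_obj[of sS H] by (simp_all add: Mod_simps c)
  have ob': "(comp_functor C \<sigma>, p) \<in> Obj sK" "(comp_functor D \<sigma>, q) \<in> Obj sK"
    using over_pull_obj[OF ob(1)] over_pull_obj[OF ob(2)] by (simp_all add: over_pull_def)
  have "u \<in> Hom sS (C, p) (D, q)" if u: "u \<in> Hom sK (comp_functor C \<sigma>, p) (comp_functor D \<sigma>, q)"
    and us: "\<forall>X. \<forall>a\<in>fob A X. u X (sec G X a) = sec H X a" for u
  proof -
    have h: "u \<in> Hom (Alg (SCom KK)) (comp_functor C \<sigma>) (comp_functor D \<sigma>)" "\<And>X x. x \<in> fob C X \<Longrightarrow> q X (u X x) = p X x"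
      using K.SC.slice_Hom_pw[OF Ash ob', of u] u by simp_all
    have "thom S C D u"
      by (rule thom_if_thom_sections[OF sG(1) sH(1) sG(2-4) sH(2-4)])
        (use h us K.SC.Hom_Alg[OF M.pull_obj[OF sG(2)] M.pull_obj[OF sH(2)], of u] in simp_all)
    then show ?thesis
      using tgt.slice_Hom_pw[OF A ob, of u] h K.SC.Hom_Alg[OF M.pull_obj[OF sG(2)] M.pull_obj[OF sH(2)], of u]
      by (simp add: tgt.Hom_Alg[OF sG(2) sH(2)])
  qed
  moreover have "u \<in> Hom sK (comp_functor C \<sigma>, p) (comp_functor D \<sigma>, q)" if "u \<in> Hom sS (C, p) (D, q)" for u
    using over_pull_hom[OF ob that] by (simp add: over_pull_def)
  ultimately have "u \<in> Hom (Mod (Alg (SCom KK)) Ash) (fob (Mod_pull A) G) (fob (Mod_pull A) H) \<longleftrightarrow> u \<in> Hom (Mod (Alg S) A) G H" for u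
    unfolding K.I.Mod_Hom[OF Ash Mod_pull_group[OF G] Mod_pull_group[OF H]] L.Mod_Hom[OF A G H] sec_Mod_pull Mod_pull_simps c
    by (auto simp: over_pull_def)
  then show ?thesis by blast
qed

lemma Ident_Comp_pull:
  "Ident (Alg (SCom KK)) (comp_functor C \<sigma>) = Ident (Alg S) C"
  "Comp (Alg (SCom KK)) (comp_functor C \<sigma>) D' E' g f = Comp (Alg S) C D E g f"
  by (simp_all add: Ident_Alg Comp_Alg)

lemma Mod_pull_functor: "cat_functor (Mod (Alg S) A) (Mod (Alg (SCom KK)) Ash) (Mod_pull A)"
proof -
  interpret S: category "Mod (Alg S) A" by (rule L.category_Mod[OF A])
  interpret K: category "Mod (Alg (SCom KK)) Ash" by (rule K.I.category_Mod[OF Ash])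
  show ?thesis
  proof unfold_locales
    fix G H f assume "G \<in> Obj (Mod (Alg S) A)" "H \<in> Obj (Mod (Alg S) A)" "f \<in> Hom (Mod (Alg S) A) G H"
    then show "fmap (Mod_pull A) G H f \<in> Hom (Mod (Alg (SCom KK)) Ash) (fob (Mod_pull A) G) (fob (Mod_pull A) H)"
      by (simp add: Mod_pull_Hom)
  next
    fix G
    show "fmap (Mod_pull A) G G (Ident (Mod (Alg S) A) G) = Ident (Mod (Alg (SCom KK)) Ash) (fob (Mod_pull A) G)"
      by (cases "ab_carrier G") (simp add: Mod_simps over_pull_def slice_Ident Ident_Comp_pull)
  next
    fix G H L f g
    show "fmap (Mod_pull A) G L (Comp (Mod (Alg S) A) G H L g f) = Comp (Mod (Alg (SCom KK)) Ash) (fob (Mod_pull A) G) (fob (Mod_pull A) H) (fob (Mod_pull A) L) (fmap (Mod_pull A) H L g) (fmap (Mod_pull A) G H f)"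
      by (cases "ab_carrier G"; cases "ab_carrier H"; cases "ab_carrier L")
        (simp add: Mod_simps over_pull_def slice_Comp Comp_Alg)
  qed (rule Mod_pull_group)
qed

end

end

context super_fermat_theory
begin

context
  fixes A :: "('s, 'u) alg"
  assumes A: "A \<in> Obj (Alg S)"
begin

text \<open>
  The carrier, the terminal object and the square of \<open>H\<close> are split square-zero extensions of \<open>A\<close>, and all
  structure maps of the group object preserve the sections. Lifting everything yields a group object in
  \<open>S\<close>-algebras with the same underlying sets and maps, so the identity is an isomorphism onto \<open>H\<close>.
\<close>

lemma Mod_pull_ess_surj:
  assumes H: "H \<in> Obj (Mod (Alg (SCom KK)) (comp_functor A \<sigma>))"
  shows "\<exists>G\<in>Obj (Mod (Alg S) A). \<exists>u. isomorphism (Mod (Alg (SCom KK)) (comp_functor A \<sigma>)) (fob (Mod_pull A) G) H u"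
proof -
  let ?A = "comp_functor A \<sigma>"
  note Ash = Ash[OF A]
  obtain C p E e P r where o: "ab_carrier H = (C, p)" "ab_one H = (E, e)" "ab_square H = (P, r)" by (metis surj_pair)
  interpret h: ab_kalg KK "SCom KK" id_functor ?A H C p E e P r
    using K.I.ab_kalgI[OF Ash _ o] H by (simp add: Mod_simps)
  have bij: "bij_betw (e X) (fob E X) (fob ?A X)" for X by (rule h.s.bij)
  note sc = split_of_group[OF A H o(1)]
  interpret c: split_ext S \<tau> A C p "sec H" by (rule sc)
  define t where "t X = inv_into (fob E X) (e X)" for X
  have tt: "thom (SCom KK) ?A E t"
    using K.SC.thom_inv[OF Ash h.s.algs(2) h.s.thoms(7) bij] by (simp add: t_def[abs_def])
  interpret UE: supercommutative "under KK E" by (rule K.supercommutative_under[OF h.s.algs(2)])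
  \<comment> \<open>the terminal object has zero kernel\<close>
  have se: "split_ext S \<tau> A E e t"
  proof unfold_locales
    show "A \<in> Obj (Alg S)" "E \<in> Obj (Alg (SCom KK))" "thom (SCom KK) E ?A e" "thom (SCom KK) ?A E t"
      by (rule A h.s.algs(2) h.s.thoms(7) tt)+
    show "e X (t X a) = a" if "a \<in> fob A X" for X a using h.s.e_inv(2)[of a X] that by (simp add: t_def)
    show "smul (under KK E) q k m n = szero (under KK E) (q + k)"
      if m: "m \<in> fob E (srt q)" "n \<in> fob E (srt k)" "e (srt q) m = szero (NN A) q" for q k m n
    proof -
      have z: "szero (under KK E) q \<in> fob E (srt q)" using UE.szero_car[of q] by simp
      have e: "e (srt q) m = e (srt q) (szero (under KK E) q)"
        using K.I.UU_szero[OF h.s.thoms(7) h.s.algs(2) Ash, of q] m(3) by (simp add: under_\<sigma>)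
      from e have "m = szero (under KK E) q"
        by (rule inj_onD[OF bij_betw_imp_inj_on[OF bij] _ m(1) z])
      then show ?thesis using UE.szero_smul[of n k q] m(2) by simp
    qed
  qed
  have oA: "(?A, Ident (Alg (SCom KK)) ?A) \<in> Obj h.s.sl"
    using Ash K.SC.category_Alg[THEN category.ident_in_hom, OF Ash] by (simp add: slice_Obj)
  define z where "z X = restrict (sec H X) (fob A X)" for X
  have z: "z \<in> Hom h.s.sl (?A, Ident (Alg (SCom KK)) ?A) (C, p)"
    using K.SC.slice_HomI[OF Ash oA h.s.objs(1) c.s] c.ps by (simp add: Ident_Alg z_def[abs_def])
  \<comment> \<open>the section of the square is the pair of neutral elements\<close>
  define w where "w = ab_pair h.s.sl H (?A, Ident (Alg (SCom KK)) ?A) z z"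
  have w: "w \<in> Hom h.s.sl (?A, Ident (Alg (SCom KK)) ?A) (P, r)"
    "\<And>X a. a \<in> fob A X \<Longrightarrow> ab_pr H 0 X (w X a) = sec H X a" "\<And>X a. a \<in> fob A X \<Longrightarrow> ab_pr H 1 X (w X a) = sec H X a"
    using h.s.pair_pw[OF oA z z] by (simp_all add: w_def z_def)
  have tw: "thom (SCom KK) ?A P w" by (rule K.SC.slice_thom(1)[OF Ash oA h.s.objs(3) w(1)])
  have w_in: "w X a \<in> fob P X" if "a \<in> fob A X" for X a using thom_in[OF tw, of a X] that by simp
  interpret UP: supercommutative "under KK P" by (rule K.supercommutative_under[OF h.s.algs(3)])
  have sp: "split_ext S \<tau> A P r w"
  proof unfold_locales
    show "A \<in> Obj (Alg S)" "P \<in> Obj (Alg (SCom KK))" "thom (SCom KK) P ?A r" "thom (SCom KK) ?A P w"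
      by (rule A h.s.algs(3) h.s.thoms(8) tw)+
    show "r X (w X a) = a" if "a \<in> fob A X" for X a
      using h.s.over(1)[OF w_in[OF that]] c.ps[OF that] by (simp add: w(2)[OF that])
    show "smul (under KK P) q k m n = szero (under KK P) (q + k)"
      if m: "m \<in> fob P (srt q)" "n \<in> fob P (srt k)" "r (srt q) m = szero (NN A) q" "r (srt k) n = szero (NN A) k" for q k m n
    proof (rule h.s.pair_eq)
      note 0 = K.I.UU_szero[OF h.s.thoms(1) h.s.algs(3,1), unfolded K.comp_functor_id]
        K.I.UU_smul[OF h.s.thoms(1) h.s.algs(3,1), unfolded K.comp_functor_id, OF m(1,2)]
      note 1 = K.I.UU_szero[OF h.s.thoms(2) h.s.algs(3,1), unfolded K.comp_functor_id]
        K.I.UU_smul[OF h.s.thoms(2) h.s.algs(3,1), unfolded K.comp_functor_id, OF m(1,2)]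
      show "smul (under KK P) q k m n \<in> fob P (srt (q + k))" "szero (under KK P) (q + k) \<in> fob P (srt (q + k))"
        using UP.smul_car[of m q n k] UP.szero_car[of "q + k"] m by simp_all
      show "ab_pr H 0 (srt (q + k)) (smul (under KK P) q k m n) = ab_pr H 0 (srt (q + k)) (szero (under KK P) (q + k))"
        unfolding 0 by (rule c.sqz) (use h.s.over(1)[OF m(1)] h.s.over(1)[OF m(2)] h.s.ins(1) m in simp_all)
      show "ab_pr H 1 (srt (q + k)) (smul (under KK P) q k m n) = ab_pr H 1 (srt (q + k)) (szero (under KK P) (q + k))"
        unfolding 1 by (rule c.sqz) (use h.s.over(2)[OF m(1)] h.s.over(2)[OF m(2)] h.s.ins(2) m in simp_all)
    qed
  qed
  interpret e: split_ext S \<tau> A E e t by (rule se)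
  interpret p: split_ext S \<tau> A P r w by (rule sp)
  \<comment> \<open>\<open>-e = -e + e = e\<close> in the fibre over \<open>a\<close>\<close>
  have neg: "ab_neg H X (sec H X a) = sec H X a" if a: "a \<in> fob A X" for X a
  proof -
    have a': "a \<in> fob ?A X" using a by simp
    have sa: "sec H X a \<in> fob C X" by (rule c.s_in[OF a])
    have na: "ab_neg H X (sec H X a) \<in> fob C X" using h.s.ins(5)[OF sa] .
    obtain v where v: "v \<in> fob P X" "ab_pr H 0 X v = ab_neg H X (sec H X a)" "ab_pr H 1 X v = sec H X a"
      using h.s.pair_ex[OF na sa] h.s.over(5)[OF sa] by auto
    have "ab_add H X v = ab_zero H X (t X a)"
      by (rule h.neg_left[OF v(1)]) (use v c.ps[OF a] e.ps[OF a] e.s_in[OF a] in simp_all)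
    then show ?thesis
      using h.add_sec_right[OF v(1) a' v(3)] v(2) by (simp add: sec_def o t_def)
  qed
  have zero: "ab_zero H X (t X a) = sec H X a" for X a by (simp add: sec_def o t_def)
  have add: "ab_add H X (w X a) = sec H X a" if a: "a \<in> fob A X" for X a
    using h.add_sec_left[OF w_in[OF a] _ w(2)[OF a]] a w(3)[OF a] by simp
  define G where "G = \<lparr>ab_carrier = (c.lift, p), ab_one = (e.lift, e), ab_square = (p.lift, r), ab_pr = ab_pr H,
    ab_add = ab_add H, ab_zero = ab_zero H, ab_neg = ab_neg H\<rparr>"
  have obj: "(c.lift, p) \<in> Obj (slice (Alg S) A)" "(e.lift, e) \<in> Obj (slice (Alg S) A)" "(p.lift, r) \<in> Obj (slice (Alg S) A)"
    using h.s.objs K.SC.Hom_Alg[OF h.s.algs(1) Ash, of p] K.SC.Hom_Alg[OF h.s.algs(2) Ash, of e] K.SC.Hom_Alg[OF h.s.algs(3) Ash, of r]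
      c.thom_p_lift e.thom_p_lift p.thom_p_lift
    by (simp_all add: slice_Obj tgt.Hom_Alg A)
  have homI: "u \<in> Hom (slice (Alg S) A) (split_ext.lift S \<tau> A D d k, d) (split_ext.lift S \<tau> A D' d' k', d')"
    if 1: "split_ext S \<tau> A D d k" "split_ext S \<tau> A D' d' k'" "(D, d) \<in> Obj h.s.sl" "(D', d') \<in> Obj h.s.sl"
      and ob: "(split_ext.lift S \<tau> A D d k, d) \<in> Obj (slice (Alg S) A)" "(split_ext.lift S \<tau> A D' d' k', d') \<in> Obj (slice (Alg S) A)"
      and u: "u \<in> Hom h.s.sl (D, d) (D', d')" and us: "\<And>X a. a \<in> fob A X \<Longrightarrow> u X (k X a) = k' X a"
    for u and D D' :: "('s trm set list, 'u) alg" and d d' k k'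
  proof -
    note uh = K.SC.slice_Hom_pw[OF Ash 1(3,4), of u] K.SC.slice_thom[OF Ash 1(3,4) u]
    have ob': "D \<in> Obj (Alg (SCom KK))" "D' \<in> Obj (Alg (SCom KK))" using 1(3,4) by (simp_all add: slice_Obj)
    have th: "thom S (split_ext.lift S \<tau> A D d k) (split_ext.lift S \<tau> A D' d' k') u"
      by (rule lift_hom[OF 1(1,2) uh(2) uh(3) us])
    show ?thesis
      unfolding tgt.slice_Hom_pw[OF A ob] tgt.Hom_Alg[OF split_ext.lift_obj[OF 1(1)] split_ext.lift_obj[OF 1(2)]]
      using th uh(1,3) u K.SC.Hom_Alg[OF ob', of u] by (simp add: split_ext.fob_lift[OF 1(1)])
  qed
  have data: "ab_data S A G"
    unfolding ab_data_def Let_def G_def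
    using obj homI[OF sp sc h.s.objs(3,1) obj(3,1) h.s.homs(1) w(2)] homI[OF sp sc h.s.objs(3,1) obj(3,1) h.s.homs(2) w(3)]
      homI[OF sp sc h.s.objs(3,1) obj(3,1) h.s.homs(3) add] homI[OF se sc h.s.objs(2,1) obj(2,1) h.s.homs(4) zero]
      homI[OF sc sc h.s.objs(1,1) obj(1,1) h.s.homs(5) neg]
    by simp
  have pw: "ab_pw A G"
  proof -
    have "ab_pw A G = ab_pw ?A H" by (simp add: ab_pw_def pw_square_def G_def o)
    then show ?thesis using h.pw by simp
  qed
  have G: "G \<in> Obj (Mod (Alg S) A)" using L.group_if_pw[OF A data pw] by (simp add: Mod_simps)
  have FG: "fob (Mod_pull A) G \<in> Obj (Mod (Alg (SCom KK)) ?A)" by (rule Mod_pull_group[OF A G])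
  have carG: "ab_carrier (fob (Mod_pull A) G) = (comp_functor c.lift \<sigma>, p)" by (simp add: G_def over_pull_def)
  have ob: "(comp_functor c.lift \<sigma>, p) \<in> Obj h.s.sl" using over_pull_obj[OF A obj(1)] by (simp add: over_pull_def)
  have secG: "sec (fob (Mod_pull A) G) X a = sec H X a" for X a by (simp add: sec_def G_def o)
  define u where "u X = (\<lambda>x\<in>fob C X. x)" for X :: "nat \<times> nat"
  have 1: "u \<in> Hom h.s.sl (comp_functor c.lift \<sigma>, p) (C, p)"
    using K.SC.slice_HomI[OF Ash ob h.s.objs(1) c.thom_lift_iso(2)] by (simp add: u_def[abs_def])
  have 2: "u \<in> Hom h.s.sl (C, p) (comp_functor c.lift \<sigma>, p)"
    using K.SC.slice_HomI[OF Ash h.s.objs(1) ob c.thom_lift_iso(1)] by (simp add: u_def[abs_def])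
  have us: "u X (sec H X a) = sec H X a" if "a \<in> fob A X" for X a using c.s_in[OF that] by (simp add: u_def)
  have "isomorphism (Mod (Alg (SCom KK)) ?A) (fob (Mod_pull A) G) H u"
    unfolding isomorphism_def K.I.Mod_Hom[OF Ash FG H] K.I.Mod_Hom[OF Ash H FG]
  proof (intro conjI bexI[of _ u])
    show "u \<in> Hom (Mod (Alg (SCom KK)) ?A) H (fob (Mod_pull A) G)"
      unfolding K.I.Mod_Hom[OF Ash H FG] carG o secG using 2 us by simp
    show "Comp (Mod (Alg (SCom KK)) ?A) (fob (Mod_pull A) G) H (fob (Mod_pull A) G) u u = Ident (Mod (Alg (SCom KK)) ?A) (fob (Mod_pull A) G)"
      "Comp (Mod (Alg (SCom KK)) ?A) H (fob (Mod_pull A) G) H u u = Ident (Mod (Alg (SCom KK)) ?A) H"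
      unfolding Mod_simps carG o slice_Comp slice_Ident Comp_Alg Ident_Alg
      by (simp_all add: u_def compose_def fun_eq_iff)
    show "u \<in> Hom h.s.sl (ab_carrier (fob (Mod_pull A) G)) (ab_carrier H)" unfolding carG o by (rule 1)
    show "\<forall>X. \<forall>a\<in>fob ?A X. u X (sec (fob (Mod_pull A) G) X a) = sec H X a" unfolding secG using us by simp
  qed
  then show ?thesis using G by blast
qed

theorem Mod_pull_equivalence:
  "equivalence_of_categories (Mod (Alg S) A) (Mod (Alg (SCom KK)) (comp_functor A \<sigma>)) (Mod_pull A)"
proof (rule equivalence_if_fully_faithful_ess_surj)
  show "cat_functor (Mod (Alg S) A) (Mod (Alg (SCom KK)) (comp_functor A \<sigma>)) (Mod_pull A)" by (rule Mod_pull_functor[OF A])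
  show "bij_betw (fmap (Mod_pull A) G H) (Hom (Mod (Alg S) A) G H) (Hom (Mod (Alg (SCom KK)) (comp_functor A \<sigma>)) (fob (Mod_pull A) G) (fob (Mod_pull A) H))"
    if "G \<in> Obj (Mod (Alg S) A)" "H \<in> Obj (Mod (Alg S) A)" for G H
    unfolding Mod_pull_Hom[OF A that] by (simp add: bij_betw_def inj_on_def)
qed (rule Mod_pull_ess_surj)

end

end

theorem theorem2p6:
  fixes S :: "('s, 'x) thy_scheme"
    and \<tau> :: "'s scom_map"
    and A :: "('s, 'u) alg"
  assumes "super_fermat_theory S \<tau>"
    and "A \<in> Obj (Alg S)"
  shows "equivalence_of_categories
    (Mod (Alg S) A)
    (Mod (Alg (SCom (ground S \<tau>))) (fob (pullback_functor (structure_map S \<tau>)) A))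
    (Mod_map (pullback_functor (structure_map S \<tau>)) A)"
proof -
  interpret super_fermat_theory S \<tau> by fact
  have "fob (pullback_functor (structure_map S \<tau>)) A = comp_functor A (structure_map S \<tau>)"
    by (simp add: pullback_functor_def)
  then show ?thesis using Mod_pull_equivalence[OF assms(2)] by simp
qed

end
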